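(* Let $\lambda\in\Bbbk$ and let $H=B(\lambda)$, with generators $z_1=Y$, $z_2=X$, $z_3=Z$. The right coideal subalgebras of $H$ are exactly: $\Bbbk$; $H$; those of GK-dimension $1$, namely $\Bbbk[aX+bY]$, parameterized by $[a,b]\in\mathbb P^1(\Bbbk)$; and the following ones of GK-dimension $2$ (each an Ore extension as indicated): (i) for all $\lambda$: $\Bbbk[z_1][z_2;\delta]$ with $\delta(z_1)=z_1$; (ii) for all $\lambda$: $\Bbbk[z_1][z_3+cz_2-z_1z_2;\delta]$ with $c\in\Bbbk$ and $\delta(z_1)=cz_1-\tfrac12z_1^2$; (iii) only if $\lambda=0$: $\Bbbk[z_2+az_1][z_3+bz_1+\tfrac a2z_1^2;\sigma]$ with $a,b\in\Bbbk$ and $\sigma(z_2+az_1)=z_2+az_1-1$.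
   Context: $\Bbbk$ is a field of characteristic zero. $B(\lambda)$ is the $\Bbbk$-algebra generated by $X,Y,Z$ with relations $[X,Y]=Y$, $[Z,X]=-Z+\lambda Y$, $[Z,Y]=\tfrac12Y^2$. It is a connected Hopf algebra of GK-dimension 3 with $\Delta(X)=X\otimes1+1\otimes X$, $\Delta(Y)=Y\otimes1+1\otimes Y$, $\Delta(Z)=Z\otimes1+1\otimes Z+X\otimes Y$ (the counit kills $X,Y,Z$). A right coideal subalgebra is a subalgebra $A\subseteq H$ with $\Delta(A)\subseteq A\otimes H$. The notation $\Bbbk[u][v;\delta]$ (resp. $\Bbbk[u][v;\sigma]$) for $u,v\in H$ means the subalgebra of $H$ generated by $u$ and $v$, which is the Ore extension of the polynomial algebra $\Bbbk[u]$ by $v$ with $vr=rv+\delta(r)$ for a derivation $\delta$ (resp. $vr=\sigma(r)v$ for an automorphism $\sigma$) of $\Bbbk[u]$. *)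

theory Defs
  imports
    "HOL-Library.Poly_Mapping"
    "HOL-Library.Extended_Real"
    "HOL-Library.Liminf_Limsup"
    "HOL-Computational_Algebra.Polynomial"
    "HOL-Algebra.Algebra"
    "HOL-Algebra.Algebraic_Closure_Type"
begin

text \<open>
  An associative unital algebra over the field \<open>'k\<close> is a \<^type>\<open>module_ext\<close> record carrying both a
  ring structure and a scalar multiplication. (The locale \<open>algebra\<close> of the library only covers
  commutative algebras.)
\<close>

abbreviation base_field :: "'k::field ring"
  where "base_field \<equiv> ring_of_type_algebra"

definition scalars :: "('k::field, 'a, 'm) module_scheme \<Rightarrow> 'a set"
  where "scalars A = range (\<lambda>c. c \<odot>\<^bsub>A\<^esub> \<one>\<^bsub>A\<^esub>)"

definition lin_span :: "('k::field, 'a, 'm) module_scheme \<Rightarrow> 'a set \<Rightarrow> 'a set"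
  where "lin_span A S = \<Inter>{N. submodule N base_field A \<and> S \<subseteq> N}"

definition is_subalgebra :: "('k::field, 'a, 'm) module_scheme \<Rightarrow> 'a set \<Rightarrow> bool"
  where "is_subalgebra A B \<longleftrightarrow> subring B A \<and> submodule B base_field A"

definition alg_gen :: "('k::field, 'a, 'm) module_scheme \<Rightarrow> 'a set \<Rightarrow> 'a set"
  where "alg_gen A S = \<Inter>{B. is_subalgebra A B \<and> S \<subseteq> B}"

definition quot_alg :: "('k::field, 'a, 'm) module_scheme \<Rightarrow> 'a set \<Rightarrow> ('k, 'a set) module"
  where "quot_alg A I =
    ring.extend (A Quot I) (module.fields (\<lambda>c S. \<Union>a\<in>S. I +>\<^bsub>A\<^esub> (c \<odot>\<^bsub>A\<^esub> a)))"

datatype 'g free_mon = Word (letters: "'g list")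

instantiation free_mon :: (type) monoid_add
begin

definition zero_free_mon :: "'a free_mon"
  where "0 = Word []"

definition plus_free_mon :: "'a free_mon \<Rightarrow> 'a free_mon \<Rightarrow> 'a free_mon"
  where "u + v = Word (letters u @ letters v)"

instance
  by standard (simp_all add: zero_free_mon_def plus_free_mon_def)

end

text \<open>
  The free algebra is the monoid algebra of the free monoid; its ring structure is the convolution
  of \<^theory>\<open>HOL-Library.Poly_Mapping\<close>, in which the monoid is written additively.
\<close>

type_synonym ('k, 'g) free_alg = "'g free_mon \<Rightarrow>\<^sub>0 'k"

definition free_algebra :: "('k::field, ('k, 'g) free_alg) module"
  where "free_algebra =
    ring.extend ring_of_type_algebra (module.fields (\<lambda>c p. Poly_Mapping.map ((*) c) p))"

definition gen :: "'g \<Rightarrow> ('k::field, 'g) free_alg"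
  where "gen g = Poly_Mapping.single (Word [g]) 1"

definition const :: "'k::field \<Rightarrow> ('k, 'g) free_alg"
  where "const c = Poly_Mapping.single 0 c"

definition free_eval ::
    "('k::field, 'a, 'm) module_scheme \<Rightarrow> ('g \<Rightarrow> 'a) \<Rightarrow> ('k, 'g) free_alg \<Rightarrow> 'a"
  where "free_eval A f p =
    (\<Oplus>\<^bsub>A\<^esub>w\<in>Poly_Mapping.keys p.
       Poly_Mapping.lookup p w \<odot>\<^bsub>A\<^esub> foldr (\<lambda>g a. f g \<otimes>\<^bsub>A\<^esub> a) (letters w) \<one>\<^bsub>A\<^esub>)"

definition presented_alg ::
    "('k::field, 'g) free_alg set \<Rightarrow> ('k, ('k, 'g) free_alg set) module"
  where "presented_alg rels = quot_alg free_algebra (Idl\<^bsub>free_algebra\<^esub> rels)"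

definition presented_cls ::
    "('k::field, 'g) free_alg set \<Rightarrow> ('k, 'g) free_alg \<Rightarrow> ('k, 'g) free_alg set"
  where "presented_cls rels p = (Idl\<^bsub>free_algebra\<^esub> rels) +>\<^bsub>free_algebra\<^esub> p"

text \<open>
  The free vector space on \<open>carrier A \<times> carrier B\<close>, with the bilinear extension of
  \<open>(a, b) (a', b') = (a a', b b')\<close> as multiplication. The tensor product is its quotient by the
  span of the bilinearity relations, which is a two-sided ideal.
\<close>

definition pair_alg ::
    "('k::field, 'a, 'm) module_scheme \<Rightarrow> ('k, 'b, 'n) module_scheme
      \<Rightarrow> ('k, ('a \<times> 'b) \<Rightarrow>\<^sub>0 'k) module"
  where "pair_alg A B =
    ring.extend
    \<lparr>carrier = {p. Poly_Mapping.keys p \<subseteq> carrier A \<times> carrier B},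
     monoid.mult = (\<lambda>p q. \<Sum>x\<in>Poly_Mapping.keys p. \<Sum>y\<in>Poly_Mapping.keys q.
               Poly_Mapping.single (fst x \<otimes>\<^bsub>A\<^esub> fst y, snd x \<otimes>\<^bsub>B\<^esub> snd y)
                 (Poly_Mapping.lookup p x * Poly_Mapping.lookup q y)),
     monoid.one = Poly_Mapping.single (\<one>\<^bsub>A\<^esub>, \<one>\<^bsub>B\<^esub>) 1,
     ring.zero = 0,
     ring.add = (+)\<rparr>
    (module.fields (\<lambda>c p. Poly_Mapping.map ((*) c) p))"

definition bilin_rels ::
    "('k::field, 'a, 'm) module_scheme \<Rightarrow> ('k, 'b, 'n) module_scheme \<Rightarrow> (('a \<times> 'b) \<Rightarrow>\<^sub>0 'k) set"
  where "bilin_rels A B =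
    {Poly_Mapping.single (a \<oplus>\<^bsub>A\<^esub> a', b) 1 - Poly_Mapping.single (a, b) 1
       - Poly_Mapping.single (a', b) 1 | a a' b.
       a \<in> carrier A \<and> a' \<in> carrier A \<and> b \<in> carrier B} \<union>
    {Poly_Mapping.single (a, b \<oplus>\<^bsub>B\<^esub> b') 1 - Poly_Mapping.single (a, b) 1
       - Poly_Mapping.single (a, b') 1 | a b b'.
       a \<in> carrier A \<and> b \<in> carrier B \<and> b' \<in> carrier B} \<union>
    {Poly_Mapping.single (c \<odot>\<^bsub>A\<^esub> a, b) 1 - Poly_Mapping.single (a, b) c | c a b.
       a \<in> carrier A \<and> b \<in> carrier B} \<union>
    {Poly_Mapping.single (a, c \<odot>\<^bsub>B\<^esub> b) 1 - Poly_Mapping.single (a, b) c | c a b.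
       a \<in> carrier A \<and> b \<in> carrier B}"

definition tensor_alg ::
    "('k::field, 'a, 'm) module_scheme \<Rightarrow> ('k, 'b, 'n) module_scheme
      \<Rightarrow> ('k, (('a \<times> 'b) \<Rightarrow>\<^sub>0 'k) set) module"
  where "tensor_alg A B = quot_alg (pair_alg A B) (lin_span (pair_alg A B) (bilin_rels A B))"

definition pure_tensor ::
    "('k::field, 'a, 'm) module_scheme \<Rightarrow> ('k, 'b, 'n) module_scheme
      \<Rightarrow> 'a \<Rightarrow> 'b \<Rightarrow> (('a \<times> 'b) \<Rightarrow>\<^sub>0 'k) set"
  where "pure_tensor A B a b =
    lin_span (pair_alg A B) (bilin_rels A B) +>\<^bsub>pair_alg A B\<^esub> Poly_Mapping.single (a, b) 1"

text \<open>
  For subspaces \<open>V \<subseteq> A\<close> and \<open>W \<subseteq> B\<close>, the canonical (over a field, injective) image of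
  \<open>V \<otimes> W\<close> in \<open>A \<otimes> B\<close>.
\<close>

definition tensor_sub ::
    "('k::field, 'a, 'm) module_scheme \<Rightarrow> ('k, 'b, 'n) module_scheme
      \<Rightarrow> 'a set \<Rightarrow> 'b set \<Rightarrow> (('a \<times> 'b) \<Rightarrow>\<^sub>0 'k) set set"
  where "tensor_sub A B V W =
    lin_span (tensor_alg A B) {pure_tensor A B v w | v w. v \<in> V \<and> w \<in> W}"

definition right_coideal_subalgebra ::
    "('k::field, 'a, 'm) module_scheme \<Rightarrow> ('a \<Rightarrow> (('a \<times> 'a) \<Rightarrow>\<^sub>0 'k) set) \<Rightarrow> 'a set \<Rightarrow> bool"
  where "right_coideal_subalgebra H \<Delta> A \<longleftrightarrow>
    is_subalgebra H A \<and> \<Delta> ` A \<subseteq> tensor_sub H H A (carrier H)"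

text \<open>\<open>word_span A S n\<close> is \<open>V\<^sup>0 + V\<^sup>1 + \<dots> + V\<^sup>n\<close> for the span \<open>V\<close> of \<open>S\<close>.\<close>

definition word_span :: "('k::field, 'a, 'm) module_scheme \<Rightarrow> 'a set \<Rightarrow> nat \<Rightarrow> 'a set"
  where "word_span A S n =
    lin_span A {foldr (\<lambda>s a. s \<otimes>\<^bsub>A\<^esub> a) ws \<one>\<^bsub>A\<^esub> | ws. set ws \<subseteq> S \<and> length ws \<le> n}"

definition GK_dim :: "('k::field, 'a, 'm) module_scheme \<Rightarrow> 'a set \<Rightarrow> ereal"
  where "GK_dim A B =
    (SUP S\<in>{S. finite S \<and> S \<subseteq> B}.
       limsup (\<lambda>n. ereal (log (real n) (real (ring.dim A (scalars A) (word_span A S n))))))"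

definition is_transcendental :: "('k::field, 'a, 'm) module_scheme \<Rightarrow> 'a \<Rightarrow> bool"
  where "is_transcendental A u \<longleftrightarrow>
    inj (\<lambda>p :: 'k poly. \<Oplus>\<^bsub>A\<^esub>i\<in>{..Polynomial.degree p}. Polynomial.coeff p i \<odot>\<^bsub>A\<^esub> (u [^]\<^bsub>A\<^esub> i))"

text \<open>
  \<open>S = R[v; \<sigma>, \<delta>]\<close> for an algebra automorphism \<open>\<sigma>\<close> and a left \<open>\<sigma>\<close>-derivation \<open>\<delta>\<close> of \<open>R\<close>. The
  maps matter only on \<open>R\<close>; the last clause is freeness of \<open>S\<close> over \<open>R\<close> on the powers of \<open>v\<close>.
\<close>

definition is_ore_extension ::
    "('k::field, 'a, 'm) module_scheme \<Rightarrow> 'a set \<Rightarrow> 'a \<Rightarrow> ('a \<Rightarrow> 'a) \<Rightarrow> ('a \<Rightarrow> 'a) \<Rightarrow> 'a set \<Rightarrow> bool"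
  where "is_ore_extension A R v \<sigma> \<delta> S \<longleftrightarrow>
    is_subalgebra A R \<and> is_subalgebra A S \<and> R \<subseteq> S \<and> v \<in> S \<and>
    \<sigma> \<in> ring_iso (A\<lparr>carrier := R\<rparr>) (A\<lparr>carrier := R\<rparr>) \<and>
    (\<forall>c. \<forall>r\<in>R. \<sigma> (c \<odot>\<^bsub>A\<^esub> r) = c \<odot>\<^bsub>A\<^esub> \<sigma> r) \<and>
    \<delta> \<in> R \<rightarrow> R \<and>
    (\<forall>r\<in>R. \<forall>s\<in>R. \<delta> (r \<oplus>\<^bsub>A\<^esub> s) = \<delta> r \<oplus>\<^bsub>A\<^esub> \<delta> s) \<and>
    (\<forall>c. \<forall>r\<in>R. \<delta> (c \<odot>\<^bsub>A\<^esub> r) = c \<odot>\<^bsub>A\<^esub> \<delta> r) \<and>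
    (\<forall>r\<in>R. \<forall>s\<in>R. \<delta> (r \<otimes>\<^bsub>A\<^esub> s) = \<sigma> r \<otimes>\<^bsub>A\<^esub> \<delta> s \<oplus>\<^bsub>A\<^esub> \<delta> r \<otimes>\<^bsub>A\<^esub> s) \<and>
    (\<forall>r\<in>R. v \<otimes>\<^bsub>A\<^esub> r = \<sigma> r \<otimes>\<^bsub>A\<^esub> v \<oplus>\<^bsub>A\<^esub> \<delta> r) \<and>
    (\<forall>s\<in>S. \<exists>!f :: nat \<Rightarrow> 'a. range f \<subseteq> R \<and> finite {n. f n \<noteq> \<zero>\<^bsub>A\<^esub>} \<and>
       s = (\<Oplus>\<^bsub>A\<^esub>n\<in>{n. f n \<noteq> \<zero>\<^bsub>A\<^esub>}. f n \<otimes>\<^bsub>A\<^esub> (v [^]\<^bsub>A\<^esub> n)))"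

definition is_ore_der :: "('k::field, 'a, 'm) module_scheme \<Rightarrow> 'a \<Rightarrow> 'a \<Rightarrow> ('a \<Rightarrow> 'a) \<Rightarrow> bool"
  where "is_ore_der A u v \<delta> \<longleftrightarrow>
    is_transcendental A u \<and> is_ore_extension A (alg_gen A {u}) v (\<lambda>r. r) \<delta> (alg_gen A {u, v})"

definition is_ore_aut :: "('k::field, 'a, 'm) module_scheme \<Rightarrow> 'a \<Rightarrow> 'a \<Rightarrow> ('a \<Rightarrow> 'a) \<Rightarrow> bool"
  where "is_ore_aut A u v \<sigma> \<longleftrightarrow>
    is_transcendental A u \<and>
    is_ore_extension A (alg_gen A {u}) v \<sigma> (\<lambda>_. \<zero>\<^bsub>A\<^esub>) (alg_gen A {u, v})"

datatype B_gen = GX | GY | GZ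

definition B_rels :: "'k::field \<Rightarrow> ('k, B_gen) free_alg set"
  where "B_rels l =
    {(gen GX * gen GY - gen GY * gen GX) - gen GY,
     (gen GZ * gen GX - gen GX * gen GZ) - (- gen GZ + const l * gen GY),
     (gen GZ * gen GY - gen GY * gen GZ) - const (1/2) * (gen GY * gen GY)}"

type_synonym 'k B_elem = "('k, B_gen) free_alg set"

definition B_alg :: "'k::field \<Rightarrow> ('k, 'k B_elem) module"
  where "B_alg l = presented_alg (B_rels l)"

definition B_of :: "'k::field \<Rightarrow> B_gen \<Rightarrow> 'k B_elem"
  where "B_of l g = presented_cls (B_rels l) (gen g)"

fun B_comult_gen :: "'k::field \<Rightarrow> B_gen \<Rightarrow> (('k B_elem \<times> 'k B_elem) \<Rightarrow>\<^sub>0 'k) set"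
  where
    "B_comult_gen l GX =
      pure_tensor (B_alg l) (B_alg l) (B_of l GX) \<one>\<^bsub>B_alg l\<^esub>
        \<oplus>\<^bsub>tensor_alg (B_alg l) (B_alg l)\<^esub>
      pure_tensor (B_alg l) (B_alg l) \<one>\<^bsub>B_alg l\<^esub> (B_of l GX)"
  | "B_comult_gen l GY =
      pure_tensor (B_alg l) (B_alg l) (B_of l GY) \<one>\<^bsub>B_alg l\<^esub>
        \<oplus>\<^bsub>tensor_alg (B_alg l) (B_alg l)\<^esub>
      pure_tensor (B_alg l) (B_alg l) \<one>\<^bsub>B_alg l\<^esub> (B_of l GY)"
  | "B_comult_gen l GZ =
      pure_tensor (B_alg l) (B_alg l) (B_of l GZ) \<one>\<^bsub>B_alg l\<^esub>
        \<oplus>\<^bsub>tensor_alg (B_alg l) (B_alg l)\<^esub>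
      pure_tensor (B_alg l) (B_alg l) \<one>\<^bsub>B_alg l\<^esub> (B_of l GZ)
        \<oplus>\<^bsub>tensor_alg (B_alg l) (B_alg l)\<^esub>
      pure_tensor (B_alg l) (B_alg l) (B_of l GX) (B_of l GY)"

text \<open>
  The comultiplication is the algebra homomorphism with these values on the generators: evaluation
  of noncommutative polynomials at them is constant on each coset modulo the relations.
\<close>

definition B_comult :: "'k::field \<Rightarrow> 'k B_elem \<Rightarrow> (('k B_elem \<times> 'k B_elem) \<Rightarrow>\<^sub>0 'k) set"
  where "B_comult l h =
    the_elem (free_eval (tensor_alg (B_alg l) (B_alg l)) (B_comult_gen l) ` h)"

end

theory Submission
  imports Defs
begin

text \<open>
  The left regular representation is realised on \<open>M = k[Y][X][Z]\<close> through
  \<open>X \<mapsto> X + Y \<partial>\<^sub>Y\<close>, \<open>Y \<mapsto> Y\<close>, \<open>Z \<mapsto> S Z + \<lambda> Y \<partial>\<^sub>X + (1/2) Y\<^sup>2 \<partial>\<^sub>Y\<close>, where \<open>S\<close> is the shift \<open>X \<mapsto> X - 1\<close>;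
  this gives the PBW basis \<open>Y\<^sup>i X\<^sup>j Z\<^sup>k\<close>. Pairing the second tensor factor of \<open>\<Delta>\<close> with functionals
  shows that a right coideal subalgebra \<open>A\<close>, viewed in \<open>M\<close>, is closed under \<open>\<partial>\<^sub>X\<close> and \<open>\<partial>\<^sub>Z\<close>, and under
  \<open>\<partial>\<^sub>Y\<close> on elements of \<open>Z\<close>-degree \<open>0\<close>; it also sends \<open>Z + p \<in> A\<close> to \<open>X + \<partial>\<^sub>Y p \<in> A\<close>. Differentiating, either
  \<open>A\<close> lies in \<open>k[Y][X]\<close> or it contains some \<open>v = Z + p\<close> with \<open>p\<close> in \<open>k[Y][X]\<close>, and then \<open>A\<close> is free over
  \<open>C = A \<inter> k[Y][X]\<close> on the powers of \<open>v\<close>. The same operators leave for \<open>C\<close> only \<open>k\<close>, \<open>k[aX + bY]\<close> and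
  \<open>k[Y][X]\<close>; the condition \<open>X + \<partial>\<^sub>Y p \<in> C\<close> and closure under commutation with \<open>v\<close> then determine \<open>p\<close>
  up to the parameters of the theorem.
\<close>

section \<open>Algebras as records\<close>

text \<open>The statement speaks of records: quotients of a free algebra and of a free vector space
  on pairs. The computation happens in one type, \<open>'k lend\<close>, the \<open>k\<close>-linear
  endomorphisms of \<open>M[t]\<close>. \<open>H\<close> acts on the coefficients by its regular
  representation, faithfully because evaluation at 1 recovers PBW coordinates, and the extra
  variable \<open>t\<close> leaves room for a second representation that commutes with the first.
  Their product is therefore a homomorphism out of \<open>H \<otimes> H\<close>, and this is how
  elements of an abstract tensor product become computable.

  The functionals of the pairing are matrix coefficients of the second representation. The one dual
  to \<open>Z\<close> yields the derivative twisted by \<open>X \<mapsto> X + 1\<close>, because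
  \<open>Z\<close> shifts \<open>X\<close>; a character with \<open>X \<mapsto> -1\<close> is
  included to undo this. For \<open>Y\<close> a formula is derived only in \<open>Z\<close>-degree
  at most 1, which suffices. Characteristic zero enters because each descent relies on derivatives
  dropping a degree by exactly one, and because antiderivatives are taken in \<open>k[Y]\<close> and
  in \<open>k[X + aY]\<close>.\<close>

locale k_algebra = ring A for A :: "('k::field, 'a, 'm) module_scheme" (structure) +
  assumes smult_closed [simp, intro]: "x \<in> carrier A \<Longrightarrow> c \<odot> x \<in> carrier A"
    and smult_l_distr: "x \<in> carrier A \<Longrightarrow> (c + d) \<odot> x = c \<odot> x \<oplus> d \<odot> x"
    and smult_r_distr: "x \<in> carrier A \<Longrightarrow> y \<in> carrier A \<Longrightarrow> c \<odot> (x \<oplus> y) = c \<odot> x \<oplus> c \<odot> y"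
    and smult_assoc: "x \<in> carrier A \<Longrightarrow> (c * d) \<odot> x = c \<odot> (d \<odot> x)"
    and smult_one [simp]: "x \<in> carrier A \<Longrightarrow> 1 \<odot> x = x"
    and smult_mult_l: "x \<in> carrier A \<Longrightarrow> y \<in> carrier A \<Longrightarrow> (c \<odot> x) \<otimes> y = c \<odot> (x \<otimes> y)"
    and smult_mult_r: "x \<in> carrier A \<Longrightarrow> y \<in> carrier A \<Longrightarrow> x \<otimes> (c \<odot> y) = c \<odot> (x \<otimes> y)"
begin

lemma smult_zero_l [simp]: assumes "x \<in> carrier A" shows "0 \<odot> x = \<zero>"
proof -
  have "0 \<odot> x = 0 \<odot> x \<oplus> 0 \<odot> x" using smult_l_distr[of x 0 0] assms by simp
  then show ?thesis using assms by (metis add.r_cancel_one' smult_closed)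
qed

lemma smult_zero_r [simp]: "c \<odot> \<zero> = \<zero>"
  using smult_r_distr[of \<zero> \<zero> c] by (metis add.r_cancel_one' smult_closed zero_closed l_zero)

lemma smult_minus_l: assumes "x \<in> carrier A" shows "(- c) \<odot> x = \<ominus> (c \<odot> x)"
proof -
  have "(- c) \<odot> x \<oplus> c \<odot> x = \<zero>"
    using smult_l_distr[of x "-c" c] assms by simp
  then show ?thesis using assms by (simp add: minus_equality)
qed

lemma smult_minus_one: "x \<in> carrier A \<Longrightarrow> (- 1) \<odot> x = \<ominus> x"
  by (simp add: smult_minus_l)

lemma smult_minus_r: assumes "x \<in> carrier A" shows "c \<odot> (\<ominus> x) = \<ominus> (c \<odot> x)"
  using smult_assoc[of x c "-1"] assms by (simp add: smult_minus_one smult_minus_l)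

lemma smult_diff: "x \<in> carrier A \<Longrightarrow> y \<in> carrier A \<Longrightarrow> c \<odot> (x \<ominus> y) = c \<odot> x \<ominus> c \<odot> y"
  by (simp add: a_minus_def smult_r_distr smult_minus_r)

text \<open>Closure under negation comes for free, as
  \<open>\<ominus> x = (- 1) \<odot> x\<close>.\<close>

lemma submodule_iff:
  "submodule N base_field A \<longleftrightarrow> N \<subseteq> carrier A \<and> \<zero> \<in> N \<and> (\<forall>x\<in>N. \<forall>y\<in>N. x \<oplus> y \<in> N) \<and>
     (\<forall>c. \<forall>x\<in>N. c \<odot> x \<in> N)" (is "?L \<longleftrightarrow> ?R")
proof
  assume L: ?L
  then interpret submodule N base_field A .
  have "\<forall>c. \<forall>x\<in>N. c \<odot> x \<in> N"
    using L smult_closed by (simp add: ring_of_type_algebra_def)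
  then show ?R using subset one_closed m_closed by auto
next
  assume R: ?R
  have "\<ominus> x \<in> N" if "x \<in> N" for x
    using R that smult_minus_one[of x] by (metis subset_eq)
  with R show ?L
    by (auto intro!: submodule.intro subgroup.intro submodule_axioms.intro
        simp: a_inv_def ring_of_type_algebra_def)
qed

lemma subalgebra_iff:
  "is_subalgebra A B \<longleftrightarrow> B \<subseteq> carrier A \<and> \<one> \<in> B \<and> (\<forall>x\<in>B. \<forall>y\<in>B. x \<oplus> y \<in> B) \<and>
     (\<forall>c. \<forall>x\<in>B. c \<odot> x \<in> B) \<and> (\<forall>x\<in>B. \<forall>y\<in>B. x \<otimes> y \<in> B)" (is "?L \<longleftrightarrow> ?R")
proof
  assume ?L
  then have 1: "subring B A" and 2: "submodule B base_field A"
    by (auto simp: is_subalgebra_def)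
  show ?R
    using 2 subringE[OF 1] by (auto simp: submodule_iff)
next
  assume R: ?R
  then have z: "\<zero> \<in> B" using smult_zero_l[of \<one>] one_closed by metis
  have "\<ominus> x \<in> B" if "x \<in> B" for x
    using R that smult_minus_one[of x] by (metis subset_eq)
  then have "subring B A"
    using R by (intro subringI) auto
  moreover have "submodule B base_field A"
    using R z by (auto simp: submodule_iff)
  ultimately show ?L by (simp add: is_subalgebra_def)
qed

lemma subalgebra_minus: "is_subalgebra A B \<Longrightarrow> x \<in> B \<Longrightarrow> y \<in> B \<Longrightarrow> x \<ominus> y \<in> B"
  unfolding a_minus_def using smult_minus_one[of y] by (metis subalgebra_iff subset_eq)

lemma carrier_subalgebra: "is_subalgebra A (carrier A)"
  by (simp add: subalgebra_iff)

lemma lin_span_submodule: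
  assumes "S \<subseteq> carrier A" shows "submodule (lin_span A S) base_field A"
  unfolding lin_span_def submodule_iff using assms
  by (auto 0 4 simp: submodule_iff[of "carrier A"] dest: submodule_iff[THEN iffD1])

lemma lin_span_base: "S \<subseteq> lin_span A S"
  by (auto simp: lin_span_def)

lemma lin_span_minimal: "submodule N base_field A \<Longrightarrow> S \<subseteq> N \<Longrightarrow> lin_span A S \<subseteq> N"
  by (auto simp: lin_span_def)

lemma lin_span_carrier: "S \<subseteq> carrier A \<Longrightarrow> lin_span A S \<subseteq> carrier A"
  by (rule lin_span_minimal) (auto simp: submodule_iff)

lemma lin_span_closed:
  assumes "S \<subseteq> carrier A"
  shows "\<zero> \<in> lin_span A S" "x \<in> lin_span A S \<Longrightarrow> y \<in> lin_span A S \<Longrightarrow> x \<oplus> y \<in> lin_span A S"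
    "x \<in> lin_span A S \<Longrightarrow> c \<odot> x \<in> lin_span A S"
  using lin_span_submodule[OF assms] by (auto simp: submodule_iff)

lemma lin_span_induct [consumes 2, case_names zero base add smult]:
  assumes "x \<in> lin_span A S" "S \<subseteq> carrier A"
    and "P \<zero>" "\<And>s. s \<in> S \<Longrightarrow> P s"
    and "\<And>x y. x \<in> lin_span A S \<Longrightarrow> y \<in> lin_span A S \<Longrightarrow> P x \<Longrightarrow> P y \<Longrightarrow> P (x \<oplus> y)"
    and "\<And>c x. x \<in> lin_span A S \<Longrightarrow> P x \<Longrightarrow> P (c \<odot> x)"
  shows "P x"
proof -
  have "lin_span A S \<subseteq> {x \<in> lin_span A S. P x}"
    using assms(2-) lin_span_closed[OF assms(2)] lin_span_carrier[OF assms(2)] lin_span_base[of S]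
    by (intro lin_span_minimal) (auto simp: submodule_iff)
  then show ?thesis using assms(1) by auto
qed

lemma alg_gen_subalgebra:
  assumes "S \<subseteq> carrier A" shows "is_subalgebra A (alg_gen A S)"
  unfolding alg_gen_def subalgebra_iff using assms
  by (auto 0 4 simp: subalgebra_iff[of "carrier A"] dest: subalgebra_iff[THEN iffD1])

lemma alg_gen_base: "S \<subseteq> alg_gen A S"
  by (auto simp: alg_gen_def)

lemma alg_gen_minimal: "is_subalgebra A B \<Longrightarrow> S \<subseteq> B \<Longrightarrow> alg_gen A S \<subseteq> B"
  by (auto simp: alg_gen_def)

lemma scalars_subalgebra: "is_subalgebra A (scalars A)"
proof -
  have "\<exists>d. (c \<odot> \<one>) \<otimes> (c' \<odot> \<one>) = d \<odot> \<one>" for c c'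
    by (intro exI[of _ "c * c'"]) (simp add: smult_mult_l smult_mult_r smult_assoc[symmetric] mult.commute)
  moreover have "\<exists>d. (c \<odot> \<one>) \<oplus> (c' \<odot> \<one>) = d \<odot> \<one>" for c c'
    by (intro exI[of _ "c + c'"]) (simp add: smult_l_distr)
  moreover have "\<exists>d. c \<odot> (c' \<odot> \<one>) = d \<odot> \<one>" for c c'
    by (intro exI[of _ "c * c'"]) (simp add: smult_assoc)
  moreover have "\<exists>d. \<one> = d \<odot> \<one>"
    by (intro exI[of _ 1]) simp
  ultimately show ?thesis
    by (auto simp: subalgebra_iff scalars_def image_iff)
qed

end

definition alg_hom ::
    "('k::field, 'a, 'm) module_scheme \<Rightarrow> ('k, 'b, 'n) module_scheme \<Rightarrow> ('a \<Rightarrow> 'b) \<Rightarrow> bool"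
  where "alg_hom A B h \<longleftrightarrow> h \<in> carrier A \<rightarrow> carrier B \<and> h \<one>\<^bsub>A\<^esub> = \<one>\<^bsub>B\<^esub> \<and>
    (\<forall>x\<in>carrier A. \<forall>y\<in>carrier A. h (x \<oplus>\<^bsub>A\<^esub> y) = h x \<oplus>\<^bsub>B\<^esub> h y) \<and>
    (\<forall>x\<in>carrier A. \<forall>y\<in>carrier A. h (x \<otimes>\<^bsub>A\<^esub> y) = h x \<otimes>\<^bsub>B\<^esub> h y) \<and>
    (\<forall>c. \<forall>x\<in>carrier A. h (c \<odot>\<^bsub>A\<^esub> x) = c \<odot>\<^bsub>B\<^esub> h x)"

lemma alg_homD:
  assumes "alg_hom A B h"
  shows "x \<in> carrier A \<Longrightarrow> h x \<in> carrier B" "h \<one>\<^bsub>A\<^esub> = \<one>\<^bsub>B\<^esub>"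
    "x \<in> carrier A \<Longrightarrow> y \<in> carrier A \<Longrightarrow> h (x \<oplus>\<^bsub>A\<^esub> y) = h x \<oplus>\<^bsub>B\<^esub> h y"
    "x \<in> carrier A \<Longrightarrow> y \<in> carrier A \<Longrightarrow> h (x \<otimes>\<^bsub>A\<^esub> y) = h x \<otimes>\<^bsub>B\<^esub> h y"
    "x \<in> carrier A \<Longrightarrow> h (c \<odot>\<^bsub>A\<^esub> x) = c \<odot>\<^bsub>B\<^esub> h x"
  using assms by (auto simp: alg_hom_def)

lemma alg_hom_zero:
  assumes "k_algebra A" "k_algebra B" "alg_hom A B h" shows "h \<zero>\<^bsub>A\<^esub> = \<zero>\<^bsub>B\<^esub>"
proof -
  interpret A: k_algebra A by fact
  interpret B: k_algebra B by fact
  show ?thesis using alg_homD(5)[OF assms(3), of "\<one>\<^bsub>A\<^esub>" 0] alg_homD(1)[OF assms(3), of "\<one>\<^bsub>A\<^esub>"] by simp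
qed

lemma alg_hom_minus:
  assumes "k_algebra A" "k_algebra B" "alg_hom A B h" "x \<in> carrier A" "y \<in> carrier A"
  shows "h (x \<ominus>\<^bsub>A\<^esub> y) = h x \<ominus>\<^bsub>B\<^esub> h y"
proof -
  interpret A: k_algebra A by fact
  interpret B: k_algebra B by fact
  note h = alg_homD[OF assms(3)]
  have "h (\<ominus>\<^bsub>A\<^esub> y) = \<ominus>\<^bsub>B\<^esub> h y"
    using h(5)[of y "-1"] h(1)[of y] assms by (simp add: A.smult_minus_one B.smult_minus_one)
  then show ?thesis using h assms by (simp add: a_minus_def)
qed

lemma alg_hom_finsum:
  assumes "k_algebra A" "k_algebra B" "alg_hom A B h" "f \<in> I \<rightarrow> carrier A"
  shows "h (\<Oplus>\<^bsub>A\<^esub>i\<in>I. f i) = (\<Oplus>\<^bsub>B\<^esub>i\<in>I. h (f i))"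
proof -
  interpret A: k_algebra A by fact
  interpret B: k_algebra B by fact
  note h = alg_homD[OF assms(3)]
  show ?thesis using assms(4)
  proof (induction I rule: infinite_finite_induct)
    case (insert i I)
    then have "f \<in> I \<rightarrow> carrier A" "f i \<in> carrier A" by auto
    moreover from this have "(\<lambda>i. h (f i)) \<in> I \<rightarrow> carrier B" using h(1) by auto
    ultimately show ?case using insert h
      by (simp add: A.finsum_insert B.finsum_insert A.finsum_closed)
  qed (auto simp: alg_hom_zero[OF assms(1-3)])
qed

lemma alg_hom_comp: "alg_hom A B g \<Longrightarrow> alg_hom B C h \<Longrightarrow> alg_hom A C (\<lambda>x. h (g x))"
  by (auto simp: alg_hom_def Pi_def)

lemma alg_hom_vimage_subalgebra:
  assumes "k_algebra A" "k_algebra B" "alg_hom A B h" "is_subalgebra B S"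
  shows "is_subalgebra A {a \<in> carrier A. h a \<in> S}"
proof -
  interpret A: k_algebra A by fact
  interpret B: k_algebra B by fact
  show ?thesis using alg_homD[OF assms(3)] assms(4)
    by (auto simp: A.subalgebra_iff B.subalgebra_iff)
qed

lemma alg_hom_image_subalgebra:
  assumes "k_algebra A" "k_algebra B" "alg_hom A B h" "is_subalgebra A S"
  shows "is_subalgebra B (h ` S)"
proof -
  interpret A: k_algebra A by fact
  interpret B: k_algebra B by fact
  note h = alg_homD[OF assms(3)]
  have S: "S \<subseteq> carrier A" "\<one>\<^bsub>A\<^esub> \<in> S" "\<And>x y. x \<in> S \<Longrightarrow> y \<in> S \<Longrightarrow> x \<oplus>\<^bsub>A\<^esub> y \<in> S"
    "\<And>c x. x \<in> S \<Longrightarrow> c \<odot>\<^bsub>A\<^esub> x \<in> S" "\<And>x y. x \<in> S \<Longrightarrow> y \<in> S \<Longrightarrow> x \<otimes>\<^bsub>A\<^esub> y \<in> S"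
    using assms(4) by (auto simp: A.subalgebra_iff)
  have "h x \<oplus>\<^bsub>B\<^esub> h y \<in> h ` S" if "x \<in> S" "y \<in> S" for x y
    using h(3)[of x y] S that by (metis imageI subset_eq)
  moreover have "h x \<otimes>\<^bsub>B\<^esub> h y \<in> h ` S" if "x \<in> S" "y \<in> S" for x y
    using h(4)[of x y] S that by (metis imageI subset_eq)
  moreover have "c \<odot>\<^bsub>B\<^esub> h x \<in> h ` S" if "x \<in> S" for c x
    using h(5)[of x c] S that by (metis imageI subset_eq)
  moreover have "\<one>\<^bsub>B\<^esub> \<in> h ` S" using h(2) S by (metis imageI)
  ultimately show ?thesis using h(1) S(1) by (auto simp: B.subalgebra_iff)
qed

lemma alg_hom_image_alg_gen:
  assumes "k_algebra A" "k_algebra B" "alg_hom A B h" "S \<subseteq> carrier A"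
  shows "h ` alg_gen A S = alg_gen B (h ` S)"
proof -
  interpret A: k_algebra A by fact
  interpret B: k_algebra B by fact
  have hS: "h ` S \<subseteq> carrier B" using alg_homD(1)[OF assms(3)] assms(4) by auto
  have "alg_gen B (h ` S) \<subseteq> h ` alg_gen A S"
    using alg_hom_image_subalgebra[OF assms(1-3) A.alg_gen_subalgebra[OF assms(4)]] A.alg_gen_base[of S]
    by (intro B.alg_gen_minimal) auto
  moreover have "alg_gen A S \<subseteq> {a \<in> carrier A. h a \<in> alg_gen B (h ` S)}"
    using alg_hom_vimage_subalgebra[OF assms(1-3) B.alg_gen_subalgebra[OF hS]] B.alg_gen_base[of "h ` S"] assms(4)
    by (intro A.alg_gen_minimal) auto
  ultimately show ?thesis by auto
qed

text \<open>\<open>quot_alg\<close> extends the quotient ring of the library by a scalar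
  multiplication, which makes it a different record with the same operations; the ring axioms are
  carried over field by field.\<close>

lemma ring_record_cong:
  assumes "ring R" "carrier S = carrier R" "monoid.mult S = monoid.mult R" "monoid.one S = monoid.one R"
    "ring.zero S = ring.zero R" "ring.add S = ring.add R"
  shows "ring S"
proof -
  interpret R: ring R by fact
  have "\<exists>y\<in>carrier R. y \<oplus>\<^bsub>R\<^esub> x = \<zero>\<^bsub>R\<^esub>" if "x \<in> carrier R" for x
    using that R.l_neg by blast
  then show ?thesis
    using assms
    by (intro ringI abelian_groupI monoidI)
      (auto simp: R.a_ac R.m_assoc R.l_distr R.r_distr)
qed

subsection \<open>Quotients\<close>

lemma quot_alg_simps:
  "carrier (quot_alg A I) = carrier (A Quot I)"
  "monoid.mult (quot_alg A I) = monoid.mult (A Quot I)"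
  "monoid.one (quot_alg A I) = monoid.one (A Quot I)"
  "ring.zero (quot_alg A I) = ring.zero (A Quot I)"
  "ring.add (quot_alg A I) = ring.add (A Quot I)"
  "module.smult (quot_alg A I) = (\<lambda>c S. \<Union>a\<in>S. I +>\<^bsub>A\<^esub> (c \<odot>\<^bsub>A\<^esub> a))"
  by (simp_all add: quot_alg_def ring.defs module.defs)

locale quotient_algebra = k_algebra A for A :: "('k::field, 'a, 'm) module_scheme" (structure) +
  fixes I assumes ideal: "ideal I A"
begin

sublocale I: ideal I A by (rule ideal)

lemma smult_ideal: assumes "i \<in> I" shows "c \<odot> i \<in> I"
proof -
  have "c \<odot> i = (c \<odot> \<one>) \<otimes> i" using assms I.Icarr by (simp add: smult_mult_l)
  then show ?thesis using assms by (simp add: I.I_l_closed)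
qed

lemma coset_eq_iff:
  "a \<in> carrier A \<Longrightarrow> b \<in> carrier A \<Longrightarrow> I +> a = I +> b \<longleftrightarrow> a \<ominus> b \<in> I"
  using quotient_eq_iff_same_a_r_cos[OF ideal] by auto

lemma mem_coset_iff: "a \<in> carrier A \<Longrightarrow> b \<in> I +> a \<longleftrightarrow> b \<in> carrier A \<and> I +> b = I +> a"
  by (metis I.a_rcos_self a_r_coset_subset_G I.a_repr_independence' I.a_subset subsetD)

lemma coset_carrier: "carrier (quot_alg A I) = (\<lambda>a. I +> a) ` carrier A"
  by (auto simp: quot_alg_simps FactRing_simps)

text \<open>The scalar multiplication of \<open>quot_alg\<close> is a union over all
  representatives. They all contribute the same coset, because an ideal absorbs
  \<open>c \<odot> \<one>\<close> and hence scalars.\<close>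

lemma smult_coset:
  assumes "a \<in> carrier A" shows "c \<odot>\<^bsub>quot_alg A I\<^esub> (I +> a) = I +> (c \<odot> a)"
proof -
  have "I +> (c \<odot> b) = I +> (c \<odot> a)" if "b \<in> I +> a" for b
  proof -
    have b: "b \<in> carrier A" "b \<ominus> a \<in> I" using that assms by (auto simp: mem_coset_iff coset_eq_iff)
    then have "c \<odot> b \<ominus> c \<odot> a \<in> I" using smult_ideal[of "b \<ominus> a" c] assms by (simp add: smult_diff)
    then show ?thesis using b assms by (simp add: coset_eq_iff)
  qed
  moreover have "a \<in> I +> a" using assms I.a_rcos_self by simp
  ultimately show ?thesis unfolding quot_alg_simps by blast
qed

lemma coset_ops:
  assumes "a \<in> carrier A" "b \<in> carrier A"
  shows "(I +> a) \<oplus>\<^bsub>quot_alg A I\<^esub> (I +> b) = I +> (a \<oplus> b)"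
    "(I +> a) \<otimes>\<^bsub>quot_alg A I\<^esub> (I +> b) = I +> (a \<otimes> b)"
  using assms I.a_rcos_sum I.rcoset_mult_add
  by (auto simp: quot_alg_simps FactRing_def)

lemma coset_one_zero:
  "\<one>\<^bsub>quot_alg A I\<^esub> = I +> \<one>" "\<zero>\<^bsub>quot_alg A I\<^esub> = I +> \<zero>"
  using a_rcos_zero[OF ideal additive_subgroup.zero_closed[OF I.additive_subgroup_axioms]]
  by (auto simp: quot_alg_simps FactRing_def)

lemma quot_k_algebra: "k_algebra (quot_alg A I)"
proof -
  interpret Q: ring "quot_alg A I"
    by (rule ring_record_cong[OF I.quotient_is_ring]) (simp_all add: quot_alg_simps)
  show ?thesis
    by unfold_locales
      (auto simp: coset_carrier smult_coset coset_ops coset_one_zero smult_l_distr smult_r_distr smult_assoc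
        smult_mult_l smult_mult_r)
qed

lemma coset_hom: "alg_hom A (quot_alg A I) (\<lambda>a. I +> a)"
  by (auto simp: alg_hom_def coset_carrier coset_ops coset_one_zero smult_coset)

lemma quot_induced_hom:
  assumes "k_algebra B" "alg_hom A B h" "\<And>i. i \<in> I \<Longrightarrow> h i = \<zero>\<^bsub>B\<^esub>"
  obtains h' where "alg_hom (quot_alg A I) B h'" "\<And>a. a \<in> carrier A \<Longrightarrow> h' (I +> a) = h a"
proof -
  interpret B: k_algebra B by fact
  note h = alg_homD[OF assms(2)]
  \<comment> \<open>Any representative will do: \<open>h\<close> vanishes on \<open>I\<close> and is
    therefore constant on cosets.\<close>
  define h' where "h' S = h (SOME a. a \<in> S)" for S
  have h': "h' (I +> a) = h a" if a: "a \<in> carrier A" for a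
  proof -
    define b where "b = (SOME b. b \<in> I +> a)"
    have "b \<in> I +> a" unfolding b_def by (rule someI[of _ a]) (use a I.a_rcos_self in simp)
    then have b: "b \<in> carrier A" "b \<ominus> a \<in> I" using a by (auto simp: mem_coset_iff coset_eq_iff)
    have "h b \<ominus>\<^bsub>B\<^esub> h a = \<zero>\<^bsub>B\<^esub>"
      using alg_hom_minus[OF k_algebra_axioms assms(1,2) b(1) a] assms(3)[OF b(2)] by simp
    then show ?thesis using h(1) a b by (simp add: h'_def b_def[symmetric])
  qed
  have "alg_hom (quot_alg A I) B h'"
    using h by (auto simp: alg_hom_def coset_carrier coset_ops coset_one_zero smult_coset h')
  with h' show ?thesis using that by blast
qed

end

section \<open>Finitely supported functions and the free algebra\<close>

lemma lookup_scale: "Poly_Mapping.lookup (Poly_Mapping.map ((*) c) p) k = (c::'k::field) * Poly_Mapping.lookup p k"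
  by (simp add: Poly_Mapping.map.rep_eq when_def)

lemma scale_single: "Poly_Mapping.map ((*) c) (Poly_Mapping.single k d) = Poly_Mapping.single k (c * d :: 'k::field)"
  by (rule poly_mapping_eqI) (simp add: lookup_scale lookup_single when_def)

lemma scale_zero [simp]: "Poly_Mapping.map ((*) (c::'k::field)) 0 = 0"
  by (rule poly_mapping_eqI) (simp add: lookup_scale)

lemma keys_scale: "Poly_Mapping.keys (Poly_Mapping.map ((*) (c::'k::field)) p) \<subseteq> Poly_Mapping.keys p"
  by (auto simp: in_keys_iff lookup_scale)

text \<open>The key set \<open>K\<close> is carried along because elements of
  \<open>pair_alg\<close> may only use pairs from the two carriers as keys.\<close>

lemma poly_mapping_induct_keys [consumes 1, case_names zero single add]:
  assumes "Poly_Mapping.keys p \<subseteq> K" "P 0"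
    and "\<And>k c. k \<in> K \<Longrightarrow> P (Poly_Mapping.single k c)"
    and "\<And>p q. Poly_Mapping.keys p \<subseteq> K \<Longrightarrow> Poly_Mapping.keys q \<subseteq> K \<Longrightarrow> P p \<Longrightarrow> P q \<Longrightarrow> P (p + q)"
  shows "P (p :: 'x \<Rightarrow>\<^sub>0 'k::ab_group_add)"
proof -
  have "P p" if "finite U" "Poly_Mapping.keys p \<subseteq> U" "U \<subseteq> K" for U p
    using that
  proof (induction U arbitrary: p rule: finite_induct)
    case empty
    then have "p = 0" by simp
    then show ?case using assms(2) by simp
  next
    case (insert x U)
    define q where "q = p - Poly_Mapping.single x (Poly_Mapping.lookup p x)"
    have q: "Poly_Mapping.keys q \<subseteq> U"
      using insert.prems(1) insert.hyps
      by (auto simp: q_def in_keys_iff lookup_minus lookup_single when_def split: if_splits)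
    have p: "p = q + Poly_Mapping.single x (Poly_Mapping.lookup p x)"
      by (simp add: q_def)
    show ?case
      using insert q by (subst p, intro assms(4) assms(3) insert.IH) auto
  qed
  from this[of "Poly_Mapping.keys p" p] assms(1) show ?thesis by simp
qed

lemmas poly_mapping_single_induct =
  poly_mapping_induct_keys[of _ UNIV, simplified, case_names zero single add]

text \<open>A ring that is a whole type, seen as an algebra record through a map of scalars. With
  such a target the carrier conditions disappear and the laws of the type class do the
  rewriting.\<close>

definition type_alg :: "('k \<Rightarrow> 'r) \<Rightarrow> ('k::field, 'r::ring_1) module"
  where "type_alg \<iota> = ring.extend ring_of_type_algebra (module.fields (\<lambda>c a. \<iota> c * a))"

lemma type_alg_simps [simp]:
  "carrier (type_alg \<iota>) = UNIV" "a \<otimes>\<^bsub>type_alg \<iota>\<^esub> b = a * b" "a \<oplus>\<^bsub>type_alg \<iota>\<^esub> b = a + b"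
  "\<one>\<^bsub>type_alg \<iota>\<^esub> = 1" "\<zero>\<^bsub>type_alg \<iota>\<^esub> = 0" "c \<odot>\<^bsub>type_alg \<iota>\<^esub> a = \<iota> c * a"
  by (simp_all add: type_alg_def ring.defs module.defs ring_of_type_algebra_def)

locale scalar_map =
  fixes \<iota> :: "'k::field \<Rightarrow> 'r::ring_1"
  assumes \<iota>_one [simp]: "\<iota> 1 = 1" and \<iota>_add: "\<iota> (c + d) = \<iota> c + \<iota> d"
    and \<iota>_mult: "\<iota> (c * d) = \<iota> c * \<iota> d" and \<iota>_central: "a * \<iota> c = \<iota> c * a"
begin

lemma \<iota>_left_commute: "a * (\<iota> c * b) = \<iota> c * (a * b)"
  by (metis \<iota>_central mult.assoc)

lemma \<iota>_zero [simp]: "\<iota> 0 = 0"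
  using \<iota>_add[of 0 0] by simp

lemma \<iota>_minus: "\<iota> (- c) = - \<iota> c"
  using \<iota>_add[of "-c" c] by (simp add: add_eq_0_iff2)

lemma \<iota>_diff: "\<iota> (c - d) = \<iota> c - \<iota> d"
  using \<iota>_add[of c "-d"] by (simp add: \<iota>_minus)

sublocale ta: k_algebra "type_alg \<iota>"
proof -
  interpret ring "type_alg \<iota>"
  proof (intro ringI abelian_groupI monoidI)
    fix x show "\<exists>y\<in>carrier (type_alg \<iota>). y \<oplus>\<^bsub>type_alg \<iota>\<^esub> x = \<zero>\<^bsub>type_alg \<iota>\<^esub>"
      by (intro bexI[of _ "- x"]) simp_all
  qed (simp_all add: add_ac mult.assoc distrib_left distrib_right)
  show "k_algebra (type_alg \<iota>)"
    by unfold_locales (simp_all add: distrib_left distrib_right mult.assoc \<iota>_add \<iota>_mult, rule \<iota>_left_commute)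
qed

lemma type_alg_minus [simp]: "\<ominus>\<^bsub>type_alg \<iota>\<^esub> a = - a" "a \<ominus>\<^bsub>type_alg \<iota>\<^esub> b = a - b"
proof -
  show 1: "\<ominus>\<^bsub>type_alg \<iota>\<^esub> a = - a" for a
    by (rule ta.minus_equality) auto
  show "a \<ominus>\<^bsub>type_alg \<iota>\<^esub> b = a - b" by (simp add: a_minus_def 1)
qed

lemma type_alg_finsum [simp]: "finsum (type_alg \<iota>) f I = sum f I"
  by (induction I rule: infinite_finite_induct) auto

lemma type_alg_pow [simp]: "a [^]\<^bsub>type_alg \<iota>\<^esub> (n::nat) = a ^ n"
  by (induction n) (simp_all add: power_commutes)

end

lemma const_central: "p * const c = const c * (p :: ('k::field, 'g) free_alg)"
  by (induction p rule: poly_mapping_single_induct)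
    (auto simp: const_def mult_single algebra_simps)

lemma const_scalar: "scalar_map (const :: 'k::field \<Rightarrow> ('k, 'g) free_alg)"
  by unfold_locales (rule const_central | simp add: const_def single_add mult_single)+

interpretation const: scalar_map "const :: 'k::field \<Rightarrow> ('k, 'g) free_alg"
  by (rule const_scalar)

lemma free_algebra_eq: "free_algebra = type_alg const"
  by (simp add: free_algebra_def type_alg_def mult_map_scale_conv_mult const_def fun_eq_iff)

text \<open>Words are built up by multiplication from the left, the side on which the regular
  representation acts.\<close>

lemma free_alg_induct [case_names one gen add scale]:
  fixes p :: "('k::field, 'g) free_alg"
  assumes "P 1" "\<And>g p. P p \<Longrightarrow> P (gen g * p)" "\<And>p q. P p \<Longrightarrow> P q \<Longrightarrow> P (p + q)"
    "\<And>c p. P p \<Longrightarrow> P (const c * p)"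
  shows "P p"
proof (induction p rule: poly_mapping_single_induct)
  case zero
  show ?case using assms(4)[OF assms(1), of 0] by simp
next
  case (single w c)
  have w: "P (Poly_Mapping.single (Word gs) 1)" for gs :: "'g list"
  proof (induction gs)
    case Nil
    have "Word [] = (0 :: 'g free_mon)" by (simp add: zero_free_mon_def)
    with assms(1) show ?case by simp
  next
    case (Cons g gs)
    have "Poly_Mapping.single (Word (g # gs)) 1 = gen g * (Poly_Mapping.single (Word gs) 1 :: ('k, 'g) free_alg)"
      by (simp add: gen_def mult_single plus_free_mon_def)
    with assms(2)[OF Cons.IH, of g] show ?case by simp
  qed
  have "Poly_Mapping.single w c = const c * Poly_Mapping.single (Word (letters w)) 1"
    by (simp add: const_def mult_single)
  then show ?case using assms(4)[OF w, of c "letters w"] by simp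
next
  case (add p q)
  then show ?case by (rule assms(3))
qed

lemma letters_zero [simp]: "letters 0 = []"
  by (simp add: zero_free_mon_def)

context k_algebra
begin

context
  fixes f :: "'g \<Rightarrow> 'a"
  assumes f [simp]: "f g \<in> carrier A"
begin

abbreviation eval_word :: "'g free_mon \<Rightarrow> 'a"
  where "eval_word w \<equiv> foldr (\<lambda>g a. f g \<otimes> a) (letters w) \<one>"

lemma foldr_closed [simp]: "foldr (\<lambda>g a. f g \<otimes> a) gs \<one> \<in> carrier A"
  by (induction gs) auto

lemma foldr_append_mult:
  "foldr (\<lambda>g a. f g \<otimes> a) (gs @ hs) \<one> = foldr (\<lambda>g a. f g \<otimes> a) gs \<one> \<otimes> foldr (\<lambda>g a. f g \<otimes> a) hs \<one>"
proof (induction gs)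
  case (Cons g gs)
  then show ?case by (simp add: m_assoc del: foldr_append)
qed simp

lemma free_eval_superset:
  assumes "finite W" "Poly_Mapping.keys p \<subseteq> W"
  shows "free_eval A f p = (\<Oplus>w\<in>W. Poly_Mapping.lookup p w \<odot> eval_word w)"
  unfolding free_eval_def using assms
  by (intro add.finprod_mono_neutral_cong_left) (auto simp: in_keys_iff)

lemma free_eval_closed [simp]: "free_eval A f p \<in> carrier A"
  unfolding free_eval_def by (intro finsum_closed) auto

lemma free_eval_add: "free_eval A f (p + q) = free_eval A f p \<oplus> free_eval A f q"
proof -
  let ?W = "Poly_Mapping.keys p \<union> Poly_Mapping.keys q"
  have W: "finite ?W" by simp
  have "free_eval A f (p + q) = (\<Oplus>w\<in>?W. Poly_Mapping.lookup (p + q) w \<odot> eval_word w)"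
    by (rule free_eval_superset[OF W keys_add])
  also have "\<dots> = (\<Oplus>w\<in>?W. Poly_Mapping.lookup p w \<odot> eval_word w \<oplus> Poly_Mapping.lookup q w \<odot> eval_word w)"
    by (intro finsum_cong') (auto simp: lookup_add smult_l_distr)
  also have "\<dots> = (\<Oplus>w\<in>?W. Poly_Mapping.lookup p w \<odot> eval_word w) \<oplus> (\<Oplus>w\<in>?W. Poly_Mapping.lookup q w \<odot> eval_word w)"
    by (intro finsum_addf) auto
  also have "\<dots> = free_eval A f p \<oplus> free_eval A f q"
    using free_eval_superset[OF W, of p] free_eval_superset[OF W, of q] by simp
  finally show ?thesis .
qed

lemma free_eval_single: "free_eval A f (Poly_Mapping.single w c) = c \<odot> eval_word w"
  by (subst free_eval_superset[of "{w}"]) auto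

lemma free_eval_zero [simp]: "free_eval A f 0 = \<zero>"
  by (simp add: free_eval_def)

lemma free_eval_mult: "free_eval A f (p * q) = free_eval A f p \<otimes> free_eval A f q"
proof (induction p rule: poly_mapping_single_induct)
  case zero
  show ?case by simp
next
  case (add p p')
  then show ?case by (simp add: distrib_right free_eval_add l_distr)
next
  case (single u c)
  show ?case
  proof (induction q rule: poly_mapping_single_induct)
    case (single v d)
    have "eval_word (u + v) = eval_word u \<otimes> eval_word v"
      by (simp add: plus_free_mon_def foldr_append_mult del: foldr_append)
    then show ?case
      by (simp add: mult_single free_eval_single smult_mult_l smult_mult_r
          smult_assoc[symmetric] mult.commute)
  qed (simp_all add: distrib_left free_eval_add r_distr)
qed

lemma free_eval_hom: "alg_hom free_algebra A (free_eval A f)"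
proof -
  have "free_eval A f 1 = \<one>"
    using free_eval_single[of 0 1] by simp
  moreover have "free_eval A f (const c * p) = c \<odot> free_eval A f p" for c p
    using free_eval_single[of 0 c]
    by (simp add: free_eval_mult const_def[symmetric] smult_mult_l)
  ultimately show ?thesis
    by (auto simp: alg_hom_def free_algebra_eq free_eval_add free_eval_mult)
qed

lemma free_eval_gen: "free_eval A f (gen g) = f g"
  by (simp add: gen_def free_eval_single)

end

end

section \<open>The tensor product of two algebras\<close>

text \<open>The multiplication of \<open>pair_alg\<close> with an arbitrary operation on keys. Being
  biadditive, it satisfies a ring law as soon as the law holds on single keys.\<close>

definition conv :: "('x \<Rightarrow> 'y \<Rightarrow> 'z) \<Rightarrow> ('x \<Rightarrow>\<^sub>0 'k::field) \<Rightarrow> ('y \<Rightarrow>\<^sub>0 'k) \<Rightarrow> ('z \<Rightarrow>\<^sub>0 'k)"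
  where "conv F p q = (\<Sum>x\<in>Poly_Mapping.keys p. \<Sum>y\<in>Poly_Mapping.keys q.
     Poly_Mapping.single (F x y) (Poly_Mapping.lookup p x * Poly_Mapping.lookup q y))"

lemma conv_superset:
  assumes "finite U" "Poly_Mapping.keys p \<subseteq> U" "finite Y" "Poly_Mapping.keys q \<subseteq> Y"
  shows "conv F p q = (\<Sum>x\<in>U. \<Sum>y\<in>Y.
     Poly_Mapping.single (F x y) (Poly_Mapping.lookup p x * Poly_Mapping.lookup q y))"
proof -
  have "(\<Sum>y\<in>Poly_Mapping.keys q. Poly_Mapping.single (F x y) (Poly_Mapping.lookup p x * Poly_Mapping.lookup q y))
      = (\<Sum>y\<in>Y. Poly_Mapping.single (F x y) (Poly_Mapping.lookup p x * Poly_Mapping.lookup q y))" for x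
    using assms by (intro sum.mono_neutral_left) (auto simp: in_keys_iff)
  then show ?thesis
    unfolding conv_def using assms by (simp, intro sum.mono_neutral_left) (auto simp: in_keys_iff)
qed

lemma conv_add_left: "conv F (p + p') q = conv F p q + conv F p' q"
proof -
  let ?U = "Poly_Mapping.keys p \<union> Poly_Mapping.keys p'" and ?V = "Poly_Mapping.keys q"
  have "conv F (p + p') q = (\<Sum>x\<in>?U. \<Sum>y\<in>?V.
     Poly_Mapping.single (F x y) (Poly_Mapping.lookup (p + p') x * Poly_Mapping.lookup q y))"
    by (rule conv_superset[OF _ keys_add]) auto
  also have "\<dots> = (\<Sum>x\<in>?U. \<Sum>y\<in>?V. Poly_Mapping.single (F x y) (Poly_Mapping.lookup p x * Poly_Mapping.lookup q y))
     + (\<Sum>x\<in>?U. \<Sum>y\<in>?V. Poly_Mapping.single (F x y) (Poly_Mapping.lookup p' x * Poly_Mapping.lookup q y))"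
    by (simp only: lookup_add distrib_right single_add sum.distrib)
  also have "\<dots> = conv F p q + conv F p' q"
    using conv_superset[of ?U p ?V q F] conv_superset[of ?U p' ?V q F] by simp
  finally show ?thesis .
qed

lemma conv_add_right: "conv F p (q + q') = conv F p q + conv F p q'"
proof -
  let ?U = "Poly_Mapping.keys q \<union> Poly_Mapping.keys q'" and ?V = "Poly_Mapping.keys p"
  have "conv F p (q + q') = (\<Sum>x\<in>?V. \<Sum>y\<in>?U.
     Poly_Mapping.single (F x y) (Poly_Mapping.lookup p x * Poly_Mapping.lookup (q + q') y))"
    by (rule conv_superset[OF _ _ _ keys_add]) auto
  also have "\<dots> = (\<Sum>x\<in>?V. \<Sum>y\<in>?U. Poly_Mapping.single (F x y) (Poly_Mapping.lookup p x * Poly_Mapping.lookup q y))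
     + (\<Sum>x\<in>?V. \<Sum>y\<in>?U. Poly_Mapping.single (F x y) (Poly_Mapping.lookup p x * Poly_Mapping.lookup q' y))"
    by (simp only: lookup_add distrib_left single_add sum.distrib)
  also have "\<dots> = conv F p q + conv F p q'"
    using conv_superset[of ?V p ?U q F] conv_superset[of ?V p ?U q' F] by simp
  finally show ?thesis .
qed

lemma conv_zero [simp]: "conv F 0 q = 0" "conv F p 0 = 0"
  by (simp_all add: conv_def)

lemma conv_single: "conv F (Poly_Mapping.single a c) (Poly_Mapping.single b d) = Poly_Mapping.single (F a b) (c * d)"
  by (subst conv_superset[of "{a}" _ "{b}"]) auto

lemma keys_conv:
  assumes "Poly_Mapping.keys p \<subseteq> K" "Poly_Mapping.keys q \<subseteq> L" "\<And>x y. x \<in> K \<Longrightarrow> y \<in> L \<Longrightarrow> F x y \<in> M"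
  shows "Poly_Mapping.keys (conv F p q) \<subseteq> M"
  using assms(1)
proof (induction p rule: poly_mapping_induct_keys)
  case (single k c)
  note k = this
  show ?case using assms(2)
  proof (induction q rule: poly_mapping_induct_keys)
    case (single l d)
    then show ?case using assms(3) k by (simp add: conv_single)
  next
    case (add q q')
    then show ?case
      using keys_add[of "conv F (Poly_Mapping.single k c) q" "conv F (Poly_Mapping.single k c) q'"]
      unfolding conv_add_right by blast
  qed simp
next
  case (add p p')
  then show ?case
    using keys_add[of "conv F p q" "conv F p' q"] unfolding conv_add_left by blast
qed simp

lemma conv_assoc:
  assumes "Poly_Mapping.keys p \<subseteq> K" "Poly_Mapping.keys q \<subseteq> K" "Poly_Mapping.keys r \<subseteq> K"
    "\<And>x y z. x \<in> K \<Longrightarrow> y \<in> K \<Longrightarrow> z \<in> K \<Longrightarrow> F (F x y) z = F x (F y z)"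
  shows "conv F (conv F p q) r = conv F p (conv F q r)"
  using assms(1)
proof (induction p rule: poly_mapping_induct_keys)
  case (single k c)
  note k = this
  show ?case using assms(2)
  proof (induction q rule: poly_mapping_induct_keys)
    case (single l d)
    note l = this
    show ?case using assms(3)
    proof (induction r rule: poly_mapping_induct_keys)
      case (single m e)
      then show ?case using k l assms(4) by (simp add: conv_single mult.assoc)
    qed (simp_all add: conv_add_right)
  qed (simp_all add: conv_add_right conv_add_left)
qed (simp_all add: conv_add_left)

lemma conv_scale:
  fixes F :: "'x \<Rightarrow> 'y \<Rightarrow> 'z" and c :: "'k::field"
  shows "conv F (Poly_Mapping.map ((*) c) p) q = Poly_Mapping.map ((*) c) (conv F p q)"
  "conv F p (Poly_Mapping.map ((*) c) q) = Poly_Mapping.map ((*) c) (conv F p q)"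
proof -
  have sc: "Poly_Mapping.map ((*) c) (u + v) = Poly_Mapping.map ((*) c) u + Poly_Mapping.map ((*) c) v"
    for u v :: "'z \<Rightarrow>\<^sub>0 'k"
    by (rule poly_mapping_eqI) (simp add: lookup_scale lookup_add algebra_simps)
  have sc': "Poly_Mapping.map ((*) c) (\<Sum>i\<in>I. f i) = (\<Sum>i\<in>I. Poly_Mapping.map ((*) c) (f i))"
    for f :: "'i \<Rightarrow> 'z \<Rightarrow>\<^sub>0 'k" and I
    by (induction I rule: infinite_finite_induct) (simp_all add: sc)
  show "conv F (Poly_Mapping.map ((*) c) p) q = Poly_Mapping.map ((*) c) (conv F p q)"
    by (subst conv_superset[of _ _ "Poly_Mapping.keys q" q, OF _ keys_scale])
      (auto simp: conv_def sc' scale_single lookup_scale mult.assoc)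
  show "conv F p (Poly_Mapping.map ((*) c) q) = Poly_Mapping.map ((*) c) (conv F p q)"
    by (subst conv_superset[of "Poly_Mapping.keys p" p, OF _ _ _ keys_scale])
      (auto simp: conv_def sc' scale_single lookup_scale mult.left_commute)
qed

locale tensor_product = A: k_algebra A + B: k_algebra B
  for A :: "('k::field, 'a, 'm) module_scheme" and B :: "('k, 'b, 'n) module_scheme"
begin

abbreviation "PA \<equiv> pair_alg A B"
abbreviation "N \<equiv> lin_span PA (bilin_rels A B)"
abbreviation "T \<equiv> tensor_alg A B"
abbreviation "pure \<equiv> pure_tensor A B"

abbreviation "F \<equiv> \<lambda>x y. (fst x \<otimes>\<^bsub>A\<^esub> fst y, snd x \<otimes>\<^bsub>B\<^esub> snd y)"

lemma pair_alg_simps: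
  "carrier PA = {p. Poly_Mapping.keys p \<subseteq> carrier A \<times> carrier B}"
  "p \<otimes>\<^bsub>PA\<^esub> q = conv F p q" "p \<oplus>\<^bsub>PA\<^esub> q = p + q"
  "\<one>\<^bsub>PA\<^esub> = Poly_Mapping.single (\<one>\<^bsub>A\<^esub>, \<one>\<^bsub>B\<^esub>) 1" "\<zero>\<^bsub>PA\<^esub> = 0"
  "c \<odot>\<^bsub>PA\<^esub> p = Poly_Mapping.map ((*) c) p"
  by (simp_all add: pair_alg_def ring.defs module.defs conv_def)

lemma single_carrier: "a \<in> carrier A \<Longrightarrow> b \<in> carrier B \<Longrightarrow> Poly_Mapping.single (a, b) c \<in> carrier PA"
  by (simp add: pair_alg_simps)

sublocale PA: k_algebra PA
proof -
  have add: "p + q \<in> carrier PA" if "p \<in> carrier PA" "q \<in> carrier PA" for p q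
    using that keys_add[of p q] by (auto simp: pair_alg_simps)
  have mult: "conv F p q \<in> carrier PA" if "p \<in> carrier PA" "q \<in> carrier PA" for p q
    using that unfolding pair_alg_simps mem_Collect_eq
    by (intro keys_conv[where K = "carrier A \<times> carrier B" and L = "carrier A \<times> carrier B"]) auto
  have one: "conv F (Poly_Mapping.single (\<one>\<^bsub>A\<^esub>, \<one>\<^bsub>B\<^esub>) 1) p = p"
    "conv F p (Poly_Mapping.single (\<one>\<^bsub>A\<^esub>, \<one>\<^bsub>B\<^esub>) 1) = p"
    if "p \<in> carrier PA" for p :: "'a \<times> 'b \<Rightarrow>\<^sub>0 'k"
    using that unfolding pair_alg_simps mem_Collect_eq
    by (induction p rule: poly_mapping_induct_keys)
      (auto simp: conv_single conv_add_left conv_add_right)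
  interpret ring PA
  proof (intro ringI abelian_groupI monoidI)
    fix p assume "p \<in> carrier PA"
    then show "\<exists>q\<in>carrier PA. q \<oplus>\<^bsub>PA\<^esub> p = \<zero>\<^bsub>PA\<^esub>"
      by (intro bexI[of _ "- p"]) (auto simp: pair_alg_simps in_keys_iff)
  next
    fix p q r assume "p \<in> carrier PA" "q \<in> carrier PA" "r \<in> carrier PA"
    then show "p \<otimes>\<^bsub>PA\<^esub> q \<otimes>\<^bsub>PA\<^esub> r = p \<otimes>\<^bsub>PA\<^esub> (q \<otimes>\<^bsub>PA\<^esub> r)"
      unfolding pair_alg_simps mem_Collect_eq
      by (intro conv_assoc) (auto simp: A.m_assoc B.m_assoc)
  qed (use add mult one in \<open>auto simp: pair_alg_simps(2-) conv_add_left conv_add_right algebra_simps\<close>,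
       auto simp: pair_alg_simps)
  show "k_algebra PA"
  proof unfold_locales
    show "c \<odot>\<^bsub>PA\<^esub> p \<in> carrier PA" if "p \<in> carrier PA" for c p
      using that keys_scale[of c p] by (auto simp: pair_alg_simps)
    show "(c + d) \<odot>\<^bsub>PA\<^esub> p = c \<odot>\<^bsub>PA\<^esub> p \<oplus>\<^bsub>PA\<^esub> d \<odot>\<^bsub>PA\<^esub> p" for c d p
      by (rule poly_mapping_eqI) (simp add: pair_alg_simps lookup_scale lookup_add algebra_simps)
    show "c \<odot>\<^bsub>PA\<^esub> (p \<oplus>\<^bsub>PA\<^esub> q) = c \<odot>\<^bsub>PA\<^esub> p \<oplus>\<^bsub>PA\<^esub> c \<odot>\<^bsub>PA\<^esub> q" for c p q
      by (rule poly_mapping_eqI) (simp add: pair_alg_simps lookup_scale lookup_add algebra_simps)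
    show "(c * d) \<odot>\<^bsub>PA\<^esub> p = c \<odot>\<^bsub>PA\<^esub> (d \<odot>\<^bsub>PA\<^esub> p)" for c d p
      by (rule poly_mapping_eqI) (simp add: pair_alg_simps lookup_scale algebra_simps)
    show "1 \<odot>\<^bsub>PA\<^esub> p = p" for p
      by (rule poly_mapping_eqI) (simp add: pair_alg_simps lookup_scale)
  qed (simp_all add: pair_alg_simps conv_scale)
qed

lemma pair_alg_minus: "p \<in> carrier PA \<Longrightarrow> \<ominus>\<^bsub>PA\<^esub> p = - p"
  by (intro PA.minus_equality) (auto simp: pair_alg_simps in_keys_iff)

lemma pair_alg_diff: "q \<in> carrier PA \<Longrightarrow> p \<ominus>\<^bsub>PA\<^esub> q = p - q"
  by (simp add: a_minus_def pair_alg_minus, simp add: pair_alg_simps)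

lemma bilin_rels_carrier: "bilin_rels A B \<subseteq> carrier PA"
proof -
  have d: "p - q \<in> carrier PA" if "p \<in> carrier PA" "q \<in> carrier PA" for p q
    using that PA.minus_closed[of p q] by (simp add: pair_alg_diff)
  show ?thesis unfolding bilin_rels_def
    by (intro Un_least subsetI; clarsimp; intro d single_carrier; simp)
qed

lemma N_add: "p \<in> N \<Longrightarrow> q \<in> N \<Longrightarrow> p + q \<in> N"
  and N_zero: "0 \<in> N" and N_scale: "p \<in> N \<Longrightarrow> Poly_Mapping.map ((*) c) p \<in> N"
  and N_rel: "r \<in> bilin_rels A B \<Longrightarrow> r \<in> N" and N_carrier: "N \<subseteq> carrier PA"
  using PA.lin_span_closed[OF bilin_rels_carrier] PA.lin_span_base[of "bilin_rels A B"]
    PA.lin_span_carrier[OF bilin_rels_carrier]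
  by (auto simp: pair_alg_simps(2-))

lemma conv_diff: "conv G (p - p') q = conv G p q - conv G p' q" "conv G p (q - q') = conv G p q - conv G p q'"
  subgoal using conv_add_left[of G "p - p'" p' q] by simp
  subgoal using conv_add_right[of G p "q - q'" q'] by simp
  done

lemma bilin_relI:
  "a \<in> carrier A \<Longrightarrow> a' \<in> carrier A \<Longrightarrow> b \<in> carrier B \<Longrightarrow>
    Poly_Mapping.single (a \<oplus>\<^bsub>A\<^esub> a', b) 1 - Poly_Mapping.single (a, b) 1 - Poly_Mapping.single (a', b) 1 \<in> bilin_rels A B"
  "a \<in> carrier A \<Longrightarrow> b \<in> carrier B \<Longrightarrow> b' \<in> carrier B \<Longrightarrow>
    Poly_Mapping.single (a, b \<oplus>\<^bsub>B\<^esub> b') 1 - Poly_Mapping.single (a, b) 1 - Poly_Mapping.single (a, b') 1 \<in> bilin_rels A B"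
  "a \<in> carrier A \<Longrightarrow> b \<in> carrier B \<Longrightarrow>
    Poly_Mapping.single (c \<odot>\<^bsub>A\<^esub> a, b) 1 - Poly_Mapping.single (a, b) c \<in> bilin_rels A B"
  "a \<in> carrier A \<Longrightarrow> b \<in> carrier B \<Longrightarrow>
    Poly_Mapping.single (a, c \<odot>\<^bsub>B\<^esub> b) 1 - Poly_Mapping.single (a, b) c \<in> bilin_rels A B"
  unfolding bilin_rels_def by blast+

lemma bilin_relE [consumes 1]:
  assumes "r \<in> bilin_rels A B"
    and "\<And>a a' b. a \<in> carrier A \<Longrightarrow> a' \<in> carrier A \<Longrightarrow> b \<in> carrier B \<Longrightarrow>
      r = Poly_Mapping.single (a \<oplus>\<^bsub>A\<^esub> a', b) 1 - Poly_Mapping.single (a, b) 1 - Poly_Mapping.single (a', b) 1 \<Longrightarrow> P"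
    and "\<And>a b b'. a \<in> carrier A \<Longrightarrow> b \<in> carrier B \<Longrightarrow> b' \<in> carrier B \<Longrightarrow>
      r = Poly_Mapping.single (a, b \<oplus>\<^bsub>B\<^esub> b') 1 - Poly_Mapping.single (a, b) 1 - Poly_Mapping.single (a, b') 1 \<Longrightarrow> P"
    and "\<And>c a b. a \<in> carrier A \<Longrightarrow> b \<in> carrier B \<Longrightarrow>
      r = Poly_Mapping.single (c \<odot>\<^bsub>A\<^esub> a, b) 1 - Poly_Mapping.single (a, b) c \<Longrightarrow> P"
    and "\<And>c a b. a \<in> carrier A \<Longrightarrow> b \<in> carrier B \<Longrightarrow>
      r = Poly_Mapping.single (a, c \<odot>\<^bsub>B\<^esub> b) 1 - Poly_Mapping.single (a, b) c \<Longrightarrow> P"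
  shows P
  using assms(1) unfolding bilin_rels_def
  by (elim UnE CollectE exE conjE) (rule assms(2-5); assumption)+

text \<open>A bilinearity relation times a single pair is a scaled relation of the same kind, with
  both entries multiplied. Hence the mere linear span \<open>N\<close> of the relations is already a
  two-sided ideal.\<close>

lemma rel_ideal:
  assumes r: "r \<in> bilin_rels A B" and x: "x \<in> carrier A" "y \<in> carrier B"
  shows "conv F r (Poly_Mapping.single (x, y) s) \<in> N" "conv F (Poly_Mapping.single (x, y) s) r \<in> N"
proof -
  have 1: "Poly_Mapping.single (a \<oplus>\<^bsub>A\<^esub> a', b) s - Poly_Mapping.single (a, b) s - Poly_Mapping.single (a', b) s \<in> N"
    if "a \<in> carrier A" "a' \<in> carrier A" "b \<in> carrier B" for a a' b
  proof -
    have "Poly_Mapping.single (a \<oplus>\<^bsub>A\<^esub> a', b) s - Poly_Mapping.single (a, b) s - Poly_Mapping.single (a', b) s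
      = Poly_Mapping.map ((*) s) (Poly_Mapping.single (a \<oplus>\<^bsub>A\<^esub> a', b) 1 - Poly_Mapping.single (a, b) 1 - Poly_Mapping.single (a', b) 1)"
      by (rule poly_mapping_eqI) (simp add: lookup_scale lookup_minus lookup_add lookup_single when_def algebra_simps)
    moreover have "\<dots> \<in> N" using that by (intro N_scale N_rel bilin_relI)
    ultimately show ?thesis by simp
  qed
  have 2: "Poly_Mapping.single (a, b \<oplus>\<^bsub>B\<^esub> b') s - Poly_Mapping.single (a, b) s - Poly_Mapping.single (a, b') s \<in> N"
    if "a \<in> carrier A" "b \<in> carrier B" "b' \<in> carrier B" for a b b'
  proof -
    have "Poly_Mapping.single (a, b \<oplus>\<^bsub>B\<^esub> b') s - Poly_Mapping.single (a, b) s - Poly_Mapping.single (a, b') s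
      = Poly_Mapping.map ((*) s) (Poly_Mapping.single (a, b \<oplus>\<^bsub>B\<^esub> b') 1 - Poly_Mapping.single (a, b) 1 - Poly_Mapping.single (a, b') 1)"
      by (rule poly_mapping_eqI) (simp add: lookup_scale lookup_minus lookup_add lookup_single when_def algebra_simps)
    moreover have "\<dots> \<in> N" using that by (intro N_scale N_rel bilin_relI)
    ultimately show ?thesis by simp
  qed
  have 3: "Poly_Mapping.single (c \<odot>\<^bsub>A\<^esub> a, b) s - Poly_Mapping.single (a, b) (c * s) \<in> N"
    if "a \<in> carrier A" "b \<in> carrier B" for a b c
  proof -
    have "Poly_Mapping.single (c \<odot>\<^bsub>A\<^esub> a, b) s - Poly_Mapping.single (a, b) (c * s)
      = Poly_Mapping.map ((*) s) (Poly_Mapping.single (c \<odot>\<^bsub>A\<^esub> a, b) 1 - Poly_Mapping.single (a, b) c)"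
      by (rule poly_mapping_eqI) (simp add: lookup_scale lookup_minus lookup_add lookup_single when_def algebra_simps)
    moreover have "\<dots> \<in> N" using that by (intro N_scale N_rel bilin_relI)
    ultimately show ?thesis by simp
  qed
  have 4: "Poly_Mapping.single (a, c \<odot>\<^bsub>B\<^esub> b) s - Poly_Mapping.single (a, b) (c * s) \<in> N"
    if "a \<in> carrier A" "b \<in> carrier B" for a b c
  proof -
    have "Poly_Mapping.single (a, c \<odot>\<^bsub>B\<^esub> b) s - Poly_Mapping.single (a, b) (c * s)
      = Poly_Mapping.map ((*) s) (Poly_Mapping.single (a, c \<odot>\<^bsub>B\<^esub> b) 1 - Poly_Mapping.single (a, b) c)"
      by (rule poly_mapping_eqI) (simp add: lookup_scale lookup_minus lookup_add lookup_single when_def algebra_simps)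
    moreover have "\<dots> \<in> N" using that by (intro N_scale N_rel bilin_relI)
    ultimately show ?thesis by simp
  qed
  show "conv F r (Poly_Mapping.single (x, y) s) \<in> N"
    using r by (rule bilin_relE)
      (use x in \<open>simp_all add: conv_diff conv_single A.l_distr B.l_distr A.smult_mult_l B.smult_mult_l 1 2 3 4\<close>)
  show "conv F (Poly_Mapping.single (x, y) s) r \<in> N"
    using r by (rule bilin_relE)
      (use x in \<open>simp_all add: conv_diff conv_single A.r_distr B.r_distr A.smult_mult_r B.smult_mult_r
        mult.commute[of s] 1 2 3 4\<close>)
qed

lemma N_ideal: "ideal N PA"
proof (rule idealI[OF PA.ring_axioms submodule.axioms(1)[OF PA.lin_span_submodule[OF bilin_rels_carrier]]])
  fix n p assume n: "n \<in> N" and p: "p \<in> carrier PA"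
  have "conv F n p \<in> N \<and> conv F p n \<in> N"
    using n bilin_rels_carrier
  proof (induction n rule: PA.lin_span_induct)
    case (base r)
    have p': "Poly_Mapping.keys p \<subseteq> carrier A \<times> carrier B"
      using p by (simp add: pair_alg_simps)
    then show ?case
    proof (induction p rule: poly_mapping_induct_keys)
      case (single k c)
      then show ?case using rel_ideal[OF base, of "fst k" "snd k" c] by auto
    qed (auto simp: N_zero conv_add_left conv_add_right N_add)
  qed (auto simp: pair_alg_simps(2-) N_zero N_add N_scale conv_add_left conv_add_right conv_scale)
  then show "p \<otimes>\<^bsub>PA\<^esub> n \<in> N" "n \<otimes>\<^bsub>PA\<^esub> p \<in> N" by (auto simp: pair_alg_simps)
qed

sublocale Q: quotient_algebra PA N
  by (intro quotient_algebra.intro quotient_algebra_axioms.intro PA.k_algebra_axioms N_ideal)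

sublocale T: k_algebra T
  unfolding tensor_alg_def by (rule Q.quot_k_algebra)

lemma pure_def': "pure a b = N +>\<^bsub>PA\<^esub> Poly_Mapping.single (a, b) 1"
  by (simp add: pure_tensor_def)

lemma pure_closed [simp]: "a \<in> carrier A \<Longrightarrow> b \<in> carrier B \<Longrightarrow> pure a b \<in> carrier T"
  by (auto simp: pure_def' tensor_alg_def Q.coset_carrier single_carrier)

lemma coset_eqI: "p \<in> carrier PA \<Longrightarrow> q \<in> carrier PA \<Longrightarrow> p - q \<in> N \<Longrightarrow> N +>\<^bsub>PA\<^esub> p = N +>\<^bsub>PA\<^esub> q"
  by (simp add: Q.coset_eq_iff pair_alg_diff)

lemma single_add_carrier: "p \<in> carrier PA \<Longrightarrow> q \<in> carrier PA \<Longrightarrow> p + q \<in> carrier PA"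
  using PA.a_closed[of p q] by (simp add: pair_alg_simps(3))

lemma pure_sum:
  assumes "a \<in> carrier A" "b \<in> carrier B" "a' \<in> carrier A" "b' \<in> carrier B"
  shows "pure a b \<oplus>\<^bsub>T\<^esub> pure a' b' = N +>\<^bsub>PA\<^esub> (Poly_Mapping.single (a, b) 1 + Poly_Mapping.single (a', b') 1)"
  using Q.coset_ops(1)[OF single_carrier[of a b 1] single_carrier[of a' b' 1]] assms
  by (simp add: pure_def' tensor_alg_def pair_alg_simps(3))

lemma pure_add_left:
  assumes "a \<in> carrier A" "a' \<in> carrier A" "b \<in> carrier B"
  shows "pure (a \<oplus>\<^bsub>A\<^esub> a') b = pure a b \<oplus>\<^bsub>T\<^esub> pure a' b"
  unfolding pure_sum[OF assms(1,3,2,3)] unfolding pure_def' using assms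
  by (intro coset_eqI single_add_carrier single_carrier)
    (auto simp: diff_diff_eq[symmetric] intro!: N_rel bilin_relI(1))

lemma pure_add_right:
  assumes "a \<in> carrier A" "b \<in> carrier B" "b' \<in> carrier B"
  shows "pure a (b \<oplus>\<^bsub>B\<^esub> b') = pure a b \<oplus>\<^bsub>T\<^esub> pure a b'"
  unfolding pure_sum[OF assms(1,2,1,3)] unfolding pure_def' using assms
  by (intro coset_eqI single_add_carrier single_carrier)
    (auto simp: diff_diff_eq[symmetric] intro!: N_rel bilin_relI(2))

lemma smult_pure:
  assumes "a \<in> carrier A" "b \<in> carrier B"
  shows "c \<odot>\<^bsub>T\<^esub> pure a b = N +>\<^bsub>PA\<^esub> Poly_Mapping.single (a, b) c"
  using Q.smult_coset[OF single_carrier, OF assms, of c 1]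
  by (simp add: pure_def' tensor_alg_def pair_alg_simps(6) scale_single)

lemma pure_smult_left:
  assumes "a \<in> carrier A" "b \<in> carrier B"
  shows "pure (c \<odot>\<^bsub>A\<^esub> a) b = c \<odot>\<^bsub>T\<^esub> pure a b"
  unfolding smult_pure[OF assms] unfolding pure_def' using assms
  by (intro coset_eqI single_carrier N_rel) (auto intro!: bilin_relI(3,4))

lemma pure_smult_right:
  assumes "a \<in> carrier A" "b \<in> carrier B"
  shows "pure a (c \<odot>\<^bsub>B\<^esub> b) = c \<odot>\<^bsub>T\<^esub> pure a b"
  unfolding smult_pure[OF assms] unfolding pure_def' using assms
  by (intro coset_eqI single_carrier N_rel) (auto intro!: bilin_relI(3,4))

lemma pure_mult:
  "a \<in> carrier A \<Longrightarrow> a' \<in> carrier A \<Longrightarrow> b \<in> carrier B \<Longrightarrow> b' \<in> carrier B \<Longrightarrow>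
   pure a b \<otimes>\<^bsub>T\<^esub> pure a' b' = pure (a \<otimes>\<^bsub>A\<^esub> a') (b \<otimes>\<^bsub>B\<^esub> b')"
  unfolding pure_def' tensor_alg_def
  by (subst Q.coset_ops) (auto simp: single_carrier pair_alg_simps(2) conv_single)

lemma pure_one: "pure \<one>\<^bsub>A\<^esub> \<one>\<^bsub>B\<^esub> = \<one>\<^bsub>T\<^esub>"
  unfolding pure_def' tensor_alg_def by (simp add: Q.coset_one_zero pair_alg_simps)

text \<open>Pure tensors span everything, so the coideal condition holds trivially for
  \<open>H\<close> itself.\<close>

lemma tensor_carrier: "carrier T = tensor_sub A B (carrier A) (carrier B)"
proof -
  let ?S = "{pure v w | v w. v \<in> carrier A \<and> w \<in> carrier B}"
  have S: "?S \<subseteq> carrier T" by auto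
  have "N +>\<^bsub>PA\<^esub> p \<in> lin_span T ?S" if "p \<in> carrier PA" for p
    using that unfolding pair_alg_simps mem_Collect_eq
  proof (induction p rule: poly_mapping_induct_keys)
    case zero
    have "N +>\<^bsub>PA\<^esub> 0 = \<zero>\<^bsub>T\<^esub>" by (simp add: tensor_alg_def Q.coset_one_zero pair_alg_simps)
    then show ?case using T.lin_span_closed(1)[OF S] by simp
  next
    case (single k c)
    then obtain a b where k: "k = (a, b)" "a \<in> carrier A" "b \<in> carrier B" by auto
    then have "N +>\<^bsub>PA\<^esub> Poly_Mapping.single k c = c \<odot>\<^bsub>T\<^esub> pure a b" by (simp add: smult_pure)
    also have "\<dots> \<in> lin_span T ?S"
      using T.lin_span_closed(3)[OF S] T.lin_span_base[of ?S] k by blast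
    finally show ?case .
  next
    case (add p q)
    then have "N +>\<^bsub>PA\<^esub> (p + q) = (N +>\<^bsub>PA\<^esub> p) \<oplus>\<^bsub>T\<^esub> (N +>\<^bsub>PA\<^esub> q)"
      unfolding tensor_alg_def by (subst Q.coset_ops) (auto simp: pair_alg_simps)
    then show ?case using T.lin_span_closed(2)[OF S] add by simp
  qed
  then have "carrier T \<subseteq> lin_span T ?S"
    by (auto simp: Q.coset_carrier tensor_alg_def)
  then show ?thesis
    using T.lin_span_carrier[OF S] by (auto simp: tensor_sub_def)
qed

lemma tensor_sub_submodule:
  assumes "V \<subseteq> carrier A" "W \<subseteq> carrier B"
  shows "submodule (tensor_sub A B V W) base_field T"
  unfolding tensor_sub_def using assms by (intro T.lin_span_submodule) (auto intro!: pure_closed)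

lemma tensor_sub_base: "v \<in> V \<Longrightarrow> w \<in> W \<Longrightarrow> pure v w \<in> tensor_sub A B V W"
  unfolding tensor_sub_def using T.lin_span_base[of "{pure v w | v w. v \<in> V \<and> w \<in> W}"] by blast

lemma tensor_sub_subalgebra:
  assumes "is_subalgebra A V" "is_subalgebra B W"
  shows "is_subalgebra T (tensor_sub A B V W)"
proof -
  let ?S = "{pure v w | v w. v \<in> V \<and> w \<in> W}"
  let ?L = "tensor_sub A B V W"
  have V: "V \<subseteq> carrier A" "W \<subseteq> carrier B" "\<one>\<^bsub>A\<^esub> \<in> V" "\<one>\<^bsub>B\<^esub> \<in> W"
    "\<And>x y. x \<in> V \<Longrightarrow> y \<in> V \<Longrightarrow> x \<otimes>\<^bsub>A\<^esub> y \<in> V" "\<And>x y. x \<in> W \<Longrightarrow> y \<in> W \<Longrightarrow> x \<otimes>\<^bsub>B\<^esub> y \<in> W"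
    using assms by (auto simp: A.subalgebra_iff B.subalgebra_iff)
  have L: "?L \<subseteq> carrier T" "\<zero>\<^bsub>T\<^esub> \<in> ?L" "\<And>x y. x \<in> ?L \<Longrightarrow> y \<in> ?L \<Longrightarrow> x \<oplus>\<^bsub>T\<^esub> y \<in> ?L"
    "\<And>c x. x \<in> ?L \<Longrightarrow> c \<odot>\<^bsub>T\<^esub> x \<in> ?L"
    using tensor_sub_submodule[OF V(1,2)] by (auto simp: T.submodule_iff)
  have S: "?S \<subseteq> carrier T" using V(1,2) by (auto intro!: pure_closed)
  have "x \<otimes>\<^bsub>T\<^esub> y \<in> ?L" if "x \<in> ?L" "y \<in> ?L" for x y
    using that(1)[unfolded tensor_sub_def] S
  proof (induction x rule: T.lin_span_induct)
    case (base x)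
    then obtain v w where x: "x = pure v w" "v \<in> V" "w \<in> W" by auto
    show ?case using that(2)[unfolded tensor_sub_def] S
    proof (induction y rule: T.lin_span_induct)
      case (base y)
      then obtain v' w' where y: "y = pure v' w'" "v' \<in> V" "w' \<in> W" by auto
      have "x \<otimes>\<^bsub>T\<^esub> y = pure (v \<otimes>\<^bsub>A\<^esub> v') (w \<otimes>\<^bsub>B\<^esub> w')"
        using x y V(1,2) by (auto simp: pure_mult subset_iff)
      then show ?case using x y V tensor_sub_base by simp
    qed (use x V L S T.lin_span_carrier[OF S] in \<open>auto simp: T.r_distr T.smult_mult_r subset_iff\<close>)
  next
    case zero
    then show ?case using that(2) L by (auto simp: subset_iff)
  next
    case (add x x')
    then show ?case using that(2) L T.lin_span_carrier[OF S] by (auto simp: T.l_distr subset_iff)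
  next
    case (smult c x)
    then show ?case using that(2) L T.lin_span_carrier[OF S] by (auto simp: T.smult_mult_l subset_iff)
  qed
  moreover have "\<one>\<^bsub>T\<^esub> \<in> ?L" using tensor_sub_base[OF V(3,4)] by (simp add: pure_one)
  ultimately show ?thesis using L by (auto simp: T.subalgebra_iff)
qed

text \<open>The universal property of the tensor product for commuting homomorphisms. Commutation is
  what regroups \<open>f a * f a' * (g b * g b')\<close> into the product of the two images. This is
  the only way in which tensors are evaluated later.\<close>

lemma tensor_type_hom:
  fixes \<iota> :: "'k \<Rightarrow> 'r::ring_1"
  assumes "scalar_map \<iota>" "alg_hom A (type_alg \<iota>) f" "alg_hom B (type_alg \<iota>) g"
    and comm: "\<And>a b. a \<in> carrier A \<Longrightarrow> b \<in> carrier B \<Longrightarrow> f a * g b = g b * f a"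
  obtains h where "alg_hom T (type_alg \<iota>) h"
    "\<And>a b. a \<in> carrier A \<Longrightarrow> b \<in> carrier B \<Longrightarrow> h (pure a b) = f a * g b"
proof -
  interpret scalar_map \<iota> by fact
  note f = alg_homD[OF assms(2), simplified] and g = alg_homD[OF assms(3), simplified]
  define k where "k p = (\<Sum>x\<in>Poly_Mapping.keys p. \<iota> (Poly_Mapping.lookup p x) * (f (fst x) * g (snd x)))" for p
  have k_sup: "k p = (\<Sum>x\<in>U. \<iota> (Poly_Mapping.lookup p x) * (f (fst x) * g (snd x)))"
    if "finite U" "Poly_Mapping.keys p \<subseteq> U" for p U
    unfolding k_def using that by (intro sum.mono_neutral_left) (auto simp: in_keys_iff)
  have k_add: "k (p + q) = k p + k q" for p q
  proof -
    let ?U = "Poly_Mapping.keys p \<union> Poly_Mapping.keys q"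
    have "k (p + q) = (\<Sum>x\<in>?U. \<iota> (Poly_Mapping.lookup (p + q) x) * (f (fst x) * g (snd x)))"
      by (rule k_sup[OF _ keys_add]) auto
    also have "\<dots> = (\<Sum>x\<in>?U. \<iota> (Poly_Mapping.lookup p x) * (f (fst x) * g (snd x)))
      + (\<Sum>x\<in>?U. \<iota> (Poly_Mapping.lookup q x) * (f (fst x) * g (snd x)))"
      by (simp only: lookup_add \<iota>_add distrib_right sum.distrib)
    also have "\<dots> = k p + k q" using k_sup[of ?U p] k_sup[of ?U q] by simp
    finally show ?thesis .
  qed
  have k_single: "k (Poly_Mapping.single (a, b) c) = \<iota> c * (f a * g b)" for a b c
    by (subst k_sup[of "{(a, b)}"]) auto
  have k_zero: "k 0 = 0" by (simp add: k_def)
  have k_diff: "k (p - q) = k p - k q" for p q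
    using k_add[of "p - q" q] by simp
  have k_scale: "k (Poly_Mapping.map ((*) c) p) = \<iota> c * k p" for c p
    by (subst k_sup[OF _ keys_scale]) (auto simp: k_def sum_distrib_left lookup_scale \<iota>_mult mult.assoc)
  have k_mult: "k (conv F p q) = k p * k q" if "p \<in> carrier PA" "q \<in> carrier PA" for p q
    using that(1) unfolding pair_alg_simps mem_Collect_eq
  proof (induction p rule: poly_mapping_induct_keys)
    case (single x c)
    then obtain a b where x: "x = (a, b)" "a \<in> carrier A" "b \<in> carrier B" by auto
    show ?case using that(2) unfolding pair_alg_simps mem_Collect_eq
    proof (induction q rule: poly_mapping_induct_keys)
      case (single y d)
      then obtain a' b' where y: "y = (a', b')" "a' \<in> carrier A" "b' \<in> carrier B" by auto
      have "f a * f a' * (g b * g b') = (f a * g b) * (f a' * g b')"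
        using comm[of a' b] x y by (metis mult.assoc)
      then show ?case using x y
        by (simp add: conv_single k_single f g \<iota>_mult \<iota>_left_commute[of "f _"] \<iota>_left_commute[of "g _"] mult.assoc)
    qed (auto simp: k_zero conv_add_right k_add distrib_left)
  qed (auto simp: k_zero conv_add_left k_add distrib_right)
  have hom: "alg_hom PA (type_alg \<iota>) k"
    using k_mult k_single[of "\<one>\<^bsub>A\<^esub>" "\<one>\<^bsub>B\<^esub>" 1] by (auto simp: alg_hom_def k_add k_scale f g pair_alg_simps(2-))
  have k_rel: "k r = 0" if "r \<in> bilin_rels A B" for r
    using that by (rule bilin_relE)
      (simp_all add: k_diff k_single f g distrib_left distrib_right \<iota>_left_commute[of "f _"] mult.assoc)
  have "k n = 0" if "n \<in> N" for n
    using that bilin_rels_carrier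
    by (induction n rule: PA.lin_span_induct) (auto simp: pair_alg_simps(2-) k_zero k_add k_scale k_rel)
  then obtain h where h: "alg_hom (quot_alg PA N) (type_alg \<iota>) h" "\<And>p. p \<in> carrier PA \<Longrightarrow> h (N +>\<^bsub>PA\<^esub> p) = k p"
    using Q.quot_induced_hom[OF ta.k_algebra_axioms hom] by auto
  have "h (pure a b) = f a * g b" if "a \<in> carrier A" "b \<in> carrier B" for a b
    using h(2)[OF single_carrier, OF that, of 1] by (simp add: pure_def' k_single)
  with h(1) show ?thesis using that by (auto simp: tensor_alg_def)
qed

end

section \<open>Linear endomorphisms of \<open>k[Y][X][Z][t]\<close>\<close>

text \<open>From the inside outwards the variables are \<open>Y\<close>, \<open>X\<close>,
  \<open>Z\<close>, and for \<open>polW\<close> finally \<open>t\<close>.\<close>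

type_synonym 'k polM = "'k poly poly poly"
type_synonym 'k polW = "'k poly poly poly poly"

abbreviation cst :: "'k::field \<Rightarrow> 'k polM" where "cst c \<equiv> [:[:[:c:]:]:]"

text \<open>Linearity is demanded over \<open>k\<close> only, since the operators of interest
  differentiate and shift the polynomial coefficients.\<close>

typedef (overloaded) 'k lend =
  "{f :: 'k::field polW \<Rightarrow> 'k polW. (\<forall>v w. f (v + w) = f v + f w) \<and> (\<forall>c w. f (smult (cst c) w) = smult (cst c) (f w))}"
  morphisms app Lend
  by (rule exI[of _ "\<lambda>w. 0"]) simp

lemma app_add: "app f (v + w) = app f v + app f w"
  and app_smult: "app f (smult (cst c) w) = smult (cst c) (app f w)"
  using app[of f] by auto

lemma app_zero [simp]: "app f 0 = 0"
  using app_add[of f 0 0] by (metis add.right_neutral add_left_cancel)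

lemma lend_eqI: "(\<And>w. app f w = app g w) \<Longrightarrow> f = g"
  by (rule app_inject[THEN iffD1]) auto

setup_lifting type_definition_lend

instantiation lend :: (field) ring_1
begin

lift_definition zero_lend :: "'a lend" is "\<lambda>w. 0" by simp
lift_definition one_lend :: "'a lend" is "\<lambda>w. w" by simp
lift_definition plus_lend :: "'a lend \<Rightarrow> 'a lend \<Rightarrow> 'a lend" is "\<lambda>f g w. f w + g w"
  by (simp add: algebra_simps smult_add_right)
lift_definition minus_lend :: "'a lend \<Rightarrow> 'a lend \<Rightarrow> 'a lend" is "\<lambda>f g w. f w - g w"
  by (simp add: algebra_simps smult_diff_right)
lift_definition uminus_lend :: "'a lend \<Rightarrow> 'a lend" is "\<lambda>f w. - f w"
  by simp
lift_definition times_lend :: "'a lend \<Rightarrow> 'a lend \<Rightarrow> 'a lend" is "\<lambda>f g w. f (g w)"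
  by simp

instance
proof
  have "app (0 :: 'a lend) 1 \<noteq> app 1 1" by (simp add: zero_lend.rep_eq one_lend.rep_eq)
  then show "(0 :: 'a lend) \<noteq> 1" by metis
qed (transfer; simp add: fun_eq_iff algebra_simps)+

end

lift_definition scl :: "'k::field \<Rightarrow> 'k lend" is "\<lambda>c w. smult (cst c) w"
  by (simp add: smult_add_right mult.commute)

lemmas app_simps [simp] =
  zero_lend.rep_eq one_lend.rep_eq plus_lend.rep_eq minus_lend.rep_eq uminus_lend.rep_eq times_lend.rep_eq

lemma app_scl [simp]: "app (scl c) w = smult (cst c) w"
  by (simp add: scl.rep_eq)

interpretation scl: scalar_map "scl :: 'k::field \<Rightarrow> 'k lend"
  by unfold_locales
    (rule lend_eqI; simp add: app_smult smult_add_left[symmetric] one_pCons[symmetric])+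

section \<open>The left regular representation in PBW coordinates\<close>

abbreviation vY :: "'k::field_char_0 poly poly" where "vY \<equiv> [:[:0, 1:]:]"
abbreviation vX :: "'k::field_char_0 poly poly" where "vX \<equiv> [:0, 1:]"

definition dY :: "'k::field_char_0 poly poly \<Rightarrow> 'k poly poly" where "dY = map_poly pderiv"
definition shX :: "'k::field_char_0 \<Rightarrow> 'k poly poly \<Rightarrow> 'k poly poly" where "shX c q = pcompose q [:[:c:], 1:]"

lemma coeff_dY [simp]: "coeff (dY q) n = pderiv (coeff q n)"
  by (simp add: dY_def coeff_map_poly)

lemma dY_0 [simp]: "dY 0 = 0" by (simp add: dY_def)
lemma dY_pCons [simp]: "dY (pCons r q) = pCons (pderiv r) (dY q)"
  by (simp add: dY_def map_poly_pCons)
lemma dY_add: "dY (p + q) = dY p + dY q"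
  by (rule poly_eqI) (simp add: pderiv_add)
lemma dY_smult: "dY (smult r q) = smult (pderiv r) q + smult r (dY q)"
  by (rule poly_eqI) (simp add: pderiv_mult)

lemma dY_mult: "dY (p * q) = dY p * q + p * dY q"
proof (induction p)
  case (pCons a p)
  then show ?case by (simp add: dY_add dY_smult algebra_simps)
qed simp

lemma shX_0 [simp]: "shX c 0 = 0" by (simp add: shX_def)
lemma shX_add: "shX c (p + q) = shX c p + shX c q" by (simp add: shX_def pcompose_add)
lemma shX_mult: "shX c (p * q) = shX c p * shX c q" by (simp add: shX_def pcompose_mult)
lemma shX_const [simp]: "shX c [:r:] = [:r:]" by (simp add: shX_def)
lemma shX_vX: "shX c vX = vX + [:[:c:]:]" by (simp add: shX_def pcompose_pCons)
lemma shX_pCons: "shX c (pCons r q) = [:r:] + (vX + [:[:c:]:]) * shX c q"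
  by (simp add: shX_def pcompose_pCons)

lemma shX_shX: "shX c (shX d q) = shX (c + d) q"
  by (simp add: shX_def pcompose_assoc[symmetric] pcompose_pCons add.commute)

lemma shX_zero [simp]: "shX 0 q = q"
  using pcompose_idR[of q] by (simp add: shX_def)

lemma pderiv_shX: "pderiv (shX c q) = shX c (pderiv q)"
  by (simp add: shX_def pderiv_pcompose pderiv_pCons)

lemma dY_shX: "dY (shX c q) = shX c (dY q)"
  by (induction q) (simp_all add: shX_pCons dY_add dY_mult dY_smult)

lemma dY_pderiv: "dY (pderiv q) = pderiv (dY q)"
  by (rule poly_eqI) (simp add: coeff_pderiv pderiv_mult pderiv_add)

text \<open>Left multiplication by \<open>X\<close> in normal form: \<open>[X, Y] = Y\<close> gives
  \<open>X f(Y) = f(Y) X + Y f'(Y)\<close>.\<close>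

definition lx :: "'k::field_char_0 poly poly \<Rightarrow> 'k poly poly" where "lx q = vX * q + vY * dY q"
definition ly :: "'k::field_char_0 poly poly \<Rightarrow> 'k poly poly" where "ly q = vY * q"
text \<open>In normal form \<open>Z q = q(X - 1, Y) Z + lz l q\<close>. The summand with
  \<open>\<lambda>\<close> carries no shift although \<open>Z\<close> shifts \<open>X\<close>:
  moving the new factor \<open>Y\<close> to the left shifts \<open>X\<close> back.\<close>

definition lz :: "'k::field_char_0 \<Rightarrow> 'k poly poly \<Rightarrow> 'k poly poly"
  where "lz l q = [:[:0, l:]:] * pderiv q + [:[:0, 0, 1/2:]:] * dY q"

lemma lx_add: "lx (p + q) = lx p + lx q" by (simp only: lx_def dY_add distrib_left add_ac)
lemma ly_add: "ly (p + q) = ly p + ly q" by (simp only: ly_def distrib_left)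
lemma lz_add: "lz l (p + q) = lz l p + lz l q"
  by (simp only: lz_def dY_add pderiv_add distrib_left add_ac)

lemma l_zero [simp]: "lx 0 = 0" "ly 0 = 0" "lz l 0 = 0"
  by (simp_all add: lx_def ly_def lz_def)

lemma lx_scale: "lx (smult [:c:] q) = smult [:c:] (lx q)"
  by (simp add: lx_def dY_smult smult_add_right)
lemma ly_scale: "ly (smult r q) = smult r (ly q)"
  by (simp add: ly_def mult.commute)
lemma lz_scale: "lz l (smult [:c:] q) = smult [:c:] (lz l q)"
  by (simp add: lz_def dY_smult pderiv_smult smult_add_right mult.commute)
lemma shX_scale: "shX c (smult r q) = smult r (shX c q)"
  by (simp add: shX_def pcompose_smult)

lemma dY_var [simp]: "dY vY = 1" "dY vX = 0"
  by (simp_all add: pderiv_pCons one_pCons)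

lemma lx_ly: "lx (ly q) = ly (lx q) + ly q"
  by (simp only: lx_def ly_def dY_mult dY_var) (simp only: algebra_simps mult_1)

lemma shX_ly: "shX c (ly q) = ly (shX c q)"
  by (simp only: ly_def shX_mult shX_const)

lemma half_Y2: "[:[:0, 0, 1/2:]:] = [:[:1/2:]:] * vY * (vY :: 'k::field_char_0 poly poly)"
  "[:[:0, l:]:] = [:[:l:]:] * (vY :: 'k::field_char_0 poly poly)"
  by simp_all

lemma pderiv_vY: "pderiv vY = 0" "pderiv vX = 1"
  by (simp_all add: pderiv_pCons)

lemma pderiv_cst: "pderiv [:r:] = 0" "dY [:[:c:]:] = 0"
  by (simp_all add: pderiv_pCons)

lemma lz_ly: "lz l (ly q) = ly (lz l q) + [:[:1/2:]:] * ly (ly q)"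
  by (simp only: lz_def ly_def half_Y2(1) half_Y2(2)[of l] dY_mult dY_var pderiv_mult pderiv_vY) (simp add: algebra_simps del: mult_pCons_left mult_pCons_right)

lemma shX_lx: "shX (- 1) (lx q) = lx (shX (- 1) q) - shX (- 1) q"
proof -
  have "[:[:-1:]:] = (- 1 :: 'a poly poly)" by (simp add: one_pCons)
  then show ?thesis
    by (simp only: lx_def shX_mult shX_add shX_const shX_vX dY_shX) (simp add: algebra_simps del: mult_pCons_left mult_pCons_right)
qed

lemma lz_lx: "lz l (lx q) = lx (lz l q) - lz l q + [:[:l:]:] * ly q"
proof -
  have two: "[:[:1/2:]:] * w + [:[:1/2:]:] * w = (w :: 'a poly poly)" for w
  proof -
    have "[:[:1/2:]:] + [:[:1/2:]:] = (1 :: 'a poly poly)" by (simp add: one_pCons)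
    then show ?thesis by (metis distrib_right mult_1)
  qed
  show ?thesis
    by (simp only: lz_def lx_def ly_def half_Y2(1) half_Y2(2)[of l] dY_mult dY_add dY_var pderiv_add pderiv_mult pderiv_vY
        pderiv_cst dY_pderiv) (simp add: algebra_simps del: mult_pCons_left mult_pCons_right)
qed

definition LX :: "'k::field_char_0 polM \<Rightarrow> 'k polM" where "LX = map_poly lx"
definition LY :: "'k::field_char_0 polM \<Rightarrow> 'k polM" where "LY = map_poly ly"
definition LZ :: "'k::field_char_0 \<Rightarrow> 'k polM \<Rightarrow> 'k polM"
  where "LZ l m = pCons 0 (map_poly (shX (- 1)) m) + map_poly (lz l) m"

lemma coeff_L [simp]:
  "coeff (LX m) n = lx (coeff m n)" "coeff (LY m) n = ly (coeff m n)"
  "coeff (LZ l m) n = (case n of 0 \<Rightarrow> 0 | Suc k \<Rightarrow> shX (- 1) (coeff m k)) + lz l (coeff m n)"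
  by (auto simp: LX_def LY_def LZ_def coeff_map_poly coeff_pCons split: nat.splits)

lemma L_pCons:
  "LX (pCons q m) = pCons (lx q) (LX m)" "LY (pCons q m) = pCons (ly q) (LY m)"
  "LZ l (pCons q m) = pCons (lz l q) ([:shX (- 1) q:] + LZ l m)"
  by (rule poly_eqI; simp add: coeff_pCons split: nat.splits)+

lemma L_0 [simp]: "LX 0 = 0" "LY 0 = 0" "LZ l 0 = 0"
  by (simp_all add: LX_def LY_def LZ_def)

definition klin :: "('k::field polM \<Rightarrow> 'k polM) \<Rightarrow> bool"
  where "klin f \<longleftrightarrow> (\<forall>m n. f (m + n) = f m + f n) \<and> (\<forall>c m. f (smult [:[:c:]:] m) = smult [:[:c:]:] (f m))"

lemma klin_L: "klin LX" "klin LY" "klin (LZ l)"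
  unfolding klin_def
  by (auto intro!: poly_eqI simp: lx_add ly_add lz_add lx_scale ly_scale lz_scale shX_add shX_scale
      smult_add_right split: nat.splits)

lemma klinD:
  assumes "klin f"
  shows "f (m + n) = f m + f n" "f (smult [:[:c:]:] m) = smult [:[:c:]:] (f m)" "f 0 = 0"
    "f (- m) = - f m" "f (m - n) = f m - f n"
proof -
  show 1: "f (m + n) = f m + f n" for m n using assms by (auto simp: klin_def)
  show "f (smult [:[:c:]:] m) = smult [:[:c:]:] (f m)" using assms by (auto simp: klin_def)
  show 0: "f 0 = 0" using 1[of 0 0] by (metis add.right_neutral add_left_cancel)
  show 2: "f (- m) = - f m" for m using 1[of m "- m"] 0 by (simp add: eq_neg_iff_add_eq_0 add.commute)
  show "f (m - n) = f m - f n" using 1[of m "- n"] 2 by simp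
qed

text \<open>Extends an operator on \<open>M\<close> to each coefficient of \<open>t\<close>, leaving
  the powers of \<open>t\<close> to the second representation.\<close>

definition cw :: "('k::field polM \<Rightarrow> 'k polM) \<Rightarrow> 'k lend" where "cw f = Lend (map_poly f)"

lemma app_cw: assumes "klin f" shows "app (cw f) w = map_poly f w"
proof -
  note f = klinD[OF assms]
  have "map_poly f \<in> {f. (\<forall>v w. f (v + w) = f v + f w) \<and> (\<forall>c w. f (smult (cst c) w) = smult (cst c) (f w))}"
    using f(2) by (auto intro!: poly_eqI simp: coeff_map_poly f)
  then show ?thesis by (simp add: cw_def Lend_inverse)
qed

lemma coeff_app_cw: "klin f \<Longrightarrow> coeff (app (cw f) w) n = f (coeff w n)"
  by (simp add: app_cw coeff_map_poly klinD(3))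

fun Lg :: "'k::field_char_0 \<Rightarrow> B_gen \<Rightarrow> 'k polM \<Rightarrow> 'k polM"
  where "Lg l GX = LX" | "Lg l GY = LY" | "Lg l GZ = LZ l"

definition Lop :: "'k::field_char_0 \<Rightarrow> B_gen \<Rightarrow> 'k lend" where "Lop l g = cw (Lg l g)"

lemma klin_Lg: "klin (Lg l g)"
  by (cases g) (simp_all add: klin_L)

lemma coeff_Lop [simp]: "coeff (app (Lop l g) w) n = Lg l g (coeff w n)"
  by (simp add: Lop_def coeff_app_cw klin_Lg)

definition B_relations :: "'k::field_char_0 \<Rightarrow> (B_gen \<Rightarrow> 'k lend) \<Rightarrow> bool"
  where "B_relations l f \<longleftrightarrow> f GX * f GY - f GY * f GX = f GY \<and>
    f GZ * f GX - f GX * f GZ = - f GZ + scl l * f GY \<and>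
    f GZ * f GY - f GY * f GZ = scl (1/2) * (f GY * f GY)"

text \<open>Compared coefficient by coefficient in \<open>t\<close> and then in \<open>Z\<close>,
  the relations become the commutation rules of \<open>lx\<close>, \<open>ly\<close>,
  \<open>lz\<close> and the shift.\<close>

lemma B_relations_Lop: "B_relations l (Lop l)"
  unfolding B_relations_def
proof (intro conjI; rule lend_eqI; rule poly_eqI)
  fix w n
  show "coeff (app (Lop l GX * Lop l GY - Lop l GY * Lop l GX) w) n = coeff (app (Lop l GY) w) n"
    by (rule poly_eqI) (simp add: lx_ly)
  show "coeff (app (Lop l GZ * Lop l GX - Lop l GX * Lop l GZ) w) n = coeff (app (- Lop l GZ + scl l * Lop l GY) w) n"
  proof (rule poly_eqI)
    fix i
    show "coeff (coeff (app (Lop l GZ * Lop l GX - Lop l GX * Lop l GZ) w) n) i =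
      coeff (coeff (app (- Lop l GZ + scl l * Lop l GY) w) n) i"
      by (cases i) (simp_all add: lz_lx shX_lx lx_add)
  qed
  show "coeff (app (Lop l GZ * Lop l GY - Lop l GY * Lop l GZ) w) n = coeff (app (scl (1/2) * (Lop l GY * Lop l GY)) w) n"
  proof (rule poly_eqI)
    fix i
    show "coeff (coeff (app (Lop l GZ * Lop l GY - Lop l GY * Lop l GZ) w) n) i =
      coeff (coeff (app (scl (1/2) * (Lop l GY * Lop l GY)) w) n) i"
      by (cases i) (simp_all add: lz_ly shX_ly ly_add)
  qed
qed

section \<open>The PBW theorem for \<open>B(\<lambda>)\<close>\<close>

text \<open>Coefficients stand to the left of the powers, and \<open>\<phi> a\<close> need not
  commute with \<open>z\<close>. Nesting three such evaluations therefore produces ordered monomials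
  \<open>Y^i X^j Z^k\<close>.\<close>

definition evp :: "('c::zero \<Rightarrow> 'r::ring_1) \<Rightarrow> 'r \<Rightarrow> 'c poly \<Rightarrow> 'r"
  where "evp \<phi> z m = (\<Sum>k\<le>degree m. \<phi> (coeff m k) * z ^ k)"

lemma evp_bound:
  assumes "\<phi> 0 = 0" "degree m \<le> n" shows "evp \<phi> z m = (\<Sum>k\<le>n. \<phi> (coeff m k) * z ^ k)"
  unfolding evp_def using assms by (intro sum.mono_neutral_left) (auto simp: coeff_eq_0)

lemma evp_pCons: assumes "\<phi> 0 = 0" shows "evp \<phi> z (pCons a m) = \<phi> a + evp \<phi> z m * z"
proof -
  have "evp \<phi> z (pCons a m) = (\<Sum>k\<le>Suc (degree m). \<phi> (coeff (pCons a m) k) * z ^ k)"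
    by (rule evp_bound[of \<phi>, OF assms]) (simp add: degree_pCons_le)
  also have "\<dots> = \<phi> a + (\<Sum>k\<le>degree m. \<phi> (coeff m k) * z ^ k) * z"
    by (subst sum.atMost_Suc_shift) (simp add: sum_distrib_right power_commutes mult.assoc)
  finally show ?thesis by (simp add: evp_def)
qed

lemma evp_0 [simp]: "\<phi> 0 = 0 \<Longrightarrow> evp \<phi> z 0 = 0"
  by (simp add: evp_def)

lemma evp_add:
  assumes "\<And>a b. \<phi> (a + b) = \<phi> a + \<phi> b" "\<phi> 0 = (0 :: 'r::ring_1)"
  shows "evp \<phi> z (m + n) = evp \<phi> z m + evp \<phi> z (n :: 'c::comm_monoid_add poly)"
proof -
  let ?d = "max (degree m) (degree n)"
  have "evp \<phi> z (m + n) = (\<Sum>k\<le>?d. \<phi> (coeff (m + n) k) * z ^ k)"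
    by (rule evp_bound[of \<phi>, OF assms(2) degree_add_le_max])
  then show ?thesis
    using evp_bound[of \<phi> m ?d z, OF assms(2)] evp_bound[of \<phi> n ?d z, OF assms(2)]
    by (simp add: assms(1) distrib_right sum.distrib)
qed

abbreviation (input) gX :: "('k::field, B_gen) free_alg" where "gX \<equiv> gen GX"
abbreviation (input) gY :: "('k::field, B_gen) free_alg" where "gY \<equiv> gen GY"
abbreviation (input) gZ :: "('k::field, B_gen) free_alg" where "gZ \<equiv> gen GZ"

definition liftY :: "'k::field_char_0 poly \<Rightarrow> ('k, B_gen) free_alg" where "liftY = evp const gY"
definition liftB :: "'k::field_char_0 poly poly \<Rightarrow> ('k, B_gen) free_alg" where "liftB = evp liftY gX"
definition lift :: "'k::field_char_0 polM \<Rightarrow> ('k, B_gen) free_alg" where "lift = evp liftB gZ"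

lemma liftY_0 [simp]: "liftY 0 = 0" by (simp add: liftY_def)
lemma liftB_0 [simp]: "liftB 0 = 0" by (simp add: liftB_def)
lemma lift_0 [simp]: "lift 0 = 0" by (simp add: lift_def)
lemma liftY_pCons: "liftY (pCons a r) = const a + liftY r * gY" by (simp add: liftY_def evp_pCons)
lemma liftB_pCons: "liftB (pCons r q) = liftY r + liftB q * gX" by (simp add: liftB_def evp_pCons)
lemma lift_pCons: "lift (pCons q m) = liftB q + lift m * gZ" by (simp add: lift_def evp_pCons)
lemma liftY_add: "liftY (r + r') = liftY r + liftY r'"
  unfolding liftY_def by (rule evp_add) (simp_all add: const.\<iota>_add)
lemma liftB_add: "liftB (q + q') = liftB q + liftB q'"
  unfolding liftB_def by (rule evp_add) (simp_all add: liftY_add)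
lemma lift_add: "lift (m + m') = lift m + lift m'"
  unfolding lift_def by (rule evp_add) (simp_all add: liftB_add)

lemma liftY_scale: "liftY (smult c r) = const c * liftY r"
  by (induction r) (simp_all add: liftY_pCons const.\<iota>_mult distrib_left mult.assoc)
lemma liftB_scale: "liftB (smult [:c:] q) = const c * liftB q"
  by (induction q) (simp_all add: liftB_pCons liftY_scale distrib_left mult.assoc)
lemma lift_scale: "lift (smult [:[:c:]:] m) = const c * lift m"
  by (induction m) (simp_all add: lift_pCons liftB_scale distrib_left mult.assoc)
lemma liftB_diff: "liftB (q - q') = liftB q - liftB q'"
  using liftB_add[of "q - q'" q'] by simp

lemma gY_liftY: "gY * liftY r = liftY r * gY"
proof (induction r)
  case (pCons a r)
  have "gY * const a = const a * gY" by (rule const.\<iota>_central)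
  moreover have "gY * (liftY r * gY) = liftY r * gY * gY" by (simp add: mult.assoc[symmetric] pCons.IH)
  ultimately show ?case by (simp add: liftY_pCons distrib_left distrib_right)
qed simp

lemma liftY_pCons_0: "liftY (pCons 0 r) = liftY r * gY"
  by (simp add: liftY_pCons)

lemma gY_liftB: "gY * liftB q = liftB (ly q)"
proof (induction q)
  case (pCons r q)
  have "gY * liftB (pCons r q) = liftY r * gY + liftB (ly q) * gX"
    by (simp only: liftB_pCons distrib_left gY_liftY mult.assoc[symmetric] pCons.IH)
  also have "\<dots> = liftB (ly (pCons r q))"
    by (simp add: ly_def liftB_pCons liftY_pCons_0)
  finally show ?case .
qed simp

section \<open>Reduction to ordered monomials modulo the relations\<close>

context
  fixes l :: "'k::field_char_0"
begin

abbreviation "relI \<equiv> Idl\<^bsub>free_algebra\<^esub> (B_rels l)"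

interpretation F: k_algebra "free_algebra :: ('k, ('k, B_gen) free_alg) module"
  unfolding free_algebra_eq by (rule const.ta.k_algebra_axioms)

lemma relI_ideal: "ideal relI free_algebra"
  by (rule F.genideal_ideal) (simp add: free_algebra_eq)

interpretation Q: quotient_algebra "free_algebra :: ('k, ('k, B_gen) free_alg) module" relI
  by (intro quotient_algebra.intro quotient_algebra_axioms.intro F.k_algebra_axioms relI_ideal)

definition fcong :: "('k, B_gen) free_alg \<Rightarrow> ('k, B_gen) free_alg \<Rightarrow> bool" (infix \<open>\<bowtie>\<close> 50)
  where "p \<bowtie> q \<longleftrightarrow> p - q \<in> relI"

lemma relI_add: "p \<in> relI \<Longrightarrow> q \<in> relI \<Longrightarrow> p + q \<in> relI"
  using Q.I.a_closed[of p q] by (simp add: free_algebra_eq)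
lemma relI_mult: "p \<in> relI \<Longrightarrow> q * p \<in> relI" "p \<in> relI \<Longrightarrow> p * q \<in> relI"
  using Q.I.I_l_closed[of p q] Q.I.I_r_closed[of p q] by (simp_all add: free_algebra_eq)
lemma relI_zero: "0 \<in> relI"
  using additive_subgroup.zero_closed[OF Q.I.additive_subgroup_axioms] by (simp add: free_algebra_eq)

lemma fcong_refl [simp]: "p \<bowtie> p" by (simp add: fcong_def relI_zero)
lemma fcong_trans [trans]: "p \<bowtie> q \<Longrightarrow> q \<bowtie> r \<Longrightarrow> p \<bowtie> r"
  unfolding fcong_def using relI_add[of "p - q" "q - r"] by simp
lemma fcong_add: "p \<bowtie> q \<Longrightarrow> p' \<bowtie> q' \<Longrightarrow> p + p' \<bowtie> q + q'"
  unfolding fcong_def using relI_add[of "p - q" "p' - q'"] by (simp add: algebra_simps)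
lemma fcong_mult: "p \<bowtie> q \<Longrightarrow> r * p \<bowtie> r * q" "p \<bowtie> q \<Longrightarrow> p * r \<bowtie> q * r"
  unfolding fcong_def using relI_mult[of "p - q" r] by (simp_all add: algebra_simps)
lemma fcong_eq_trans [trans]: "p \<bowtie> q \<Longrightarrow> q = r \<Longrightarrow> p \<bowtie> r" "p = q \<Longrightarrow> q \<bowtie> r \<Longrightarrow> p \<bowtie> r"
  by auto

lemma rel_mem: "B_rels l \<subseteq> relI"
  by (rule F.genideal_self) (simp add: free_algebra_eq)

lemma XY: "gX * gY \<bowtie> gY * gX + gY"
  and ZX: "gZ * gX \<bowtie> gX * gZ - gZ + const l * gY"
  and ZY: "gZ * gY \<bowtie> gY * gZ + const (1/2) * (gY * gY)"
  using rel_mem by (simp_all add: B_rels_def fcong_def algebra_simps)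

lemma X_liftY: "gX * liftY r \<bowtie> liftY r * gX + liftY (pCons 0 (pderiv r))"
proof (induction r)
  case (pCons a r)
  have "gX * liftY (pCons a r) = const a * gX + (gX * liftY r) * gY"
    by (simp add: liftY_pCons distrib_left mult.assoc const.\<iota>_central[of gX a])
  also have "\<dots> \<bowtie> const a * gX + (liftY r * gX + liftY (pCons 0 (pderiv r))) * gY"
    by (intro fcong_add fcong_mult pCons.IH fcong_refl)
  also have "\<dots> = const a * gX + (liftY r * (gX * gY) + liftY (pCons 0 (pderiv r)) * gY)"
    by (simp add: distrib_right mult.assoc)
  also have "\<dots> \<bowtie> const a * gX + (liftY r * (gY * gX + gY) + liftY (pCons 0 (pderiv r)) * gY)"
    by (intro fcong_add fcong_mult XY fcong_refl)
  also have "\<dots> = liftY (pCons a r) * gX + liftY (pCons 0 (pderiv (pCons a r)))"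
    by (simp add: liftY_pCons pderiv_pCons liftY_add algebra_simps)
  finally show ?case .
qed simp

lemma Z_liftY: "gZ * liftY r \<bowtie> liftY r * gZ + const (1/2) * liftY (pCons 0 (pCons 0 (pderiv r)))"
proof (induction r)
  case (pCons a r)
  have "gZ * liftY (pCons a r) = const a * gZ + (gZ * liftY r) * gY"
    by (simp add: liftY_pCons distrib_left mult.assoc const.\<iota>_central[of gZ a])
  also have "\<dots> \<bowtie> const a * gZ + (liftY r * gZ + const (1/2) * liftY (pCons 0 (pCons 0 (pderiv r)))) * gY"
    by (intro fcong_add fcong_mult pCons.IH fcong_refl)
  also have "\<dots> = const a * gZ + (liftY r * (gZ * gY) + const (1/2) * liftY (pCons 0 (pCons 0 (pderiv r))) * gY)"
    by (simp add: distrib_right mult.assoc)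
  also have "\<dots> \<bowtie> const a * gZ + (liftY r * (gY * gZ + const (1/2) * (gY * gY)) + const (1/2) * liftY (pCons 0 (pCons 0 (pderiv r))) * gY)"
    by (intro fcong_add fcong_mult ZY fcong_refl)
  also have "\<dots> = liftY (pCons a r) * gZ + const (1/2) * liftY (pCons 0 (pCons 0 (pderiv (pCons a r))))"
    using const.\<iota>_left_commute[of "liftY r" "1/2"]
    by (simp add: liftY_pCons pderiv_pCons liftY_add distrib_left distrib_right add_ac mult.assoc)
  finally show ?case .
qed simp

text \<open>\<open>X Y = Y (X + 1)\<close>, so \<open>Y\<close> travels to the left end at the price
  of the substitution \<open>X \<mapsto> X + 1\<close>.\<close>

lemma liftB_Y: "liftB q * gY \<bowtie> liftB (ly (shX 1 q))"
proof (induction q)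
  case (pCons r q)
  have "liftB (pCons r q) * gY = liftY r * gY + liftB q * (gX * gY)"
    by (simp add: liftB_pCons distrib_right mult.assoc)
  also have "\<dots> \<bowtie> liftY r * gY + liftB q * (gY * gX + gY)"
    by (intro fcong_add fcong_mult XY fcong_refl)
  also have "\<dots> = liftY r * gY + ((liftB q * gY) * gX + liftB q * gY)"
    by (simp add: distrib_left mult.assoc)
  also have "\<dots> \<bowtie> liftY r * gY + (liftB (ly (shX 1 q)) * gX + liftB (ly (shX 1 q)))"
    by (intro fcong_add fcong_mult pCons.IH fcong_refl)
  also have "\<dots> = liftB (ly (shX 1 (pCons r q)))"
  proof -
    have "ly (shX 1 (pCons r q)) = pCons (pCons 0 r) (ly (shX 1 q)) + ly (shX 1 q)"
      by (simp add: shX_pCons ly_def algebra_simps smult_add_right one_pCons[symmetric])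
    then show ?thesis by (simp add: liftB_add liftB_pCons liftY_pCons_0 algebra_simps)
  qed
  finally show ?case .
qed simp

lemma lx_pCons: "lx (pCons r q) = pCons (pCons 0 (pderiv r)) ([:r:] + lx q)"
  by (simp add: lx_def smult_add_right)

lemma X_liftB: "gX * liftB q \<bowtie> liftB (lx q)"
proof (induction q)
  case (pCons r q)
  have "gX * liftB (pCons r q) = gX * liftY r + (gX * liftB q) * gX"
    by (simp add: liftB_pCons distrib_left mult.assoc)
  also have "\<dots> \<bowtie> (liftY r * gX + liftY (pCons 0 (pderiv r))) + liftB (lx q) * gX"
    by (intro fcong_add fcong_mult pCons.IH X_liftY)
  also have "\<dots> = liftB (lx (pCons r q))"
    by (simp add: lx_pCons liftB_pCons liftB_add distrib_right add_ac)
  finally show ?case .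
qed simp

lemma lz_pCons:
  "lz l (pCons r q) = pCons (smult (1/2) (pCons 0 (pCons 0 (pderiv r)))) (lz l q) + smult [:l:] (ly q)"
  by (simp add: lz_def ly_def pderiv_pCons smult_add_right)

lemma Z_liftB: "gZ * liftB q \<bowtie> liftB (shX (- 1) q) * gZ + liftB (lz l q)"
proof (induction q)
  case (pCons r q)
  let ?S = "shX (- 1) q"
  have "gZ * liftB (pCons r q) = gZ * liftY r + (gZ * liftB q) * gX"
    by (simp add: liftB_pCons distrib_left mult.assoc)
  also have "\<dots> \<bowtie> (liftY r * gZ + const (1/2) * liftY (pCons 0 (pCons 0 (pderiv r)))) + (liftB ?S * gZ + liftB (lz l q)) * gX"
    by (intro fcong_add fcong_mult pCons.IH Z_liftY)
  also have "\<dots> = (liftY r * gZ + const (1/2) * liftY (pCons 0 (pCons 0 (pderiv r)))) + (liftB ?S * (gZ * gX) + liftB (lz l q) * gX)"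
    by (simp add: distrib_right mult.assoc)
  also have "\<dots> \<bowtie> (liftY r * gZ + const (1/2) * liftY (pCons 0 (pCons 0 (pderiv r)))) + (liftB ?S * (gX * gZ - gZ + const l * gY) + liftB (lz l q) * gX)"
    by (intro fcong_add fcong_mult ZX fcong_refl)
  also have "\<dots> = (liftY r * gZ + const (1/2) * liftY (pCons 0 (pCons 0 (pderiv r)))) +
      (liftB ?S * gX * gZ - liftB ?S * gZ + const l * (liftB ?S * gY) + liftB (lz l q) * gX)"
    using const.\<iota>_left_commute[of "liftB ?S" l gY] by (simp add: distrib_left right_diff_distrib mult.assoc)
  \<comment> \<open>On its way to the left \<open>Y\<close> meets \<open>?S = q(X - 1)\<close> and
    turns it back into \<open>q\<close>; this is why \<open>lz\<close> contains an unshifted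
    derivative.\<close>
  also have "\<dots> \<bowtie> (liftY r * gZ + const (1/2) * liftY (pCons 0 (pCons 0 (pderiv r)))) +
      (liftB ?S * gX * gZ - liftB ?S * gZ + const l * liftB (ly q) + liftB (lz l q) * gX)"
    using liftB_Y[of ?S] by (intro fcong_add fcong_mult fcong_refl) (simp add: shX_shX)
  also have "\<dots> = liftB (shX (- 1) (pCons r q)) * gZ + liftB (lz l (pCons r q))"
  proof -
    have m1: "[:- 1:] = (- 1 :: 'k poly)" by (simp add: one_pCons)
    have "shX (- 1) (pCons r q) = pCons r ?S - ?S"
      using m1 by (simp add: shX_pCons algebra_simps)
    then have shl: "liftB (shX (- 1) (pCons r q)) = liftY r + liftB ?S * gX - liftB ?S"
      by (simp add: liftB_diff liftB_pCons)
    have lzl: "liftB (lz l (pCons r q)) = const (1/2) * liftY (pCons 0 (pCons 0 (pderiv r))) + liftB (lz l q) * gX + const l * liftB (ly q)"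
      unfolding lz_pCons liftB_add liftB_pCons liftB_scale liftY_scale ..
    show ?thesis unfolding shl lzl by (simp add: algebra_simps)
  qed
  finally show ?case .
qed simp

text \<open>Here the operators of the representation originate: they describe left multiplication by
  a generator on ordered expressions.\<close>

lemma gen_lift: "gen g * lift m \<bowtie> lift (Lg l g m)"
proof (induction m)
  case (pCons q m)
  have IH: "gen g * lift m * gZ \<bowtie> lift (Lg l g m) * gZ" by (rule fcong_mult(2)[OF pCons.IH])
  have eq: "gen g * lift (pCons q m) = gen g * liftB q + gen g * lift m * gZ"
    by (simp add: lift_pCons distrib_left mult.assoc)
  show ?case
  proof (cases g)
    case GX
    show ?thesis unfolding eq
      using fcong_add[OF X_liftB IH, of q] GX by (simp add: L_pCons lift_pCons)
  next
    case GY
    show ?thesis unfolding eq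
      using fcong_add[OF fcong_refl IH, of "gY * liftB q"] GY by (simp add: L_pCons lift_pCons gY_liftB)
  next
    case GZ
    have "lift (LZ l (pCons q m)) = liftB (lz l q) + (liftB (shX (- 1) q) + lift (LZ l m)) * gZ"
      by (simp add: L_pCons lift_pCons lift_add)
    then show ?thesis unfolding eq
      using fcong_add[OF Z_liftB IH, of q] GZ by (simp add: distrib_right add_ac)
  qed
qed (cases g; simp)

lemma pbw_spanning: "\<exists>m. p \<bowtie> lift m"
proof (induction p rule: free_alg_induct)
  case one
  have "lift 1 = 1"
    by (simp add: one_pCons lift_pCons liftB_pCons liftY_pCons)
  then show ?case using fcong_refl[of 1] by metis
next
  case (gen g p)
  then obtain m where "p \<bowtie> lift m" by auto
  then have "gen g * p \<bowtie> lift (Lg l g m)" using fcong_mult(1) gen_lift fcong_trans by blast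
  then show ?case by auto
next
  case (add p q)
  then obtain m n where "p \<bowtie> lift m" "q \<bowtie> lift n" by auto
  then have "p + q \<bowtie> lift (m + n)" by (simp add: lift_add fcong_add)
  then show ?case by auto
next
  case (scale c p)
  then obtain m where "p \<bowtie> lift m" by auto
  then have "const c * p \<bowtie> lift (smult [:[:c:]:] m)" by (simp add: lift_scale fcong_mult)
  then show ?case by auto
qed

subsection \<open>Faithfulness\<close>

definition rep :: "('k, B_gen) free_alg \<Rightarrow> 'k lend"
  where "rep = free_eval (type_alg scl) (Lop l)"

lemma rep_hom: "alg_hom free_algebra (type_alg scl) rep"
  unfolding rep_def by (rule scl.ta.free_eval_hom) simp

lemma rep_simps [simp]: "rep 1 = 1" "rep (p * q) = rep p * rep q" "rep (p + q) = rep p + rep q"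
  "rep (gen g) = Lop l g" "rep (const c * p) = scl c * rep p"
  using rep_hom alg_homD(5)[OF rep_hom, of p c] scl.ta.free_eval_gen[of "Lop l"]
  by (auto simp: alg_hom_def free_algebra_eq rep_def)

lemma rep_const [simp]: "rep (const c) = scl c"
  using rep_simps(5)[of c 1] by (simp del: rep_simps(2,5))

text \<open>\<open>rep p\<close> treats all coefficients of \<open>t\<close> alike;
  \<open>act p\<close> is its effect on one of them, as \<open>coeff_rep\<close> confirms.\<close>

definition act :: "('k, B_gen) free_alg \<Rightarrow> 'k polM \<Rightarrow> 'k polM"
  where "act p m = coeff (app (rep p) [:m:]) 0"

lemma coeff_rep: "coeff (app (rep p) w) n = act p (coeff w n)"
proof -
  have "\<forall>w n. coeff (app (rep p) w) n = act p (coeff w n)"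
    by (induction p rule: free_alg_induct) (auto simp: act_def coeff_pCons)
  then show ?thesis by simp
qed

lemma act_simps [simp]: "act 1 m = m" "act (p + q) m = act p m + act q m"
  "act (gen g) m = Lg l g m" "act (const c) m = smult [:[:c:]:] m"
  by (auto simp: act_def)

lemma act_mult [simp]: "act (p * q) m = act p (act q m)"
  using coeff_rep[of p "app (rep q) [:m:]" 0] by (simp add: act_def)

lemma act_zero [simp]: "act 0 m = 0"
  using act_simps(2)[of 0 0 m] by (metis add.right_neutral add_left_cancel)

lemma act_liftY: "act (liftY r) m = smult [:r:] m"
proof (induction r arbitrary: m)
  case (pCons a r)
  have "LY m = smult vY m" by (rule poly_eqI) (simp add: ly_def)
  then show ?case using pCons.IH
    by (simp add: liftY_pCons smult_add_left[symmetric])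
qed simp

text \<open>The factors \<open>X\<close> stand to the right and act first, and on coefficients free
  of \<open>Y\<close> the operator \<open>lx\<close> is plain multiplication by
  \<open>X\<close>.\<close>

lemma act_liftB:
  assumes "\<And>n. dY (coeff w n) = 0" shows "act (liftB q) w = smult q w"
  using assms
proof (induction q arbitrary: w)
  case (pCons r q)
  have LX: "LX w = smult vX w" by (rule poly_eqI) (simp add: lx_def pCons.prems)
  have "act (liftB q) (LX w) = smult q (LX w)"
    by (rule pCons.IH) (simp add: LX pCons.prems)
  then show ?case
    by (simp add: liftB_pCons act_liftY LX smult_add_left[symmetric])
qed simp

text \<open>The factors \<open>Z\<close> act before everything else, so the induction has to start
  at an arbitrary power \<open>Z^k\<close>. The shift fixes 1 and \<open>lz\<close> kills it, whence
  \<open>Z\<close> sends \<open>Z^k\<close> to \<open>Z^(k+1)\<close>.\<close>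

lemma act_lift_monom: "act (lift m) (monom 1 k) = m * monom 1 k"
proof (induction m arbitrary: k)
  case (pCons q m)
  have "LZ l (monom 1 k) = monom 1 (Suc k)"
    by (rule poly_eqI) (auto simp: lz_def one_pCons shX_def pderiv_pCons split: nat.splits)
  moreover have "act (liftB q) (monom 1 k) = smult q (monom 1 k)"
    by (rule act_liftB) (auto simp: one_pCons)
  ultimately show ?case
    using pCons.IH[of "Suc k"] by (simp add: lift_pCons monom_Suc)
qed simp

text \<open>An ordered expression applied to the vector 1 returns its own polynomial: the
  independence half of the PBW theorem.\<close>

lemma act_lift: "act (lift m) 1 = m"
  using act_lift_monom[of m 0] by (simp add: monom_0 one_pCons[symmetric])

lemma free_eval_relations:
  assumes "B_relations l f" "p \<in> relI"
  shows "free_eval (type_alg scl) f p = 0"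
proof -
  let ?f = "free_eval (type_alg scl) f"
  have hom: "alg_hom free_algebra (type_alg scl) ?f" by (rule scl.ta.free_eval_hom) simp
  have add: "?f (p + q) = ?f p + ?f q" and mult: "?f (p * q) = ?f p * ?f q"
    and sc: "?f (const c * p) = scl c * ?f p" and g: "?f (gen g) = f g" and one: "?f 1 = 1" for p q c g
    using hom alg_homD(5)[OF hom, of p c] scl.ta.free_eval_gen[of f]
    by (auto simp: alg_hom_def free_algebra_eq)
  have diff: "?f (p - q) = ?f p - ?f q" for p q using add[of "p - q" q] by simp
  have zero: "?f 0 = 0" using diff[of 0 0] by simp
  have neg: "?f (- p) = - ?f p" for p using diff[of 0 p] zero by simp
  have cc: "?f (const c) = scl c" for c using sc[of c 1] one by simp
  have "ideal {p. ?f p = 0} free_algebra"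
  proof (rule idealI[OF F.ring_axioms])
    have "submodule {p. ?f p = 0} base_field free_algebra"
      by (simp add: F.submodule_iff) (simp add: free_algebra_eq add sc zero)
    then show "subgroup {p. ?f p = 0} (add_monoid free_algebra)" by (rule submodule.axioms(1))
  qed (simp_all add: free_algebra_eq mult)
  moreover have "B_rels l \<subseteq> {p. ?f p = 0}"
    using assms(1) by (simp add: B_rels_def B_relations_def diff neg add mult g cc)
  ultimately have "relI \<subseteq> {p. ?f p = 0}"
    by (rule F.genideal_minimal)
  then show ?thesis using assms(2) by auto
qed

text \<open>An element of the kernel is congruent to some \<open>lift m\<close>, which then also
  acts as zero; applied to 1 it gives \<open>m = 0\<close>.\<close>

lemma kernel_rep: "rep p = 0 \<longleftrightarrow> p \<in> relI"
proof
  show "p \<in> relI \<Longrightarrow> rep p = 0"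
    unfolding rep_def by (rule free_eval_relations[OF B_relations_Lop])
  assume 0: "rep p = 0"
  obtain m where m: "p \<bowtie> lift m" using pbw_spanning by auto
  then have "rep (p - lift m) = 0"
    unfolding rep_def fcong_def by (rule free_eval_relations[OF B_relations_Lop])
  then have "rep (lift m) = 0"
    using rep_simps(3)[of "p - lift m" "lift m"] 0 by simp
  then have "m = 0" using act_lift[of m] by (simp add: act_def)
  then show "p \<in> relI" using m by (simp add: fcong_def)
qed

subsection \<open>Transport to \<open>B_alg\<close>\<close>

lemma B_alg_eq: "B_alg l = quot_alg free_algebra relI"
  by (simp add: B_alg_def presented_alg_def)

lemma B_alg_k_algebra: "k_algebra (B_alg l)"
  unfolding B_alg_eq by (rule Q.quot_k_algebra)

lemma B_of_eq: "B_of l g = relI +>\<^bsub>free_algebra\<^esub> gen g"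
  by (simp add: B_of_def presented_cls_def)

lemma B_alg_carrier: "carrier (B_alg l) = range (\<lambda>p. relI +>\<^bsub>free_algebra\<^esub> p)"
  by (simp add: B_alg_eq Q.coset_carrier) (simp add: free_algebra_eq)

lemma coset_hom_B: "alg_hom free_algebra (B_alg l) (\<lambda>p. relI +>\<^bsub>free_algebra\<^esub> p)"
  unfolding B_alg_eq by (rule Q.coset_hom)

lemma B_of_carrier [simp]: "B_of l g \<in> carrier (B_alg l)"
  by (auto simp: B_alg_carrier B_of_eq)

lemma coset_mem: "q \<in> relI +>\<^bsub>free_algebra\<^esub> p \<longleftrightarrow> q - p \<in> relI"
  using Q.mem_coset_iff[of p q] Q.coset_eq_iff[of q p] by (simp add: free_algebra_eq)

lemma B_hom_ext:
  assumes "B_relations l f"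
  shows "\<exists>h. alg_hom (B_alg l) (type_alg scl) h \<and> (\<forall>g. h (B_of l g) = f g) \<and>
    (\<forall>p. h (relI +>\<^bsub>free_algebra\<^esub> p) = free_eval (type_alg scl) f p)"
proof -
  have hom: "alg_hom free_algebra (type_alg scl) (free_eval (type_alg scl) f)"
    by (rule scl.ta.free_eval_hom) simp
  obtain h where h: "alg_hom (quot_alg free_algebra relI) (type_alg scl) h"
      "\<And>p. p \<in> carrier free_algebra \<Longrightarrow> h (relI +>\<^bsub>free_algebra\<^esub> p) = free_eval (type_alg scl) f p"
    by (rule Q.quot_induced_hom[OF scl.ta.k_algebra_axioms hom]) (simp_all add: free_eval_relations[OF assms])
  have h2: "h (relI +>\<^bsub>free_algebra\<^esub> p) = free_eval (type_alg scl) f p" for p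
    using h(2)[of p] by (simp add: free_algebra_eq)
  moreover have "h (B_of l g) = f g" for g
    using h2 by (simp add: B_of_eq scl.ta.free_eval_gen)
  ultimately show ?thesis using h(1) unfolding B_alg_eq by blast
qed

definition repr :: "'k B_elem \<Rightarrow> 'k lend"
  where "repr = (SOME h. alg_hom (B_alg l) (type_alg scl) h \<and> (\<forall>p. h (relI +>\<^bsub>free_algebra\<^esub> p) = rep p))"

lemma repr_hom: "alg_hom (B_alg l) (type_alg scl) repr"
  and repr_coset: "repr (relI +>\<^bsub>free_algebra\<^esub> p) = rep p"
proof -
  obtain h where h: "alg_hom (B_alg l) (type_alg scl) h"
    "\<forall>p. h (relI +>\<^bsub>free_algebra\<^esub> p) = free_eval (type_alg scl) (Lop l) p"
    using B_hom_ext[OF B_relations_Lop] by (elim exE conjE)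
  define P where "P h \<longleftrightarrow> alg_hom (B_alg l) (type_alg scl) h \<and> (\<forall>p. h (relI +>\<^bsub>free_algebra\<^esub> p) = rep p)" for h
  have "P h" using h by (simp add: P_def rep_def)
  then have "P (SOME h. P h)"
    by (metis someI_ex)
  moreover have "repr = (SOME h. P h)" unfolding repr_def P_def ..
  ultimately have "P repr" by metis
  then have "alg_hom (B_alg l) (type_alg scl) repr \<and> (\<forall>p. repr (relI +>\<^bsub>free_algebra\<^esub> p) = rep p)"
    unfolding P_def .
  then show "alg_hom (B_alg l) (type_alg scl) repr" "repr (relI +>\<^bsub>free_algebra\<^esub> p) = rep p" by auto
qed

lemma repr_of [simp]: "repr (B_of l g) = Lop l g"
  by (simp add: B_of_eq repr_coset)

lemma repr_inj: "inj_on repr (carrier (B_alg l))"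
proof (rule inj_onI)
  fix a b assume "a \<in> carrier (B_alg l)" "b \<in> carrier (B_alg l)" "repr a = repr b"
  then obtain p q where pq: "a = relI +>\<^bsub>free_algebra\<^esub> p" "b = relI +>\<^bsub>free_algebra\<^esub> q" "rep p = rep q"
    by (auto simp: B_alg_carrier repr_coset)
  then have "p - q \<in> relI" using rep_simps(3)[of "p - q" q] by (simp add: kernel_rep[symmetric])
  then show "a = b" using pq Q.coset_eq_iff[of p q] by (simp add: free_algebra_eq)
qed

text \<open>Together with \<open>coord\<close>, which applies an operator to the vector 1, this
  identifies the image of \<open>H\<close> with \<open>M\<close> as vector spaces.\<close>

definition op :: "'k polM \<Rightarrow> 'k lend" where "op m = rep (lift m)"

definition coord :: "'k lend \<Rightarrow> 'k polM" where "coord f = coeff (app f 1) 0"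

lemma coord_op [simp]: "coord (op m) = m"
  using act_lift[of m] by (simp add: op_def coord_def act_def one_pCons)

lemma rep_eq_op: "rep p = op (coord (rep p))"
proof -
  obtain m where "p \<bowtie> lift m" using pbw_spanning by auto
  then have "rep (p - lift m) = 0" by (simp add: fcong_def kernel_rep)
  then have "rep p = op m" using rep_simps(3)[of "p - lift m" "lift m"] by (simp add: op_def)
  then show ?thesis by simp
qed

lemma B_alg_generated:
  assumes "is_subalgebra (B_alg l) S" "\<And>g. B_of l g \<in> S"
  shows "S = carrier (B_alg l)"
proof -
  interpret H: k_algebra "B_alg l" by (rule B_alg_k_algebra)
  have "relI +>\<^bsub>free_algebra\<^esub> p \<in> S" for p
  proof (induction p rule: free_alg_induct)
    case one
    then show ?case using assms(1) alg_homD(2)[OF coset_hom_B] by (simp add: H.subalgebra_iff free_algebra_eq)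
  next
    case (gen g p)
    then show ?case using assms alg_homD(4)[OF coset_hom_B, of "gen g" p]
      by (simp add: H.subalgebra_iff free_algebra_eq B_of_eq)
  next
    case (add p q)
    then show ?case using assms(1) alg_homD(3)[OF coset_hom_B, of p q]
      by (simp add: H.subalgebra_iff free_algebra_eq)
  next
    case (scale c p)
    then show ?case using assms(1) alg_homD(5)[OF coset_hom_B, of p c]
      by (simp add: H.subalgebra_iff free_algebra_eq)
  qed
  then show ?thesis using assms(1) by (auto simp: H.subalgebra_iff B_alg_carrier)
qed

end

section \<open>The comultiplication\<close>

lemma alg_hom_kernel_ideal:
  assumes "k_algebra A" "k_algebra B" "alg_hom A B h"
  shows "ideal {a \<in> carrier A. h a = \<zero>\<^bsub>B\<^esub>} A"
proof -
  interpret A: k_algebra A by fact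
  interpret B: k_algebra B by fact
  note h = alg_homD[OF assms(3)] alg_hom_zero[OF assms]
  have "submodule {a \<in> carrier A. h a = \<zero>\<^bsub>B\<^esub>} base_field A"
    by (auto simp: A.submodule_iff h)
  then show ?thesis
    using h by (intro idealI[OF A.ring_axioms submodule.axioms(1)]) auto
qed

context
  fixes l :: "'k::field_char_0"
begin

interpretation F: k_algebra "free_algebra :: ('k, ('k, B_gen) free_alg) module"
  unfolding free_algebra_eq by (rule const.ta.k_algebra_axioms)

interpretation H: k_algebra "B_alg l" by (rule B_alg_k_algebra)

interpretation HH: tensor_product "B_alg l" "B_alg l" ..

abbreviation (input) "hx \<equiv> B_of l GX"
abbreviation (input) "hy \<equiv> B_of l GY"
abbreviation (input) "hz \<equiv> B_of l GZ"
abbreviation mulH (infixl "\<cdot>" 70) where "a \<cdot> b \<equiv> a \<otimes>\<^bsub>B_alg l\<^esub> b"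
abbreviation addH (infixl "\<boxplus>" 65) where "a \<boxplus> b \<equiv> a \<oplus>\<^bsub>B_alg l\<^esub> b"
abbreviation sclH (infixr "\<bullet>" 75) where "c \<bullet> b \<equiv> c \<odot>\<^bsub>B_alg l\<^esub> b"
abbreviation "oneH \<equiv> \<one>\<^bsub>B_alg l\<^esub>"
abbreviation "TH \<equiv> tensor_alg (B_alg l) (B_alg l)"
abbreviation "pt \<equiv> pure_tensor (B_alg l) (B_alg l)"

lemmas repr_simps = alg_homD[OF repr_hom[of l], simplified]

text \<open>Proved for operators and pulled back along the injective \<open>repr\<close>. The forms
  avoid subtraction, so that both sides are sums that associative-commutative rewriting can
  compare.\<close>

lemma B_alg_relations:
  "hx \<cdot> hy = hy \<cdot> hx \<boxplus> hy"
  "hz \<cdot> hx \<boxplus> hz = hx \<cdot> hz \<boxplus> l \<bullet> hy"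
  "hz \<cdot> hy = hy \<cdot> hz \<boxplus> (1/2) \<bullet> (hy \<cdot> hy)"
proof -
  note rel = B_relations_Lop[of l, unfolded B_relations_def]
  note inj = inj_onD[OF repr_inj[of l]]
  show "hx \<cdot> hy = hy \<cdot> hx \<boxplus> hy"
    by (rule inj) (use rel in \<open>simp_all add: repr_simps algebra_simps\<close>)
  show "hz \<cdot> hx \<boxplus> hz = hx \<cdot> hz \<boxplus> l \<bullet> hy"
    by (rule inj) (use rel in \<open>simp_all add: repr_simps algebra_simps\<close>)
  show "hz \<cdot> hy = hy \<cdot> hz \<boxplus> (1/2) \<bullet> (hy \<cdot> hy)"
    by (rule inj) (use rel in \<open>simp_all add: repr_simps algebra_simps\<close>)
qed

lemma B_comult_gen_closed [simp]: "B_comult_gen l g \<in> carrier TH"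
  by (cases g) simp_all

lemmas tensor_expand = HH.T.l_distr HH.T.r_distr HH.pure_mult HH.pure_add_left HH.pure_add_right
  HH.pure_smult_left HH.pure_smult_right HH.T.smult_r_distr

text \<open>This is the well-definedness of \<open>\<Delta>\<close>. The terms that need care come
  from \<open>X \<otimes> Y\<close>: its commutator with \<open>1 \<otimes> X\<close> is
  \<open>- X \<otimes> Y\<close>, matching the \<open>-Z\<close> in \<open>[Z, X]\<close>, and its
  commutator with \<open>Y \<otimes> 1\<close> is \<open>Y \<otimes> Y\<close>, the cross term of
  half the square of \<open>\<Delta> Y\<close>.\<close>

lemma comult_relations:
  defines "DX \<equiv> B_comult_gen l GX" and "DY \<equiv> B_comult_gen l GY" and "DZ \<equiv> B_comult_gen l GZ"
  shows "DX \<otimes>\<^bsub>TH\<^esub> DY = DY \<otimes>\<^bsub>TH\<^esub> DX \<oplus>\<^bsub>TH\<^esub> DY"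
    "DZ \<otimes>\<^bsub>TH\<^esub> DX \<oplus>\<^bsub>TH\<^esub> DZ = DX \<otimes>\<^bsub>TH\<^esub> DZ \<oplus>\<^bsub>TH\<^esub> l \<odot>\<^bsub>TH\<^esub> DY"
    "DZ \<otimes>\<^bsub>TH\<^esub> DY = DY \<otimes>\<^bsub>TH\<^esub> DZ \<oplus>\<^bsub>TH\<^esub> (1/2) \<odot>\<^bsub>TH\<^esub> (DY \<otimes>\<^bsub>TH\<^esub> DY)"
proof -
  show "DX \<otimes>\<^bsub>TH\<^esub> DY = DY \<otimes>\<^bsub>TH\<^esub> DX \<oplus>\<^bsub>TH\<^esub> DY"
    by (simp add: DX_def DY_def tensor_expand B_alg_relations HH.T.a_ac)
  \<comment> \<open>The second relation rewrites a sum and not a product, so its instances in either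
    tensor factor are grouped by hand and replaced as blocks.\<close>
  have 1: "pt (hz \<cdot> hx) oneH \<oplus>\<^bsub>TH\<^esub> pt hz oneH = pt (hx \<cdot> hz) oneH \<oplus>\<^bsub>TH\<^esub> l \<odot>\<^bsub>TH\<^esub> pt hy oneH"
    using B_alg_relations(2)
    by (simp add: HH.pure_add_left[symmetric] HH.pure_smult_left[symmetric])
  have 2: "pt oneH (hz \<cdot> hx) \<oplus>\<^bsub>TH\<^esub> pt oneH hz = pt oneH (hx \<cdot> hz) \<oplus>\<^bsub>TH\<^esub> l \<odot>\<^bsub>TH\<^esub> pt oneH hy"
    using B_alg_relations(2)
    by (simp add: HH.pure_add_right[symmetric] HH.pure_smult_right[symmetric])
  have "DZ \<otimes>\<^bsub>TH\<^esub> DX \<oplus>\<^bsub>TH\<^esub> DZ =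
    (pt (hz \<cdot> hx) oneH \<oplus>\<^bsub>TH\<^esub> pt hz oneH) \<oplus>\<^bsub>TH\<^esub> (pt oneH (hz \<cdot> hx) \<oplus>\<^bsub>TH\<^esub> pt oneH hz) \<oplus>\<^bsub>TH\<^esub>
    (pt hz hx \<oplus>\<^bsub>TH\<^esub> pt hx hz \<oplus>\<^bsub>TH\<^esub> pt (hx \<cdot> hx) hy \<oplus>\<^bsub>TH\<^esub> (pt hx (hy \<cdot> hx) \<oplus>\<^bsub>TH\<^esub> pt hx hy))"
    by (simp add: DX_def DZ_def tensor_expand HH.T.a_ac)
  also have "\<dots> = (pt (hx \<cdot> hz) oneH \<oplus>\<^bsub>TH\<^esub> l \<odot>\<^bsub>TH\<^esub> pt hy oneH) \<oplus>\<^bsub>TH\<^esub>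
    (pt oneH (hx \<cdot> hz) \<oplus>\<^bsub>TH\<^esub> l \<odot>\<^bsub>TH\<^esub> pt oneH hy) \<oplus>\<^bsub>TH\<^esub>
    (pt hz hx \<oplus>\<^bsub>TH\<^esub> pt hx hz \<oplus>\<^bsub>TH\<^esub> pt (hx \<cdot> hx) hy \<oplus>\<^bsub>TH\<^esub> (pt hx (hy \<cdot> hx) \<oplus>\<^bsub>TH\<^esub> pt hx hy))"
    unfolding 1 2 ..
  also have "\<dots> = DX \<otimes>\<^bsub>TH\<^esub> DZ \<oplus>\<^bsub>TH\<^esub> l \<odot>\<^bsub>TH\<^esub> DY"
    by (simp add: DX_def DY_def DZ_def tensor_expand B_alg_relations(1) HH.T.a_ac)
  finally show "DZ \<otimes>\<^bsub>TH\<^esub> DX \<oplus>\<^bsub>TH\<^esub> DZ = DX \<otimes>\<^bsub>TH\<^esub> DZ \<oplus>\<^bsub>TH\<^esub> l \<odot>\<^bsub>TH\<^esub> DY" .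
  have half: "(1/2) \<odot>\<^bsub>TH\<^esub> pt hy hy \<oplus>\<^bsub>TH\<^esub> (1/2) \<odot>\<^bsub>TH\<^esub> pt hy hy = pt hy hy"
    by (simp add: HH.T.smult_l_distr[symmetric])
  have "(1/2) \<odot>\<^bsub>TH\<^esub> (DY \<otimes>\<^bsub>TH\<^esub> DY) = (1/2) \<odot>\<^bsub>TH\<^esub> pt (hy \<cdot> hy) oneH \<oplus>\<^bsub>TH\<^esub> (1/2) \<odot>\<^bsub>TH\<^esub> pt oneH (hy \<cdot> hy)
     \<oplus>\<^bsub>TH\<^esub> ((1/2) \<odot>\<^bsub>TH\<^esub> pt hy hy \<oplus>\<^bsub>TH\<^esub> (1/2) \<odot>\<^bsub>TH\<^esub> pt hy hy)"
    by (simp add: DY_def tensor_expand HH.T.a_ac)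
  then have "(1/2) \<odot>\<^bsub>TH\<^esub> (DY \<otimes>\<^bsub>TH\<^esub> DY) = (1/2) \<odot>\<^bsub>TH\<^esub> pt (hy \<cdot> hy) oneH \<oplus>\<^bsub>TH\<^esub> (1/2) \<odot>\<^bsub>TH\<^esub> pt oneH (hy \<cdot> hy) \<oplus>\<^bsub>TH\<^esub> pt hy hy"
    unfolding half .
  then show "DZ \<otimes>\<^bsub>TH\<^esub> DY = DY \<otimes>\<^bsub>TH\<^esub> DZ \<oplus>\<^bsub>TH\<^esub> (1/2) \<odot>\<^bsub>TH\<^esub> (DY \<otimes>\<^bsub>TH\<^esub> DY)"
    by (simp add: DY_def DZ_def tensor_expand B_alg_relations(1,3) HH.T.a_ac)
qed

definition DeltaF :: "('k, B_gen) free_alg \<Rightarrow> ('k B_elem \<times> 'k B_elem \<Rightarrow>\<^sub>0 'k) set"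
  where "DeltaF = free_eval TH (B_comult_gen l)"

lemma DeltaF_hom: "alg_hom free_algebra TH DeltaF"
  unfolding DeltaF_def by (rule HH.T.free_eval_hom) simp

lemma DeltaF_relI: assumes "p \<in> relI l" shows "DeltaF p = \<zero>\<^bsub>TH\<^esub>"
proof -
  note k = F.k_algebra_axioms HH.T.k_algebra_axioms DeltaF_hom
  note h = alg_homD[OF DeltaF_hom, unfolded free_algebra_eq, simplified]
  have g: "DeltaF (gen g) = B_comult_gen l g" for g
    unfolding DeltaF_def by (rule HH.T.free_eval_gen) simp
  have cc: "DeltaF (const c * p) = c \<odot>\<^bsub>TH\<^esub> DeltaF p" for c p
    using alg_homD(5)[OF DeltaF_hom, of p c] by (simp add: free_algebra_eq)
  have diff: "DeltaF (p - q) = \<zero>\<^bsub>TH\<^esub>" if "DeltaF p = DeltaF q" for p q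
    using alg_hom_minus[OF k, of p q] that h(1)[of q] by (simp add: free_algebra_eq)
  have 1: "DeltaF (gen GX * gen GY - gen GY * gen GX - gen GY) = \<zero>\<^bsub>TH\<^esub>"
  proof -
    have "DeltaF (gen GX * gen GY) = DeltaF (gen GY * gen GX + gen GY)"
      by (simp only: h g comult_relations)
    then show ?thesis using diff by (simp add: diff_diff_eq)
  qed
  have 2: "DeltaF (gen GZ * gen GX - gen GX * gen GZ - (- gen GZ + const l * gen GY)) = \<zero>\<^bsub>TH\<^esub>"
  proof -
    have "DeltaF (gen GZ * gen GX + gen GZ) = DeltaF (gen GX * gen GZ + const l * gen GY)"
      by (simp only: h(1,3) h(4)[of "gen GX"] h(4)[of "gen GY"] h(4)[of "gen GZ"] cc g comult_relations)
    then have "DeltaF ((gen GZ * gen GX + gen GZ) - (gen GX * gen GZ + const l * gen GY)) = \<zero>\<^bsub>TH\<^esub>"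
      by (rule diff)
    then show ?thesis by (simp add: algebra_simps)
  qed
  have 3: "DeltaF (gen GZ * gen GY - gen GY * gen GZ - const (1/2) * (gen GY * gen GY)) = \<zero>\<^bsub>TH\<^esub>"
  proof -
    have "DeltaF (gen GZ * gen GY) = DeltaF (gen GY * gen GZ + const (1/2) * (gen GY * gen GY))"
      by (simp only: h(1,3) h(4)[of "gen GX"] h(4)[of "gen GY"] h(4)[of "gen GZ"] cc g comult_relations)
    then show ?thesis using diff by (simp add: diff_diff_eq)
  qed
  have "relI l \<subseteq> {p \<in> carrier free_algebra. DeltaF p = \<zero>\<^bsub>TH\<^esub>}"
    by (rule F.genideal_minimal[OF alg_hom_kernel_ideal[OF k]])
      (use 1 2 3 in \<open>simp add: B_rels_def free_algebra_eq\<close>)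
  then show ?thesis using assms by auto
qed

text \<open>\<open>B_comult\<close> takes \<open>the_elem\<close> of the image of a coset; this
  image is a singleton because \<open>DeltaF\<close> kills the relations.\<close>

lemma comult_coset: "B_comult l (relI l +>\<^bsub>free_algebra\<^esub> p) = DeltaF p"
proof -
  have eq: "DeltaF q = DeltaF p" if "q - p \<in> relI l" for q
  proof -
    have "DeltaF ((q - p) + p) = DeltaF (q - p) \<oplus>\<^bsub>TH\<^esub> DeltaF p"
      using alg_homD(3)[OF DeltaF_hom, of "q - p" p] by (simp add: free_algebra_eq)
    then show ?thesis
      using DeltaF_relI[OF that] alg_homD(1)[OF DeltaF_hom, of p] by (simp add: free_algebra_eq)
  qed
  have "p \<in> relI l +>\<^bsub>free_algebra\<^esub> p" by (simp add: coset_mem relI_zero)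
  moreover have "DeltaF q \<in> {DeltaF p}" if "q \<in> relI l +>\<^bsub>free_algebra\<^esub> p" for q
    using eq[OF that[unfolded coset_mem]] by blast
  ultimately have "DeltaF ` (relI l +>\<^bsub>free_algebra\<^esub> p) = {DeltaF p}" by blast
  then show ?thesis by (simp add: B_comult_def DeltaF_def)
qed

lemma comult_hom: "alg_hom (B_alg l) TH (B_comult l)"
proof -
  note h = alg_homD[OF DeltaF_hom] alg_homD(2-5)[OF coset_hom_B[of l], symmetric]
  have c: "p \<in> carrier free_algebra" for p :: "('k, B_gen) free_alg" by (simp add: free_algebra_eq)
  show ?thesis
    using h c unfolding alg_hom_def B_alg_carrier by (auto simp: comult_coset)
qed

lemma comult_gen: "B_comult l (B_of l g) = B_comult_gen l g"
  by (simp add: B_of_eq comult_coset DeltaF_def HH.T.free_eval_gen)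

text \<open>The preimage of the subalgebra \<open>A \<otimes> H\<close> under the homomorphism
  \<open>\<Delta>\<close> is a subalgebra, so the coideal condition need only be tested on
  generators.\<close>

lemma right_coideal_subalgebraI:
  assumes "S \<subseteq> carrier (B_alg l)"
    "\<And>s. s \<in> S \<Longrightarrow> B_comult l s \<in> tensor_sub (B_alg l) (B_alg l) (alg_gen (B_alg l) S) (carrier (B_alg l))"
  shows "right_coideal_subalgebra (B_alg l) (B_comult l) (alg_gen (B_alg l) S)"
proof -
  let ?A = "alg_gen (B_alg l) S" and ?C = "carrier (B_alg l)"
  have A: "is_subalgebra (B_alg l) ?A" by (rule H.alg_gen_subalgebra[OF assms(1)])
  have "is_subalgebra TH (tensor_sub (B_alg l) (B_alg l) ?A ?C)"
    by (rule HH.tensor_sub_subalgebra[OF A H.carrier_subalgebra])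
  then have "is_subalgebra (B_alg l) {a \<in> ?C. B_comult l a \<in> tensor_sub (B_alg l) (B_alg l) ?A ?C}"
    by (rule alg_hom_vimage_subalgebra[OF H.k_algebra_axioms HH.T.k_algebra_axioms comult_hom])
  then have "?A \<subseteq> {a \<in> ?C. B_comult l a \<in> tensor_sub (B_alg l) (B_alg l) ?A ?C}"
    by (rule H.alg_gen_minimal) (use assms in auto)
  then show ?thesis using A by (auto simp: right_coideal_subalgebra_def)
qed

section \<open>Operators preserving right coideals\<close>

text \<open>
  \<open>RX\<close>, \<open>RY\<close>, \<open>RZ\<close> make the span of \<open>1, t, \<dots>, t^4\<close> an \<open>H\<close>-module. On its tensor product with the
  regular representation \<open>h\<close> acts through \<open>\<Delta> h\<close>, so the coefficients of \<open>\<Delta> h \<cdot> (t^2 + t^4)\<close> lie in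
  every right coideal subalgebra containing \<open>h\<close>.
\<close>

definition RX :: "'k polW \<Rightarrow> 'k polW"
  where "RX w = [:coeff w 0 - smult [:[:l:]:] (coeff w 1), coeff w 1, 0, coeff w 2, - coeff w 4:]"
definition RY :: "'k polW \<Rightarrow> 'k polW" where "RY w = [:coeff w 2:]"
definition RZ :: "'k polW \<Rightarrow> 'k polW" where "RZ w = [:0, coeff w 2:]"

fun Rg :: "B_gen \<Rightarrow> 'k polW \<Rightarrow> 'k polW" where "Rg GX = RX" | "Rg GY = RY" | "Rg GZ = RZ"

definition Rop :: "B_gen \<Rightarrow> 'k lend" where "Rop g = Lend (Rg g)"

lemma app_Rop [simp]: "app (Rop g) = Rg g"
proof -
  have "Rg g \<in> {f. (\<forall>v w. f (v + w) = f v + f w) \<and> (\<forall>c w. f (smult (cst c) w) = smult (cst c) (f w))}"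
    by (cases g) (simp_all add: RX_def RY_def RZ_def smult_add_right smult_diff_right mult.commute)
  then show ?thesis by (simp add: Rop_def Lend_inverse)
qed

text \<open>The matrices are forced by a small choice. Let \<open>X\<close>, \<open>Y\<close>,
  \<open>Z\<close> send \<open>t^2\<close> to \<open>t^3\<close>, \<open>1\<close>,
  \<open>t\<close>, and let all three kill \<open>t^3\<close>. Then \<open>[X, Y] = Y\<close>
  requires \<open>X\<close> to fix \<open>1\<close>, and \<open>[Z, X] = - Z + \<lambda> Y\<close>
  requires \<open>X\<close> to send \<open>t\<close> to \<open>t - \<lambda>\<close>. The summand of
  \<open>t^4\<close> is the character with \<open>X \<mapsto> -1\<close> and
  \<open>Y, Z \<mapsto> 0\<close>.\<close>

lemma B_relations_Rop: "B_relations l Rop"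
  unfolding B_relations_def
  by (intro conjI; rule lend_eqI) (simp_all add: RX_def RY_def RZ_def eval_nat_numeral)

lemma act_linear: "act l p (m + n) = act l p m + act l p n"
  "act l p (smult [:[:c:]:] m) = smult [:[:c:]:] (act l p m)" "act l p 0 = 0"
proof -
  show 1: "act l p (m + n) = act l p m + act l p n" for m n
    using app_add[of "rep l p" "[:m:]" "[:n:]"] by (simp add: act_def)
  show "act l p (smult [:[:c:]:] m) = smult [:[:c:]:] (act l p m)"
    using app_smult[of "rep l p" c "[:m:]"] by (simp add: act_def)
  show "act l p 0 = 0" by (simp add: act_def)
qed

lemma act_minus: "act l p (- m) = - act l p m" "act l p (m - n) = act l p m - act l p n"
proof -
  show 1: "act l p (- m) = - act l p m" for m
    using act_linear(1)[of p m "- m"] act_linear(3) by (simp add: eq_neg_iff_add_eq_0 add.commute)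
  show "act l p (m - n) = act l p m - act l p n"
    using act_linear(1)[of p m "- n"] 1 by simp
qed

text \<open>One operator acts on the coefficients of \<open>t\<close>, the other permutes and scales
  powers of \<open>t\<close> with entries in \<open>k\<close>.\<close>

lemma rep_Rop_commute: "rep l p * Rop g = Rop g * rep l p"
proof (rule lend_eqI, rule poly_eqI)
  fix w n
  show "coeff (app (rep l p * Rop g) w) n = coeff (app (Rop g * rep l p) w) n"
    by (cases g) (simp_all add: coeff_rep RX_def RY_def RZ_def coeff_pCons act_linear act_minus
        del: One_nat_def split: nat.split)
qed

definition rho :: "'k B_elem \<Rightarrow> 'k lend"
  where "rho = (SOME h. alg_hom (B_alg l) (type_alg scl) h \<and> (\<forall>g. h (B_of l g) = Rop g))"

lemma rho_hom: "alg_hom (B_alg l) (type_alg scl) rho" and rho_of: "rho (B_of l g) = Rop g"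
proof -
  define P where "P h \<longleftrightarrow> alg_hom (B_alg l) (type_alg scl) h \<and> (\<forall>g. h (B_of l g) = Rop g)" for h
  have "\<exists>h. P h" using B_hom_ext[OF B_relations_Rop] unfolding P_def by blast
  then have "P (SOME h. P h)" by (metis someI_ex)
  moreover have "rho = (SOME h. P h)" unfolding rho_def P_def ..
  ultimately have "P rho" by metis
  then show "alg_hom (B_alg l) (type_alg scl) rho" "rho (B_of l g) = Rop g"
    unfolding P_def by auto
qed

lemmas rho_simps = alg_homD[OF rho_hom, simplified]

lemma rho_induct:
  assumes "h \<in> carrier (B_alg l)" "P 1" "\<And>g. P (Rop g)" "\<And>f f'. P f \<Longrightarrow> P f' \<Longrightarrow> P (f + f')"
    "\<And>f f'. P f \<Longrightarrow> P f' \<Longrightarrow> P (f * f')" "\<And>c f. P f \<Longrightarrow> P (scl c * f)"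
  shows "P (rho h)"
proof -
  have "{h \<in> carrier (B_alg l). P (rho h)} = carrier (B_alg l)"
    by (rule B_alg_generated) (auto simp: H.subalgebra_iff rho_simps rho_of assms(2-))
  then show ?thesis using assms(1) by auto
qed

lemma repr_rho_commute:
  assumes "a \<in> carrier (B_alg l)" "b \<in> carrier (B_alg l)"
  shows "repr l a * rho b = rho b * repr l a"
proof -
  obtain p where p: "repr l a = rep l p" using assms(1) by (auto simp: B_alg_carrier repr_coset)
  show ?thesis unfolding p
  proof (rule rho_induct[OF assms(2)])
    show "rep l p * (f * f') = f * f' * rep l p"
      if "rep l p * f = f * rep l p" "rep l p * f' = f' * rep l p" for f f'
      by (metis that mult.assoc)
    show "rep l p * (scl c * f) = scl c * f * rep l p" if "rep l p * f = f * rep l p" for c f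
      by (metis that mult.assoc scl.\<iota>_left_commute)
  qed (simp_all add: rep_Rop_commute distrib_left distrib_right)
qed

text \<open>Lets an abstract tensor act on \<open>M[t]\<close>, the first factor on coefficients and
  the second on powers of \<open>t\<close>; it exists since the two actions commute.\<close>

definition Lam :: "('k B_elem \<times> 'k B_elem \<Rightarrow>\<^sub>0 'k) set \<Rightarrow> 'k lend"
  where "Lam = (SOME h. alg_hom TH (type_alg scl) h \<and>
    (\<forall>a\<in>carrier (B_alg l). \<forall>b\<in>carrier (B_alg l). h (pt a b) = repr l a * rho b))"

lemma Lam_hom: "alg_hom TH (type_alg scl) Lam"
  and Lam_pure: "a \<in> carrier (B_alg l) \<Longrightarrow> b \<in> carrier (B_alg l) \<Longrightarrow> Lam (pt a b) = repr l a * rho b"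
proof -
  define P where "P h \<longleftrightarrow> alg_hom TH (type_alg scl) h \<and>
    (\<forall>a\<in>carrier (B_alg l). \<forall>b\<in>carrier (B_alg l). h (pt a b) = repr l a * rho b)" for h
  obtain h where "alg_hom TH (type_alg scl) h"
    "\<And>a b. a \<in> carrier (B_alg l) \<Longrightarrow> b \<in> carrier (B_alg l) \<Longrightarrow> h (pt a b) = repr l a * rho b"
    using HH.tensor_type_hom[OF scl.scalar_map_axioms repr_hom rho_hom repr_rho_commute] by metis
  then have "P h" by (auto simp: P_def)
  then have "P (SOME h. P h)" by (metis someI_ex)
  moreover have "Lam = (SOME h. P h)" unfolding Lam_def P_def ..
  ultimately have "P Lam" by metis
  then show "alg_hom TH (type_alg scl) Lam"
    "a \<in> carrier (B_alg l) \<Longrightarrow> b \<in> carrier (B_alg l) \<Longrightarrow> Lam (pt a b) = repr l a * rho b"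
    unfolding P_def by auto
qed

lemmas Lam_simps = alg_homD[OF Lam_hom, simplified]

text \<open>\<open>t^2\<close> generates the summand whose matrix coefficients are the counit and
  the functionals for \<open>X\<close>, \<open>Y\<close>, \<open>Z\<close>; \<open>t^4\<close> adds
  the character. One vector serves both.\<close>

definition evec :: "'k polW" where "evec = [:0, 0, 1, 0, 1:]"

text \<open>The coefficients are values of functionals, that is, scalars of \<open>k\<close> and not
  just elements of \<open>M\<close>. Pairing the second tensor factor with them therefore does not
  leave \<open>A\<close>.\<close>

lemma rho_evec: assumes "h \<in> carrier (B_alg l)" shows "\<exists>c. coeff (app (rho h) evec) n = cst c"
proof -
  have "\<forall>w. (\<forall>n. \<exists>c. coeff w n = cst c) \<longrightarrow> (\<forall>n. \<exists>c. coeff (app (rho h) w) n = cst c)"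
  proof (rule rho_induct[OF assms])
    fix g
    have neg: "\<exists>d. - cst c = cst d" and add: "\<exists>d. cst c + cst c' = cst d" and dif: "\<exists>d. cst c - cst c' = cst d"
      and zero: "\<exists>d. 0 = cst d" for c c' :: 'k
      by (rule exI[of _ "- c"], simp, rule exI[of _ "c + c'"], simp, rule exI[of _ "c - c'"], simp, rule exI[of _ 0], simp)
    show "\<forall>w. (\<forall>n. \<exists>c. coeff w n = cst c) \<longrightarrow> (\<forall>n. \<exists>c. coeff (app (Rop g) w) n = cst c)"
    proof (intro allI impI)
      fix w :: "'k polW" and n assume w: "\<forall>n. \<exists>c. coeff w n = cst c"
      obtain c0 c1 c2 c4 where c: "coeff w 0 = cst c0" "coeff w 1 = cst c1" "coeff w 2 = cst c2" "coeff w 4 = cst c4"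
        using w by metis
      show "\<exists>c. coeff (app (Rop g) w) n = cst c"
        by (cases g)
          (use neg add dif zero in \<open>auto simp: RX_def RY_def RZ_def c coeff_pCons simp del: One_nat_def split: nat.split\<close>)
    qed
  next
    fix f f' :: "'k lend"
    assume f: "\<forall>w. (\<forall>n. \<exists>c. coeff w n = cst c) \<longrightarrow> (\<forall>n. \<exists>c. coeff (app f w) n = cst c)"
      and f': "\<forall>w. (\<forall>n. \<exists>c. coeff w n = cst c) \<longrightarrow> (\<forall>n. \<exists>c. coeff (app f' w) n = cst c)"
    show "\<forall>w. (\<forall>n. \<exists>c. coeff w n = cst c) \<longrightarrow> (\<forall>n. \<exists>c. coeff (app (f + f') w) n = cst c)"
    proof (intro allI impI)
      fix w :: "'k polW" and n assume w: "\<forall>n. \<exists>c. coeff w n = cst c"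
      then obtain c d where "coeff (app f w) n = cst c" "coeff (app f' w) n = cst d" using f f' by metis
      then show "\<exists>c. coeff (app (f + f') w) n = cst c" by (intro exI[of _ "c + d"]) simp
    qed
    show "\<forall>w. (\<forall>n. \<exists>c. coeff w n = cst c) \<longrightarrow> (\<forall>n. \<exists>c. coeff (app (f * f') w) n = cst c)"
      using f f' by simp
  next
    fix c and f :: "'k lend"
    assume f: "\<forall>w. (\<forall>n. \<exists>c. coeff w n = cst c) \<longrightarrow> (\<forall>n. \<exists>c. coeff (app f w) n = cst c)"
    show "\<forall>w. (\<forall>n. \<exists>c. coeff w n = cst c) \<longrightarrow> (\<forall>n. \<exists>d. coeff (app (scl c * f) w) n = cst d)"
    proof (intro allI impI)
      fix w :: "'k polW" and n assume w: "\<forall>n. \<exists>c. coeff w n = cst c"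
      then obtain d where "coeff (app f w) n = cst d" using f by metis
      then show "\<exists>d. coeff (app (scl c * f) w) n = cst d" by (intro exI[of _ "c * d"]) simp
    qed
  qed simp
  moreover have "\<exists>c. coeff evec n = cst c" for n
    by (auto simp: evec_def coeff_pCons one_pCons intro: exI[of _ 0] exI[of _ 1] split: nat.split)
  ultimately show ?thesis by blast
qed

definition crd :: "'k B_elem set \<Rightarrow> 'k polM set" where "crd A = (\<lambda>h. coord (repr l h)) ` A"

lemma coord_add: "coord (f + g) = coord f + coord g" and coord_scl: "coord (scl c * f) = smult [:[:c:]:] (coord f)"
  and coord_zero: "coord 0 = 0"
  by (simp_all add: coord_def)

text \<open>On a pure tensor of \<open>a\<close> and \<open>b\<close> the coefficient is a scalar
  multiple of the coordinates of \<open>a\<close>; linearity does the rest.\<close>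

lemma tensor_sub_crd:
  assumes "is_subalgebra (B_alg l) A" "t \<in> tensor_sub (B_alg l) (B_alg l) A (carrier (B_alg l))"
  shows "coeff (app (Lam t) evec) n \<in> crd A"
proof -
  have A: "A \<subseteq> carrier (B_alg l)" "\<one>\<^bsub>B_alg l\<^esub> \<in> A" "\<And>x y. x \<in> A \<Longrightarrow> y \<in> A \<Longrightarrow> x \<boxplus> y \<in> A" "\<And>c x. x \<in> A \<Longrightarrow> c \<bullet> x \<in> A"
    using assms(1) by (auto simp: H.subalgebra_iff)
  have add: "u + v \<in> crd A" if uv: "u \<in> crd A" "v \<in> crd A" for u v
  proof -
    obtain a b where "a \<in> A" "b \<in> A" "u = coord (repr l a)" "v = coord (repr l b)" using uv by (auto simp: crd_def)
    then have "u + v = coord (repr l (a \<boxplus> b))" "a \<boxplus> b \<in> A" using A by (auto simp: repr_simps coord_add subset_iff)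
    then show ?thesis by (auto simp: crd_def)
  qed
  have scale: "smult [:[:c:]:] u \<in> crd A" if u: "u \<in> crd A" for c u
  proof -
    obtain a where "a \<in> A" "u = coord (repr l a)" using u by (auto simp: crd_def)
    then have "smult [:[:c:]:] u = coord (repr l (c \<bullet> a))" "c \<bullet> a \<in> A" using A by (auto simp: repr_simps coord_scl subset_iff)
    then show ?thesis by (auto simp: crd_def)
  qed
  let ?S = "{pt v w | v w. v \<in> A \<and> w \<in> carrier (B_alg l)}"
  have S: "?S \<subseteq> carrier TH" using A by (auto intro!: HH.pure_closed)
  have C: "x \<in> carrier TH" if "x \<in> lin_span TH ?S" for x using that HH.T.lin_span_carrier[OF S] by auto
  have zero: "0 \<in> crd A" using scale[of "coord (repr l (\<one>\<^bsub>B_alg l\<^esub>))" 0] A(2) by (auto simp: crd_def)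
  show ?thesis using assms(2)[unfolded tensor_sub_def] S
  proof (induction t rule: HH.T.lin_span_induct)
    case zero
    have "Lam \<zero>\<^bsub>TH\<^esub> = 0" using alg_hom_zero[OF HH.T.k_algebra_axioms scl.ta.k_algebra_axioms Lam_hom] by simp
    then show ?case using \<open>0 \<in> crd A\<close> by simp
  next
    case (base s)
    then obtain v w where s: "s = pt v w" "v \<in> A" "w \<in> carrier (B_alg l)" by auto
    obtain c where c: "coeff (app (rho w) evec) n = cst c" using rho_evec[OF s(3)] by auto
    obtain p where p: "repr l v = rep l p" using A(1) s(2) by (auto simp: B_alg_carrier repr_coset)
    have "coeff (app (Lam s) evec) n = act l p (cst c)"
      using s A(1) by (auto simp: Lam_pure subset_iff p coeff_rep c)
    also have "\<dots> = smult [:[:c:]:] (act l p 1)"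
      using act_linear(2)[of p c 1] by (simp add: one_pCons)
    also have "act l p 1 = coord (repr l v)" by (simp add: p act_def coord_def one_pCons)
    finally show ?case using scale s(2) by (auto simp: crd_def)
  next
    case (add x y)
    then show ?case using C \<open>\<And>u v. u \<in> crd A \<Longrightarrow> v \<in> crd A \<Longrightarrow> u + v \<in> crd A\<close> by (simp add: Lam_simps)
  next
    case (smult c x)
    then show ?case using C scale by (simp add: Lam_simps)
  qed
qed

text \<open>Defined on the free algebra rather than on \<open>H\<close>, to make induction over
  words available.\<close>

definition DF :: "('k, B_gen) free_alg \<Rightarrow> 'k lend" where "DF p = Lam (DeltaF p)"

lemma DF_hom: "alg_hom free_algebra (type_alg scl) DF"
  unfolding DF_def by (rule alg_hom_comp[OF DeltaF_hom Lam_hom])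

lemma DF_simps [simp]: "DF 1 = 1" "DF (p + q) = DF p + DF q" "DF (p * q) = DF p * DF q" "DF (const c) = scl c"
  "DF (gen GX) = Lop l GX + Rop GX" "DF (gen GY) = Lop l GY + Rop GY"
  "DF (gen GZ) = Lop l GZ + Rop GZ + Lop l GX * Rop GY"
proof -
  have "DF (const c * p) = scl c * DF p" for p
    using alg_homD(5)[OF DF_hom, of p c] by (simp add: free_algebra_eq)
  from this[of 1] show "DF (const c) = scl c"
    using DF_hom by (simp add: alg_hom_def free_algebra_eq)
  have "DF (gen g) = Lam (B_comult_gen l g)" for g
    by (simp add: DF_def DeltaF_def HH.T.free_eval_gen)
  then show "DF (gen GX) = Lop l GX + Rop GX" "DF (gen GY) = Lop l GY + Rop GY"
    "DF (gen GZ) = Lop l GZ + Rop GZ + Lop l GX * Rop GY"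
    by (simp_all add: Lam_simps Lam_pure rho_of rho_simps repr_simps)
qed (use DF_hom in \<open>auto simp: alg_hom_def free_algebra_eq\<close>)

end

section \<open>Derivatives and shifts against the regular representation\<close>

lemma dY_1 [simp]: "dY 1 = 0"
  by (simp add: one_pCons)

definition dXM :: "'k::field_char_0 polM \<Rightarrow> 'k polM" where "dXM = map_poly pderiv"
definition shM :: "'k::field_char_0 \<Rightarrow> 'k polM \<Rightarrow> 'k polM" where "shM c = map_poly (shX c)"

lemma coeff_dXM [simp]: "coeff (dXM m) n = pderiv (coeff m n)"
  and coeff_shM [simp]: "coeff (shM c m) n = shX c (coeff m n)"
  by (simp_all add: dXM_def shM_def coeff_map_poly)

lemma shX_lx_gen: "shX c (lx q) = lx (shX c q) + [:[:c:]:] * shX c q"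
  by (simp only: lx_def shX_mult shX_add shX_const shX_vX dY_shX) (simp only: algebra_simps)

lemma shX_lz: "shX c (lz l q) = lz l (shX c q)"
  by (simp only: lz_def shX_mult shX_add shX_const dY_shX pderiv_shX)

lemma pderiv_lx: "pderiv (lx q) = lx (pderiv q) + q"
  by (simp only: lx_def pderiv_add pderiv_mult pderiv_vY dY_pderiv) (simp add: algebra_simps del: mult_pCons_left mult_pCons_right)

lemma pderiv_ly: "pderiv (ly q) = ly (pderiv q)"
  by (simp only: ly_def pderiv_mult pderiv_vY) simp

lemma pderiv_lz: "pderiv (lz l q) = lz l (pderiv q)"
  by (simp only: lz_def pderiv_add pderiv_mult pderiv_cst dY_pderiv) simp

lemma of_nat_poly: "(of_nat n :: 'k::field_char_0 poly poly) = [:[:of_nat n:]:]"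
  by (simp add: of_nat_poly)

lemma of_nat_L: "lx (of_nat n * q) = of_nat n * lx q" "ly (of_nat n * q) = of_nat n * ly q"
  "lz l (of_nat n * q) = of_nat n * lz l q" "shX c (of_nat n * q) = of_nat n * shX c q"
  by (simp_all add: of_nat_poly lx_scale ly_scale lz_scale shX_scale)

lemma dXM_L: "dXM (LX m) = LX (dXM m) + m" "dXM (LY m) = LY (dXM m)" "dXM (LZ l m) = LZ l (dXM m)"
  by (rule poly_eqI; simp add: pderiv_lx pderiv_ly pderiv_lz pderiv_add pderiv_shX split: nat.split)+

lemma shM_L: "shM c (LX m) = LX (shM c m) + smult [:[:c:]:] (shM c m)" "shM c (LY m) = LY (shM c m)"
  "shM c (LZ l m) = LZ l (shM c m)"
  by (rule poly_eqI; simp add: shX_lx_gen shX_ly shX_lz shX_add shX_shX add.commute split: nat.split)+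

lemma shM_LX: "shM 1 (LX m) = LX (shM 1 m) + shM 1 m" "shM (- 1) (LX m) = LX (shM (- 1) m) - shM (- 1) m"
proof -
  have "[:[:1:]:] = (1 :: 'a poly poly)" "[:[:- 1:]:] = (- 1 :: 'a poly poly)" by (simp_all add: one_pCons)
  then show "shM 1 (LX m) = LX (shM 1 m) + shM 1 m" "shM (- 1) (LX m) = LX (shM (- 1) m) - shM (- 1) m"
    by (simp_all add: shM_L)
qed

lemma pderiv_L: "pderiv (LX m) = LX (pderiv m)" "pderiv (LY m) = LY (pderiv m)"
  by (rule poly_eqI; simp add: coeff_pderiv of_nat_L del: of_nat_Suc)+

text \<open>Differentiating the new factor \<open>Z\<close> leaves the shifted polynomial. This
  shift is the source of the twist by \<open>shM 1\<close> in the pairing with the functional dual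
  to \<open>Z\<close>.\<close>

lemma pderiv_LZ: "pderiv (LZ l m) = LZ l (pderiv m) + shM (- 1) m"
proof (rule poly_eqI)
  fix n
  show "coeff (pderiv (LZ l m)) n = coeff (LZ l (pderiv m) + shM (- 1) m) n"
    by (cases n) (simp_all add: coeff_pderiv of_nat_L algebra_simps del: of_nat_Suc,
      simp_all add: algebra_simps lz_add shX_add)
qed

lemma shM_add: "shM c (m + n) = shM c m + shM c n"
  by (rule poly_eqI) (simp add: shX_add)

lemma shM_shM: "shM c (shM d m) = shM (c + d) m"
  by (rule poly_eqI) (simp add: shX_shX)

lemma shM_zero [simp]: "shM 0 m = m"
  by (rule poly_eqI) simp

lemma dXM_lin: "dXM (m + n) = dXM m + dXM n" "dXM (smult [:[:c:]:] m) = smult [:[:c:]:] (dXM m)"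
  by (rule poly_eqI; simp add: pderiv_add pderiv_smult)+

lemma shM_smult: "shM c (smult [:[:d:]:] m) = smult [:[:d:]:] (shM c m)"
  by (rule poly_eqI) (simp add: shX_scale)

lemma shM_one: "shM c 1 = 1" and dXM_one: "dXM 1 = 0"
  by (simp_all add: one_pCons shM_def dXM_def map_poly_pCons pderiv_pCons)

context
  fixes l :: "'k::field_char_0"
begin

text \<open>Both sides transform in the same way under each generator, so induction over words
  suffices. Coefficient 2 pairs with the counit, 3 with the functional dual to \<open>X\<close>, 4
  with the character, 1 with the functional dual to \<open>Z\<close>; as \<open>X\<close> acts on
  \<open>t\<close> with eigenvalue 1, the last value comes out shifted. Coefficient 0, which sees
  \<open>Y\<close>, is treated separately below.\<close>

lemma DF_evec:
  fixes p :: "('k, B_gen) free_alg"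
  shows "coeff (app (DF l p) evec) 1 = shM 1 (pderiv (act l p 1)) \<and> coeff (app (DF l p) evec) 2 = act l p 1 \<and>
    coeff (app (DF l p) evec) 3 = dXM (act l p 1) \<and> coeff (app (DF l p) evec) 4 = shM (- 1) (act l p 1)"
proof (induction p rule: free_alg_induct)
  case one
  show ?case by (simp add: evec_def eval_nat_numeral shM_one dXM_one, simp add: one_pCons shM_def)
next
  case (gen g p)
  then show ?case
    by (cases g) (simp_all add: eval_nat_numeral RX_def RY_def RZ_def dXM_L shM_LX shM_L(2,3) pderiv_L pderiv_LZ shM_add shM_shM)
next
  case (add p q)
  then show ?case by (simp add: pderiv_add shM_add dXM_lin)
next
  case (scale c p)
  then show ?case by (simp add: pderiv_smult shM_smult dXM_lin)
qed

lemma LY_smult: "LY m = smult vY m"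
  by (rule poly_eqI) (simp add: ly_def)

text \<open>Each factor \<open>Y\<close> either multiplies or, through \<open>RY\<close>, moves
  coefficient 2 into coefficient 0; summing over the position of that factor gives the
  derivative.\<close>

lemma DF_liftY:
  "coeff (app (DF l (liftY r)) w) 0 = smult [:r:] (coeff w 0) + smult [:pderiv r:] (coeff w 2)"
proof (induction r arbitrary: w)
  case 0
  show ?case using DF_simps(4)[of l 0] by simp
next
  case (pCons a r)
  have c2: "coeff (app (DF l (gen GY)) w) 2 = smult vY (coeff w 2)"
    and c0: "coeff (app (DF l (gen GY)) w) 0 = smult vY (coeff w 0) + coeff w 2"
    by (simp_all add: RY_def LY_smult eval_nat_numeral)
  have e: "smult [:pCons a r:] u = smult [:[:a:]:] u + smult [:pCons 0 r:] u"
      "smult [:r + s:] u = smult [:r:] u + smult [:s:] u" for s and u :: "'k polM"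
    by (simp_all add: smult_add_left[symmetric])
  show ?case
    using pCons.IH[of "app (DF l (gen GY)) w"]
    by (simp del: DF_simps(5-) add: liftY_pCons c0 c2 pderiv_pCons smult_add_right e add_ac)
qed

lemma LX_smult: "(\<And>n. dY (coeff m n) = 0) \<Longrightarrow> LX m = smult vX m"
  by (rule poly_eqI) (simp add: lx_def)

lemma DF_liftB_pCons:
  "coeff (app (DF l (liftB (pCons r q))) w) 0 = smult [:r:] (coeff w 0) + smult [:pderiv r:] (coeff w 2)
    + coeff (app (DF l (liftB q)) (app (DF l (gen GX)) w)) 0"
  by (simp del: DF_simps(5-) add: liftB_pCons DF_liftY)

text \<open>The factors \<open>X\<close> act first. They keep coefficients 0 and 1 at zero and
  multiply coefficient 2, which is free of \<open>Y\<close>, by \<open>X\<close>. Only the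
  polynomials in \<open>Y\<close> applied afterwards feed coefficient 0.\<close>

lemma DF_liftB:
  assumes "coeff w 0 = 0" "coeff w 1 = 0" "\<And>n. dY (coeff (coeff w 2) n) = 0"
  shows "coeff (app (DF l (liftB q)) w) 0 = smult (dY q) (coeff w 2)"
  using assms
proof (induction q arbitrary: w)
  case 0
  show ?case using DF_simps(4)[of l 0] by simp
next
  case (pCons r q)
  let ?w = "app (DF l (gen GX)) w"
  have w: "coeff ?w 0 = 0" "coeff ?w 1 = 0" "coeff ?w 2 = smult vX (coeff w 2)"
    using pCons.prems LX_smult[of "coeff w 2"] by (simp_all add: RX_def eval_nat_numeral)
  have "coeff (app (DF l (liftB q)) ?w) 0 = smult (dY q) (coeff ?w 2)"
    by (rule pCons.IH) (use w pCons.prems in simp_all)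
  then show ?case
    using pCons.prems by (simp add: DF_liftB_pCons w smult_add_left[symmetric] del: DF_simps(5-))
qed

text \<open>The situation after a factor \<open>Z\<close> has acted: coefficients 0 and 1 are no
  longer zero, but they live in \<open>Z\<close>-degree 0. They can only disturb the unspecified
  \<open>r\<close>, not the coefficient of \<open>Z\<close>.\<close>

lemma DF_liftB_Z:
  assumes "coeff w 0 = [:g:]" "coeff w 1 = [:h:]" "coeff w 2 = [:0, f:]" "dY f = 0"
  shows "\<exists>r. coeff (app (DF l (liftB q)) w) 0 = [:r, dY q * f:]"
  using assms
proof (induction q arbitrary: w g h f)
  case 0
  show ?case using DF_simps(4)[of l 0] by (intro exI[of _ 0]) simp
next
  case (pCons r q)
  let ?w = "app (DF l (gen GX)) w"
  have w: "coeff ?w 0 = [:lx g + g - [:[:l:]:] * h:]" "coeff ?w 1 = [:lx h + h:]" "coeff ?w 2 = [:0, vX * f:]"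
    using pCons.prems by (simp_all add: RX_def L_pCons eval_nat_numeral, simp add: lx_def)
  have "dY (vX * f) = 0" by (simp add: pCons.prems)
  then obtain s where s: "coeff (app (DF l (liftB q)) ?w) 0 = [:s, dY q * (vX * f):]"
    using pCons.IH[OF w] by auto
  have "coeff (app (DF l (liftB (pCons r q))) w) 0 = [:[:r:] * g + s, dY (pCons r q) * f:]"
    by (simp add: DF_liftB_pCons s pCons.prems del: DF_simps(5-))
  then show ?case by blast
qed

interpretation H: k_algebra "B_alg l" by (rule B_alg_k_algebra)

lemma coset_lift: assumes "h \<in> carrier (B_alg l)" shows "h = relI l +>\<^bsub>free_algebra\<^esub> lift (coord (repr l h))"
proof -
  obtain p where p: "h = relI l +>\<^bsub>free_algebra\<^esub> p" using assms by (auto simp: B_alg_carrier)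
  have "repr l h = repr l (relI l +>\<^bsub>free_algebra\<^esub> lift (coord (repr l h)))"
    unfolding p repr_coset by (metis rep_eq_op op_def)
  then show ?thesis
    by (rule inj_onD[OF repr_inj]) (use assms in \<open>simp_all add: B_alg_carrier\<close>)
qed

lemma crd_coeff:
  assumes "right_coideal_subalgebra (B_alg l) (B_comult l) A" "m \<in> crd l A"
  shows "coeff (app (DF l (lift m)) evec) n \<in> crd l A"
proof -
  obtain h where h: "h \<in> A" "m = coord (repr l h)" using assms(2) by (auto simp: crd_def)
  have A: "is_subalgebra (B_alg l) A" using assms(1) by (simp add: right_coideal_subalgebra_def)
  then have "h \<in> carrier (B_alg l)" using h(1) by (auto simp: H.subalgebra_iff)
  from coset_lift[OF this] have "B_comult l h = DeltaF l (lift m)"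
    unfolding h(2) using comult_coset[of l "lift (coord (repr l h))"] by simp
  moreover have "B_comult l h \<in> tensor_sub (B_alg l) (B_alg l) A (carrier (B_alg l))"
    using assms(1) h(1) by (auto simp: right_coideal_subalgebra_def)
  ultimately show ?thesis using tensor_sub_crd[OF A] by (simp add: DF_def)
qed

theorem right_coideal_operators:
  assumes "right_coideal_subalgebra (B_alg l) (B_comult l) A"
  shows "m \<in> crd l A \<Longrightarrow> dXM m \<in> crd l A" "m \<in> crd l A \<Longrightarrow> pderiv m \<in> crd l A"
    "[:p:] \<in> crd l A \<Longrightarrow> [:dY p:] \<in> crd l A"
    "[:p, 1:] \<in> crd l A \<Longrightarrow> [:vX + dY p:] \<in> crd l A"
    "[:p, q:] \<in> crd l A \<Longrightarrow> \<exists>r. [:r, dY q:] \<in> crd l A"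
proof -
  note c = crd_coeff[OF assms]
  have ev: "coeff (app (DF l (lift m)) evec) 1 = shM 1 (pderiv m)" "coeff (app (DF l (lift m)) evec) 3 = dXM m"
    "coeff (app (DF l (lift m)) evec) 4 = shM (- 1) m" for m
    using DF_evec[of "lift m"] by (simp_all add: act_lift)
  show "m \<in> crd l A \<Longrightarrow> dXM m \<in> crd l A" using c[of m 3] ev by simp
  show "pderiv m \<in> crd l A" if m: "m \<in> crd l A" for m
  proof -
    \<comment> \<open>The coefficient at \<open>t\<close> is the derivative shifted by
      \<open>+1\<close>; a second pairing, with the character at \<open>t^4\<close>, shifts it
      back.\<close>
    have "shM 1 (pderiv m) \<in> crd l A" using c[OF m, of 1] unfolding ev(1) .
    then have "shM (- 1) (shM 1 (pderiv m)) \<in> crd l A" using c[of _ 4] unfolding ev(3) by blast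
    then show ?thesis by (simp add: shM_shM)
  qed
  have e: "coeff evec 0 = 0" "coeff evec 1 = 0" "coeff evec 2 = 1"
    by (simp_all add: evec_def eval_nat_numeral)
  have B: "coeff (app (DF l (liftB q)) evec) 0 = [:dY q:]" for q
  proof -
    have "dY (coeff (1 :: 'k polM) n) = 0" for n by (cases n) (simp_all add: one_pCons)
    then show ?thesis using DF_liftB[of evec q, OF e(1,2)] unfolding e(3) by simp
  qed
  have lift1: "lift [:p, q:] = liftB p + liftB q * gen GZ" for p q :: "'k poly poly"
    by (simp add: lift_pCons)
  \<comment> \<open>\<open>Z\<close> is the rightmost letter of \<open>liftB q * gen GZ\<close> and
    acts first. The \<open>X\<close> that appears in coefficient 0 of \<open>w\<close> is the trace
    of the summand \<open>X \<otimes> Y\<close> of \<open>\<Delta> Z\<close>.\<close>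
  define w where "w = app (DF l (gen GZ)) evec"
  have w: "coeff w 0 = [:vX:]" "coeff w 1 = [:1:]" "coeff w 2 = [:0, 1:]"
    by (simp_all add: w_def RZ_def RY_def e evec_def eval_nat_numeral)
      (simp_all add: one_pCons L_pCons lx_def lz_def pderiv_pCons)
  have D: "coeff (app (DF l (lift [:p, q:])) evec) 0 = [:dY p:] + coeff (app (DF l (liftB q)) w) 0" for p q
    by (simp del: DF_simps(5-) add: lift1 B w_def)
  show "[:p:] \<in> crd l A \<Longrightarrow> [:dY p:] \<in> crd l A"
    using c[of "[:p:]" 0] by (simp add: lift_pCons B)
  show "[:p, q:] \<in> crd l A \<Longrightarrow> \<exists>r. [:r, dY q:] \<in> crd l A"
  proof -
    assume pq: "[:p, q:] \<in> crd l A"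
    obtain r where "coeff (app (DF l (liftB q)) w) 0 = [:r, dY q * 1:]"
      using DF_liftB_Z[OF w, of q] by (metis dY_1)
    then show ?thesis using c[OF pq, of 0] unfolding D by auto
  qed
  have "liftB 1 = (1 :: ('k, B_gen) free_alg)" by (simp add: one_pCons liftB_pCons liftY_pCons)
  then show "[:p, 1:] \<in> crd l A \<Longrightarrow> [:vX + dY p:] \<in> crd l A"
    using c[of "[:p, 1:]" 0] unfolding D by (simp add: w add.commute)
qed

end

lemma evp_scl_commute: "evp scl u r * u = u * evp scl u r"
proof (induction r)
  case (pCons c r)
  have "evp scl u (pCons c r) * u = scl c * u + evp scl u r * u * u"
    by (simp add: evp_pCons distrib_right)
  also have "\<dots> = u * scl c + u * (evp scl u r * u)"
    using pCons.IH by (simp only: scl.\<iota>_central mult.assoc)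
  also have "\<dots> = u * evp scl u (pCons c r)"
    by (simp add: evp_pCons distrib_left)
  finally show ?case .
qed simp

section \<open>Classification of the stable subalgebras\<close>

context
  fixes l :: "'k::field_char_0"
begin

abbreviation "xo \<equiv> Lop l GX"
abbreviation "yo \<equiv> Lop l GY"
abbreviation "zo \<equiv> Lop l GZ"
abbreviation "EE \<equiv> range (rep l)"

lemma EE_subalgebra: "is_subalgebra (type_alg scl) EE"
proof -
  have "rep l p + rep l q \<in> EE" "rep l p * rep l q \<in> EE" "scl c * rep l p \<in> EE" "1 \<in> EE" for p q c
    by (metis rep_simps(3) rangeI, metis rep_simps(2) rangeI, metis rep_simps(5) rangeI, metis rep_simps(1) rangeI)
  then show ?thesis by (auto simp: scl.ta.subalgebra_iff)
qed

lemma EE_closed: "f \<in> EE \<Longrightarrow> g \<in> EE \<Longrightarrow> f + g \<in> EE" "f \<in> EE \<Longrightarrow> g \<in> EE \<Longrightarrow> f * g \<in> EE"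
  "f \<in> EE \<Longrightarrow> scl c * f \<in> EE" "1 \<in> EE" "f \<in> EE \<Longrightarrow> g \<in> EE \<Longrightarrow> f - g \<in> EE" "Lop l g' \<in> EE" "scl c \<in> EE"
proof -
  show "f \<in> EE \<Longrightarrow> g \<in> EE \<Longrightarrow> f - g \<in> EE" for f g
    using scl.ta.subalgebra_minus[OF EE_subalgebra, of f g] by simp
  show 1: "f \<in> EE \<Longrightarrow> scl c * f \<in> EE" for f c using EE_subalgebra by (auto simp: scl.ta.subalgebra_iff)
  show 2: "1 \<in> EE" using EE_subalgebra by (auto simp: scl.ta.subalgebra_iff)
  show "scl c \<in> EE" using 1[OF 2, of c] by simp
  show "Lop l g' \<in> EE" by (metis rep_simps(4) rangeI)
qed (use EE_subalgebra in \<open>auto simp: scl.ta.subalgebra_iff\<close>)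

lemma EE_eq_op: "f \<in> EE \<Longrightarrow> f = op l (coord f)"
  using rep_eq_op by auto

lemma op_EE [simp]: "op l m \<in> EE" by (simp add: op_def)

lemma EE_eqI: "f \<in> EE \<Longrightarrow> g \<in> EE \<Longrightarrow> coord f = coord g \<Longrightarrow> f = g"
  using EE_eq_op by metis

lemma coord_simps [simp]:
  fixes f g :: "'k lend" and c :: 'k
  shows "coord (f + g) = coord f + coord g" "coord (f - g) = coord f - coord g" "coord (scl c * f) = smult [:[:c:]:] (coord f)"
  "coord (Lop l g' * f) = Lg l g' (coord f)" "coord (1 :: 'k lend) = 1" "coord (0 :: 'k lend) = 0"
  "coord (- f) = - coord f"
  by (simp_all add: coord_def)

lemma coord_scl1 [simp]: "coord (scl (c :: 'k)) = cst c"
  using coord_simps(3)[of c 1] by simp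

lemma op_add: "op l (m + n) = op l m + op l n"
  by (rule EE_eqI) (auto intro: EE_closed)
lemma op_scale: "op l (smult [:[:c:]:] m) = scl c * op l m"
  by (rule EE_eqI) (auto intro: EE_closed)

lemma coord_Lop [simp]: "coord xo = [:vX:]" "coord yo = [:vY:]" "coord zo = [:0, 1:]"
proof -
  have "coord (Lop l g) = Lg l g 1" for g using coord_simps(4)[of g 1] by simp
  then show "coord xo = [:vX:]" "coord yo = [:vY:]" "coord zo = [:0, 1:]"
    by (simp_all add: one_pCons L_pCons lx_def ly_def lz_def pderiv_pCons)
qed

text \<open>The product in \<open>H\<close> of two elements of \<open>k[Y][X]\<close>, brought to
  normal form. It agrees with the commutative product when \<open>b\<close> is free of
  \<open>Y\<close>.\<close>

definition actB :: "'k poly poly \<Rightarrow> 'k poly poly \<Rightarrow> 'k poly poly"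
  where "actB q b = coeff (act l (liftB q) [:b:]) 0"

lemma actB_pCons: "actB (pCons r q) b = [:r:] * b + actB q (lx b)"
  by (simp add: actB_def liftB_pCons act_liftY L_pCons)

lemma actB_0 [simp]: "actB 0 b = 0" by (simp add: actB_def)

lemma coeff_act_liftB: "coeff (act l (liftB q) m) k = actB q (coeff m k)"
proof (induction q arbitrary: m)
  case (pCons r q)
  then show ?case by (simp add: liftB_pCons act_liftY actB_pCons)
qed simp

lemma actB_flat: "dY b = 0 \<Longrightarrow> actB q b = q * b"
proof (induction q arbitrary: b)
  case (pCons r q)
  have "actB q (lx b) = q * lx b" by (rule pCons.IH) (simp add: lx_def pCons.prems)
  then show ?case by (simp add: actB_pCons lx_def pCons.prems)
qed simp

lemma actB_zero [simp]: "actB q 0 = 0" by (simp add: actB_flat)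
lemma actB_one [simp]: "actB q 1 = q" by (simp add: actB_flat)

lemma coord_op_mult: "coord (op l m * f) = act l (lift m) (coord f)"
  by (simp add: op_def coord_def coeff_rep)

lemma coord_op_const: "coeff (coord (op l [:q:] * f)) k = actB q (coeff (coord f) k)"
  by (simp add: coord_op_mult lift_pCons coeff_act_liftB)

text \<open>A bound on the \<open>Z\<close>-degree together with the coefficient at the bound;
  \<open>b = 0\<close> is allowed, so no case distinction on degrees arises.\<close>

definition top :: "nat \<Rightarrow> 'k polM \<Rightarrow> 'k poly poly \<Rightarrow> bool"
  where "top k m b \<longleftrightarrow> (\<forall>j>k. coeff m j = 0) \<and> coeff m k = b"

text \<open>Multiplying by an element of \<open>k[Y][X]\<close> does not raise the
  \<open>Z\<close>-degree, and \<open>LZ\<close> raises it by one and shifts the leading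
  coefficient, which is 1 and stays 1. So \<open>v ^ k\<close> is monic.\<close>

lemma top_Z_power:
  assumes "v = zo + op l [:p:]"
  shows "top k (coord (v ^ k)) 1"
proof (induction k)
  case 0
  show ?case by (simp add: top_def)
next
  case (Suc k)
  have *: "coord (v ^ Suc k) = LZ l (coord (v ^ k)) + coord (op l [:p:] * v ^ k)"
    by (simp add: assms distrib_right)
  have "shX (- 1) 1 = (1 :: 'k poly poly)" "lz l 1 = 0" by (simp_all add: one_pCons lz_def pderiv_pCons)
  then show ?case
    using Suc unfolding * by (auto simp: top_def coord_op_const split: nat.splits)
qed

lemma top_B_mult_Z_power: "v = zo + op l [:p:] \<Longrightarrow> top k (coord (op l [:q:] * v ^ k)) q"
  using top_Z_power[of v p k] by (auto simp: top_def coord_op_const)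

text \<open>Polynomials in \<open>u = X + aY\<close>, kept as operators because their normal form
  \<open>cu\<close> is in general not a plain substitution.\<close>

definition polyu :: "'k \<Rightarrow> 'k poly \<Rightarrow> 'k lend" where "polyu a = evp scl (xo + scl a * yo)"
definition cu :: "'k \<Rightarrow> 'k poly \<Rightarrow> 'k poly poly" where "cu a r = coeff (coord (polyu a r)) 0"

lemma polyu_pCons: "polyu a (pCons c r) = scl c + polyu a r * (xo + scl a * yo)"
  by (simp add: polyu_def evp_pCons)

lemma polyu_0 [simp]: "polyu a 0 = 0" by (simp add: polyu_def)

lemma polyu_commute: "polyu a r * (xo + scl a * yo) = (xo + scl a * yo) * polyu a r"
  by (simp only: polyu_def evp_scl_commute)

lemma polyu_EE: "polyu a r \<in> EE"
  by (induction r) (use EE_closed(7)[of 0] in \<open>auto simp: polyu_pCons intro!: EE_closed\<close>)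

lemma coord_polyu: "coord (polyu a r) = [:cu a r:]"
proof -
  have "degree (coord (polyu a r)) = 0"
  proof (induction r)
    case (pCons c r)
    then obtain q where q: "coord (polyu a r) = [:q:]" by (metis degree_eq_zeroE)
    show ?case by (simp add: polyu_pCons polyu_commute distrib_right mult.assoc q L_pCons)
  qed simp
  then show ?thesis by (auto simp: cu_def elim: degree_eq_zeroE)
qed

lemma cu_pCons: "cu a (pCons c r) = [:[:c:]:] + (lx (cu a r) + [:[:a:]:] * ly (cu a r))"
proof -
  have "[:cu a (pCons c r):] = [:[:[:c:]:] + (lx (cu a r) + [:[:a:]:] * ly (cu a r)):]"
    unfolding coord_polyu[symmetric] polyu_pCons polyu_commute
    by (simp add: distrib_right mult.assoc coord_polyu L_pCons)
  then show ?thesis by simp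
qed

lemma cu_0 [simp]: "cu a 0 = 0" by (simp add: cu_def)

lemma cu_add: "cu a (r + s) = cu a r + cu a s"
proof -
  have "polyu a (r + s) = polyu a r + polyu a s"
    unfolding polyu_def by (rule evp_add) (simp_all add: scl.\<iota>_add)
  then show ?thesis by (simp add: cu_def)
qed

text \<open>On \<open>k[u]\<close> the derivative in \<open>X\<close> is \<open>d/du\<close>.
  Elements of \<open>k[u]\<close> can thus be integrated inside \<open>k[u]\<close>.\<close>

lemma pderiv_cu: "pderiv (cu a r) = cu a (pderiv r)"
proof (induction r)
  case (pCons c r)
  have "pderiv (cu a (pCons c r)) = cu a r + (lx (cu a (pderiv r)) + [:[:a:]:] * ly (cu a (pderiv r)))"
    unfolding cu_pCons pderiv_add pderiv_cst pderiv_lx pderiv_mult pderiv_ly pCons.IH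
    by simp
  also have "\<dots> = cu a (pderiv (pCons c r))"
    by (simp add: pderiv_pCons cu_add cu_pCons)
  finally show ?case .
qed simp

lemma cu_const [simp]: "cu a [:c:] = [:[:c:]:]"
  by (simp add: cu_pCons)

lemma op_cu: "op l [:cu a r:] = polyu a r"
  by (rule EE_eqI) (simp_all add: polyu_EE coord_polyu)

end

lemma antiderivative: "\<exists>s. pderiv s = (r :: 'k::field_char_0 poly)"
proof -
  define s where "s = pCons 0 (\<Sum>i\<le>degree r. monom (coeff r i / of_nat (Suc i)) i)"
  have "pderiv s = r"
  proof (rule poly_eqI)
    fix n
    have "coeff (\<Sum>i\<le>degree r. monom (coeff r i / of_nat (Suc i)) i) n = coeff r n / of_nat (Suc n)"
      by (simp add: coeff_sum coeff_eq_0 del: of_nat_Suc)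
    then show "coeff (pderiv s) n = coeff r n"
      by (simp add: s_def coeff_pderiv del: of_nat_Suc)
  qed
  then show ?thesis by blast
qed

lemma deg0E: "degree p = 0 \<Longrightarrow> \<exists>c. p = [:c:]"
  by (metis degree_eq_zeroE)

lemma deg1E: assumes "degree p \<le> 1" shows "\<exists>c d. p = [:c, d:]"
proof -
  obtain c q where p: "p = pCons c q" by (cases p)
  then have "degree q = 0" using assms by (auto split: if_splits)
  then show ?thesis using p deg0E by metis
qed

text \<open>All that the classification retains of the coproduct: a subalgebra of the image of
  \<open>H\<close> whose coordinates are stable under the operators obtained by pairing.\<close>

locale stable_subalgebra =
  fixes l :: "'k::field_char_0" and R :: "'k lend set"
  assumes R_subalgebra: "is_subalgebra (type_alg scl) R" and R_EE: "R \<subseteq> range (rep l)"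
    and stable_dX: "m \<in> coord ` R \<Longrightarrow> dXM m \<in> coord ` R"
    and stable_dZ: "m \<in> coord ` R \<Longrightarrow> pderiv m \<in> coord ` R"
    and stable_dY0: "[:p:] \<in> coord ` R \<Longrightarrow> [:dY p:] \<in> coord ` R"
    and stable_dY1: "[:p, 1:] \<in> coord ` R \<Longrightarrow> [:vX + dY p:] \<in> coord ` R"
    and stable_dY: "[:p, q:] \<in> coord ` R \<Longrightarrow> \<exists>r. [:r, dY q:] \<in> coord ` R"
begin

abbreviation "cR \<equiv> coord ` R"

lemma R_closed: "f \<in> R \<Longrightarrow> g \<in> R \<Longrightarrow> f + g \<in> R" "f \<in> R \<Longrightarrow> g \<in> R \<Longrightarrow> f * g \<in> R"
  "f \<in> R \<Longrightarrow> scl c * f \<in> R" "1 \<in> R" "f \<in> R \<Longrightarrow> g \<in> R \<Longrightarrow> f - g \<in> R" "scl c \<in> R"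
proof -
  show "f \<in> R \<Longrightarrow> g \<in> R \<Longrightarrow> f - g \<in> R" for f g
    using scl.ta.subalgebra_minus[OF R_subalgebra, of f g] by simp
  show 1: "f \<in> R \<Longrightarrow> scl c * f \<in> R" for f c using R_subalgebra by (auto simp: scl.ta.subalgebra_iff)
  show 2: "1 \<in> R" using R_subalgebra by (auto simp: scl.ta.subalgebra_iff)
  show "scl c \<in> R" using 1[OF 2, of c] by simp
qed (use R_subalgebra in \<open>auto simp: scl.ta.subalgebra_iff\<close>)

lemma R_iff: "f \<in> R \<longleftrightarrow> f \<in> range (rep l) \<and> coord f \<in> cR"
  using R_EE EE_eqI[of _ l] by (auto, metis rangeI subsetD)

lemma op_mem: "op l m \<in> R \<longleftrightarrow> m \<in> cR"
  using R_iff[of "op l m"] by simp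

lemma cR_add: "m \<in> cR \<Longrightarrow> n \<in> cR \<Longrightarrow> m + n \<in> cR"
  using R_closed(1) by (simp add: op_mem[symmetric] op_add)
lemma cR_scale: "m \<in> cR \<Longrightarrow> smult [:[:c:]:] m \<in> cR"
  using R_closed(3) by (simp add: op_mem[symmetric] op_scale)
lemma cR_diff: "m \<in> cR \<Longrightarrow> n \<in> cR \<Longrightarrow> m - n \<in> cR"
proof -
  have "[:[:- 1:]:] = (- 1 :: 'k poly poly)" by (simp add: one_pCons)
  then show "m \<in> cR \<Longrightarrow> n \<in> cR \<Longrightarrow> m - n \<in> cR"
    using cR_add[OF _ cR_scale[of n "- 1"], of m] by simp
qed

definition "C = {q. [:q:] \<in> cR}"

lemma C_add: "p \<in> C \<Longrightarrow> q \<in> C \<Longrightarrow> p + q \<in> C"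
  using cR_add[of "[:p:]" "[:q:]"] by (simp add: C_def)
lemma C_diff: "p \<in> C \<Longrightarrow> q \<in> C \<Longrightarrow> p - q \<in> C"
  using cR_diff[of "[:p:]" "[:q:]"] by (simp add: C_def)
lemma C_scale: "p \<in> C \<Longrightarrow> smult [:c:] p \<in> C"
  using cR_scale[of "[:p:]" c] by (simp add: C_def)
lemma C_const: "[:[:c:]:] \<in> C"
proof -
  have "coord (scl c) \<in> cR" using R_closed(6) by blast
  then show ?thesis by (simp add: C_def)
qed
lemma C_pderiv: "p \<in> C \<Longrightarrow> pderiv p \<in> C"
  using stable_dX[of "[:p:]"] by (simp add: C_def dXM_def map_poly_pCons)
lemma C_dY: "p \<in> C \<Longrightarrow> dY p \<in> C"
  using stable_dY0 by (simp add: C_def)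
lemma C_mult: assumes "p \<in> C" "q \<in> C" shows "actB l p q \<in> C"
proof -
  have "coord (op l [:p:] * op l [:q:]) = [:actB l p q:]"
    by (rule poly_eqI) (simp add: coord_op_const coeff_pCons split: nat.split)
  moreover have "op l [:p:] * op l [:q:] \<in> R" using assms by (intro R_closed) (auto simp: C_def op_mem)
  ultimately show ?thesis by (metis (no_types, lifting) C_def imageI mem_Collect_eq)
qed

lemma C_unscale: assumes "smult [:c:] p \<in> C" "c \<noteq> 0" shows "p \<in> C"
  using C_scale[OF assms(1), of "inverse c"] assms(2) by (simp add: one_pCons[symmetric])

text \<open>Differentiation in \<open>Y\<close> leads down to degree 1; removing the constant and
  rescaling leaves \<open>Y\<close>.\<close>

lemma vY_of_polyY: assumes "[:s:] \<in> C" "degree s > 0" shows "vY \<in> C"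
  using assms
proof (induction "degree s" arbitrary: s rule: less_induct)
  case less
  show ?case
  proof (cases "degree s = 1")
    case True
    then obtain c d where s: "s = [:c, d:]" using deg1E[of s] by auto
    with True have d: "d \<noteq> 0" by auto
    have "[:s:] - [:[:c:]:] \<in> C" by (rule C_diff[OF less.prems(1) C_const])
    also have "[:s:] - [:[:c:]:] = smult [:d:] vY" by (simp add: s)
    finally show ?thesis using d by (rule C_unscale)
  next
    case False
    have "[:pderiv s:] \<in> C" using C_dY[OF less.prems(1)] by simp
    then show ?thesis
      by (rule less.hyps[of "pderiv s", rotated]) (use less.prems(2) False in \<open>simp_all add: degree_pderiv\<close>)
  qed
qed

lemma polyY_mem: assumes "vY \<in> C" shows "[:r:] \<in> C"
proof (induction r)
  case 0
  then show ?case using C_const[of 0] by simp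
next
  case (pCons c r)
  have "actB l vY [:r:] \<in> C" by (rule C_mult[OF assms pCons.IH])
  then have "[:pCons 0 r:] \<in> C" by (simp add: actB_pCons)
  from C_add[OF C_const[of c] this] show ?case by simp
qed

text \<open>Applying the derivative in \<open>X\<close> leads either into \<open>k[Y]\<close> or to
  \<open>q = s(Y) + cX\<close> with \<open>c \<noteq> 0\<close>. If \<open>s\<close> is affine,
  \<open>q\<close> is \<open>X + aY\<close> up to a constant and a factor; otherwise
  \<open>s'\<close> is a nonconstant polynomial in \<open>Y\<close> and produces
  \<open>Y\<close>.\<close>

lemma primitive_mem:
  assumes "q \<in> C" "\<nexists>c. q = [:[:c:]:]"
  shows "vY \<in> C \<or> (\<exists>a. vX + smult [:a:] vY \<in> C)"
  using assms
proof (induction "degree q" arbitrary: q rule: less_induct)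
  case less
  show ?case
  proof (cases "degree q = 0")
    case True
    then obtain s where s: "q = [:s:]" using deg0E by blast
    then have "degree s > 0" using less.prems(2) deg0E[of s] by (cases "degree s = 0") auto
    then show ?thesis using vY_of_polyY less.prems(1) s by blast
  next
    case False
    have d: "pderiv q \<in> C" "degree (pderiv q) < degree q"
      using C_pderiv[OF less.prems(1)] False by (simp_all add: degree_pderiv)
    show ?thesis
    proof (cases "\<exists>c. pderiv q = [:[:c:]:]")
      case False
      then show ?thesis using less.hyps[OF d(2) d(1)] by blast
    next
      case True
      then obtain c where c: "pderiv q = [:[:c:]:]" by blast
      then have "degree q \<le> 1" using degree_pderiv[of q] by simp
      then obtain s t where q: "q = [:s, t:]" using deg1E by blast
      with c have t: "t = [:c:]" by (simp add: pderiv_pCons)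
      have c0: "c \<noteq> 0" using False q t by auto
      show ?thesis
      proof (cases "degree s \<le> 1")
        case True
        then obtain s0 s1 where s: "s = [:s0, s1:]" using deg1E by blast
        have "q - [:[:s0:]:] \<in> C" by (rule C_diff[OF less.prems(1) C_const])
        also have "q - [:[:s0:]:] = smult [:c:] (vX + smult [:s1 / c:] vY)"
          using c0 by (simp add: q t s)
        finally show ?thesis using C_unscale c0 by blast
      next
        case False
        have "[:pderiv s:] \<in> C" using C_dY[OF less.prems(1)] by (simp add: q t)
        moreover have "degree (pderiv s) > 0" using False by (simp add: degree_pderiv)
        ultimately show ?thesis using vY_of_polyY by blast
      qed
    qed
  qed
qed

lemma C_UNIV: assumes "vX \<in> C" "vY \<in> C" shows "q \<in> C"
proof (induction q)
  case 0
  then show ?case using C_const[of 0] by simp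
next
  case (pCons r q)
  have "actB l q vX \<in> C" by (rule C_mult[OF pCons.IH assms(1)])
  then have "pCons 0 q \<in> C" by (simp add: actB_flat)
  from C_add[OF polyY_mem[OF assms(2), of r] this] show ?case by simp
qed

text \<open>Suppose \<open>s + rX\<close> lies in \<open>C\<close> with \<open>r \<noteq> 0\<close>.
  Differentiation in \<open>Y\<close> makes \<open>r\<close> a scalar, \<open>s\<close> can be
  subtracted since \<open>k[Y]\<close> is contained in \<open>C\<close>, and \<open>X\<close>
  appears. Higher degrees in \<open>X\<close> come down to this one by differentiation in
  \<open>X\<close>.\<close>

lemma C_degree_zero:
  assumes "vX \<notin> C" "vY \<in> C" "q \<in> C" shows "degree q = 0"
  using assms(3)
proof (induction "degree q" arbitrary: q rule: less_induct)
  case less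
  have lin: "r = 0" if "[:s, r:] \<in> C" for s r
    using that
  proof (induction "degree r" arbitrary: r s rule: less_induct)
    case (less r s)
    show ?case
    proof (cases "degree r = 0")
      case True
      then obtain c where r: "r = [:c:]" using deg0E by blast
      have "[:s, r:] - [:s:] \<in> C" by (rule C_diff[OF less.prems polyY_mem[OF assms(2)]])
      also have "[:s, r:] - [:s:] = smult [:c:] vX" by (simp add: r)
      finally show ?thesis using C_unscale assms(1) r by fastforce
    next
      case False
      have "[:pderiv s, pderiv r:] \<in> C" using C_dY[OF less.prems] by simp
      then have "pderiv r = 0" using less.hyps[of "pderiv r" "pderiv s"] False by (simp add: degree_pderiv)
      then show ?thesis using False by (simp add: pderiv_eq_0_iff)
    qed
  qed
  show ?case
  proof (rule ccontr)
    assume nz: "degree q \<noteq> 0"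
    have "degree (pderiv q) = 0"
      using less.hyps[of "pderiv q"] C_pderiv[OF less.prems] nz by (simp add: degree_pderiv)
    then have "degree q \<le> 1" by (simp add: degree_pderiv)
    then obtain s t where q: "q = [:s, t:]" using deg1E by blast
    with lin less.prems have "t = 0" by blast
    with q nz show False by simp
  qed
qed

lemma polyu_mem: assumes "vX + smult [:a:] vY \<in> C" shows "cu l a r \<in> C" "polyu l a r \<in> R"
proof -
  have "op l [:vX + smult [:a:] vY:] = xo l + scl a * yo l"
    by (rule EE_eqI) (auto intro!: EE_closed)
  then have u: "xo l + scl a * yo l \<in> R" using assms by (simp add: C_def op_mem[symmetric])
  show "polyu l a r \<in> R"
  proof (induction r)
    case 0
    then show ?case using R_closed(6)[of 0] by simp
  next
    case (pCons c r)
    then show ?case unfolding polyu_pCons by (intro R_closed u)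
  qed
  then show "cu l a r \<in> C"
    using coord_polyu[of l a r] by (metis (no_types, lifting) C_def imageI mem_Collect_eq)
qed

text \<open>Integration in \<open>u\<close>: the derivative of \<open>q\<close> is a polynomial in
  \<open>u\<close> by induction. Subtracting an antiderivative leaves an element of \<open>C\<close>
  inside \<open>k[Y]\<close>, which is constant, for otherwise \<open>Y\<close> would lie in
  \<open>C\<close>.\<close>

lemma C_polyu:
  assumes "vX + smult [:a:] vY \<in> C" "vY \<notin> C" "q \<in> C" shows "\<exists>r. q = cu l a r"
  using assms(3)
proof (induction "degree q" arbitrary: q rule: less_induct)
  case less
  have const: "\<exists>c. p = [:[:c:]:]" if p: "p \<in> C" "degree p = 0" for p
  proof -
    obtain s where s: "p = [:s:]" using p deg0E by blast
    then have "degree s = 0" using vY_of_polyY[of s] p assms(2) by blast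
    then show ?thesis using s deg0E by blast
  qed
  show ?case
  proof (cases "degree q = 0")
    case True
    then show ?thesis using const[OF less.prems] by (metis cu_const)
  next
    case False
    then obtain r where r: "pderiv q = cu l a r"
      using less.hyps[of "pderiv q"] C_pderiv[OF less.prems] by (auto simp: degree_pderiv)
    obtain s where s: "pderiv s = r" using antiderivative by blast
    have "q - cu l a s \<in> C" by (rule C_diff[OF less.prems polyu_mem(1)[OF assms(1)]])
    moreover have "pderiv (q - cu l a s) = 0" by (simp add: pderiv_diff r pderiv_cu s)
    ultimately obtain c where "q - cu l a s = [:[:c:]:]" using const by (metis pderiv_eq_0_iff)
    then have "q = cu l a (s + [:c:])" by (simp add: cu_add algebra_simps)
    then show ?thesis by blast
  qed
qed

text \<open>Three descents: in \<open>Z\<close> to reach degree 1, in \<open>X\<close> to free the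
  leading coefficient of \<open>X\<close>, in \<open>Y\<close> to make it a scalar. The last one
  changes the part of \<open>Z\<close>-degree 0 in an uncontrolled way, which is harmless since only
  the leading coefficient is followed.\<close>

lemma Z_mem:
  assumes "m \<in> cR" "degree m > 0" shows "\<exists>p. [:p, 1:] \<in> cR"
proof -
  have 1: "\<exists>p q. q \<noteq> 0 \<and> [:p, q:] \<in> cR"
    using assms
  proof (induction "degree m" arbitrary: m rule: less_induct)
    case less
    show ?case
    proof (cases "degree m = 1")
      case True
      then obtain p q where m: "m = [:p, q:]" using deg1E[of m] by auto
      with True have "q \<noteq> 0" by auto
      with m less.prems show ?thesis by blast
    next
      case False
      then show ?thesis using less.hyps[of "pderiv m"] stable_dZ[OF less.prems(1)] less.prems(2)
        by (simp add: degree_pderiv)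
    qed
  qed
  then obtain p q where "q \<noteq> 0" "[:p, q:] \<in> cR" by blast
  then have 2: "\<exists>p r. r \<noteq> 0 \<and> [:p, [:r:]:] \<in> cR"
  proof (induction "degree q" arbitrary: p q rule: less_induct)
    case less
    show ?case
    proof (cases "degree q = 0")
      case True
      then obtain r where "q = [:r:]" using deg0E by blast
      then show ?thesis using less.prems by (auto intro!: exI[of _ p] exI[of _ r])
    next
      case False
      have "[:pderiv p, pderiv q:] \<in> cR" using stable_dX[OF less.prems(2)] by (simp add: dXM_def map_poly_pCons)
      moreover have "pderiv q \<noteq> 0" using False by (simp add: pderiv_eq_0_iff)
      ultimately show ?thesis using less.hyps[of "pderiv q"] False by (simp add: degree_pderiv)
    qed
  qed
  then obtain p r where "r \<noteq> 0" "[:p, [:r:]:] \<in> cR" by blast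
  then show ?thesis
  proof (induction "degree r" arbitrary: p r rule: less_induct)
    case less
    show ?case
    proof (cases "degree r = 0")
      case True
      then obtain c where r: "r = [:c:]" using deg0E by blast
      then have "c \<noteq> 0" using less.prems by auto
      then have "smult [:[:inverse c:]:] [:p, [:r:]:] = [:smult [:inverse c:] p, 1:]" by (simp add: r one_pCons)
      then show ?thesis using cR_scale[OF less.prems(2), of "inverse c"] by auto
    next
      case False
      obtain s where "[:s, dY [:r:]:] \<in> cR" using stable_dY[OF less.prems(2)] by blast
      then have "[:s, [:pderiv r:]:] \<in> cR" by simp
      moreover have "pderiv r \<noteq> 0" using False by (simp add: pderiv_eq_0_iff)
      ultimately show ?thesis using less.hyps[of "pderiv r"] False by (simp add: degree_pderiv)
    qed
  qed
qed

text \<open>Differentiating \<open>n\<close> times in \<open>Z\<close> leaves only the leading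
  coefficient, multiplied by \<open>n!\<close>.\<close>

lemma lead_coeff_mem: assumes "m \<in> cR" "degree m \<le> n" shows "coeff m n \<in> C"
  using assms
proof (induction n arbitrary: m)
  case 0
  then obtain q where "m = [:q:]" using deg0E by blast
  then show ?case using 0 by (simp add: C_def)
next
  case (Suc n)
  have "coeff (pderiv m) n \<in> C"
    by (rule Suc.IH[OF stable_dZ[OF Suc.prems(1)]]) (use Suc.prems(2) in \<open>simp add: degree_pderiv\<close>)
  also have "coeff (pderiv m) n = smult [:of_nat (Suc n):] (coeff m (Suc n))"
    by (simp add: coeff_pderiv of_nat_poly del: of_nat_Suc)
  finally show ?case by (rule C_unscale) (simp del: of_nat_Suc)
qed

text \<open>Division by the monic \<open>v\<close>: the leading coefficient lies in
  \<open>C\<close>, so subtracting it times a power of \<open>v\<close> stays in \<open>R\<close>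
  and lowers the \<open>Z\<close>-degree.\<close>

lemma R_subset_generated:
  assumes "is_subalgebra (type_alg scl) S" "\<And>q. q \<in> C \<Longrightarrow> op l [:q:] \<in> S"
    and v: "v \<in> R" "v \<in> S" "v = zo l + op l [:p:]"
  shows "R \<subseteq> S"
proof
  have S: "1 \<in> S" "\<And>f g. f \<in> S \<Longrightarrow> g \<in> S \<Longrightarrow> f + g \<in> S" "\<And>f g. f \<in> S \<Longrightarrow> g \<in> S \<Longrightarrow> f * g \<in> S"
    using assms(1) by (auto simp: scl.ta.subalgebra_iff)
  have "v ^ n \<in> S \<and> v ^ n \<in> R" for n
    by (induction n) (use S v R_closed in auto)
  then have vn: "v ^ n \<in> S" "v ^ n \<in> R" for n by auto
  fix f assume "f \<in> R"
  \<comment> \<open>The strict degree bound makes the base case vacuous; at \<open>n = 1\<close> the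
    division leaves zero.\<close>
  have "f \<in> S" if "f \<in> R" "degree (coord f) < n" for n f
    using that
  proof (induction n arbitrary: f)
    case (Suc n)
    define q where "q = coeff (coord f) n"
    define g where "g = f - op l [:q:] * v ^ n"
    have q: "q \<in> C" unfolding q_def by (rule lead_coeff_mem) (use Suc.prems in auto)
    have g: "g \<in> R" unfolding g_def
      using q by (intro R_closed Suc.prems vn) (simp add: C_def op_mem)
    have zero: "coeff (coord g) j = 0" if "j \<ge> n" for j
      using top_B_mult_Z_power[OF v(3), of n q] that Suc.prems(2)
      by (cases "j = n") (auto simp: g_def top_def q_def coeff_eq_0)
    have "g \<in> S"
    proof (cases n)
      case 0
      then have "coord g = 0" using zero by (intro poly_eqI) auto
      then have "g = op l [:0:]" using EE_eq_op[of g l] g R_EE by auto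
      then show ?thesis using assms(2)[of 0] C_const[of 0] by simp
    next
      case (Suc n')
      have "degree (coord g) \<le> n'" by (rule degree_le) (use zero Suc in auto)
      then show ?thesis using Suc.IH g Suc by (simp add: \<open>\<And>f. f \<in> R \<Longrightarrow> degree (coord f) < n \<Longrightarrow> f \<in> S\<close>)
    qed
    moreover have "f = g + op l [:q:] * v ^ n" by (simp add: g_def)
    ultimately show ?case using S assms(2)[OF q] vn by auto
  qed simp
  then show "f \<in> S" using \<open>f \<in> R\<close> by blast
qed

end

section \<open>Generated subalgebras of operators and the relations between their generators\<close>

abbreviation TA :: "('k::field_char_0, 'k lend) module" where "TA \<equiv> type_alg scl"

lemma TA_gen_subalgebra: "is_subalgebra TA (alg_gen TA S)"
  by (rule scl.ta.alg_gen_subalgebra) simp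

lemma TA_gen_closed:
  fixes f g :: "'k::field_char_0 lend"
  shows "f \<in> alg_gen TA S \<Longrightarrow> g \<in> alg_gen TA S \<Longrightarrow> f + g \<in> alg_gen TA S"
    "f \<in> alg_gen TA S \<Longrightarrow> g \<in> alg_gen TA S \<Longrightarrow> f * g \<in> alg_gen TA S"
    "f \<in> alg_gen TA S \<Longrightarrow> g \<in> alg_gen TA S \<Longrightarrow> f - g \<in> alg_gen TA S"
    "f \<in> alg_gen TA S \<Longrightarrow> scl c * f \<in> alg_gen TA S" "1 \<in> alg_gen TA S" "scl c \<in> alg_gen TA S"
    "f \<in> S \<Longrightarrow> f \<in> alg_gen TA S" "f \<in> alg_gen TA S \<Longrightarrow> f ^ n \<in> alg_gen TA S"
proof -
  have sub: "\<forall>f\<in>alg_gen TA S. \<forall>g\<in>alg_gen TA S. f + g \<in> alg_gen TA S" "\<forall>f\<in>alg_gen TA S. \<forall>g\<in>alg_gen TA S. f * g \<in> alg_gen TA S"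
    "\<forall>c. \<forall>f\<in>alg_gen TA S. scl c * f \<in> alg_gen TA S" "1 \<in> alg_gen TA S"
    using TA_gen_subalgebra[of S] by (simp_all add: scl.ta.subalgebra_iff)
  show "f \<in> alg_gen TA S \<Longrightarrow> g \<in> alg_gen TA S \<Longrightarrow> f - g \<in> alg_gen TA S"
    using scl.ta.subalgebra_minus[OF TA_gen_subalgebra[of S], of f g] by simp
  show "f \<in> S \<Longrightarrow> f \<in> alg_gen TA S" using scl.ta.alg_gen_base[of S] by auto
  show "scl c \<in> alg_gen TA S" using sub(3)[rule_format, of 1 c] sub(4) by simp
  show "f \<in> alg_gen TA S \<Longrightarrow> f ^ n \<in> alg_gen TA S" by (induction n) (use sub in auto)
  show "f \<in> alg_gen TA S \<Longrightarrow> g \<in> alg_gen TA S \<Longrightarrow> f + g \<in> alg_gen TA S"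
    "f \<in> alg_gen TA S \<Longrightarrow> g \<in> alg_gen TA S \<Longrightarrow> f * g \<in> alg_gen TA S"
    "f \<in> alg_gen TA S \<Longrightarrow> scl c * f \<in> alg_gen TA S" "1 \<in> alg_gen TA S"
    using sub by auto
qed

context
  fixes l :: "'k::field_char_0"
begin

lemma op_const: "op l [:[:[:c:]:]:] = scl c"
  by (rule EE_eqI[of _ l]) (auto intro: EE_closed)

lemma op_polyY: "op l [:[:pCons c r:]:] = scl c + yo l * op l [:[:r:]:]"
  by (rule EE_eqI[of _ l]) (auto intro!: EE_closed simp: L_pCons ly_def)

lemma op_pCons: "op l [:pCons r q:] = op l [:[:r:]:] + op l [:q:] * xo l"
proof (rule EE_eqI[of _ l])
  have "coord (op l [:q:] * xo l) = [:q * vX:]"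
    by (rule poly_eqI) (simp add: coord_op_const actB_flat coeff_pCons split: nat.split)
  then show "coord (op l [:pCons r q:]) = coord (op l [:[:r:]:] + op l [:q:] * xo l)" by simp
qed (auto intro!: EE_closed)

lemma op_polyY_mem: "yo l \<in> S \<Longrightarrow> op l [:[:r:]:] \<in> alg_gen TA S"
proof (induction r)
  case 0
  then show ?case using op_const[of 0] TA_gen_closed(6)[of 0] by simp
next
  case (pCons c r)
  then show ?case by (auto simp: op_polyY intro!: TA_gen_closed(1,2,6) intro: TA_gen_closed(7))
qed

lemma op_B_mem: "yo l \<in> S \<Longrightarrow> xo l \<in> S \<Longrightarrow> op l [:q:] \<in> alg_gen TA S"
proof (induction q)
  case 0
  then show ?case using op_const[of 0] TA_gen_closed(6)[of 0] by simp
next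
  case (pCons r q)
  then show ?case by (auto simp: op_pCons[of r q] intro!: TA_gen_closed(1,2) op_polyY_mem intro: TA_gen_closed(7))
qed

lemma polyu_mem_gen: "xo l + scl a * yo l \<in> S \<Longrightarrow> polyu l a r \<in> alg_gen TA S"
proof (induction r)
  case 0
  then show ?case using TA_gen_closed(6)[of 0] by simp
next
  case (pCons c r)
  show ?case unfolding polyu_pCons
    by (rule TA_gen_closed(1)[OF TA_gen_closed(6) TA_gen_closed(2)[OF pCons.IH[OF pCons.prems] TA_gen_closed(7)[OF pCons.prems]]])
qed

text \<open>In the form \<open>Z + p\<close> these generators have \<open>p = (c - Y) X\<close> and,
  for \<open>viii\<close>, \<open>p = bY + (a/2) Y^2\<close>. Both arise below as solutions of the
  condition on \<open>X + \<partial>_Y p\<close>.\<close>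

abbreviation "vii c \<equiv> zo l + scl c * xo l - yo l * xo l"
abbreviation "viii a b \<equiv> zo l + scl b * yo l + scl (a / 2) * (yo l * yo l)"

lemma vii_eq: "vii c = zo l + op l [:[:0, [:c, -1:]:]:]"
  by (rule EE_eqI[of _ l]) (auto intro!: EE_closed simp: L_pCons ly_def)

lemma viii_eq: "viii a b = zo l + op l [:[:[:0, b, a/2:]:]:]"
  by (rule EE_eqI[of _ l]) (auto intro!: EE_closed simp: L_pCons ly_def)

lemma vii_commute: "vii c * yo l = yo l * vii c + scl c * yo l - scl (1/2) * (yo l * yo l)"
  by (rule EE_eqI[of _ l])
    (auto intro!: EE_closed simp: L_pCons lx_def ly_def lz_def algebra_simps shX_pCons pderiv_pCons)

text \<open>The summand \<open>scl l * yo l\<close> is the obstruction: when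
  \<open>l \<noteq> 0\<close> it brings \<open>Y\<close> into every subalgebra containing both
  generators.\<close>

lemma viii_commute: "viii a b * (xo l + scl a * yo l) = (xo l + scl a * yo l) * viii a b - viii a b + scl l * yo l"
  by (rule EE_eqI[of _ l])
    (auto intro!: EE_closed simp: L_pCons lx_def ly_def lz_def algebra_simps shX_pCons pderiv_pCons distrib_right,
      simp_all add: one_pCons)

lemma xy_commute: "xo l * yo l = yo l * xo l + yo l"
  using B_relations_Lop[of l] by (simp add: B_relations_def algebra_simps)

end

context stable_subalgebra
begin

lemma R_op: "f \<in> R \<Longrightarrow> f = op l (coord f)"
  using R_EE EE_eq_op by blast

lemma R_subset_of_no_Z:
  assumes "\<And>m. m \<in> cR \<Longrightarrow> degree m = 0" "\<And>q. q \<in> C \<Longrightarrow> op l [:q:] \<in> S"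
  shows "R \<subseteq> S"
proof
  fix f assume f: "f \<in> R"
  then obtain q where q: "coord f = [:q:]" using assms(1)[of "coord f"] deg0E by blast
  then have "q \<in> C" using f by (metis (no_types, lifting) C_def imageI mem_Collect_eq)
  then show "f \<in> S" using assms(2) R_op[OF f] q by metis
qed

lemma gen_subset: "S \<subseteq> R \<Longrightarrow> alg_gen TA S \<subseteq> R"
  by (rule scl.ta.alg_gen_minimal[OF R_subalgebra])

lemma vX_iff: "xo l \<in> R \<longleftrightarrow> vX \<in> C" and vY_iff: "yo l \<in> R \<longleftrightarrow> vY \<in> C"
  using R_iff[of "xo l"] R_iff[of "yo l"] EE_closed(6)[of l] by (simp_all add: C_def)

lemma R_full: assumes "xo l \<in> R" "yo l \<in> R" "zo l \<in> R" shows "R = range (rep l)"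
proof -
  have "rep l p \<in> R" for p
  proof (induction p rule: free_alg_induct)
    case one
    show ?case using R_closed(4) by simp
  next
    case (gen g p)
    then show ?case using assms R_closed(2) by (cases g) auto
  qed (auto intro: R_closed)
  then show ?thesis using R_EE by auto
qed

theorem classification:
  "R = range scl \<or> R = range (rep l) \<or>
   (\<exists>a b. (a, b) \<noteq> (0, 0) \<and> R = alg_gen TA {scl a * xo l + scl b * yo l}) \<or>
   R = alg_gen TA {yo l, xo l} \<or>
   (\<exists>c. R = alg_gen TA {yo l, vii l c}) \<or>
   (l = 0 \<and> (\<exists>a b. R = alg_gen TA {xo l + scl a * yo l, viii l a b}))"
proof -
  consider (K) "\<And>q. q \<in> C \<Longrightarrow> \<exists>c. q = [:[:c:]:]" | (XY) "vX \<in> C" "vY \<in> C"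
    | (Y) "vY \<in> C" "vX \<notin> C" | (u) a where "vY \<notin> C" "vX + smult [:a:] vY \<in> C"
    using primitive_mem by metis
  note C_cases = this
  have const_sub: "range scl \<subseteq> R" using R_closed(6) by auto
  have mem_u: "xo l + scl a * yo l \<in> R" if "vX + smult [:a:] vY \<in> C" for a
  proof -
    have "xo l + scl a * yo l = polyu l a [:0, 1:]" by (simp add: polyu_pCons)
    then show ?thesis using polyu_mem(2)[OF that] by metis
  qed
  show ?thesis
  proof (cases "\<forall>m\<in>cR. degree m = 0")
    case True
    note sub = R_subset_of_no_Z[OF True[rule_format]]
    show ?thesis
    proof (cases rule: C_cases)
      case K
      have "op l [:q:] \<in> range scl" if "q \<in> C" for q
        using K[OF that] op_const by fastforce
      then have "R \<subseteq> range scl" using sub[of "range scl"] by blast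
      then show ?thesis using const_sub by blast
    next
      case XY
      have "R = alg_gen TA {yo l, xo l}"
        using sub[of "alg_gen TA {yo l, xo l}"] op_B_mem[of l "{yo l, xo l}"] gen_subset[of "{yo l, xo l}"] XY
        by (auto simp: vX_iff vY_iff)
      then show ?thesis by blast
    next
      case Y
      have "op l [:q:] \<in> alg_gen TA {yo l}" if "q \<in> C" for q
        using C_degree_zero[OF Y(2,1) that] op_polyY_mem[of l "{yo l}"] deg0E by blast
      then have "R = alg_gen TA {yo l}"
        using sub[of "alg_gen TA {yo l}"] gen_subset[of "{yo l}"] Y by (auto simp: vY_iff)
      then have "R = alg_gen TA {scl 0 * xo l + scl 1 * yo l}" by simp
      then show ?thesis by (metis prod.inject zero_neq_one)
    next
      case (u a)
      let ?u = "xo l + scl a * yo l"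
      have "op l [:q:] \<in> alg_gen TA {?u}" if qC: "q \<in> C" for q
      proof -
        obtain r where "q = cu l a r" using C_polyu[OF u(2,1) qC] by blast
        then show ?thesis using polyu_mem_gen[of l a "{?u}"] by (simp add: op_cu)
      qed
      then have "R \<subseteq> alg_gen TA {?u}" using sub[of "alg_gen TA {?u}"] by blast
      moreover have "alg_gen TA {?u} \<subseteq> R" using gen_subset[of "{?u}"] mem_u[OF u(2)] by simp
      ultimately have "R = alg_gen TA {scl 1 * xo l + scl a * yo l}" by simp
      then show ?thesis by (metis prod.inject zero_neq_one)
    qed
  next
    case False
    then obtain p where p: "[:p, 1:] \<in> cR" using Z_mem by blast
    have dp: "pderiv p \<in> C" using stable_dX[OF p] by (simp add: C_def dXM_def map_poly_pCons)
    have dy: "vX + dY p \<in> C" using stable_dY1[OF p] by (simp add: C_def)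
    have sub_p: "[:p - q, 1:] \<in> cR" if "q \<in> C" for q
      using cR_diff[OF p, of "[:q:]"] that by (simp add: C_def)
    have z_eq: "op l [:p, 1:] = zo l + op l [:p:]" for p
      by (rule EE_eqI[of _ l]) (auto intro!: EE_closed)
    show ?thesis
    proof (cases rule: C_cases)
      case K
      \<comment> \<open>With \<open>C = k\<close> one gets \<open>p = s(Y) + cX\<close>, and
        \<open>X + \<partial>_Y p\<close> has \<open>X\<close>-degree 1, so it cannot be a constant:
        this case is void.\<close>
      obtain c where c: "pderiv p = [:[:c:]:]" using K[OF dp] by blast
      then have "degree p \<le> 1" using degree_pderiv[of p] by simp
      then obtain s t where st: "p = [:s, t:]" using deg1E by blast
      then have "t = [:c:]" using c by (simp add: pderiv_pCons)
      then have "vX + dY p = [:pderiv s, 1:]" using st by (simp add: one_pCons)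
      then show ?thesis using K[OF dy] by auto
    next
      case XY
      have "[:0, 1:] \<in> cR" using sub_p[OF C_UNIV[OF XY, of p]] by simp
      then have "zo l \<in> R" using R_iff[of "zo l"] EE_closed(6)[of l] by simp
      then show ?thesis using R_full XY by (simp add: vX_iff vY_iff)
    next
      case Y
      have d0: "degree (pderiv p) = 0" by (rule C_degree_zero[OF Y(2,1) dp])
      then have "degree p \<le> 1" by (simp add: degree_pderiv)
      then obtain s r where p_eq: "p = [:s, r:]" using deg1E by blast
      \<comment> \<open>The part of \<open>p\<close> free of \<open>X\<close> lies in
        \<open>k[Y]\<close>, which is contained in \<open>C\<close>, and is subtracted.\<close>
      have q: "[: [:0, r:], 1:] \<in> cR" using sub_p[OF polyY_mem[OF Y(1), of s]] by (simp add: p_eq)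
      \<comment> \<open>For \<open>p = rX\<close> the element \<open>X + \<partial>_Y p\<close> is
        \<open>(1 + r') X\<close>. As \<open>C\<close> contains only polynomials in
        \<open>Y\<close>, this forces \<open>r' = -1\<close>, that is,
        \<open>r = c - Y\<close>.\<close>
      have "[:0, 1 + pderiv r:] \<in> C"
        using stable_dY1[OF q] by (simp add: C_def)
      then have "1 + pderiv r = 0" using C_degree_zero[OF Y(2,1), of "[:0, 1 + pderiv r:]"] by (auto split: if_splits)
      then have "pderiv (r + [:0, 1:]) = 0" by (simp add: pderiv_add pderiv_pCons add.commute one_pCons)
      then obtain c where "r + [:0, 1:] = [:c:]" using pderiv_iszero by blast
      then have "r = [:c:] - [:0, 1:]" by (metis add_diff_cancel)
      then have r: "r = [:c, -1:]" by simp
      define v where "v = vii l c"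
      have v: "v = zo l + op l [:[:0, [:c, -1:]:]:]" unfolding v_def by (rule vii_eq)
      have vR: "v \<in> R" using q unfolding v z_eq[symmetric] r op_mem .
      let ?S = "{yo l, v}"
      have "R \<subseteq> alg_gen TA ?S"
      proof (rule R_subset_generated[OF TA_gen_subalgebra _ vR _ v])
        show "op l [:q:] \<in> alg_gen TA ?S" if "q \<in> C" for q
          using C_degree_zero[OF Y(2,1) that] op_polyY_mem[of l ?S] deg0E by blast
      qed (rule TA_gen_closed(7), simp)
      moreover have "alg_gen TA ?S \<subseteq> R" using gen_subset[of ?S] vR Y by (auto simp: vY_iff)
      ultimately show ?thesis unfolding v_def by blast
    next
      case (u a)
      \<comment> \<open>The derivative of \<open>p\<close> in \<open>X\<close> is a polynomial in
        \<open>u\<close>; subtracting an antiderivative from \<open>p\<close> leaves a polynomial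
        \<open>s\<close> in \<open>Y\<close> alone.\<close>
      obtain r where r: "pderiv p = cu l a r" using C_polyu[OF u(2,1) dp] by blast
      obtain r1 where r1: "pderiv r1 = r" using antiderivative by blast
      have q1: "[:p - cu l a r1, 1:] \<in> cR" by (rule sub_p[OF polyu_mem(1)[OF u(2)]])
      have "pderiv (p - cu l a r1) = 0" by (simp add: pderiv_diff r pderiv_cu r1)
      then obtain s where s: "p - cu l a r1 = [:s:]" using pderiv_iszero by blast
      have "vX + [:pderiv s:] \<in> C" using stable_dY1[OF q1] by (simp add: s C_def)
      \<comment> \<open>Both \<open>X + s'\<close> and \<open>X + aY\<close> lie in
        \<open>C\<close>. Their difference lies in \<open>k[Y]\<close> and must be a constant
        \<open>b\<close>, so \<open>s\<close> is \<open>bY + (a/2) Y^2\<close> up to a constant of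
        integration.\<close>
      then have "(vX + [:pderiv s:]) - (vX + smult [:a:] vY) \<in> C" by (rule C_diff[OF _ u(2)])
      then have "[:pderiv s - [:0, a:]:] \<in> C" by simp
      then have "degree (pderiv s - [:0, a:]) = 0" using vY_of_polyY u(1) by blast
      then obtain b where b: "pderiv s - [:0, a:] = [:b:]" using deg0E by blast
      have "pderiv (s - [:0, b, a/2:]) = 0"
        using b by (simp add: pderiv_diff pderiv_pCons algebra_simps)
      then obtain c where "s - [:0, b, a/2:] = [:c:]" using pderiv_iszero by blast
      then have s': "[:s:] - [:[:c:]:] = [:[:0, b, a/2:]:]" by (simp add: algebra_simps)
      have q: "[: [:[:0, b, a/2:]:], 1:] \<in> cR"
        using cR_diff[OF q1, of "[:[:[:c:]:]:]"] C_const[of c] s' unfolding s C_def by simp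
      define v where "v = viii l a b"
      have v: "v = zo l + op l [:[:[:0, b, a/2:]:]:]" unfolding v_def by (rule viii_eq)
      have vR: "v \<in> R" using q unfolding v z_eq[symmetric] op_mem .
      let ?u = "xo l + scl a * yo l"
      let ?S = "{?u, v}"
      have uR: "?u \<in> R" by (rule mem_u[OF u(2)])
      have "R \<subseteq> alg_gen TA ?S"
      proof (rule R_subset_generated[OF TA_gen_subalgebra _ vR _ v])
        show "op l [:q:] \<in> alg_gen TA ?S" if qC: "q \<in> C" for q
        proof -
          obtain r where "q = cu l a r" using C_polyu[OF u(2,1) qC] by blast
          then show ?thesis using polyu_mem_gen[of l a ?S] by (simp add: op_cu)
        qed
      qed (rule TA_gen_closed(7), simp)
      moreover have "alg_gen TA ?S \<subseteq> R" using gen_subset[of ?S] vR uR by auto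
      moreover have "l = 0"
      proof (rule ccontr)
        assume "l \<noteq> 0"
        \<comment> \<open>By \<open>viii_commute\<close> this element is \<open>\<lambda> Y\<close>,
          whereas \<open>Y\<close> does not belong to \<open>R\<close>.\<close>
        have "v * ?u - ?u * v + v \<in> R" by (intro R_closed vR uR)
        also have "v * ?u - ?u * v + v = scl l * yo l" unfolding v_def viii_commute by simp
        finally have "scl (inverse l) * (scl l * yo l) \<in> R" by (rule R_closed(3))
        then have "yo l \<in> R" using \<open>l \<noteq> 0\<close> by (simp add: mult.assoc[symmetric] scl.\<iota>_mult[symmetric])
        then show False using u(1) by (simp add: vY_iff)
      qed
      ultimately show ?thesis unfolding v_def by blast
    qed
  qed
qed

end

section \<open>Right coideal subalgebras of \<open>B_alg\<close>\<close>

context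
  fixes l :: "'k::field_char_0"
begin

interpretation H: k_algebra "B_alg l" by (rule B_alg_k_algebra)

interpretation HH: tensor_product "B_alg l" "B_alg l" ..

lemma repr_range: "repr l ` carrier (B_alg l) = range (rep l)"
  by (simp add: B_alg_carrier image_image repr_coset)

lemma stable_of_right_coideal:
  assumes "right_coideal_subalgebra (B_alg l) (B_comult l) A"
  shows "stable_subalgebra l (repr l ` A)"
proof
  have A: "is_subalgebra (B_alg l) A" using assms by (simp add: right_coideal_subalgebra_def)
  then show "is_subalgebra TA (repr l ` A)"
    by (rule alg_hom_image_subalgebra[OF H.k_algebra_axioms scl.ta.k_algebra_axioms repr_hom])
  show "repr l ` A \<subseteq> range (rep l)"
    using A repr_range unfolding H.subalgebra_iff by blast
  have crd: "crd l A = coord ` repr l ` A" by (simp add: crd_def image_image)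
  note ops = right_coideal_operators[OF assms, unfolded crd]
  show "m \<in> coord ` repr l ` A \<Longrightarrow> dXM m \<in> coord ` repr l ` A" for m by (rule ops(1))
  show "m \<in> coord ` repr l ` A \<Longrightarrow> pderiv m \<in> coord ` repr l ` A" for m by (rule ops(2))
  show "[:p:] \<in> coord ` repr l ` A \<Longrightarrow> [:dY p:] \<in> coord ` repr l ` A" for p by (rule ops(3))
  show "[:p, 1:] \<in> coord ` repr l ` A \<Longrightarrow> [:vX + dY p:] \<in> coord ` repr l ` A" for p by (rule ops(4))
  show "[:p, q:] \<in> coord ` repr l ` A \<Longrightarrow> \<exists>r. [:r, dY q:] \<in> coord ` repr l ` A" for p q by (rule ops(5))
qed

text \<open>Equality of subalgebras of \<open>H\<close> may be decided among operators; both the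
  classification and the comparison of lines come back to \<open>H\<close> this way.\<close>

lemma repr_image_inj:
  "A \<subseteq> carrier (B_alg l) \<Longrightarrow> B \<subseteq> carrier (B_alg l) \<Longrightarrow> repr l ` A = repr l ` B \<longleftrightarrow> A = B"
  by (rule inj_on_image_eq_iff[OF repr_inj])

lemma repr_alg_gen:
  "S \<subseteq> carrier (B_alg l) \<Longrightarrow> repr l ` alg_gen (B_alg l) S = alg_gen TA (repr l ` S)"
  by (rule alg_hom_image_alg_gen[OF H.k_algebra_axioms scl.ta.k_algebra_axioms repr_hom])

lemma repr_minus: "a \<in> carrier (B_alg l) \<Longrightarrow> b \<in> carrier (B_alg l) \<Longrightarrow> repr l (a \<ominus>\<^bsub>B_alg l\<^esub> b) = repr l a - repr l b"
  using alg_hom_minus[OF H.k_algebra_axioms scl.ta.k_algebra_axioms repr_hom] by simp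

lemma repr_scalars: "repr l ` scalars (B_alg l) = range scl"
  by (auto simp: scalars_def image_image repr_simps)

abbreviation "genl a b \<equiv> a \<odot>\<^bsub>B_alg l\<^esub> hx l \<oplus>\<^bsub>B_alg l\<^esub> b \<odot>\<^bsub>B_alg l\<^esub> hy l"
abbreviation "gen2 c \<equiv> hz l \<oplus>\<^bsub>B_alg l\<^esub> c \<odot>\<^bsub>B_alg l\<^esub> hx l \<ominus>\<^bsub>B_alg l\<^esub> hy l \<otimes>\<^bsub>B_alg l\<^esub> hx l"
abbreviation "gen3u a \<equiv> hx l \<oplus>\<^bsub>B_alg l\<^esub> a \<odot>\<^bsub>B_alg l\<^esub> hy l"
abbreviation "gen3 a b \<equiv> hz l \<oplus>\<^bsub>B_alg l\<^esub> b \<odot>\<^bsub>B_alg l\<^esub> hy l \<oplus>\<^bsub>B_alg l\<^esub> (a / 2) \<odot>\<^bsub>B_alg l\<^esub> (hy l \<otimes>\<^bsub>B_alg l\<^esub> hy l)"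

lemma repr_gens:
  "repr l (genl a b) = scl a * xo l + scl b * yo l" "repr l (gen2 c) = vii l c"
  "repr l (gen3u a) = xo l + scl a * yo l" "repr l (gen3 a b) = viii l a b"
  by (simp_all add: repr_simps repr_minus)

lemma gens_carrier: "genl a b \<in> carrier (B_alg l)" "gen2 c \<in> carrier (B_alg l)"
  "gen3u a \<in> carrier (B_alg l)" "gen3 a b \<in> carrier (B_alg l)"
  by simp_all

lemma right_coideal_cases:
  assumes "right_coideal_subalgebra (B_alg l) (B_comult l) A"
  shows "A = scalars (B_alg l) \<or> A = carrier (B_alg l) \<or>
    (\<exists>a b. (a, b) \<noteq> (0, 0) \<and> A = alg_gen (B_alg l) {genl a b}) \<or>
    A = alg_gen (B_alg l) {hy l, hx l} \<or>
    (\<exists>c. A = alg_gen (B_alg l) {hy l, gen2 c}) \<or>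
    (l = 0 \<and> (\<exists>a b. A = alg_gen (B_alg l) {gen3u a, gen3 a b}))"
proof -
  interpret stable_subalgebra l "repr l ` A" by (rule stable_of_right_coideal[OF assms])
  have A: "A \<subseteq> carrier (B_alg l)" using assms by (simp add: right_coideal_subalgebra_def H.subalgebra_iff)
  have *: "A = alg_gen (B_alg l) S" if "repr l ` A = alg_gen TA (repr l ` S)" "S \<subseteq> carrier (B_alg l)" for S
    using that A repr_image_inj[of A "alg_gen (B_alg l) S"] H.alg_gen_subalgebra[OF that(2)]
    by (simp add: repr_alg_gen H.subalgebra_iff)
  have sc: "scalars (B_alg l) \<subseteq> carrier (B_alg l)" using H.scalars_subalgebra by (simp add: H.subalgebra_iff)
  from classification show ?thesis
  proof (elim disjE exE conjE)
    assume "repr l ` A = range scl"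
    then show ?thesis using repr_image_inj[OF A sc] by (simp add: repr_scalars)
  next
    assume "repr l ` A = range (rep l)"
    then show ?thesis using repr_image_inj[OF A subset_refl] by (simp add: repr_range)
  next
    fix a b assume "(a, b) \<noteq> (0, 0)" "repr l ` A = alg_gen TA {scl a * xo l + scl b * yo l}"
    then show ?thesis using *[of "{genl a b}"] gens_carrier by (auto simp: repr_gens)
  next
    assume "repr l ` A = alg_gen TA {yo l, xo l}"
    then show ?thesis using *[of "{hy l, hx l}"] by simp
  next
    fix c assume "repr l ` A = alg_gen TA {yo l, vii l c}"
    then show ?thesis using *[of "{hy l, gen2 c}"] gens_carrier by (auto simp: repr_gens)
  next
    fix a b assume "l = 0" "repr l ` A = alg_gen TA {xo l + scl a * yo l, viii l a b}"
    moreover have "repr l ` {gen3u a, gen3 a b} = {xo l + scl a * yo l, viii l a b}"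
      by (simp only: image_insert image_empty repr_gens)
    ultimately have "A = alg_gen (B_alg l) {gen3u a, gen3 a b}" "l = 0"
      using *[of "{gen3u a, gen3 a b}"] gens_carrier by simp_all
    then show ?thesis by blast
  qed
qed

end

section \<open>The listed subalgebras satisfy the coideal condition\<close>

context
  fixes l :: "'k::field_char_0"
begin

interpretation H: k_algebra "B_alg l" by (rule B_alg_k_algebra)

interpretation HH: tensor_product "B_alg l" "B_alg l" ..

abbreviation "TT S \<equiv> tensor_sub (B_alg l) (B_alg l) (alg_gen (B_alg l) S) (carrier (B_alg l))"

text \<open>Every generator is primitive up to one extra tensor. Only the left factor of each tensor
  has to lie in the subalgebra, and for the primitive part it is \<open>w\<close> or 1.\<close>

lemma comult_mem:
  assumes "S \<subseteq> carrier (B_alg l)" "w \<in> alg_gen (B_alg l) S" "a \<in> alg_gen (B_alg l) S" "b \<in> carrier (B_alg l)"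
    and "B_comult l w = pt l w (oneH l) \<oplus>\<^bsub>TH l\<^esub> pt l (oneH l) w \<oplus>\<^bsub>TH l\<^esub> pt l a b"
  shows "B_comult l w \<in> TT S"
proof -
  have A: "is_subalgebra (B_alg l) (alg_gen (B_alg l) S)" by (rule H.alg_gen_subalgebra[OF assms(1)])
  then have sub: "alg_gen (B_alg l) S \<subseteq> carrier (B_alg l)" "oneH l \<in> alg_gen (B_alg l) S"
    by (auto simp: H.subalgebra_iff)
  have add: "x \<oplus>\<^bsub>TH l\<^esub> y \<in> TT S" if "x \<in> TT S" "y \<in> TT S" for x y
    using HH.tensor_sub_submodule[OF sub(1) subset_refl] that by (auto simp: HH.T.submodule_iff)
  show ?thesis unfolding assms(5)
    by (intro add HH.tensor_sub_base) (use assms sub in auto)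
qed

lemma comult_prim_mem:
  assumes "S \<subseteq> carrier (B_alg l)" "w \<in> alg_gen (B_alg l) S"
    and "B_comult l w = pt l w (oneH l) \<oplus>\<^bsub>TH l\<^esub> pt l (oneH l) w"
  shows "B_comult l w \<in> TT S"
proof (rule comult_mem[OF assms(1,2)])
  have A: "is_subalgebra (B_alg l) (alg_gen (B_alg l) S)" by (rule H.alg_gen_subalgebra[OF assms(1)])
  then show "\<zero>\<^bsub>B_alg l\<^esub> \<in> alg_gen (B_alg l) S"
    by (simp add: is_subalgebra_def H.submodule_iff)
  have w: "w \<in> carrier (B_alg l)" using A assms(2) by (auto simp: H.subalgebra_iff)
  have "pt l (0 \<odot>\<^bsub>B_alg l\<^esub> oneH l) (oneH l) = 0 \<odot>\<^bsub>TH l\<^esub> pt l (oneH l) (oneH l)"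
    by (rule HH.pure_smult_left) auto
  then have "pt l (\<zero>\<^bsub>B_alg l\<^esub>) (oneH l) = \<zero>\<^bsub>TH l\<^esub>" by simp
  then show "B_comult l w = pt l w (oneH l) \<oplus>\<^bsub>TH l\<^esub> pt l (oneH l) w \<oplus>\<^bsub>TH l\<^esub> pt l (\<zero>\<^bsub>B_alg l\<^esub>) (oneH l)"
    using assms(3) w by simp
qed simp

lemmas comult_simps = alg_homD[OF comult_hom[of l]] comult_gen

lemma comult_genl: "B_comult l (genl l a b) = pt l (genl l a b) (oneH l) \<oplus>\<^bsub>TH l\<^esub> pt l (oneH l) (genl l a b)"
  by (simp add: comult_simps tensor_expand HH.T.a_ac)

lemma comult_xy: "B_comult l (hx l) = pt l (hx l) (oneH l) \<oplus>\<^bsub>TH l\<^esub> pt l (oneH l) (hx l)"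
  "B_comult l (hy l) = pt l (hy l) (oneH l) \<oplus>\<^bsub>TH l\<^esub> pt l (oneH l) (hy l)"
  by (simp_all add: comult_simps)

lemma comult_gen3u: "B_comult l (gen3u l a) = pt l (gen3u l a) (oneH l) \<oplus>\<^bsub>TH l\<^esub> pt l (oneH l) (gen3u l a)"
  by (simp add: comult_simps tensor_expand HH.T.a_ac)

text \<open>This explains the summand \<open>- Y X\<close> of the generator: expanding
  \<open>\<Delta> (Y X)\<close> yields the cross terms \<open>Y \<otimes> X\<close> and
  \<open>X \<otimes> Y\<close>. The second cancels the \<open>X \<otimes> Y\<close> of
  \<open>\<Delta> Z\<close>, and what remains has the admissible left factor
  \<open>- Y\<close>.\<close>

lemma comult_gen2:
  "B_comult l (gen2 l c) = pt l (gen2 l c) (oneH l) \<oplus>\<^bsub>TH l\<^esub> pt l (oneH l) (gen2 l c) \<oplus>\<^bsub>TH l\<^esub>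
     pt l ((- 1) \<odot>\<^bsub>B_alg l\<^esub> hy l) (hx l)"
proof -
  let ?v = "hz l \<oplus>\<^bsub>B_alg l\<^esub> c \<odot>\<^bsub>B_alg l\<^esub> hx l \<oplus>\<^bsub>B_alg l\<^esub> (- 1) \<odot>\<^bsub>B_alg l\<^esub> (hy l \<otimes>\<^bsub>B_alg l\<^esub> hx l)"
  have v: "gen2 l c = ?v" by (simp add: a_minus_def H.smult_minus_one)
  have neg: "pt l (hx l) (hy l) \<oplus>\<^bsub>TH l\<^esub> (- 1) \<odot>\<^bsub>TH l\<^esub> pt l (hx l) (hy l) = \<zero>\<^bsub>TH l\<^esub>"
    by (simp add: HH.T.smult_minus_one HH.T.r_neg)
  have "B_comult l ?v = (pt l ?v (oneH l) \<oplus>\<^bsub>TH l\<^esub> pt l (oneH l) ?v \<oplus>\<^bsub>TH l\<^esub>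
     pt l ((- 1) \<odot>\<^bsub>B_alg l\<^esub> hy l) (hx l)) \<oplus>\<^bsub>TH l\<^esub> (pt l (hx l) (hy l) \<oplus>\<^bsub>TH l\<^esub> (- 1) \<odot>\<^bsub>TH l\<^esub> pt l (hx l) (hy l))"
    by (simp add: comult_simps tensor_expand HH.T.a_ac)
  then show ?thesis unfolding v neg by simp
qed

text \<open>The two cross terms of \<open>(a/2) Y^2\<close> add up to
  \<open>a (Y \<otimes> Y)\<close> and complete \<open>X \<otimes> Y\<close> to a tensor with left
  factor \<open>X + aY\<close>.\<close>

lemma comult_gen3:
  "B_comult l (gen3 l a b) = pt l (gen3 l a b) (oneH l) \<oplus>\<^bsub>TH l\<^esub> pt l (oneH l) (gen3 l a b) \<oplus>\<^bsub>TH l\<^esub>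
     pt l (gen3u l a) (hy l)"
proof -
  have half: "(a/2) \<odot>\<^bsub>TH l\<^esub> pt l (hy l) (hy l) \<oplus>\<^bsub>TH l\<^esub> (a/2) \<odot>\<^bsub>TH l\<^esub> pt l (hy l) (hy l) = a \<odot>\<^bsub>TH l\<^esub> pt l (hy l) (hy l)"
    by (simp add: HH.T.smult_l_distr[symmetric])
  have "B_comult l (gen3 l a b) = pt l (gen3 l a b) (oneH l) \<oplus>\<^bsub>TH l\<^esub> pt l (oneH l) (gen3 l a b) \<oplus>\<^bsub>TH l\<^esub>
     (pt l (hx l) (hy l) \<oplus>\<^bsub>TH l\<^esub> ((a/2) \<odot>\<^bsub>TH l\<^esub> pt l (hy l) (hy l) \<oplus>\<^bsub>TH l\<^esub> (a/2) \<odot>\<^bsub>TH l\<^esub> pt l (hy l) (hy l)))"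
    by (simp add: comult_simps tensor_expand HH.T.a_ac)
  then show ?thesis unfolding half by (simp add: tensor_expand)
qed

theorem right_coideal_converse:
  "right_coideal_subalgebra (B_alg l) (B_comult l) (scalars (B_alg l))"
  "right_coideal_subalgebra (B_alg l) (B_comult l) (carrier (B_alg l))"
  "right_coideal_subalgebra (B_alg l) (B_comult l) (alg_gen (B_alg l) {genl l a b})"
  "right_coideal_subalgebra (B_alg l) (B_comult l) (alg_gen (B_alg l) {hy l, hx l})"
  "right_coideal_subalgebra (B_alg l) (B_comult l) (alg_gen (B_alg l) {hy l, gen2 l c})"
  "right_coideal_subalgebra (B_alg l) (B_comult l) (alg_gen (B_alg l) {gen3u l a, gen3 l a b})"
proof -
  have mem: "s \<in> alg_gen (B_alg l) S" if "s \<in> S" for s S using H.alg_gen_base[of S] that by auto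
  \<comment> \<open>The scalars are generated by the empty set, for which the test on generators is
    vacuous.\<close>
  have "alg_gen (B_alg l) {} \<subseteq> scalars (B_alg l)" by (rule H.alg_gen_minimal[OF H.scalars_subalgebra]) simp
  moreover have "scalars (B_alg l) \<subseteq> alg_gen (B_alg l) {}"
    using H.alg_gen_subalgebra[of "{}"] by (auto simp: H.subalgebra_iff scalars_def)
  ultimately have "alg_gen (B_alg l) {} = scalars (B_alg l)" by blast
  then show "right_coideal_subalgebra (B_alg l) (B_comult l) (scalars (B_alg l))"
    using right_coideal_subalgebraI[of "{}" l] by simp
  show "right_coideal_subalgebra (B_alg l) (B_comult l) (carrier (B_alg l))"
    using alg_homD(1)[OF comult_hom] H.carrier_subalgebra
    by (auto simp: right_coideal_subalgebra_def HH.tensor_carrier[symmetric])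
  show "right_coideal_subalgebra (B_alg l) (B_comult l) (alg_gen (B_alg l) {genl l a b})"
  proof (rule right_coideal_subalgebraI)
    let ?S = "{genl l a b}"
    show S: "?S \<subseteq> carrier (B_alg l)" by simp
    have "B_comult l (genl l a b) \<in> TT ?S"
      by (intro comult_prim_mem[OF S mem comult_genl]) auto
    then show "B_comult l s \<in> TT ?S" if "s \<in> ?S" for s using that by blast
  qed
  show "right_coideal_subalgebra (B_alg l) (B_comult l) (alg_gen (B_alg l) {hy l, hx l})"
  proof (rule right_coideal_subalgebraI)
    let ?S = "{hy l, hx l}"
    show S: "?S \<subseteq> carrier (B_alg l)" by simp
    have "B_comult l (hx l) \<in> TT ?S"
      by (intro comult_prim_mem[OF S mem comult_xy(1)]) auto
    moreover have "B_comult l (hy l) \<in> TT ?S"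
      by (intro comult_prim_mem[OF S mem comult_xy(2)]) auto
    ultimately show "B_comult l s \<in> TT ?S" if "s \<in> ?S" for s using that by blast
  qed
  show "right_coideal_subalgebra (B_alg l) (B_comult l) (alg_gen (B_alg l) {hy l, gen2 l c})"
  proof (rule right_coideal_subalgebraI)
    let ?S = "{hy l, gen2 l c}"
    show S: "?S \<subseteq> carrier (B_alg l)" by simp
    have "(- 1) \<odot>\<^bsub>B_alg l\<^esub> hy l \<in> alg_gen (B_alg l) ?S"
      using H.alg_gen_subalgebra[OF S] mem[of "hy l" ?S] unfolding H.subalgebra_iff by blast
    then have "B_comult l (gen2 l c) \<in> TT ?S"
      by (intro comult_mem[OF S mem _ _ comult_gen2]) auto
    moreover have "B_comult l (hy l) \<in> TT ?S"
      by (intro comult_prim_mem[OF S mem comult_xy(2)]) auto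
    ultimately show "B_comult l s \<in> TT ?S" if "s \<in> ?S" for s using that by blast
  qed
  show "right_coideal_subalgebra (B_alg l) (B_comult l) (alg_gen (B_alg l) {gen3u l a, gen3 l a b})"
  proof (rule right_coideal_subalgebraI)
    let ?S = "{gen3u l a, gen3 l a b}"
    show S: "?S \<subseteq> carrier (B_alg l)" by simp
    have "B_comult l (gen3 l a b) \<in> TT ?S"
      by (intro comult_mem[OF S mem mem _ comult_gen3]) auto
    moreover have "B_comult l (gen3u l a) \<in> TT ?S"
      by (intro comult_prim_mem[OF S mem comult_gen3u]) auto
    ultimately show "B_comult l s \<in> TT ?S" if "s \<in> ?S" for s using that by blast
  qed
qed

end

section \<open>Gelfand-Kirillov dimension\<close>

context k_algebra
begin

lemma scalars_subfield:
  assumes "\<one> \<noteq> \<zero>" shows "subfield (scalars A) A"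
proof (rule subfieldI)
  have mult: "(c \<odot> \<one>) \<otimes> (d \<odot> \<one>) = (c * d) \<odot> \<one>" for c d
    by (simp add: smult_mult_l smult_mult_r smult_assoc[symmetric] mult.commute)
  show "subcring (scalars A) A"
  proof (rule subcringI)
    show "subring (scalars A) A" using scalars_subalgebra by (simp add: is_subalgebra_def)
  qed (auto simp: scalars_def mult mult.commute)
  show "Units (A\<lparr>carrier := scalars A\<rparr>) = scalars A - {\<zero>}"
  proof
    show "Units (A\<lparr>carrier := scalars A\<rparr>) \<subseteq> scalars A - {\<zero>}"
      using assms scalars_subalgebra by (auto simp: Units_def subalgebra_iff)
    show "scalars A - {\<zero>} \<subseteq> Units (A\<lparr>carrier := scalars A\<rparr>)"
    proof
      fix x assume "x \<in> scalars A - {\<zero>}"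
      then obtain c where c: "x = c \<odot> \<one>" "x \<noteq> \<zero>" by (auto simp: scalars_def)
      then have "c \<noteq> 0" by auto
      note c = c this
      then have "(inverse c \<odot> \<one>) \<otimes> x = \<one>" "x \<otimes> (inverse c \<odot> \<one>) = \<one>"
        by (simp_all only: mult) simp_all
      then show "x \<in> Units (A\<lparr>carrier := scalars A\<rparr>)"
        using c by (auto simp: Units_def scalars_def)
    qed
  qed
qed

text \<open>A bridge between two views of vector spaces: \<open>dim\<close> works over a subfield of
  the ring, here the copy of \<open>k\<close> in \<open>A\<close>, whereas \<open>lin_span\<close>
  uses submodules over the field as a type.\<close>

lemma subalgebra_scalars_iff: "subalgebra (scalars A) V A \<longleftrightarrow> submodule V base_field A"
proof -
  have sc: "(c \<odot> \<one>) \<otimes> v = c \<odot> v" if "v \<in> carrier A" for c v using that by (simp add: smult_mult_l)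
  have "subalgebra_axioms (scalars A) V A \<longleftrightarrow> submodule_axioms V base_field A" if V: "V \<subseteq> carrier A"
  proof -
    have "subalgebra_axioms (scalars A) V A \<longleftrightarrow> (\<forall>c. \<forall>v\<in>V. (c \<odot> \<one>) \<otimes> v \<in> V)"
      by (auto simp: subalgebra_axioms_def scalars_def)
    also have "\<dots> \<longleftrightarrow> (\<forall>c. \<forall>v\<in>V. c \<odot> v \<in> V)"
      using V sc by (metis subsetD)
    also have "\<dots> \<longleftrightarrow> submodule_axioms V base_field A"
      by (auto simp: submodule_axioms_def ring_of_type_algebra_def)
    finally show ?thesis .
  qed
  then show ?thesis
    unfolding subalgebra_def submodule_def using subgroup.subset by fastforce
qed

lemma lin_span_eq_Span:
  assumes "\<one> \<noteq> \<zero>" "set Us \<subseteq> carrier A" shows "lin_span A (set Us) = Span (scalars A) Us"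
  unfolding Span_subalgebra_minimal[OF scalars_subfield[OF assms(1)] assms(2)] lin_span_def subalgebra_scalars_iff ..

lemma basis_of_Span:
  assumes K: "subfield K A" and "set Us \<subseteq> carrier A"
  shows "\<exists>Vs. independent K Vs \<and> Span K Vs = Span K Us \<and> length Vs \<le> length Us"
  using assms(2)
proof (induction Us)
  case (Cons u Us)
  then obtain Vs where Vs: "independent K Vs" "Span K Vs = Span K Us" "length Vs \<le> length Us" by auto
  show ?case
  proof (cases "u \<in> Span K Us")
    case True
    have "Span K (u # Us) \<subseteq> Span K Us"
      using mono_Span_subset[OF K, of "u # Us" Us] True Span_base_incl[OF K, of Us] Cons.prems by auto
    moreover have "Span K Us \<subseteq> Span K (u # Us)"
      using mono_Span_subset[OF K, of Us "u # Us"] Span_base_incl[OF K, of "u # Us"] Cons.prems by auto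
    ultimately have "Span K (u # Us) = Span K Us" by blast
    then show ?thesis using Vs by (intro exI[of _ Vs]) auto
  next
    case False
    then have "independent K (u # Vs)" using Cons.prems Vs by (intro li_Cons) auto
    then show ?thesis using Vs by (intro exI[of _ "u # Vs"]) auto
  qed
qed auto

text \<open>Thinning the spanning set to a basis of its span bounds the length of every independent
  list in \<open>W\<close> by \<open>card G\<close>.\<close>

lemma dim_le:
  assumes "\<one> \<noteq> \<zero>" "submodule W base_field A" "finite G" "G \<subseteq> carrier A" "W \<subseteq> lin_span A G"
  shows "finite_dimension (scalars A) W" "dim (scalars A) W \<le> card G"
proof -
  let ?K = "scalars A"
  have K: "subfield ?K A" by (rule scalars_subfield[OF assms(1)])
  obtain Us where Us: "set Us = G" "distinct Us" using finite_distinct_list[OF assms(3)] by auto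
  have sp: "lin_span A G = Span ?K Us" using lin_span_eq_Span[of Us] assms Us by simp
  show fin: "finite_dimension ?K W"
    using subalbegra_incl_imp_finite_dimension[OF K Span_finite_dimension[OF K, of Us], of W] assms Us
    by (simp add: subalgebra_scalars_iff sp)
  have d: "dimension (dim ?K W) ?K W" using finite_dimensionE[OF K fin] by (simp add: over_def)
  obtain Vs where Vs: "independent ?K Vs" "length Vs = dim ?K W" "Span ?K Vs = W" "set Vs \<subseteq> carrier A"
    using exists_base[OF K d] by auto
  obtain Ws where Ws: "independent ?K Ws" "Span ?K Ws = Span ?K Us" "length Ws \<le> length Us"
    using basis_of_Span[OF K, of Us] assms Us by auto
  have "set Vs \<subseteq> Span ?K Ws" using Span_base_incl[OF K Vs(4)] Vs(3) assms(5) Ws(2) sp by auto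
  then have "length Vs \<le> length Ws" by (rule independent_length_le[OF K Vs(1) Ws(1)])
  also have "\<dots> \<le> card G" using Ws(3) Us distinct_card[OF Us(2)] by simp
  finally show "dim ?K W \<le> card G" using Vs by simp
qed

lemma dim_ge:
  assumes "\<one> \<noteq> \<zero>" "finite_dimension (scalars A) W" "independent (scalars A) Us" "set Us \<subseteq> W"
  shows "length Us \<le> dim (scalars A) W"
proof -
  let ?K = "scalars A"
  have K: "subfield ?K A" by (rule scalars_subfield[OF assms(1)])
  have d: "dimension (dim ?K W) ?K W" using finite_dimensionE[OF K assms(2)] by (simp add: over_def)
  show ?thesis by (rule independent_length_le_dimension[OF K d assms(3,4)])
qed

lemma finite_words: "finite S \<Longrightarrow> finite {foldr (\<lambda>s a. s \<otimes> a) ws \<one> | ws. set ws \<subseteq> S \<and> length ws \<le> n}"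
  using finite_lists_length_le[of S n] by (simp add: Setcompr_eq_image)

lemma words_carrier: "S \<subseteq> carrier A \<Longrightarrow> {foldr (\<lambda>s a. s \<otimes> a) ws \<one> | ws. set ws \<subseteq> S \<and> length ws \<le> n} \<subseteq> carrier A"
proof -
  assume S: "S \<subseteq> carrier A"
  have "foldr (\<lambda>s a. s \<otimes> a) ws \<one> \<in> carrier A" if "set ws \<subseteq> S" for ws
    using that S by (induction ws) auto
  then show ?thesis by auto
qed

lemma word_span_finite_dimension:
  assumes "\<one> \<noteq> \<zero>" "finite S" "S \<subseteq> carrier A"
  shows "finite_dimension (scalars A) (word_span A S n)"
  unfolding word_span_def
  by (rule dim_le(1)[OF assms(1) lin_span_submodule finite_words words_carrier subset_refl])
    (use assms words_carrier in auto)

lemma lin_span_mult: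
  assumes "G \<subseteq> carrier A" "G' \<subseteq> carrier A" "G'' \<subseteq> carrier A"
    and "\<And>a b. a \<in> G \<Longrightarrow> b \<in> G' \<Longrightarrow> a \<otimes> b \<in> lin_span A G''"
    and "x \<in> lin_span A G" "y \<in> lin_span A G'"
  shows "x \<otimes> y \<in> lin_span A G''"
proof -
  note c = lin_span_carrier[OF assms(1)] lin_span_carrier[OF assms(2)] lin_span_closed[OF assms(3)]
  have 1: "a \<otimes> y \<in> lin_span A G''" if a: "a \<in> G" for a
    using assms(6,2)
  proof (induction y rule: lin_span_induct)
    case zero
    then show ?case using a assms(1) c(3) by (simp add: subset_iff)
  next
    case (base s)
    then show ?case using assms(4) a by blast
  next
    case (add x y)
    moreover have "a \<in> carrier A" "x \<in> carrier A" "y \<in> carrier A" using a add c assms(1) by auto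
    ultimately show ?case using c(4) by (simp add: r_distr)
  next
    case (smult k x)
    moreover have "a \<in> carrier A" "x \<in> carrier A" using a smult c assms(1) by auto
    ultimately show ?case using c(5) by (simp add: smult_mult_r)
  qed
  have y: "y \<in> carrier A" using c(2) assms(6) by auto
  show ?thesis using assms(5,1)
  proof (induction x rule: lin_span_induct)
    case zero
    then show ?case using y c(3) by simp
  next
    case (base s)
    then show ?case using 1 by blast
  next
    case (add x x')
    moreover have "x \<in> carrier A" "x' \<in> carrier A" using add c by auto
    ultimately show ?case using c(4) y by (simp add: l_distr)
  next
    case (smult k x)
    moreover have "x \<in> carrier A" using smult c by auto
    ultimately show ?case using c(5) y by (simp add: smult_mult_l)
  qed
qed

lemma lin_span_mono: "G \<subseteq> G' \<Longrightarrow> lin_span A G \<subseteq> lin_span A G'"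
  by (auto simp: lin_span_def)

end

text \<open>The factor \<open>c\<close> contributes \<open>ln c / ln n\<close>, which tends to 0, so
  only the exponent of growth survives.\<close>

lemma log_power_limit:
  assumes "0 < c" shows "(\<lambda>n. ereal (log (real n) (c * real n ^ g))) \<longlonglongrightarrow> ereal (real g)"
proof -
  have "filterlim (\<lambda>n. ln (real n)) at_top sequentially"
    by (rule filterlim_compose[OF ln_at_top filterlim_real_sequentially])
  then have "filterlim (\<lambda>n. ln (real n)) at_infinity sequentially"
    by (rule filterlim_at_top_imp_at_infinity)
  then have "(\<lambda>n. ln c / ln (real n)) \<longlonglongrightarrow> 0"
    by (intro tendsto_divide_0[OF tendsto_const])
  then have "(\<lambda>n. ln c / ln (real n) + real g) \<longlonglongrightarrow> 0 + real g"
    by (intro tendsto_add tendsto_const)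
  moreover have "eventually (\<lambda>n. log (real n) (c * real n ^ g) = ln c / ln (real n) + real g) sequentially"
    using eventually_ge_at_top[of 2]
  proof eventually_elim
    case (elim n)
    then have "ln (real n) \<noteq> 0" by simp
    then show ?case using elim assms by (simp add: log_def ln_mult ln_realpow add_divide_distrib)
  qed
  ultimately have "(\<lambda>n. log (real n) (c * real n ^ g)) \<longlonglongrightarrow> real g"
    by (simp add: tendsto_cong)
  then show ?thesis by simp
qed

context k_algebra
begin

text \<open>A single finite set bounds the supremum from below; independent lists of size about
  \<open>c n^g\<close> in its word spans are enough.\<close>

lemma GK_dim_ge:
  assumes "\<one> \<noteq> \<zero>" "finite S" "S \<subseteq> B" "B \<subseteq> carrier A" "0 < c"
    and "\<And>n. \<exists>Us. independent (scalars A) Us \<and> set Us \<subseteq> word_span A S n \<and> c * real n ^ g \<le> real (length Us)"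
  shows "ereal (real g) \<le> GK_dim A B"
proof -
  have le: "c * real n ^ g \<le> real (dim (scalars A) (word_span A S n))" for n
  proof -
    obtain Us where Us: "independent (scalars A) Us" "set Us \<subseteq> word_span A S n" "c * real n ^ g \<le> real (length Us)"
      using assms(6) by blast
    have "length Us \<le> dim (scalars A) (word_span A S n)"
      by (rule dim_ge[OF assms(1) word_span_finite_dimension Us(1,2)]) (use assms in auto)
    then show ?thesis using Us(3) by linarith
  qed
  have "ereal (real g) = limsup (\<lambda>n. ereal (log (real n) (c * real n ^ g)))"
    using lim_imp_Limsup[OF _ log_power_limit[OF assms(5)]] by simp
  also have "\<dots> \<le> limsup (\<lambda>n. ereal (log (real n) (real (dim (scalars A) (word_span A S n)))))"
  proof (rule Limsup_mono)
    show "eventually (\<lambda>n. ereal (log (real n) (c * real n ^ g)) \<le> ereal (log (real n) (real (dim (scalars A) (word_span A S n))))) sequentially"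
      using eventually_ge_at_top[of 2]
    proof eventually_elim
      case (elim n)
      have "0 < c * real n ^ g" using assms(5) elim by simp
      then show ?case using le[of n] elim by simp
    qed
  qed
  also have "\<dots> \<le> GK_dim A B"
    unfolding GK_dim_def using assms by (intro SUP_upper) auto
  finally show ?thesis .
qed

lemma filtration_alg_gen:
  fixes G :: "nat \<Rightarrow> 'a set"
  assumes G: "\<And>d. G d \<subseteq> carrier A" "\<one> \<in> lin_span A (G 0)" "\<And>d e. d \<le> e \<Longrightarrow> G d \<subseteq> G e"
    and mult: "\<And>d e a b. a \<in> G d \<Longrightarrow> b \<in> G e \<Longrightarrow> a \<otimes> b \<in> lin_span A (G (d + e))"
    and S: "S \<subseteq> lin_span A (G 1)"
  shows "alg_gen A S \<subseteq> (\<Union>d. lin_span A (G d))"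
proof (rule alg_gen_minimal)
  have mono: "x \<in> lin_span A (G e)" if "x \<in> lin_span A (G d)" "d \<le> e" for x d e
    using lin_span_mono[OF G(3)[OF that(2)]] that(1) by auto
  show "is_subalgebra A (\<Union>d. lin_span A (G d))"
    unfolding subalgebra_iff
  proof (intro conjI ballI allI; (elim UN_E)?)
    show "(\<Union>d. lin_span A (G d)) \<subseteq> carrier A" using lin_span_carrier[OF G(1)] by blast
    show "\<one> \<in> (\<Union>d. lin_span A (G d))" using G(2) by blast
    show "x \<oplus> y \<in> (\<Union>d. lin_span A (G d))" if "x \<in> lin_span A (G d)" "y \<in> lin_span A (G e)" for x y d e
      using lin_span_closed(2)[OF G(1)[of "max d e"] mono[OF that(1) max.cobounded1] mono[OF that(2) max.cobounded2]] by blast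
    show "x \<otimes> y \<in> (\<Union>d. lin_span A (G d))" if "x \<in> lin_span A (G d)" "y \<in> lin_span A (G e)" for x y d e
      using lin_span_mult[OF G(1) G(1) G(1) mult that] by blast
    show "c \<odot> x \<in> (\<Union>d. lin_span A (G d))" if "x \<in> lin_span A (G d)" for c x d
      using lin_span_closed(3)[OF G(1) that] by blast
  qed
qed (use S in auto)

text \<open>A finite set lies in one layer \<open>D\<close> of the filtration, so its words of
  length \<open>n\<close> lie in layer \<open>D n\<close>, of dimension at most
  \<open>(D n + 1)^g\<close>. The dependence on \<open>D\<close> only affects the constant.\<close>

lemma GK_dim_le:
  assumes one: "\<one> \<noteq> \<zero>" and G: "\<And>d. G d \<subseteq> carrier A" "\<one> \<in> lin_span A (G 0)" "\<And>d e. d \<le> e \<Longrightarrow> G d \<subseteq> G e"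
    and mult: "\<And>d e a b. a \<in> G d \<Longrightarrow> b \<in> G e \<Longrightarrow> a \<otimes> b \<in> lin_span A (G (d + e))"
    and B: "B \<subseteq> (\<Union>d. lin_span A (G d))"
    and card: "\<And>d. finite (G d)" "\<And>d. card (G d) \<le> (d + 1) ^ g"
  shows "GK_dim A B \<le> ereal (real g)"
  unfolding GK_dim_def
proof (rule SUP_least)
  fix S assume "S \<in> {S. finite S \<and> S \<subseteq> B}"
  then have S: "finite S" "S \<subseteq> B" by auto
  have mono: "x \<in> lin_span A (G e)" if "x \<in> lin_span A (G d)" "d \<le> e" for x d e
    using lin_span_mono[OF G(3)[OF that(2)]] that(1) by auto
  have "\<exists>D. S \<subseteq> lin_span A (G D)"
    using S
  proof (induction S rule: finite_induct)
    case (insert x S)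
    then obtain D d where "S \<subseteq> lin_span A (G D)" "x \<in> lin_span A (G d)" using B by blast
    then have "insert x S \<subseteq> lin_span A (G (max D d))" using mono[of _ D "max D d"] mono[of _ d "max D d"] by auto
    then show ?case by blast
  qed auto
  then obtain D where D: "S \<subseteq> lin_span A (G D)" by blast
  have Sc: "S \<subseteq> carrier A" using D lin_span_carrier[OF G(1)] by blast
  have words: "foldr (\<lambda>s a. s \<otimes> a) ws \<one> \<in> lin_span A (G (D * length ws))" if "set ws \<subseteq> S" for ws
    using that
  proof (induction ws)
    case (Cons w ws)
    have "w \<otimes> foldr (\<lambda>s a. s \<otimes> a) ws \<one> \<in> lin_span A (G (D + D * length ws))"
      by (rule lin_span_mult[OF G(1) G(1) G(1) mult]) (use Cons D in auto)
    then show ?case by simp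
  qed (use G(2) in simp)
  have dim: "dim (scalars A) (word_span A S n) \<le> (D * n + 1) ^ g" for n
  proof -
    have "word_span A S n \<subseteq> lin_span A (G (D * n))"
      unfolding word_span_def
    proof (rule lin_span_minimal[OF lin_span_submodule[OF G(1)]], clarify)
      fix ws assume "set ws \<subseteq> S" "length ws \<le> n"
      then show "foldr (\<lambda>s a. s \<otimes> a) ws \<one> \<in> lin_span A (G (D * n))"
        by (intro mono[OF words]) auto
    qed
    then have "dim (scalars A) (word_span A S n) \<le> card (G (D * n))"
      using card(1) G(1) lin_span_submodule[OF words_carrier[OF Sc]]
      unfolding word_span_def by (intro dim_le(2)[OF one]) auto
    then show ?thesis using card(2)[of "D * n"] by simp
  qed
  let ?c = "(real D + 1) ^ g"
  have "limsup (\<lambda>n. ereal (log (real n) (real (dim (scalars A) (word_span A S n))))) \<le>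
    limsup (\<lambda>n. ereal (log (real n) (?c * real n ^ g)))"
  proof (rule Limsup_mono)
    show "eventually (\<lambda>n. ereal (log (real n) (real (dim (scalars A) (word_span A S n)))) \<le> ereal (log (real n) (?c * real n ^ g))) sequentially"
      using eventually_ge_at_top[of 2]
    proof eventually_elim
      case (elim n)
      let ?d = "dim (scalars A) (word_span A S n)"
      have "real ?d \<le> real ((D * n + 1) ^ g)" using dim[of n] by (simp only: of_nat_le_iff)
      also have "\<dots> = (real D * real n + 1) ^ g" by (simp add: add.commute)
      also have "\<dots> \<le> ((real D + 1) * real n) ^ g"
        using elim by (intro power_mono) (auto simp: algebra_simps)
      also have "\<dots> = ?c * real n ^ g" by (simp add: power_mult_distrib)
      finally have le: "real ?d \<le> ?c * real n ^ g" .
      have ge: "1 \<le> ?c * real n ^ g"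
      proof -
        have "1 \<le> ?c" "1 \<le> real n ^ g" using elim by (simp_all add: one_le_power)
        then show ?thesis using mult_mono[of 1 ?c 1 "real n ^ g"] by simp
      qed
      show ?case
      proof (cases "?d = 0")
        case True
        \<comment> \<open>Since \<open>ln 0 = 0\<close>, dimension zero has logarithm 0;
          monotonicity does not apply there, and the bound is compared with 0 directly.\<close>
        have "0 \<le> log (real n) (?c * real n ^ g)" using ge elim by (simp add: zero_le_log_cancel_iff)
        then show ?thesis using True by (simp add: log_def)
      next
        case False
        then show ?thesis using le ge elim by simp
      qed
    qed
  qed
  also have "\<dots> = ereal (real g)"
    using lim_imp_Limsup[OF _ log_power_limit[of ?c g]] by simp
  finally show "limsup (\<lambda>n. ereal (log (real n) (real (dim (scalars A) (word_span A S n))))) \<le> ereal (real g)" .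
qed

end

lemma alg_hom_image_lin_span:
  assumes "k_algebra A" "k_algebra B" "alg_hom A B h" "G \<subseteq> carrier A"
  shows "h ` lin_span A G = lin_span B (h ` G)"
proof -
  interpret A: k_algebra A by fact
  interpret B: k_algebra B by fact
  note h = alg_homD[OF assms(3)] alg_hom_zero[OF assms(1-3)]
  have hG: "h ` G \<subseteq> carrier B" using h(1) assms(4) by auto
  note cA = A.lin_span_closed[OF assms(4)] A.lin_span_carrier[OF assms(4)]
  note cB = B.lin_span_closed[OF hG]
  have "submodule {a \<in> carrier A. h a \<in> lin_span B (h ` G)} base_field A"
    using h cB by (auto simp: A.submodule_iff)
  then have "lin_span A G \<subseteq> {a \<in> carrier A. h a \<in> lin_span B (h ` G)}"
    by (rule A.lin_span_minimal) (use assms(4) B.lin_span_base[of "h ` G"] in auto)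
  moreover have "lin_span B (h ` G) \<subseteq> h ` lin_span A G"
  proof (rule B.lin_span_minimal)
    have "\<zero>\<^bsub>B\<^esub> \<in> h ` lin_span A G" using h(6) cA(1) by (metis imageI)
    moreover have "h x \<oplus>\<^bsub>B\<^esub> h y \<in> h ` lin_span A G" if "x \<in> lin_span A G" "y \<in> lin_span A G" for x y
      using h(3)[of x y] cA(2)[OF that] cA(4) that by (metis imageI subsetD)
    moreover have "c \<odot>\<^bsub>B\<^esub> h x \<in> h ` lin_span A G" if "x \<in> lin_span A G" for x c
      using h(5)[of x c] cA(3)[OF that] cA(4) that by (metis imageI subsetD)
    ultimately show "submodule (h ` lin_span A G) base_field B"
      using h(1) cA(4) by (auto simp: B.submodule_iff)
  qed (use A.lin_span_base[of G] in auto)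
  ultimately show ?thesis by auto
qed

text \<open>An injective homomorphism matches finite subsets and preserves the dimensions of their
  word spans, so GK-dimensions of subalgebras of \<open>H\<close> can be computed among
  operators.\<close>

lemma GK_dim_inj_hom:
  assumes "k_algebra A" "k_algebra B" "alg_hom A B h" "inj_on h (carrier A)" "S \<subseteq> carrier A" "\<one>\<^bsub>A\<^esub> \<noteq> \<zero>\<^bsub>A\<^esub>"
  shows "GK_dim B (h ` S) = GK_dim A S"
proof -
  interpret A: k_algebra A by fact
  interpret B: k_algebra B by fact
  note h = alg_homD[OF assms(3)] alg_hom_zero[OF assms(1-3)]
  interpret rh: ring_hom_ring A B h
    by (rule ring_hom_ringI[OF A.ring_axioms B.ring_axioms]) (use h in auto)
  have one: "\<one>\<^bsub>B\<^esub> \<noteq> \<zero>\<^bsub>B\<^esub>"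
    using inj_onD[OF assms(4), of "\<one>\<^bsub>A\<^esub>" "\<zero>\<^bsub>A\<^esub>"] h assms(6) by auto
  have words: "h (foldr (\<lambda>s a. s \<otimes>\<^bsub>A\<^esub> a) ws \<one>\<^bsub>A\<^esub>) = foldr (\<lambda>s a. s \<otimes>\<^bsub>B\<^esub> a) (map h ws) \<one>\<^bsub>B\<^esub> \<and>
      foldr (\<lambda>s a. s \<otimes>\<^bsub>A\<^esub> a) ws \<one>\<^bsub>A\<^esub> \<in> carrier A" if "set ws \<subseteq> carrier A" for ws
    using that by (induction ws) (use h in auto)
  have span: "word_span B (h ` S') n = h ` word_span A S' n" if S': "S' \<subseteq> carrier A" for S' n
  proof -
    have "{foldr (\<lambda>s a. s \<otimes>\<^bsub>B\<^esub> a) ws \<one>\<^bsub>B\<^esub> | ws. set ws \<subseteq> h ` S' \<and> length ws \<le> n}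
      = h ` {foldr (\<lambda>s a. s \<otimes>\<^bsub>A\<^esub> a) ws \<one>\<^bsub>A\<^esub> | ws. set ws \<subseteq> S' \<and> length ws \<le> n}"
    proof (intro equalityI subsetI)
      fix x assume "x \<in> {foldr (\<lambda>s a. s \<otimes>\<^bsub>B\<^esub> a) ws \<one>\<^bsub>B\<^esub> | ws. set ws \<subseteq> h ` S' \<and> length ws \<le> n}"
      then obtain ws where ws: "x = foldr (\<lambda>s a. s \<otimes>\<^bsub>B\<^esub> a) ws \<one>\<^bsub>B\<^esub>" "set ws \<subseteq> h ` S'" "length ws \<le> n" by auto
      have "ws \<in> lists (h ` S')" using ws(2) by (simp add: lists_eq_set)
      then have "ws \<in> map h ` lists S'" by (simp only: lists_image)
      then obtain vs where vs: "ws = map h vs" "set vs \<subseteq> S'"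
        unfolding lists_eq_set by blast
      then show "x \<in> h ` {foldr (\<lambda>s a. s \<otimes>\<^bsub>A\<^esub> a) ws \<one>\<^bsub>A\<^esub> | ws. set ws \<subseteq> S' \<and> length ws \<le> n}"
        using ws words[of vs] S' by (intro image_eqI[of _ _ "foldr (\<lambda>s a. s \<otimes>\<^bsub>A\<^esub> a) vs \<one>\<^bsub>A\<^esub>"]) auto
    next
      fix x assume "x \<in> h ` {foldr (\<lambda>s a. s \<otimes>\<^bsub>A\<^esub> a) ws \<one>\<^bsub>A\<^esub> | ws. set ws \<subseteq> S' \<and> length ws \<le> n}"
      then obtain ws where ws: "x = h (foldr (\<lambda>s a. s \<otimes>\<^bsub>A\<^esub> a) ws \<one>\<^bsub>A\<^esub>)" "set ws \<subseteq> S'" "length ws \<le> n" by auto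
      then have "x = foldr (\<lambda>s a. s \<otimes>\<^bsub>B\<^esub> a) (map h ws) \<one>\<^bsub>B\<^esub>" using words[of ws] S' by auto
      then show "x \<in> {foldr (\<lambda>s a. s \<otimes>\<^bsub>B\<^esub> a) ws \<one>\<^bsub>B\<^esub> | ws. set ws \<subseteq> h ` S' \<and> length ws \<le> n}"
        using ws by (intro CollectI exI[of _ "map h ws"]) auto
    qed
    then show ?thesis
      unfolding word_span_def using alg_hom_image_lin_span[OF assms(1-3) A.words_carrier[OF S']] by simp
  qed
  have sc: "h ` scalars A = scalars B" unfolding scalars_def image_image using h(2) h(5)[of "\<one>\<^bsub>A\<^esub>"] by simp
  have dim: "B.dim (scalars B) (h ` word_span A S' n) = A.dim (scalars A) (word_span A S' n)"
    if S': "finite S'" "S' \<subseteq> carrier A" for S' n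
  proof -
    let ?W = "word_span A S' n"
    have K: "subfield (scalars A) A" by (rule A.scalars_subfield[OF assms(6)])
    have d: "A.dimension (A.dim (scalars A) ?W) (scalars A) ?W"
      using A.finite_dimensionE[OF K A.word_span_finite_dimension[OF assms(6) S']] by (simp add: over_def)
    have "?W \<subseteq> carrier A" unfolding word_span_def by (rule A.lin_span_carrier[OF A.words_carrier[OF S'(2)]])
    then have "inj_on h ?W" using assms(4) inj_on_subset by blast
    then have "B.dimension (A.dim (scalars A) ?W) (scalars B) (h ` ?W)"
      using rh.inj_hom_dimension[OF K _ _ d] one unfolding sc by blast
    then show ?thesis using B.dimI[OF B.scalars_subfield[OF one]] by (simp add: over_def)
  qed
  have sets: "{S'. finite S' \<and> S' \<subseteq> h ` S} = (\<lambda>S'. h ` S') ` {S'. finite S' \<and> S' \<subseteq> S}"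
  proof (intro equalityI subsetI)
    fix S' assume "S' \<in> {S'. finite S' \<and> S' \<subseteq> h ` S}"
    then show "S' \<in> (\<lambda>S'. h ` S') ` {S'. finite S' \<and> S' \<subseteq> S}"
      using finite_subset_image[of S' h S] by blast
  qed auto
  show ?thesis
    unfolding GK_dim_def sets image_image
    by (rule SUP_cong[OF refl]) (use assms(5) span dim in auto)
qed

section \<open>Ore extensions inside the endomorphism algebra\<close>

lemma evp_scl_add: "evp scl u (r + s) = evp scl u r + evp scl u (s :: 'k::field_char_0 poly)"
  by (rule evp_add) (simp_all add: scl.\<iota>_add)

lemma evp_scl_smult: "evp scl u (smult c r) = scl c * evp scl u (r :: 'k::field_char_0 poly)"
  by (induction r) (simp_all add: evp_pCons scl.\<iota>_mult distrib_left mult.assoc)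

lemma evp_scl_diff: "evp scl u (r - s) = evp scl u r - evp scl u (s :: 'k::field_char_0 poly)"
  using evp_scl_add[of u "r - s" s] by simp

lemma evp_scl_mult: "evp scl u (r * s) = evp scl u r * evp scl u (s :: 'k::field_char_0 poly)"
proof (induction r)
  case (pCons c r)
  have "evp scl u (pCons c r * s) = scl c * evp scl u s + evp scl u r * evp scl u s * u"
    by (simp add: evp_scl_add evp_scl_smult evp_pCons pCons.IH)
  also have "\<dots> = scl c * evp scl u s + evp scl u r * (u * evp scl u s)"
    by (simp only: mult.assoc evp_scl_commute)
  also have "\<dots> = evp scl u (pCons c r) * evp scl u s"
    by (simp add: evp_pCons distrib_right mult.assoc)
  finally show ?case .
qed simp

lemma evp_scl_const [simp]: "evp scl u [:c:] = scl (c :: 'k::field_char_0)"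
  by (simp add: evp_pCons)

lemma evp_scl_var [simp]: "evp scl u [:0, 1 :: 'k::field_char_0:] = u"
  by (simp add: evp_pCons)

lemma evp_scl_one [simp]: "evp scl u (1 :: 'k::field_char_0 poly) = 1"
  by (simp add: one_pCons)

lemma evp_scl_monom: "evp scl u (monom c n) = scl c * u ^ n" for c :: "'k::field_char_0"
  by (induction n) (simp_all add: monom_0 monom_Suc evp_pCons power_commutes mult.assoc)

lemma evp_scl_pcompose: "evp scl u (pcompose r q) = evp scl (evp scl u q) (r :: 'k::field_char_0 poly)"
  by (induction r) (simp_all add: pcompose_pCons evp_scl_add evp_scl_mult evp_pCons evp_scl_commute)

definition transc :: "'k::field_char_0 lend \<Rightarrow> bool" where "transc u \<longleftrightarrow> (\<forall>r. evp scl u r = 0 \<longrightarrow> r = 0)"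

definition free_over :: "'k::field_char_0 lend set \<Rightarrow> 'k lend \<Rightarrow> bool"
  where "free_over K v \<longleftrightarrow> (\<forall>r N. (\<forall>n. r n \<in> K) \<longrightarrow> (\<Sum>n\<le>N. r n * v ^ n) = 0 \<longrightarrow> (\<forall>n\<le>N. r n = 0))"

lemma free_over_mono: "free_over K v \<Longrightarrow> K' \<subseteq> K \<Longrightarrow> free_over K' v"
  unfolding free_over_def by blast

lemma transc_scale: assumes "transc w" "a \<noteq> 0" shows "transc (scl a * w)"
  unfolding transc_def
proof (intro allI impI)
  fix r assume 0: "evp scl (scl a * w) r = 0"
  have "evp scl w [:0, a:] = scl a * w" by (simp add: evp_pCons)
  then have "evp scl w (pcompose r [:0, a:]) = 0" using 0 by (simp add: evp_scl_pcompose)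
  then have "pcompose r [:0, a:] = 0" using assms(1) by (simp add: transc_def)
  then show "r = 0" using assms(2) by (simp add: pcompose_eq_0_iff)
qed

lemma transc_inj: "transc u \<Longrightarrow> evp scl u r = evp scl u s \<longleftrightarrow> r = s"
  using evp_scl_diff[of u r s] unfolding transc_def by (metis right_minus_eq)

lemma evp_alg_gen: "alg_gen TA {u} = range (evp scl u)"
proof
  have "is_subalgebra TA (range (evp scl u))"
  proof -
    have "evp scl u r + evp scl u s \<in> range (evp scl u)" "evp scl u r * evp scl u s \<in> range (evp scl u)"
      "scl c * evp scl u r \<in> range (evp scl u)" "1 \<in> range (evp scl u)" for r s c
      by (metis evp_scl_add rangeI, metis evp_scl_mult rangeI, metis evp_scl_smult rangeI, metis evp_scl_one rangeI)
    then show ?thesis by (auto simp: scl.ta.subalgebra_iff)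
  qed
  moreover have "u \<in> range (evp scl u)" by (metis evp_scl_var rangeI)
  ultimately show "alg_gen TA {u} \<subseteq> range (evp scl u)"
    by (intro scl.ta.alg_gen_minimal) auto
  have "evp scl u r \<in> alg_gen TA {u}" for r
  proof (induction r)
    case 0
    then show ?case using TA_gen_closed(6)[of 0] by simp
  next
    case (pCons c r)
    have "evp scl u (pCons c r) = scl c + evp scl u r * u" by (simp add: evp_pCons)
    then show ?case using TA_gen_closed(1)[OF TA_gen_closed(6) TA_gen_closed(2)[OF pCons.IH(1) TA_gen_closed(7)]] by simp
  qed
  then show "range (evp scl u) \<subseteq> alg_gen TA {u}" by auto
qed

text \<open>Independence of a family, so that repeated values count as dependent and any
  duplicate-free list of indices yields an independent list.\<close>

definition lin_indep :: "('i \<Rightarrow> 'k::field_char_0 lend) \<Rightarrow> bool"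
  where "lin_indep f \<longleftrightarrow> (\<forall>I c. finite I \<longrightarrow> (\<Sum>i\<in>I. scl (c i) * f i) = 0 \<longrightarrow> (\<forall>i\<in>I. c i = 0))"

lemma transc_indep: assumes "transc u" shows "lin_indep (\<lambda>i. u ^ i)"
  unfolding lin_indep_def
proof (intro allI impI)
  fix I :: "nat set" and c :: "nat \<Rightarrow> 'a"
  assume I: "finite I" and 0: "(\<Sum>i\<in>I. scl (c i) * u ^ i) = 0"
  have "evp scl u (\<Sum>i\<in>J. monom (c i) i) = (\<Sum>i\<in>J. scl (c i) * u ^ i)" for J
    by (induction J rule: infinite_finite_induct) (simp_all add: evp_scl_add evp_scl_monom)
  then have p: "(\<Sum>i\<in>I. monom (c i) i) = 0" using 0 assms by (simp add: transc_def)
  show "\<forall>i\<in>I. c i = 0"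
  proof
    fix i assume i: "i \<in> I"
    have "coeff (\<Sum>i\<in>I. monom (c i) i) i = c i" using I i by (simp add: coeff_sum)
    then show "c i = 0" using p by simp
  qed
qed

text \<open>Tower argument: a relation is sorted by powers of \<open>v\<close>, freeness makes each
  coefficient in \<open>K\<close> vanish, and independence of \<open>g\<close> finishes.\<close>

lemma lin_indep_powers:
  fixes g :: "'i \<Rightarrow> 'k::field_char_0 lend"
  assumes g: "lin_indep g" "\<And>i. g i \<in> K" and K: "0 \<in> K" "\<And>a b. a \<in> K \<Longrightarrow> b \<in> K \<Longrightarrow> a + b \<in> K"
    "\<And>c a. a \<in> K \<Longrightarrow> scl c * a \<in> K" and free: "free_over K v"
  shows "lin_indep (\<lambda>(i, j). g i * v ^ j)"
  unfolding lin_indep_def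
proof (intro allI impI)
  fix F and c :: "'i \<times> nat \<Rightarrow> 'k"
  assume F: "finite F" and 0: "(\<Sum>x\<in>F. scl (c x) * (case x of (i, j) \<Rightarrow> g i * v ^ j)) = 0"
  define I where "I = fst ` F"
  define N where "N = Max (insert 0 (snd ` F))"
  have N: "j \<le> N" if "(i, j) \<in> F" for i j unfolding N_def using F that by (intro Max_ge) (auto intro: rev_image_eqI)
  have sub: "F \<subseteq> I \<times> {..N}" using N by (auto simp: I_def intro: rev_image_eqI)
  \<comment> \<open>Extending the coefficients by zero to a full rectangle of indices allows the sum
    to be reordered.\<close>
  define d where "d x = (if x \<in> F then c x else 0)" for x
  define r where "r j = (\<Sum>i\<in>I. scl (d (i, j)) * g i)" for j
  have I: "finite I" using F by (simp add: I_def)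
  have rK: "r j \<in> K" for j
  proof -
    have "(\<Sum>i\<in>J. scl (d (i, j)) * g i) \<in> K" for J
      by (induction J rule: infinite_finite_induct) (use K g(2) in auto)
    then show ?thesis by (simp add: r_def)
  qed
  have "(\<Sum>j\<le>N. r j * v ^ j) = (\<Sum>j\<le>N. \<Sum>i\<in>I. scl (d (i, j)) * (g i * v ^ j))"
    by (simp add: r_def sum_distrib_right mult.assoc)
  also have "\<dots> = (\<Sum>x\<in>I \<times> {..N}. scl (d x) * (case x of (i, j) \<Rightarrow> g i * v ^ j))"
    by (subst sum.swap) (simp add: sum.cartesian_product split_beta)
  also have "\<dots> = (\<Sum>x\<in>F. scl (d x) * (case x of (i, j) \<Rightarrow> g i * v ^ j))"
    by (rule sum.mono_neutral_right) (use I sub in \<open>auto simp: d_def\<close>)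
  also have "\<dots> = 0" using 0 by (simp add: d_def)
  finally have r0: "\<forall>j\<le>N. r j = 0" using free rK unfolding free_over_def by blast
  show "\<forall>x\<in>F. c x = 0"
  proof
    fix x assume x: "x \<in> F"
    obtain i j where ij: "x = (i, j)" by force
    have "r j = 0" using r0 N x ij by blast
    then have "\<forall>i\<in>I. d (i, j) = 0"
      using g(1)[unfolded lin_indep_def, THEN spec, THEN spec, of I "\<lambda>i. d (i, j)"] I by (simp add: r_def)
    then have "d (i, j) = 0" using x ij sub by blast
    then show "c x = 0" using x ij by (simp add: d_def)
  qed
qed

lemma lin_indep_independent:
  assumes f: "lin_indep f" and xs: "distinct xs"
  shows "ring.independent TA (scalars TA) (map f xs)"
  using xs
proof (induction xs)
  case Nil
  show ?case by simp
next
  case (Cons x xs)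
  let ?V = "{a. \<exists>c. a = (\<Sum>y\<in>set xs. scl (c y) * f y)}"
  have "submodule ?V base_field TA"
  proof -
    have "\<exists>c. 0 = (\<Sum>y\<in>set xs. scl (c y) * f y)" by (rule exI[of _ "\<lambda>_. 0"]) simp
    moreover have "\<exists>c. (\<Sum>y\<in>set xs. scl (c1 y) * f y) + (\<Sum>y\<in>set xs. scl (c2 y) * f y) = (\<Sum>y\<in>set xs. scl (c y) * f y)" for c1 c2
      by (rule exI[of _ "\<lambda>y. c1 y + c2 y"]) (simp add: scl.\<iota>_add distrib_right sum.distrib)
    moreover have "\<exists>c. scl k * (\<Sum>y\<in>set xs. scl (c1 y) * f y) = (\<Sum>y\<in>set xs. scl (c y) * f y)" for k c1
      by (rule exI[of _ "\<lambda>y. k * c1 y"]) (simp add: scl.\<iota>_mult sum_distrib_left mult.assoc)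
    ultimately show ?thesis by (auto simp: scl.ta.submodule_iff)
  qed
  moreover have "f ` set xs \<subseteq> ?V"
  proof
    fix a assume "a \<in> f ` set xs"
    then obtain z where z: "z \<in> set xs" "a = f z" by auto
    have "(\<Sum>y\<in>set xs. scl (if y = z then 1 else 0) * f y) = (\<Sum>y\<in>set xs. if y = z then f y else 0)"
      by (rule sum.cong) auto
    then show "a \<in> ?V" using z by (auto intro!: exI[of _ "\<lambda>y. if y = z then 1 else 0"])
  qed
  ultimately have "lin_span TA (f ` set xs) \<subseteq> ?V" by (rule scl.ta.lin_span_minimal)
  then have span: "scl.ta.Span (scalars TA) (map f xs) \<subseteq> ?V"
    using scl.ta.lin_span_eq_Span[of "map f xs"] by simp
  have "f x \<notin> ?V"
  proof
    assume "f x \<in> ?V"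
    then obtain c where c: "f x = (\<Sum>y\<in>set xs. scl (c y) * f y)" by blast
    define d where "d y = (if y = x then - 1 else c y)" for y
    have "(\<Sum>y\<in>set xs. scl (d y) * f y) = f x"
      unfolding c by (rule sum.cong) (use Cons.prems in \<open>auto simp: d_def\<close>)
    then have "(\<Sum>y\<in>insert x (set xs). scl (d y) * f y) = 0"
      using Cons.prems by (simp add: d_def scl.\<iota>_minus)
    then have "d x = 0" using f unfolding lin_indep_def by blast
    then show False by (simp add: d_def)
  qed
  then show ?case using span Cons by (auto intro!: scl.ta.li_Cons)
qed

lemma word_mem:
  fixes ws :: "'k::field_char_0 lend list"
  assumes "set ws \<subseteq> S" "length ws \<le> n" shows "prod_list ws \<in> word_span TA S n"
proof -
  have "foldr (\<lambda>s a. s \<otimes>\<^bsub>TA\<^esub> a) ws \<one>\<^bsub>TA\<^esub> = prod_list ws" by (induction ws) auto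
  then show ?thesis
    using assms scl.ta.lin_span_base[of "{foldr (\<lambda>s a. s \<otimes>\<^bsub>TA\<^esub> a) ws \<one>\<^bsub>TA\<^esub> | ws. set ws \<subseteq> S \<and> length ws \<le> n}"]
    unfolding word_span_def by (metis (mono_tags, lifting) mem_Collect_eq subsetD)
qed

lemma GK_ge1: assumes "transc u" "u \<in> B" shows "1 \<le> GK_dim TA B"
proof -
  have "ereal (real 1) \<le> GK_dim TA B"
  proof (rule scl.ta.GK_dim_ge[of "{u}" _ 1])
    fix n
    let ?Us = "map (\<lambda>i. u ^ i) [0..<Suc n]"
    have "u ^ i \<in> word_span TA {u} n" if "i \<le> n" for i
      using word_mem[of "replicate i u" "{u}" n] that
      by (simp add: prod_list_replicate set_replicate_conv_if split: if_splits)
    then show "\<exists>Us. scl.ta.independent (scalars TA) Us \<and> set Us \<subseteq> word_span TA {u} n \<and> 1 * real n ^ 1 \<le> real (length Us)"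
      using lin_indep_independent[OF transc_indep[OF assms(1)], of "[0..<Suc n]"]
      by (intro exI[of _ ?Us]) (auto simp del: upt_Suc)
  qed (use assms in auto)
  then show ?thesis by (simp add: one_ereal_def)
qed

lemma GK_ge2:
  assumes "lin_indep (\<lambda>(i, j). u ^ i * v ^ j)" "u \<in> B" "v \<in> B" shows "2 \<le> GK_dim TA B"
proof -
  have "ereal (real 2) \<le> GK_dim TA B"
  proof (rule scl.ta.GK_dim_ge[of "{u, v}" _ "1/4"])
    fix n
    \<comment> \<open>Exponents up to \<open>n div 2\<close> keep the words within length
      \<open>n\<close>. There are at least \<open>(n/2)^2\<close> such pairs, whence the constant
      \<open>1/4\<close>.\<close>
    let ?xs = "List.product [0..<Suc (n div 2)] [0..<Suc (n div 2)]"
    let ?Us = "map (\<lambda>(i, j). u ^ i * v ^ j) ?xs"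
    have "u ^ i * v ^ j \<in> word_span TA {u, v} n" if "i \<le> n div 2" "j \<le> n div 2" for i j
      using word_mem[of "replicate i u @ replicate j v" "{u, v}" n] that
      by (auto simp: prod_list_replicate set_replicate_conv_if split: if_splits)
    then have "set ?Us \<subseteq> word_span TA {u, v} n" by (auto simp del: upt_Suc)
    moreover have "scl.ta.independent (scalars TA) ?Us"
      by (rule lin_indep_independent[OF assms(1)]) (simp add: distinct_product del: upt_Suc)
    moreover have "1/4 * real n ^ 2 \<le> real (length ?Us)"
    proof -
      have "real n / 2 \<le> real (Suc (n div 2))" by linarith
      then have "(real n / 2) ^ 2 \<le> real (Suc (n div 2)) ^ 2" by (intro power_mono) auto
      moreover have "length ?Us = Suc (n div 2) ^ 2"
        by (simp add: power2_eq_square del: upt_Suc mult_Suc mult_Suc_right)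
      ultimately show ?thesis by (simp add: power_divide del: upt_Suc of_nat_Suc)
    qed
    ultimately show "\<exists>Us. scl.ta.independent (scalars TA) Us \<and> set Us \<subseteq> word_span TA {u, v} n \<and> 1/4 * real n ^ 2 \<le> real (length Us)"
      by blast
  qed (use assms in auto)
  then show ?thesis by simp
qed

lemma GK_ge3:
  assumes "lin_indep (\<lambda>((i, j), k). u ^ i * v ^ j * w ^ k)" "u \<in> B" "v \<in> B" "w \<in> B" shows "3 \<le> GK_dim TA B"
proof -
  have "ereal (real 3) \<le> GK_dim TA B"
  proof (rule scl.ta.GK_dim_ge[of "{u, v, w}" _ "1/27"])
    fix n
    \<comment> \<open>With three generators each exponent gets a third of the length, which gives
      the constant \<open>1/27\<close>.\<close>
    let ?m = "[0..<Suc (n div 3)]"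
    let ?xs = "List.product (List.product ?m ?m) ?m"
    let ?Us = "map (\<lambda>((i, j), k). u ^ i * v ^ j * w ^ k) ?xs"
    have "u ^ i * v ^ j * w ^ k \<in> word_span TA {u, v, w} n" if "i \<le> n div 3" "j \<le> n div 3" "k \<le> n div 3" for i j k
      using word_mem[of "replicate i u @ replicate j v @ replicate k w" "{u, v, w}" n] that
      by (auto simp: prod_list_replicate set_replicate_conv_if mult.assoc split: if_splits)
    then have "set ?Us \<subseteq> word_span TA {u, v, w} n" by (auto simp del: upt_Suc)
    moreover have "scl.ta.independent (scalars TA) ?Us"
      by (rule lin_indep_independent[OF assms(1)]) (simp add: distinct_product del: upt_Suc)
    moreover have "1/27 * real n ^ 3 \<le> real (length ?Us)"
    proof -
      have "real n / 3 \<le> real (Suc (n div 3))" by linarith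
      then have "(real n / 3) ^ 3 \<le> real (Suc (n div 3)) ^ 3" by (intro power_mono) auto
      moreover have "length ?Us = Suc (n div 3) ^ 3"
        by (simp add: power3_eq_cube del: upt_Suc mult_Suc mult_Suc_right)
      ultimately show ?thesis by (simp add: power_divide del: upt_Suc of_nat_Suc)
    qed
    ultimately show "\<exists>Us. scl.ta.independent (scalars TA) Us \<and> set Us \<subseteq> word_span TA {u, v, w} n \<and> 1/27 * real n ^ 3 \<le> real (length Us)"
      by blast
  qed (use assms in auto)
  then show ?thesis by simp
qed

lemma GK_le0: "GK_dim TA (range scl) \<le> 0"
proof -
  have "GK_dim TA (range scl) \<le> ereal (real 0)"
  proof (rule scl.ta.GK_dim_le[of "\<lambda>_. {1}"])
    have 1: "1 \<in> lin_span TA {1}" using scl.ta.lin_span_base[of "{1}"] by auto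
    then show "range scl \<subseteq> (\<Union>d::nat. lin_span TA {1})"
      using scl.ta.lin_span_closed(3)[of "{1}" 1] by auto
    show "a \<otimes>\<^bsub>TA\<^esub> b \<in> lin_span TA {1}" if "a \<in> {1}" "b \<in> {1}" for a b using that 1 by simp
  qed (use scl.ta.lin_span_base[of "{1}"] in auto)
  then show ?thesis by (simp add: zero_ereal_def)
qed

lemma GK_le1: "GK_dim TA (alg_gen TA {u}) \<le> 1"
proof -
  let ?G = "\<lambda>d. (\<lambda>i. u ^ i) ` {..d}"
  have base: "u ^ i \<in> lin_span TA (?G d)" if "i \<le> d" for i d
    using scl.ta.lin_span_base[of "?G d"] that by auto
  have one: "\<one>\<^bsub>TA\<^esub> \<in> lin_span TA (?G 0)" using base[of 0 0] by simp
  have mult: "a \<otimes>\<^bsub>TA\<^esub> b \<in> lin_span TA (?G (d + e))" if "a \<in> ?G d" "b \<in> ?G e" for a b d e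
    using that base by (auto simp: power_add[symmetric])
  have sub: "alg_gen TA {u} \<subseteq> (\<Union>d. lin_span TA (?G d))"
    by (rule scl.ta.filtration_alg_gen) (use one mult base[of 1 1] in auto)
  have "GK_dim TA (alg_gen TA {u}) \<le> ereal (real 1)"
    by (rule scl.ta.GK_dim_le[of ?G, OF _ _ one _ mult sub]) (auto intro: order_trans[OF card_image_le])
  then show ?thesis by (simp add: one_ereal_def)
qed

section \<open>Algebras with two generators and one quadratic skew relation\<close>

context
  fixes u v :: "'k::field_char_0 lend" and \<alpha> \<beta> \<gamma> :: 'k
  assumes rel: "v * u = u * v + scl \<alpha> * u + scl \<beta> * (u * u) + scl \<gamma> * v"
begin

text \<open>One relation covers all planes: \<open>\<alpha> = 1\<close> for \<open>Y, X\<close>,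
  then \<open>\<alpha> = c\<close> and \<open>\<beta> = -1/2\<close> for \<open>vii\<close>, and
  \<open>\<gamma> = -1\<close> for \<open>viii\<close>. Its correction terms have total degree at
  most 2, so ordered monomials filtered by total degree are compatible with products.\<close>

abbreviation "GG d \<equiv> (\<lambda>(i, j). u ^ i * v ^ j) ` {(i, j). i + j \<le> d}"
abbreviation "LG d \<equiv> lin_span TA (GG d)"

lemma LG_base: "i + j \<le> d \<Longrightarrow> u ^ i * v ^ j \<in> LG d"
  using scl.ta.lin_span_base[of "GG d"] by auto

lemma LG_closed: "a \<in> LG d \<Longrightarrow> b \<in> LG d \<Longrightarrow> a + b \<in> LG d" "a \<in> LG d \<Longrightarrow> scl c * a \<in> LG d" "0 \<in> LG d"
  using scl.ta.lin_span_closed[of "GG d"] by auto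

lemma LG_mono: "a \<in> LG d \<Longrightarrow> d \<le> e \<Longrightarrow> a \<in> LG e"
proof -
  assume a: "a \<in> LG d" "d \<le> e"
  then have "GG d \<subseteq> GG e" by auto
  then show ?thesis using scl.ta.lin_span_mono a(1) by blast
qed

lemma LG_induct [consumes 1]:
  assumes "a \<in> LG d" "\<And>i j. i + j \<le> d \<Longrightarrow> P (u ^ i * v ^ j)" "\<And>a b. P a \<Longrightarrow> P b \<Longrightarrow> P (a + b)"
    "\<And>c a. P a \<Longrightarrow> P (scl c * a)" "P 0"
  shows "P a"
  using assms(1) by (rule scl.ta.lin_span_induct) (use assms(2-) in auto)

lemma u_LG: "a \<in> LG d \<Longrightarrow> u * a \<in> LG (Suc d)"
proof (induction rule: LG_induct)
  case (1 i j)
  then show ?case using LG_base[of "Suc i" j "Suc d"] by (simp add: mult.assoc)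
qed (auto simp: distrib_left scl.\<iota>_left_commute[of u] intro: LG_closed)

lemma LG_v: "a \<in> LG d \<Longrightarrow> a * v ^ k \<in> LG (d + k)"
proof (induction rule: LG_induct)
  case (1 i j)
  then show ?case using LG_base[of i "j + k" "d + k"] by (simp add: mult.assoc power_add)
qed (auto simp: distrib_right mult.assoc intro: LG_closed)

text \<open>One factor \<open>u\<close> is crossed at a time; the corrections stay within the degree
  bound, and the term with \<open>\<gamma>\<close> is again covered by the induction
  hypothesis.\<close>

lemma v_u_power: "v * u ^ i \<in> LG (Suc i)"
proof (induction i)
  case 0
  then show ?case using LG_base[of 0 1 1] by simp
next
  case (Suc i)
  have "v * u ^ Suc i = (v * u) * u ^ i" by (simp add: mult.assoc)
  also have "\<dots> = u * (v * u ^ i) + scl \<alpha> * u ^ Suc i + scl \<beta> * u ^ Suc (Suc i) + scl \<gamma> * (v * u ^ i)"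
    by (simp add: rel distrib_right mult.assoc)
  also have "\<dots> \<in> LG (Suc (Suc i))"
    using LG_base[of "Suc i" 0 "Suc (Suc i)"] LG_base[of "Suc (Suc i)" 0 "Suc (Suc i)"]
    by (intro LG_closed u_LG Suc.IH LG_mono[OF Suc.IH]) auto
  finally show ?case .
qed

lemma v_LG: "a \<in> LG d \<Longrightarrow> v * a \<in> LG (Suc d)"
proof (induction rule: LG_induct)
  case (1 i j)
  have "(v * u ^ i) * v ^ j \<in> LG (Suc i + j)" by (rule LG_v[OF v_u_power])
  then show ?case using 1 LG_mono[of _ "Suc i + j" "Suc d"] by (simp add: mult.assoc)
qed (auto simp: distrib_left scl.\<iota>_left_commute[of v] intro: LG_closed)

lemma GG_mult: assumes "a \<in> GG d" "b \<in> GG e" shows "a * b \<in> LG (d + e)"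
proof -
  obtain i j where a: "a = u ^ i * v ^ j" "i + j \<le> d" using assms(1) by auto
  have b: "b \<in> LG e" using assms(2) scl.ta.lin_span_base[of "GG e"] by auto
  have 1: "v ^ j * b \<in> LG (e + j)" for j
    by (induction j) (use b v_LG in \<open>auto simp: mult.assoc\<close>)
  have "u ^ i * c \<in> LG (m + i)" if "c \<in> LG m" for c m
    by (induction i) (use that u_LG in \<open>auto simp: mult.assoc\<close>)
  from this[OF 1] have "u ^ i * (v ^ j * b) \<in> LG (e + j + i)" .
  then show ?thesis using a LG_mono[of _ "e + j + i" "d + e"] by (simp add: mult.assoc)
qed

lemma GG_alg_gen: "alg_gen TA {u, v} \<subseteq> (\<Union>d. LG d)"
proof (rule scl.ta.filtration_alg_gen)
  show "a \<otimes>\<^bsub>TA\<^esub> b \<in> LG (d + e)" if "a \<in> GG d" "b \<in> GG e" for a b d e using GG_mult[OF that] by simp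
  show "{u, v} \<subseteq> LG 1" using LG_base[of 1 0 1] LG_base[of 0 1 1] by simp
  show "\<one>\<^bsub>TA\<^esub> \<in> LG 0" using LG_base[of 0 0 0] by simp
qed auto

lemma GK_le2: "GK_dim TA (alg_gen TA {u, v}) \<le> 2"
proof -
  have sub: "{(i, j). i + j \<le> d} \<subseteq> {..d} \<times> {..d}" for d :: nat by auto
  then have fin: "finite {(i, j). i + j \<le> d}" for d :: nat by (rule finite_subset) simp
  have card: "card (GG d) \<le> (d + 1) ^ 2" for d
  proof -
    have "card (GG d) \<le> card {(i, j). i + j \<le> d}" by (rule card_image_le[OF fin])
    also have "\<dots> \<le> card ({..d} \<times> {..d})" by (rule card_mono[OF _ sub]) simp
    finally show ?thesis by (simp add: power2_eq_square)
  qed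
  have "GK_dim TA (alg_gen TA {u, v}) \<le> ereal (real 2)"
  proof (rule scl.ta.GK_dim_le[of "\<lambda>d. GG d", OF _ _ _ _ _ GG_alg_gen _ card])
    show "a \<otimes>\<^bsub>TA\<^esub> b \<in> LG (d + e)" if "a \<in> GG d" "b \<in> GG e" for a b d e using GG_mult[OF that] by simp
    show "\<one>\<^bsub>TA\<^esub> \<in> LG 0" using LG_base[of 0 0 0] by simp
  qed (use fin in auto)
  then show ?thesis by simp
qed

text \<open>The shape of expansion that \<open>is_ore_extension\<close> asks for, with the sum over
  the support of \<open>f\<close>.\<close>

definition "fin_sum f = (\<Sum>n\<in>{n. f n \<noteq> 0}. f n * v ^ n)"

lemma fin_sum_bound:
  fixes f :: "nat \<Rightarrow> 'k lend" assumes "{n. f n \<noteq> 0} \<subseteq> {..N}" shows "fin_sum f = (\<Sum>n\<le>N. f n * v ^ n)"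
  unfolding fin_sum_def using assms by (intro sum.mono_neutral_left) auto

lemma ore_expansion_ex:
  assumes "s \<in> alg_gen TA {u, v}"
  shows "\<exists>f. range f \<subseteq> alg_gen TA {u} \<and> finite {n. f n \<noteq> 0} \<and> s = fin_sum f"
proof -
  let ?K = "alg_gen TA {u}"
  let ?P = "\<lambda>s. \<exists>f. range f \<subseteq> ?K \<and> finite {n. f n \<noteq> 0} \<and> s = fin_sum f"
  obtain d where "s \<in> LG d" using GG_alg_gen assms by blast
  then show ?thesis
  proof (induction rule: LG_induct)
    case (1 i j)
    let ?f = "\<lambda>n. if n = j then u ^ i else 0"
    have "0 \<in> ?K" using TA_gen_closed(6)[of 0] by simp
    then have "range ?f \<subseteq> ?K" using TA_gen_closed(8)[OF TA_gen_closed(7)[of u "{u}"]] by auto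
    moreover have "{n. ?f n \<noteq> 0} \<subseteq> {..j}" by auto
    moreover from this have "fin_sum ?f = u ^ i * v ^ j"
      by (simp add: fin_sum_bound if_distrib[of "\<lambda>a. a * _"] cong: if_cong)
    ultimately show ?case by (intro exI[of _ ?f]) (auto intro: finite_subset)
  next
    case (2 a b)
    then obtain f g where f: "range f \<subseteq> ?K" "finite {n. f n \<noteq> 0}" "a = fin_sum f"
      and g: "range g \<subseteq> ?K" "finite {n. g n \<noteq> 0}" "b = fin_sum g" by blast
    obtain N where N: "{n. f n \<noteq> 0} \<subseteq> {..N}" "{n. g n \<noteq> 0} \<subseteq> {..N}"
      using f(2) g(2) finite_nat_set_iff_bounded_le[of "{n. f n \<noteq> 0} \<union> {n. g n \<noteq> 0}"] by auto
    let ?h = "\<lambda>n. f n + g n"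
    have h: "{n. ?h n \<noteq> 0} \<subseteq> {..N}" using N by (force simp: subset_iff)
    have "a + b = fin_sum ?h"
      using fin_sum_bound[OF N(1)] fin_sum_bound[OF N(2)] fin_sum_bound[OF h] f(3) g(3)
      by (simp add: distrib_right sum.distrib)
    moreover have "range ?h \<subseteq> ?K" using f(1) g(1) by (auto intro!: TA_gen_closed(1))
    ultimately show ?case using h by (intro exI[of _ ?h]) (auto intro: finite_subset)
  next
    case (3 c a)
    then obtain f where f: "range f \<subseteq> ?K" "finite {n. f n \<noteq> 0}" "a = fin_sum f" by blast
    obtain N where N: "{n. f n \<noteq> 0} \<subseteq> {..N}"
      using f(2) finite_nat_set_iff_bounded_le[of "{n. f n \<noteq> 0}"] by auto
    let ?h = "\<lambda>n. scl c * f n"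
    have h: "{n. ?h n \<noteq> 0} \<subseteq> {..N}" using N by (force simp: subset_iff)
    have "scl c * a = fin_sum ?h"
      using fin_sum_bound[OF N] fin_sum_bound[OF h] f(3) by (simp add: sum_distrib_left mult.assoc)
    moreover have "range ?h \<subseteq> ?K" using f(1) by (auto intro!: TA_gen_closed(4))
    ultimately show ?case using h by (intro exI[of _ ?h]) (auto intro: finite_subset)
  next
    case 4
    have "0 \<in> ?K" using TA_gen_closed(6)[of 0] by simp
    then show ?case by (intro exI[of _ "\<lambda>_. 0"]) (auto simp: fin_sum_def)
  qed
qed

lemma ore_expansion_unique:
  assumes free: "free_over (alg_gen TA {u}) v"
    and f: "range f \<subseteq> alg_gen TA {u}" "finite {n. f n \<noteq> 0}" and g: "range g \<subseteq> alg_gen TA {u}" "finite {n. g n \<noteq> 0}"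
    and eq: "fin_sum f = fin_sum g"
  shows "f = g"
proof -
  obtain N where N: "{n. f n \<noteq> 0} \<subseteq> {..N}" "{n. g n \<noteq> 0} \<subseteq> {..N}"
    using f(2) g(2) finite_nat_set_iff_bounded_le[of "{n. f n \<noteq> 0} \<union> {n. g n \<noteq> 0}"] by auto
  let ?h = "\<lambda>n. f n - g n"
  have zero: "(\<Sum>n\<le>N. ?h n * v ^ n) = 0"
    using eq fin_sum_bound[OF N(1)] fin_sum_bound[OF N(2)] by (simp add: left_diff_distrib sum_subtractf)
  have "?h n \<in> alg_gen TA {u}" for n using f(1) g(1) by (intro TA_gen_closed(3)) auto
  then have h: "?h n = 0" if "n \<le> N" for n
    using free[unfolded free_over_def, THEN spec, THEN spec, of ?h N] zero that by simp
  show "f = g"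
  proof
    fix n show "f n = g n"
    proof (cases "n \<le> N")
      case False
      then have "f n = 0" "g n = 0" using N by (auto simp: subset_iff)
      then show ?thesis by simp
    qed (use h in auto)
  qed
qed

text \<open>\<open>\<delta>\<close> is determined by \<open>\<sigma>\<close> through
  \<open>v r = \<sigma> r v + \<delta> r\<close>, and its skew Leibniz rule is then an identity.
  Expansions exist by ordered monomials and are unique by freeness.\<close>

lemma ore_extensionI:
  assumes free: "free_over (alg_gen TA {u}) v"
    and \<sigma>: "bij_betw \<sigma> (alg_gen TA {u}) (alg_gen TA {u})" "\<sigma> 1 = 1"
      "\<And>r s. r \<in> alg_gen TA {u} \<Longrightarrow> s \<in> alg_gen TA {u} \<Longrightarrow> \<sigma> (r + s) = \<sigma> r + \<sigma> s"
      "\<And>r s. r \<in> alg_gen TA {u} \<Longrightarrow> s \<in> alg_gen TA {u} \<Longrightarrow> \<sigma> (r * s) = \<sigma> r * \<sigma> s"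
      "\<And>c r. r \<in> alg_gen TA {u} \<Longrightarrow> \<sigma> (scl c * r) = scl c * \<sigma> r"
    and \<delta>: "\<And>r. r \<in> alg_gen TA {u} \<Longrightarrow> \<delta> r = v * r - \<sigma> r * v" "\<And>r. r \<in> alg_gen TA {u} \<Longrightarrow> \<delta> r \<in> alg_gen TA {u}"
  shows "is_ore_extension TA (alg_gen TA {u}) v \<sigma> \<delta> (alg_gen TA {u, v})"
proof -
  let ?K = "alg_gen TA {u}" and ?S = "alg_gen TA {u, v}"
  have KS: "?K \<subseteq> ?S" by (rule scl.ta.alg_gen_minimal[OF TA_gen_subalgebra]) (auto intro: TA_gen_closed(7))
  have iso: "\<sigma> \<in> ring_iso (TA\<lparr>carrier := ?K\<rparr>) (TA\<lparr>carrier := ?K\<rparr>)"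
    using \<sigma> by (auto simp: ring_iso_def ring_hom_def bij_betw_def)
  have unique: "\<exists>!f :: nat \<Rightarrow> 'k lend. range f \<subseteq> ?K \<and> finite {n. f n \<noteq> 0} \<and> s = fin_sum f" if "s \<in> ?S" for s
    using ore_expansion_ex[OF that] ore_expansion_unique[OF free] by blast
  have \<delta>d: "\<delta> (r * s) = \<sigma> r * \<delta> s + \<delta> r * s" if "r \<in> ?K" "s \<in> ?K" for r s
    using that TA_gen_closed(2)[OF that] by (simp add: \<delta>(1) \<sigma>(4) algebra_simps)
  have \<delta>a: "\<delta> (r + s) = \<delta> r + \<delta> s" if "r \<in> ?K" "s \<in> ?K" for r s
    using that TA_gen_closed(1)[OF that] by (simp add: \<delta>(1) \<sigma>(3) algebra_simps)
  have \<delta>s: "\<delta> (scl c * r) = scl c * \<delta> r" if "r \<in> ?K" for r c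
    using that TA_gen_closed(4)[OF that] by (simp add: \<delta>(1) \<sigma>(5) right_diff_distrib mult.assoc scl.\<iota>_left_commute[of v])
  have dec: "v * r = \<sigma> r * v + \<delta> r" if "r \<in> ?K" for r using \<delta>(1)[OF that] by simp
  show ?thesis
    unfolding is_ore_extension_def
    using TA_gen_subalgebra[of "{u}"] TA_gen_subalgebra[of "{u, v}"] KS TA_gen_closed(7)[of v "{u, v}"] iso \<sigma>(5) \<delta>(2) \<delta>a \<delta>s \<delta>d dec unique
    by (simp add: fin_sum_def)
qed

text \<open>With \<open>\<gamma> = 0\<close> the commutator of \<open>v\<close> and \<open>u\<close>
  lies in \<open>k[u]\<close>; being a derivation, commutation with \<open>v\<close> then maps all
  of \<open>k[u]\<close> into itself.\<close>

lemma ore_derI: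
  assumes "free_over (alg_gen TA {u}) v" "\<gamma> = 0"
  shows "is_ore_extension TA (alg_gen TA {u}) v (\<lambda>r. r) (\<lambda>r. v * r - r * v) (alg_gen TA {u, v})"
proof (rule ore_extensionI[OF assms(1)])
  show "v * r - r * v \<in> alg_gen TA {u}" if rK: "r \<in> alg_gen TA {u}" for r
  proof -
    have 1: "v * u - u * v = scl \<alpha> * u + scl \<beta> * (u * u)" using rel assms(2) by simp
    have u: "u \<in> alg_gen TA {u}" by (rule TA_gen_closed(7)) simp
    obtain p where p: "r = evp scl u p" using rK unfolding evp_alg_gen by blast
    show ?thesis unfolding p
    proof (induction p)
      case 0
      then show ?case using TA_gen_closed(6)[of 0] by simp
    next
      case (pCons c p)
      let ?p = "evp scl u p"
      have pm: "?p \<in> alg_gen TA {u}" by (simp add: evp_alg_gen)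
      have "v * evp scl u (pCons c p) - evp scl u (pCons c p) * v = (v * ?p - ?p * v) * u + ?p * (v * u - u * v)"
        by (simp add: evp_pCons algebra_simps scl.\<iota>_central[of v])
      also have "\<dots> \<in> alg_gen TA {u}" unfolding 1
        by (intro TA_gen_closed(1) TA_gen_closed(2) TA_gen_closed(4) pCons.IH pm u)
      finally show ?case .
    qed
  qed
qed (auto simp: bij_betw_def inj_on_def)

text \<open>The relation reads \<open>v u = (u - 1) v\<close>. Transcendence of \<open>u\<close>
  makes the substitution \<open>u \<mapsto> u - 1\<close> well defined on \<open>k[u]\<close>, and
  \<open>u \<mapsto> u + 1\<close> inverts it.\<close>

lemma ore_autI:
  assumes "free_over (alg_gen TA {u}) v" "\<alpha> = 0" "\<beta> = 0" "\<gamma> = - 1" "transc u"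
  obtains \<sigma> where "is_ore_extension TA (alg_gen TA {u}) v \<sigma> (\<lambda>_. 0) (alg_gen TA {u, v})" "\<sigma> u = u - 1"
proof -
  let ?K = "alg_gen TA {u}"
  define \<sigma> where "\<sigma> f = evp scl (u - 1) (inv_into UNIV (evp scl u) f)" for f
  have inj: "inj (evp scl u)" using transc_inj[OF assms(5)] by (auto intro: injI)
  have \<sigma>: "\<sigma> (evp scl u r) = evp scl (u - 1) r" for r unfolding \<sigma>_def by (simp add: inv_into_f_f[OF inj])
  have K: "\<exists>r. f = evp scl u r" if "f \<in> ?K" for f using that unfolding evp_alg_gen by blast
  have shift: "evp scl (u - 1) r = evp scl u (pcompose r [:- 1, 1:])" for r
    by (simp add: evp_scl_pcompose) (simp add: evp_pCons scl.\<iota>_minus)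
  have unshift: "evp scl u r = evp scl (u - 1) (pcompose r [:1, 1:])" for r
    by (simp add: evp_scl_pcompose) (simp add: evp_pCons)
  have su: "\<sigma> u = u - 1" using \<sigma>[of "[:0, 1:]"] by simp
  have vu: "v * u = (u - 1) * v" using rel assms(2-4) by (simp add: scl.\<iota>_minus algebra_simps)
  have comm: "v * evp scl u r = evp scl (u - 1) r * v" for r
  proof (induction r)
    case (pCons c r)
    have "v * evp scl u (pCons c r) = scl c * v + (v * u) * evp scl u r"
      by (simp add: evp_pCons distrib_left evp_scl_commute scl.\<iota>_central[of v] mult.assoc)
    also have "\<dots> = scl c * v + (u - 1) * (v * evp scl u r)" by (simp only: vu mult.assoc)
    also have "\<dots> = evp scl (u - 1) (pCons c r) * v"
      by (simp add: pCons.IH evp_pCons distrib_right evp_scl_commute mult.assoc)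
    finally show ?case .
  qed simp
  have "is_ore_extension TA ?K v \<sigma> (\<lambda>_. 0) (alg_gen TA {u, v})"
  proof (rule ore_extensionI[OF assms(1)])
    show "bij_betw \<sigma> ?K ?K"
    proof (rule bij_betw_imageI)
      show "inj_on \<sigma> ?K"
      proof (rule inj_onI)
        fix f g assume "f \<in> ?K" "g \<in> ?K" "\<sigma> f = \<sigma> g"
        then obtain r s where rs: "f = evp scl u r" "g = evp scl u s" "evp scl (u - 1) r = evp scl (u - 1) s"
          using K \<sigma> by metis
        then have "pcompose r [:- 1, 1:] = pcompose s [:- 1, 1:]"
          unfolding shift transc_inj[OF assms(5)] by simp
        then have "pcompose (r - s) [:- 1, 1:] = 0" by (simp add: pcompose_diff)
        then have "r - s = 0" by (simp add: pcompose_eq_0_iff)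
        then show "f = g" using rs by simp
      qed
      show "\<sigma> ` ?K = ?K"
      proof (intro equalityI subsetI)
        fix f assume "f \<in> \<sigma> ` ?K"
        then obtain r where "f = evp scl (u - 1) r" using K \<sigma> by (metis imageE)
        then show "f \<in> ?K" unfolding shift evp_alg_gen by blast
      next
        fix f assume "f \<in> ?K"
        then obtain r where "f = evp scl u r" using K by blast
        then have "f = \<sigma> (evp scl u (pcompose r [:1, 1:]))" unfolding \<sigma> using unshift by simp
        then show "f \<in> \<sigma> ` ?K" unfolding evp_alg_gen by blast
      qed
    qed
    show "\<sigma> 1 = 1" using \<sigma>[of 1] by simp
    fix r s c assume r: "r \<in> ?K"
    then obtain p where p: "r = evp scl u p" using K by blast
    show "\<sigma> (scl c * r) = scl c * \<sigma> r" using \<sigma>[of "smult c p"] by (simp add: p \<sigma> evp_scl_smult)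
    show "0 = v * r - \<sigma> r * v" by (simp add: p \<sigma> comm)
    show "0 \<in> ?K" using TA_gen_closed(6)[of 0] by simp
    assume "s \<in> ?K"
    then obtain q where q: "s = evp scl u q" using K by blast
    show "\<sigma> (r + s) = \<sigma> r + \<sigma> s" using \<sigma>[of "p + q"] by (simp add: p q \<sigma> evp_scl_add)
    show "\<sigma> (r * s) = \<sigma> r * \<sigma> s" using \<sigma>[of "p * q"] by (simp add: p q \<sigma> evp_scl_mult)
  qed
  then show thesis using su by (rule that)
qed

end

section \<open>Transcendence, freeness and dimensions for the concrete generators\<close>

context
  fixes l :: "'k::field_char_0"
begin

text \<open>The kernel is stable under differentiation, by \<open>pderiv_cu\<close>, and contains no
  nonzero constant.\<close>

lemma cu_eq_0: "cu l a r = 0 \<Longrightarrow> r = 0"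
proof (induction "degree r" arbitrary: r rule: less_induct)
  case less
  show ?case
  proof (cases "degree r = 0")
    case True
    then obtain c where "r = [:c:]" using deg0E by blast
    then show ?thesis using less.prems by simp
  next
    case False
    have "cu l a (pderiv r) = 0" using pderiv_cu[of l a r] less.prems by simp
    then have "pderiv r = 0" using less.hyps[of "pderiv r"] False by (simp add: degree_pderiv)
    then show ?thesis using False by (simp add: pderiv_eq_0_iff)
  qed
qed

lemma transc_u: "transc (xo l + scl a * yo l)"
  unfolding transc_def
proof (intro allI impI)
  fix r assume "evp scl (xo l + scl a * yo l) r = 0"
  then have "polyu l a r = 0" by (simp add: polyu_def)
  then have "cu l a r = 0" by (simp add: cu_def)
  then show "r = 0" by (rule cu_eq_0)
qed

lemma evp_yo: "evp scl (yo l) r = op l [:[:r:]:]"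
proof (induction r)
  case 0
  then show ?case using op_const[of l 0] by simp
next
  case (pCons c r)
  have c: "yo l * op l [:[:r:]:] = op l [:[:r:]:] * yo l"
    using evp_scl_commute[of "yo l" r] by (simp add: pCons.IH)
  have "evp scl (yo l) (pCons c r) = scl c + yo l * op l [:[:r:]:]"
    unfolding c by (simp add: evp_pCons pCons.IH)
  then show ?case by (simp only: op_polyY)
qed

lemma transc_yo: "transc (yo l)"
  unfolding transc_def
proof (intro allI impI)
  fix r assume "evp scl (yo l) r = 0"
  then have "coord (op l [:[:r:]:]) = 0" by (simp only: evp_yo coord_simps)
  then show "r = 0" by simp
qed

lemma transc_primitive: assumes "(a, b) \<noteq> (0, 0)" shows "transc (scl a * xo l + scl b * yo l)"
proof (cases "a = 0")
  case True
  then show ?thesis using assms transc_scale[OF transc_yo, of b] by simp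
next
  case False
  have "scl a * (xo l + scl (b / a) * yo l) = scl a * xo l + scl b * yo l"
    using False by (simp add: distrib_left mult.assoc[symmetric] scl.\<iota>_mult[symmetric])
  then show ?thesis using transc_scale[OF transc_u[of "b / a"] False] by simp
qed

abbreviation "KB \<equiv> range (\<lambda>q. op l [:q:])"

lemma KB_subalgebra: "is_subalgebra TA KB"
proof -
  have "op l [:p:] + op l [:q:] = op l [:p + q:]" for p q using op_add[of l "[:p:]" "[:q:]"] by simp
  moreover have "op l [:p:] * op l [:q:] = op l [:actB l p q:]" for p q
  proof (rule EE_eqI[of _ l])
    show "coord (op l [:p:] * op l [:q:]) = coord (op l [:actB l p q:])"
      by (rule poly_eqI) (simp add: coord_op_const coeff_pCons split: nat.split)
  qed (auto intro: EE_closed)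
  moreover have "scl c * op l [:q:] = op l [:smult [:c:] q:]" for c q using op_scale[of l c "[:q:]"] by simp
  moreover have "1 = op l [:[:[:1:]:]:]" using op_const[of l 1] by simp
  ultimately show ?thesis unfolding scl.ta.subalgebra_iff type_alg_simps by (auto; metis rangeI)
qed

lemma KB_closed:
  "a \<in> KB \<Longrightarrow> b \<in> KB \<Longrightarrow> a + b \<in> KB" "a \<in> KB \<Longrightarrow> b \<in> KB \<Longrightarrow> a * b \<in> KB" "a \<in> KB \<Longrightarrow> scl c * a \<in> KB"
  "1 \<in> KB" "0 \<in> KB"
proof -
  show "a \<in> KB \<Longrightarrow> b \<in> KB \<Longrightarrow> a + b \<in> KB" "a \<in> KB \<Longrightarrow> b \<in> KB \<Longrightarrow> a * b \<in> KB" and c: "a \<in> KB \<Longrightarrow> scl c * a \<in> KB" for a c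
    using KB_subalgebra unfolding scl.ta.subalgebra_iff type_alg_simps by blast+
  show "1 \<in> KB" using KB_subalgebra unfolding scl.ta.subalgebra_iff type_alg_simps by blast
  from c[OF this, of 0] show "0 \<in> KB" by simp
qed

lemma KB_gens: "xo l \<in> KB" "yo l \<in> KB"
proof -
  have "xo l = op l [:vX:]" "yo l = op l [:vY:]" by (rule EE_eqI[of _ l]; auto intro: EE_closed)+
  then show "xo l \<in> KB" "yo l \<in> KB" by blast+
qed

text \<open>The powers of \<open>v\<close> are monic in \<open>Z\<close> of increasing degree, so
  the highest coefficient of a relation vanishes and can be peeled off.\<close>

lemma free_over_Z: assumes "v = zo l + op l [:p:]" shows "free_over KB v"
  unfolding free_over_def
proof (intro allI impI)
  fix r :: "nat \<Rightarrow> 'k lend" and N n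
  assume r: "\<forall>n. r n \<in> KB" and 0: "(\<Sum>n\<le>N. r n * v ^ n) = 0" and n: "n \<le> N"
  have "\<forall>n. \<exists>q. r n = op l [:q:]" using r by blast
  then obtain q where q: "\<And>n. r n = op l [:q n:]" by metis
  have "\<forall>n\<le>N. q n = 0"
    using 0
  proof (induction N)
    case (Suc N)
    have top: "coeff (coord (r n * v ^ n)) (Suc N) = (if n = Suc N then q n else 0)" if "n \<le> Suc N" for n
      using top_B_mult_Z_power[OF assms, of n "q n"] that by (auto simp: q top_def)
    have "coord (\<Sum>n\<in>J. r n * v ^ n) = (\<Sum>n\<in>J. coord (r n * v ^ n))" for J
      by (induction J rule: infinite_finite_induct) simp_all
    then have "(\<Sum>n\<le>Suc N. coeff (coord (r n * v ^ n)) (Suc N)) = 0"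
      using Suc.prems by (metis coeff_0 coeff_sum coord_simps(6))
    also have "(\<Sum>n\<le>Suc N. coeff (coord (r n * v ^ n)) (Suc N)) = (\<Sum>n\<le>Suc N. if n = Suc N then q n else 0)"
      by (rule sum.cong) (use top in auto)
    also have "\<dots> = q (Suc N)" by simp
    finally have z: "q (Suc N) = 0" .
    then have "r (Suc N) = 0" using op_const[of l 0] by (simp add: q)
    then have "(\<Sum>n\<le>N. r n * v ^ n) = 0" using Suc.prems by simp
    then show ?case using Suc.IH z le_Suc_eq by auto
  next
    case 0
    then have "coord (op l [:q 0:]) = 0" by (simp add: q[symmetric])
    then show ?case by simp
  qed
  then show "r n = 0" using n op_const[of l 0] by (simp add: q)
qed

lemma op_monom: "op l [:monom r n:] = op l [:[:r:]:] * xo l ^ n"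
proof (induction n)
  case (Suc n)
  have "op l [:[:0:]:] = 0" using op_const[of l 0] by simp
  then show ?case using op_pCons[of l 0 "monom r n"] Suc by (simp add: monom_Suc mult.assoc power_commutes)
qed (simp add: monom_0)

text \<open>A sum of polynomials in \<open>Y\<close> times powers of \<open>X\<close> is already in
  normal form, so its coefficients can be read off from \<open>coord\<close>.\<close>

lemma free_over_X: "free_over (alg_gen TA {yo l}) (xo l)"
  unfolding free_over_def
proof (intro allI impI)
  fix r :: "nat \<Rightarrow> 'k lend" and N n
  assume r: "\<forall>n. r n \<in> alg_gen TA {yo l}" and 0: "(\<Sum>n\<le>N. r n * xo l ^ n) = 0" and n: "n \<le> N"
  have "\<forall>n. \<exists>q. r n = op l [:[:q:]:]" using r unfolding evp_alg_gen evp_yo by blast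
  then obtain q where q: "\<And>n. r n = op l [:[:q n:]:]" by metis
  have s: "(\<Sum>n\<in>J. r n * xo l ^ n) = op l [:\<Sum>n\<in>J. monom (q n) n:]" if "finite J" for J
    using that
  proof (induction J rule: finite_induct)
    case empty
    then show ?case using op_const[of l 0] by simp
  next
    case (insert x J)
    then show ?case
      using op_add[of l "[:monom (q x) x:]" "[:\<Sum>n\<in>J. monom (q n) n:]"] by (simp add: q op_monom[symmetric])
  qed
  have "coord (op l [:\<Sum>n\<le>N. monom (q n) n:]) = 0" using 0 s[of "{..N}"] by simp
  then have z: "(\<Sum>n\<le>N. monom (q n) n) = 0" by simp
  have "coeff (\<Sum>n\<le>N. monom (q n) n) n = q n" using n by (simp add: coeff_sum)
  then have "q n = 0" using z by simp
  then show "r n = 0" using op_const[of l 0] by (simp add: q)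
qed

lemma free_gen_Z:
  assumes "u \<in> KB" "v = zo l + op l [:p:]" shows "free_over (alg_gen TA {u}) v"
  using free_over_Z[OF assms(2)] scl.ta.alg_gen_minimal[OF KB_subalgebra, of "{u}"] assms(1)
  by (auto intro: free_over_mono)

lemma indep_of_free:
  assumes "transc u" "free_over (alg_gen TA {u}) v" shows "lin_indep (\<lambda>(i, j). u ^ i * v ^ j)"
proof (rule lin_indep_powers[OF transc_indep[OF assms(1)] _ _ _ _ assms(2)])
  show "0 \<in> alg_gen TA {u}" using TA_gen_closed(6)[of 0] by simp
qed (auto intro: TA_gen_closed)

lemma GK_line: "(a, b) \<noteq> (0, 0) \<Longrightarrow> GK_dim TA (alg_gen TA {scl a * xo l + scl b * yo l}) = 1"
  by (rule antisym[OF GK_le1 GK_ge1[OF transc_primitive TA_gen_closed(7)]]) simp_all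

lemma GK_plane:
  assumes "v * u = u * v + scl \<alpha> * u + scl \<beta> * (u * u) + scl \<gamma> * v" "transc u" "free_over (alg_gen TA {u}) v"
  shows "GK_dim TA (alg_gen TA {u, v}) = 2"
  by (intro antisym GK_le2[OF assms(1)] GK_ge2[OF indep_of_free[OF assms(2,3)]] TA_gen_closed(7)) auto

lemma rel_yx: "xo l * yo l = yo l * xo l + scl 1 * yo l + scl 0 * (yo l * yo l) + scl 0 * xo l"
  by (simp add: xy_commute)

lemma rel_vii: "vii l c * yo l = yo l * vii l c + scl c * yo l + scl (- (1/2)) * (yo l * yo l) + scl 0 * vii l c"
  unfolding vii_commute by (simp add: scl.\<iota>_minus)

lemma rel_viii: "l = 0 \<Longrightarrow> viii l a b * (xo l + scl a * yo l) = (xo l + scl a * yo l) * viii l a b +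
   scl 0 * (xo l + scl a * yo l) + scl 0 * ((xo l + scl a * yo l) * (xo l + scl a * yo l)) + scl (- 1) * viii l a b"
  unfolding viii_commute by (simp add: scl.\<iota>_minus)

lemma free_vii: "free_over (alg_gen TA {yo l}) (vii l c)"
  by (rule free_gen_Z[OF KB_gens(2) vii_eq])

lemma free_viii: "free_over (alg_gen TA {xo l + scl a * yo l}) (viii l a b)"
proof (rule free_gen_Z[OF _ viii_eq])
  show "xo l + scl a * yo l \<in> KB"
    by (intro KB_closed KB_gens)
qed

text \<open>The PBW monomials form a tower: powers of \<open>Y\<close>, then of \<open>X\<close>
  over \<open>k[Y]\<close>, then of \<open>Z\<close> over \<open>KB\<close>.\<close>

lemma GK_full: "3 \<le> GK_dim TA (range (rep l))"
proof (rule GK_ge3)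
  have 1: "lin_indep (\<lambda>(i, j). yo l ^ i * xo l ^ j)" by (rule indep_of_free[OF transc_yo free_over_X])
  have pow: "a ^ n \<in> KB" if "a \<in> KB" for a n 
  proof (induction n)
    case 0
    show ?case unfolding power_0 by (rule KB_closed)
  next
    case (Suc n)
    show ?case unfolding power_Suc by (rule KB_closed(2)[OF that Suc])
  qed
  have "lin_indep (\<lambda>(x, k). (case x of (i, j) \<Rightarrow> yo l ^ i * xo l ^ j) * zo l ^ k)"
  proof (rule lin_indep_powers[OF 1 _ KB_closed(5,1,3)])
    show "(case x of (i, j) \<Rightarrow> yo l ^ i * xo l ^ j) \<in> KB" for x
      by (cases x) (simp only: prod.case KB_closed(2)[OF pow[OF KB_gens(2)] pow[OF KB_gens(1)]])
    show "free_over KB (zo l)" by (rule free_over_Z[of _ 0]) (use op_const[of l 0] in simp)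
  qed
  moreover have "(\<lambda>(x, k). (case x of (i, j) \<Rightarrow> yo l ^ i * xo l ^ j) * zo l ^ k) = (\<lambda>((i, j), k). yo l ^ i * xo l ^ j * zo l ^ k)"
    by (auto simp: fun_eq_iff)
  ultimately show "lin_indep (\<lambda>((i, j), k). yo l ^ i * xo l ^ j * zo l ^ k)" by simp
qed (rule EE_closed(6))+

text \<open>If the two algebras agree, each generator is a polynomial in the other and the
  polynomials compose to the identity, so both have degree 1. Comparing coordinates of
  \<open>?w'\<close> and \<open>c + t ?w\<close> gives proportionality.\<close>

lemma line_eq_iff:
  assumes ab: "(a, b) \<noteq> (0, 0)" "(a', b') \<noteq> (0, 0)"
  shows "alg_gen TA {scl a * xo l + scl b * yo l} = alg_gen TA {scl a' * xo l + scl b' * yo l} \<longleftrightarrow>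
    (\<exists>t. t \<noteq> 0 \<and> a' = t * a \<and> b' = t * b)" (is "alg_gen TA {?w} = alg_gen TA {?w'} \<longleftrightarrow> ?R")
proof
  assume ?R
  then obtain t where t: "t \<noteq> 0" "a' = t * a" "b' = t * b" by blast
  have w: "?w' = scl t * ?w" by (simp add: t scl.\<iota>_mult distrib_left mult.assoc)
  have w': "?w = scl (inverse t) * ?w'"
    using t(1) by (simp only: w mult.assoc[symmetric] scl.\<iota>_mult[symmetric]) simp
  have "?w' \<in> alg_gen TA {?w}" unfolding w by (rule TA_gen_closed(4), rule TA_gen_closed(7)) simp
  moreover have "?w \<in> alg_gen TA {?w'}" using TA_gen_closed(4)[OF TA_gen_closed(7)[of ?w' "{?w'}"], of "inverse t"] unfolding w'[symmetric] by blast
  ultimately show "alg_gen TA {?w} = alg_gen TA {?w'}"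
    using scl.ta.alg_gen_minimal[OF TA_gen_subalgebra, of "{?w}" "{?w'}"]
      scl.ta.alg_gen_minimal[OF TA_gen_subalgebra, of "{?w'}" "{?w}"] by blast
next
  assume eq: "alg_gen TA {?w} = alg_gen TA {?w'}"
  have "?w' \<in> alg_gen TA {?w}" "?w \<in> alg_gen TA {?w'}" 
    using TA_gen_closed(7)[of ?w' "{?w'}"] TA_gen_closed(7)[of ?w "{?w}"] by (simp_all only: eq singletonI)
  then obtain p q where p: "?w' = evp scl ?w p" and q: "?w = evp scl ?w' q" unfolding evp_alg_gen by blast
  have "evp scl ?w (pcompose q p) = evp scl ?w [:0, 1:]"
    using p q by (simp add: evp_scl_pcompose)
  then have "pcompose q p = [:0, 1:]" using transc_inj[OF transc_primitive[OF ab(1)]] by blast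
  then have "degree q * degree p = 1" using degree_pcompose[of q p] by simp
  then have "degree p = 1" by simp
  moreover from this obtain c t where ct: "p = [:c, t:]" using deg1E[of p] by auto
  ultimately have t: "t \<noteq> 0" by auto
  have "?w' = scl c + scl t * ?w" using p ct by (simp add: evp_pCons)
  then have "coord ?w' = coord (scl c + scl t * ?w)" by simp
  then have "a' = t * a \<and> b' = t * b" by simp
  then show ?R using t by blast
qed

end

section \<open>Transport along injective homomorphisms\<close>

lemma alg_hom_pow:
  assumes "k_algebra A" "k_algebra B" "alg_hom A B h" "v \<in> carrier A"
  shows "h (v [^]\<^bsub>A\<^esub> (n::nat)) = h v [^]\<^bsub>B\<^esub> n"
proof -
  interpret A: k_algebra A by fact
  interpret B: k_algebra B by fact
  show ?thesis
    by (induction n) (simp_all add: alg_homD[OF assms(3)] assms(4))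
qed

context
  fixes A :: "('k::field, 'a, 'm) module_scheme" and B :: "('k, 'b, 'n) module_scheme" and h
  assumes kA: "k_algebra A" and kB: "k_algebra B" and h: "alg_hom A B h" and inj: "inj_on h (carrier A)"
begin

interpretation A: k_algebra A by (rule kA)
interpretation B: k_algebra B by (rule kB)

lemma is_transcendental_transfer:
  assumes "u \<in> carrier A" "is_transcendental B (h u)" shows "is_transcendental A u"
  unfolding is_transcendental_def
proof (rule injI)
  let ?F = "\<lambda>p :: 'k poly. \<Oplus>\<^bsub>A\<^esub>i\<in>{..Polynomial.degree p}. coeff p i \<odot>\<^bsub>A\<^esub> (u [^]\<^bsub>A\<^esub> i)"
  have "h (?F p) = (\<Oplus>\<^bsub>B\<^esub>i\<in>{..Polynomial.degree p}. coeff p i \<odot>\<^bsub>B\<^esub> (h u [^]\<^bsub>B\<^esub> i))" for p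
  proof -
    have "h (?F p) = (\<Oplus>\<^bsub>B\<^esub>i\<in>{..Polynomial.degree p}. h (coeff p i \<odot>\<^bsub>A\<^esub> (u [^]\<^bsub>A\<^esub> i)))"
      by (rule alg_hom_finsum[OF kA kB h]) (use assms(1) in auto)
    then show ?thesis by (simp add: alg_homD(5)[OF h] alg_hom_pow[OF kA kB h] assms(1))
  qed
  then show "p = q" if "?F p = ?F q" for p q
    using injD[OF assms(2)[unfolded is_transcendental_def], of p q] that by metis
qed

text \<open>Identities and memberships are reflected by the injective \<open>h\<close>, and
  expansions correspond one to one because their coefficients lie in \<open>h\<close>
  \<open>R\<close>.\<close>

lemma is_ore_extension_transfer:
  assumes ore: "is_ore_extension B (h ` R) (h v) \<sigma>' \<delta>' (h ` S)"
    and R: "is_subalgebra A R" and S: "is_subalgebra A S" and RS: "R \<subseteq> S" and v: "v \<in> S"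
    and \<sigma>: "\<And>r. r \<in> R \<Longrightarrow> \<sigma> r \<in> carrier A" "\<And>r. r \<in> R \<Longrightarrow> h (\<sigma> r) = \<sigma>' (h r)"
    and \<delta>: "\<And>r. r \<in> R \<Longrightarrow> \<delta> r \<in> carrier A" "\<And>r. r \<in> R \<Longrightarrow> h (\<delta> r) = \<delta>' (h r)"
  shows "is_ore_extension A R v \<sigma> \<delta> S"
proof -
  note E = ore[unfolded is_ore_extension_def]
  have Rc: "r \<in> carrier A" if "r \<in> R" for r using R that unfolding A.subalgebra_iff by blast
  have Sc: "r \<in> carrier A" if "r \<in> S" for r using S that unfolding A.subalgebra_iff by blast
  have R1: "\<one>\<^bsub>A\<^esub> \<in> R"
    and Rcl: "\<And>r s. r \<in> R \<Longrightarrow> s \<in> R \<Longrightarrow> r \<oplus>\<^bsub>A\<^esub> s \<in> R" "\<And>r s. r \<in> R \<Longrightarrow> s \<in> R \<Longrightarrow> r \<otimes>\<^bsub>A\<^esub> s \<in> R"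
      "\<And>c r. r \<in> R \<Longrightarrow> c \<odot>\<^bsub>A\<^esub> r \<in> R"
    using R unfolding A.subalgebra_iff by simp_all
  have eq: "a = b" if "h a = h b" "a \<in> carrier A" "b \<in> carrier A" for a b using inj_onD[OF inj that] .
  have reflect: "a \<in> R" if "h a \<in> h ` R" "a \<in> carrier A" for a using that eq Rc by (metis imageE)
  note hs = alg_homD(3-5)[OF h] alg_homD(2)[OF h]
  have iso: "\<sigma>' \<in> ring_iso (B\<lparr>carrier := h ` R\<rparr>) (B\<lparr>carrier := h ` R\<rparr>)" using E by (elim conjE)
  have E1: "\<forall>c. \<forall>r\<in>h ` R. \<sigma>' (c \<odot>\<^bsub>B\<^esub> r) = c \<odot>\<^bsub>B\<^esub> \<sigma>' r" using E by (elim conjE)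
  have E2: "\<delta>' \<in> h ` R \<rightarrow> h ` R" using E by (elim conjE)
  have E3: "\<forall>r\<in>h ` R. \<forall>s\<in>h ` R. \<delta>' (r \<oplus>\<^bsub>B\<^esub> s) = \<delta>' r \<oplus>\<^bsub>B\<^esub> \<delta>' s" using E by (elim conjE)
  have E4: "\<forall>c. \<forall>r\<in>h ` R. \<delta>' (c \<odot>\<^bsub>B\<^esub> r) = c \<odot>\<^bsub>B\<^esub> \<delta>' r" using E by (elim conjE)
  have E5: "\<forall>r\<in>h ` R. \<forall>s\<in>h ` R. \<delta>' (r \<otimes>\<^bsub>B\<^esub> s) = \<sigma>' r \<otimes>\<^bsub>B\<^esub> \<delta>' s \<oplus>\<^bsub>B\<^esub> \<delta>' r \<otimes>\<^bsub>B\<^esub> s" using E by (elim conjE)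
  have E6: "\<forall>r\<in>h ` R. h v \<otimes>\<^bsub>B\<^esub> r = \<sigma>' r \<otimes>\<^bsub>B\<^esub> h v \<oplus>\<^bsub>B\<^esub> \<delta>' r" using E by (elim conjE)
  have E7: "\<forall>s\<in>h ` S. \<exists>!f :: nat \<Rightarrow> 'b. range f \<subseteq> h ` R \<and> finite {n. f n \<noteq> \<zero>\<^bsub>B\<^esub>} \<and>
      s = (\<Oplus>\<^bsub>B\<^esub>n\<in>{n. f n \<noteq> \<zero>\<^bsub>B\<^esub>}. f n \<otimes>\<^bsub>B\<^esub> (h v [^]\<^bsub>B\<^esub> n))" using E by (elim conjE)
  have bij': "bij_betw \<sigma>' (h ` R) (h ` R)" using iso by (simp add: ring_iso_def)
  have \<sigma>R: "\<sigma> r \<in> R" if "r \<in> R" for r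
    using reflect[OF _ \<sigma>(1)[OF that]] bij' that \<sigma>(2)[OF that] by (auto simp: bij_betw_def)
  have \<delta>R: "\<delta> r \<in> R" if "r \<in> R" for r
  proof -
    have "\<delta>' (h r) \<in> h ` R" using E2 that by (auto simp: Pi_iff)
    then show ?thesis using reflect[OF _ \<delta>(1)[OF that]] \<delta>(2)[OF that] by simp
  qed
  have bij: "bij_betw \<sigma> R R"
  proof (rule bij_betw_imageI)
    show "inj_on \<sigma> R"
    proof (rule inj_onI)
      fix r s assume rs: "r \<in> R" "s \<in> R" "\<sigma> r = \<sigma> s"
      then have "\<sigma>' (h r) = \<sigma>' (h s)" using \<sigma>(2) by metis
      then have "h r = h s" using bij' rs by (auto simp: bij_betw_def dest: inj_onD)
      then show "r = s" using eq Rc rs by blast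
    qed
    show "\<sigma> ` R = R"
    proof (intro equalityI subsetI)
      fix t assume t: "t \<in> R"
      then have "h t \<in> \<sigma>' ` h ` R" using bij' by (simp add: bij_betw_def)
      then obtain r where r: "r \<in> R" "h t = \<sigma>' (h r)" by blast
      then have "t = \<sigma> r" using eq[of t "\<sigma> r"] \<sigma> Rc t by simp
      then show "t \<in> \<sigma> ` R" using r by blast
    qed (use \<sigma>R in blast)
  qed
  have \<sigma>h: "\<sigma>' (h r \<oplus>\<^bsub>B\<^esub> h s) = \<sigma>' (h r) \<oplus>\<^bsub>B\<^esub> \<sigma>' (h s)" "\<sigma>' (h r \<otimes>\<^bsub>B\<^esub> h s) = \<sigma>' (h r) \<otimes>\<^bsub>B\<^esub> \<sigma>' (h s)" "\<sigma>' \<one>\<^bsub>B\<^esub> = \<one>\<^bsub>B\<^esub>"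
    if "r \<in> R" "s \<in> R" for r s
    using iso that by (auto simp: ring_iso_def ring_hom_def)
  have s1: "\<sigma> (r \<oplus>\<^bsub>A\<^esub> s) = \<sigma> r \<oplus>\<^bsub>A\<^esub> \<sigma> s" if "r \<in> R" "s \<in> R" for r s
    using that Rc Rcl \<sigma> by (intro eq) (simp_all add: hs \<sigma>h)
  have s2: "\<sigma> (r \<otimes>\<^bsub>A\<^esub> s) = \<sigma> r \<otimes>\<^bsub>A\<^esub> \<sigma> s" if "r \<in> R" "s \<in> R" for r s
    using that Rc Rcl \<sigma> by (intro eq) (simp_all add: hs \<sigma>h)
  have s3: "\<sigma> \<one>\<^bsub>A\<^esub> = \<one>\<^bsub>A\<^esub>"
    using R1 Rc \<sigma> \<sigma>h(3)[OF R1 R1] by (intro eq) (simp_all add: hs)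
  have s4: "\<sigma> (c \<odot>\<^bsub>A\<^esub> r) = c \<odot>\<^bsub>A\<^esub> \<sigma> r" if "r \<in> R" for r c
  proof (rule eq)
    have "\<sigma>' (c \<odot>\<^bsub>B\<^esub> h r) = c \<odot>\<^bsub>B\<^esub> \<sigma>' (h r)" using E1 that by simp
    then show "h (\<sigma> (c \<odot>\<^bsub>A\<^esub> r)) = h (c \<odot>\<^bsub>A\<^esub> \<sigma> r)" using that Rc Rcl \<sigma> by (simp add: hs)
  qed (use that Rc Rcl \<sigma> in auto)
  have d1: "\<delta> (r \<oplus>\<^bsub>A\<^esub> s) = \<delta> r \<oplus>\<^bsub>A\<^esub> \<delta> s" if "r \<in> R" "s \<in> R" for r s
  proof (rule eq)
    have "\<delta>' (h r \<oplus>\<^bsub>B\<^esub> h s) = \<delta>' (h r) \<oplus>\<^bsub>B\<^esub> \<delta>' (h s)" using E3 that by simp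
    then show "h (\<delta> (r \<oplus>\<^bsub>A\<^esub> s)) = h (\<delta> r \<oplus>\<^bsub>A\<^esub> \<delta> s)" using that Rc Rcl \<delta> by (simp add: hs)
  qed (use that Rc Rcl \<delta> in auto)
  have d2: "\<delta> (c \<odot>\<^bsub>A\<^esub> r) = c \<odot>\<^bsub>A\<^esub> \<delta> r" if "r \<in> R" for r c
  proof (rule eq)
    have "\<delta>' (c \<odot>\<^bsub>B\<^esub> h r) = c \<odot>\<^bsub>B\<^esub> \<delta>' (h r)" using E4 that by simp
    then show "h (\<delta> (c \<odot>\<^bsub>A\<^esub> r)) = h (c \<odot>\<^bsub>A\<^esub> \<delta> r)" using that Rc Rcl \<delta> by (simp add: hs)
  qed (use that Rc Rcl \<delta> in auto)
  have d3: "\<delta> (r \<otimes>\<^bsub>A\<^esub> s) = \<sigma> r \<otimes>\<^bsub>A\<^esub> \<delta> s \<oplus>\<^bsub>A\<^esub> \<delta> r \<otimes>\<^bsub>A\<^esub> s" if "r \<in> R" "s \<in> R" for r s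
  proof (rule eq)
    have "\<delta>' (h r \<otimes>\<^bsub>B\<^esub> h s) = \<sigma>' (h r) \<otimes>\<^bsub>B\<^esub> \<delta>' (h s) \<oplus>\<^bsub>B\<^esub> \<delta>' (h r) \<otimes>\<^bsub>B\<^esub> h s" using E5 that by simp
    then show "h (\<delta> (r \<otimes>\<^bsub>A\<^esub> s)) = h (\<sigma> r \<otimes>\<^bsub>A\<^esub> \<delta> s \<oplus>\<^bsub>A\<^esub> \<delta> r \<otimes>\<^bsub>A\<^esub> s)" using that Rc Rcl \<delta> \<sigma> by (simp add: hs)
  qed (use that Rc Rcl \<delta> \<sigma> in auto)
  have d4: "v \<otimes>\<^bsub>A\<^esub> r = \<sigma> r \<otimes>\<^bsub>A\<^esub> v \<oplus>\<^bsub>A\<^esub> \<delta> r" if "r \<in> R" for r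
  proof (rule eq)
    have "h v \<otimes>\<^bsub>B\<^esub> h r = \<sigma>' (h r) \<otimes>\<^bsub>B\<^esub> h v \<oplus>\<^bsub>B\<^esub> \<delta>' (h r)" using E6 that by simp
    then show "h (v \<otimes>\<^bsub>A\<^esub> r) = h (\<sigma> r \<otimes>\<^bsub>A\<^esub> v \<oplus>\<^bsub>A\<^esub> \<delta> r)" using that Rc Sc[OF v] \<delta> \<sigma> by (simp add: hs)
  qed (use that Rc Sc[OF v] \<delta> \<sigma> in auto)
  have unique: "\<exists>!f :: nat \<Rightarrow> 'a. range f \<subseteq> R \<and> finite {n. f n \<noteq> \<zero>\<^bsub>A\<^esub>} \<and>
      s = (\<Oplus>\<^bsub>A\<^esub>n\<in>{n. f n \<noteq> \<zero>\<^bsub>A\<^esub>}. f n \<otimes>\<^bsub>A\<^esub> (v [^]\<^bsub>A\<^esub> n))" (is "\<exists>!f. ?P f") if s: "s \<in> S" for s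
  proof -
    define Q where "Q g \<longleftrightarrow> range g \<subseteq> h ` R \<and> finite {n. g n \<noteq> \<zero>\<^bsub>B\<^esub>} \<and>
      h s = (\<Oplus>\<^bsub>B\<^esub>n\<in>{n. g n \<noteq> \<zero>\<^bsub>B\<^esub>}. g n \<otimes>\<^bsub>B\<^esub> (h v [^]\<^bsub>B\<^esub> n))" for g :: "nat \<Rightarrow> 'b"
    have "\<exists>!g. Q g" unfolding Q_def by (rule E7[THEN bspec, OF imageI[OF s]])
    then obtain g where g: "Q g" "\<And>g'. Q g' \<Longrightarrow> g' = g" by blast
    have PQ: "?P f \<longleftrightarrow> Q (\<lambda>n. h (f n))" if f: "range f \<subseteq> R" for f
    proof -
      have fR: "f n \<in> R" for n using f by auto
      have "h (f n) = \<zero>\<^bsub>B\<^esub> \<longleftrightarrow> f n = \<zero>\<^bsub>A\<^esub>" for n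
        using eq[of "f n" "\<zero>\<^bsub>A\<^esub>"] Rc[OF fR] alg_hom_zero[OF kA kB h] by auto
      then have set: "{n. h (f n) \<noteq> \<zero>\<^bsub>B\<^esub>} = {n. f n \<noteq> \<zero>\<^bsub>A\<^esub>}" by simp
      have t: "f n \<otimes>\<^bsub>A\<^esub> (v [^]\<^bsub>A\<^esub> n) \<in> carrier A" for n using Rc[OF fR] Sc[OF v] by simp
      have "h (\<Oplus>\<^bsub>A\<^esub>n\<in>J. f n \<otimes>\<^bsub>A\<^esub> (v [^]\<^bsub>A\<^esub> n)) = (\<Oplus>\<^bsub>B\<^esub>n\<in>J. h (f n \<otimes>\<^bsub>A\<^esub> (v [^]\<^bsub>A\<^esub> n)))" for J
        by (rule alg_hom_finsum[OF kA kB h]) (use t in auto)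
      then have sum: "h (\<Oplus>\<^bsub>A\<^esub>n\<in>J. f n \<otimes>\<^bsub>A\<^esub> (v [^]\<^bsub>A\<^esub> n)) = (\<Oplus>\<^bsub>B\<^esub>n\<in>J. h (f n) \<otimes>\<^bsub>B\<^esub> (h v [^]\<^bsub>B\<^esub> n))" for J
        by (simp add: hs Rc[OF fR] Sc[OF v] alg_hom_pow[OF kA kB h])
      have "s = (\<Oplus>\<^bsub>A\<^esub>n\<in>J. f n \<otimes>\<^bsub>A\<^esub> (v [^]\<^bsub>A\<^esub> n)) \<longleftrightarrow> h s = h (\<Oplus>\<^bsub>A\<^esub>n\<in>J. f n \<otimes>\<^bsub>A\<^esub> (v [^]\<^bsub>A\<^esub> n))" for J
        using eq[OF _ Sc[OF s], of "\<Oplus>\<^bsub>A\<^esub>n\<in>J. f n \<otimes>\<^bsub>A\<^esub> (v [^]\<^bsub>A\<^esub> n)"] t by (auto intro: A.finsum_closed)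
      then show ?thesis unfolding Q_def set sum using f by auto
    qed
    define f where "f n = inv_into R h (g n)" for n
    have gR: "g n \<in> h ` R" for n using g(1) by (auto simp: Q_def)
    have f: "range f \<subseteq> R" "(\<lambda>n. h (f n)) = g"
      using inv_into_into[OF gR] f_inv_into_f[OF gR] by (auto simp: f_def)
    show ?thesis
    proof (rule ex1I[of _ f])
      show "?P f" using PQ[OF f(1)] g(1) f(2) by simp
      fix f' assume P: "?P f'"
      then have r: "range f' \<subseteq> R" by blast
      have "(\<lambda>n. h (f' n)) = g" using g(2) PQ[OF r] P by blast
      then have hf: "h (f' n) = h (f n)" for n using f(2) by metis
      have "f' n = f n" for n by (rule eq[OF hf]) (use r f(1) Rc in auto)
      then show "f' = f" by (rule ext)
    qed
  qed
  have "\<sigma> \<in> ring_iso (A\<lparr>carrier := R\<rparr>) (A\<lparr>carrier := R\<rparr>)"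
    using bij \<sigma>R s1 s2 s3 by (simp add: ring_iso_def ring_hom_def)
  then show ?thesis
    unfolding is_ore_extension_def using R S RS v s4 \<delta>R d1 d2 d3 d4 unique by (intro conjI ballI allI) auto
qed

end

section \<open>Right coideal subalgebras\<close>

context
  fixes l :: "'k::field_char_0"
begin

interpretation H: k_algebra "B_alg l" by (rule B_alg_k_algebra)

lemma GK_dim_repr: "S \<subseteq> carrier (B_alg l) \<Longrightarrow> GK_dim (B_alg l) S = GK_dim TA (repr l ` S)"
proof -
  assume S: "S \<subseteq> carrier (B_alg l)"
  have "repr l \<one>\<^bsub>B_alg l\<^esub> = 1" "repr l \<zero>\<^bsub>B_alg l\<^esub> = 0"
    using alg_homD(2)[OF repr_hom[of l]] alg_hom_zero[OF H.k_algebra_axioms scl.ta.k_algebra_axioms repr_hom[of l]] by simp_all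
  then have "\<one>\<^bsub>B_alg l\<^esub> \<noteq> \<zero>\<^bsub>B_alg l\<^esub>" by (metis zero_neq_one)
  then show ?thesis
    using GK_dim_inj_hom[OF H.k_algebra_axioms scl.ta.k_algebra_axioms repr_hom repr_inj S] by simp
qed

lemma GK_dim_alg_gen:
  "S \<subseteq> carrier (B_alg l) \<Longrightarrow> GK_dim (B_alg l) (alg_gen (B_alg l) S) = GK_dim TA (alg_gen TA (repr l ` S))"
  using GK_dim_repr[of "alg_gen (B_alg l) S"] H.alg_gen_subalgebra[of S] repr_alg_gen[of S l]
  by (simp add: H.subalgebra_iff)

text \<open>For \<open>k\<close> and \<open>H\<close> one-sided bounds already keep them apart from
  dimensions 1 and 2.\<close>

lemma GK_dim_values:
  "GK_dim (B_alg l) (scalars (B_alg l)) \<le> 0" "3 \<le> GK_dim (B_alg l) (carrier (B_alg l))"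
  "(a, b) \<noteq> (0, 0) \<Longrightarrow> GK_dim (B_alg l) (alg_gen (B_alg l) {genl l a b}) = 1"
  "GK_dim (B_alg l) (alg_gen (B_alg l) {hy l, hx l}) = 2"
  "GK_dim (B_alg l) (alg_gen (B_alg l) {hy l, gen2 l c}) = 2"
  "l = 0 \<Longrightarrow> GK_dim (B_alg l) (alg_gen (B_alg l) {gen3u l a, gen3 l a b}) = 2"
proof -
  have sc: "scalars (B_alg l) \<subseteq> carrier (B_alg l)" using H.scalars_subalgebra by (simp add: H.subalgebra_iff)
  show "GK_dim (B_alg l) (scalars (B_alg l)) \<le> 0"
    using GK_le0 GK_dim_repr[OF sc] repr_scalars[of l] by simp
  show "3 \<le> GK_dim (B_alg l) (carrier (B_alg l))"
    using GK_full[of l] GK_dim_repr[OF subset_refl] repr_range[of l] by simp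
  show "GK_dim (B_alg l) (alg_gen (B_alg l) {genl l a b}) = 1" if "(a, b) \<noteq> (0, 0)"
    using GK_line[OF that, of l] GK_dim_alg_gen[of "{genl l a b}"] gens_carrier(1)[of l a b] repr_gens(1)[of l a b] by simp
  show "GK_dim (B_alg l) (alg_gen (B_alg l) {hy l, hx l}) = 2"
    using GK_plane[OF rel_yx transc_yo free_over_X, of l] GK_dim_alg_gen[of "{hy l, hx l}"] by simp
  show "GK_dim (B_alg l) (alg_gen (B_alg l) {hy l, gen2 l c}) = 2"
    using GK_plane[OF rel_vii transc_yo free_vii, of l c] GK_dim_alg_gen[of "{hy l, gen2 l c}"] gens_carrier(2)[of l c] repr_gens(2)[of l c] by simp
  show "GK_dim (B_alg l) (alg_gen (B_alg l) {gen3u l a, gen3 l a b}) = 2" if "l = 0"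
    using GK_plane[OF rel_viii[OF that] transc_u free_viii, of a b] GK_dim_alg_gen[of "{gen3u l a, gen3 l a b}"]
      gens_carrier(3,4)[of l] repr_gens(3,4)[of l] by simp
qed

lemma is_transcendental_repr:
  assumes "u \<in> carrier (B_alg l)" "transc (repr l u)" shows "is_transcendental (B_alg l) u"
proof (rule is_transcendental_transfer[OF H.k_algebra_axioms scl.ta.k_algebra_axioms repr_hom repr_inj assms(1)])
  have "(\<Sum>i\<le>Polynomial.degree p. scl (coeff p i) * repr l u ^ i) = evp scl (repr l u) p" for p
  proof -
    have "evp scl (repr l u) (\<Sum>i\<in>J. monom (coeff p i) i) = (\<Sum>i\<in>J. scl (coeff p i) * repr l u ^ i)" for J
      by (induction J rule: infinite_finite_induct) (simp_all add: evp_scl_add evp_scl_monom)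
    from this[of "{..Polynomial.degree p}"] show ?thesis by (simp only: poly_as_sum_of_monoms)
  qed
  then show "is_transcendental TA (repr l u)"
    using transc_inj[OF assms(2)] by (auto simp: is_transcendental_def intro!: injI)
qed

lemma is_ore_extension_repr:
  assumes u: "u \<in> carrier (B_alg l)" and v: "v \<in> carrier (B_alg l)"
    and ext: "is_ore_extension TA (alg_gen TA {repr l u}) (repr l v) \<sigma>' \<delta>' (alg_gen TA {repr l u, repr l v})"
    and \<sigma>: "\<And>r. r \<in> carrier (B_alg l) \<Longrightarrow> r \<in> alg_gen (B_alg l) {u} \<Longrightarrow> \<sigma> r \<in> carrier (B_alg l) \<and> repr l (\<sigma> r) = \<sigma>' (repr l r)"
    and \<delta>: "\<And>r. r \<in> carrier (B_alg l) \<Longrightarrow> r \<in> alg_gen (B_alg l) {u} \<Longrightarrow> \<delta> r \<in> carrier (B_alg l) \<and> repr l (\<delta> r) = \<delta>' (repr l r)"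
  shows "is_ore_extension (B_alg l) (alg_gen (B_alg l) {u}) v \<sigma> \<delta> (alg_gen (B_alg l) {u, v})"
proof -
  have c: "{u} \<subseteq> carrier (B_alg l)" "{u, v} \<subseteq> carrier (B_alg l)" using u v by auto
  have sub: "alg_gen (B_alg l) {u} \<subseteq> alg_gen (B_alg l) {u, v}"
    using H.alg_gen_minimal[OF H.alg_gen_subalgebra[OF c(2)], of "{u}"] H.alg_gen_base[of "{u, v}"] by blast
  have mem: "v \<in> alg_gen (B_alg l) {u, v}" using H.alg_gen_base[of "{u, v}"] by blast
  have R: "r \<in> carrier (B_alg l)" if "r \<in> alg_gen (B_alg l) {u}" for r
    using H.alg_gen_subalgebra[OF c(1)] that unfolding H.subalgebra_iff by blast
  have ext': "is_ore_extension TA (repr l ` alg_gen (B_alg l) {u}) (repr l v) \<sigma>' \<delta>' (repr l ` alg_gen (B_alg l) {u, v})"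
    using ext repr_alg_gen[OF c(1)] repr_alg_gen[OF c(2)] by simp
  show ?thesis
    by (rule is_ore_extension_transfer[OF H.k_algebra_axioms scl.ta.k_algebra_axioms repr_hom repr_inj ext'
        H.alg_gen_subalgebra[OF c(1)] H.alg_gen_subalgebra[OF c(2)] sub mem]) (use \<sigma> \<delta> R in blast)+
qed

lemma is_ore_der_repr:
  assumes u: "u \<in> carrier (B_alg l)" and v: "v \<in> carrier (B_alg l)"
    and "repr l v * repr l u = repr l u * repr l v + scl \<alpha> * repr l u + scl \<beta> * (repr l u * repr l u) + scl 0 * repr l v"
    and "transc (repr l u)" "free_over (alg_gen TA {repr l u}) (repr l v)"
  shows "is_ore_der (B_alg l) u v (\<lambda>r. v \<otimes>\<^bsub>B_alg l\<^esub> r \<ominus>\<^bsub>B_alg l\<^esub> r \<otimes>\<^bsub>B_alg l\<^esub> v)"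
  unfolding is_ore_der_def
proof
  show "is_transcendental (B_alg l) u" by (rule is_transcendental_repr) fact+
  show "is_ore_extension (B_alg l) (alg_gen (B_alg l) {u}) v (\<lambda>r. r)
    (\<lambda>r. v \<otimes>\<^bsub>B_alg l\<^esub> r \<ominus>\<^bsub>B_alg l\<^esub> r \<otimes>\<^bsub>B_alg l\<^esub> v) (alg_gen (B_alg l) {u, v})"
    by (rule is_ore_extension_repr[OF u v ore_derI[OF assms(3,5) refl]]) (simp_all add: v repr_simps repr_minus)
qed

lemma is_ore_aut_repr:
  assumes u: "u \<in> carrier (B_alg l)" and v: "v \<in> carrier (B_alg l)"
    and "repr l v * repr l u = repr l u * repr l v + scl 0 * repr l u + scl 0 * (repr l u * repr l u) + scl (- 1) * repr l v"
    and "transc (repr l u)" "free_over (alg_gen TA {repr l u}) (repr l v)"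
  shows "\<exists>\<sigma>. is_ore_aut (B_alg l) u v \<sigma> \<and> \<sigma> u = u \<ominus>\<^bsub>B_alg l\<^esub> \<one>\<^bsub>B_alg l\<^esub>"
proof -
  obtain \<sigma>' where ext: "is_ore_extension TA (alg_gen TA {repr l u}) (repr l v) \<sigma>' (\<lambda>_. 0) (alg_gen TA {repr l u, repr l v})"
    and \<sigma>': "\<sigma>' (repr l u) = repr l u - 1"
    using ore_autI[OF assms(3,5) refl refl refl assms(4)] by blast
  \<comment> \<open>The operator automorphism is pulled back along \<open>repr\<close>; its values
    lie in the image because it preserves the image of \<open>k[u]\<close>.\<close>
  define \<sigma> where "\<sigma> r = inv_into (carrier (B_alg l)) (repr l) (\<sigma>' (repr l r))" for r
  have c: "{u} \<subseteq> carrier (B_alg l)" using u by simp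
  have iso: "\<sigma>' \<in> ring_iso (TA\<lparr>carrier := alg_gen TA {repr l u}\<rparr>) (TA\<lparr>carrier := alg_gen TA {repr l u}\<rparr>)"
    using ext unfolding is_ore_extension_def by (elim conjE)
  have \<sigma>: "\<sigma> r \<in> carrier (B_alg l) \<and> repr l (\<sigma> r) = \<sigma>' (repr l r)" if "r \<in> alg_gen (B_alg l) {u}" for r
  proof -
    have "repr l r \<in> alg_gen TA {repr l u}" using repr_alg_gen[OF c] that by auto
    then have "\<sigma>' (repr l r) \<in> alg_gen TA {repr l u}" using iso by (auto simp: ring_iso_def ring_hom_def)
    also have "alg_gen TA {repr l u} = repr l ` alg_gen (B_alg l) {u}" using repr_alg_gen[OF c] by simp
    also have "\<dots> \<subseteq> repr l ` carrier (B_alg l)" using H.alg_gen_subalgebra[OF c] unfolding H.subalgebra_iff by blast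
    finally have "\<sigma>' (repr l r) \<in> repr l ` carrier (B_alg l)" .
    then show ?thesis unfolding \<sigma>_def using inv_into_into f_inv_into_f by metis
  qed
  have "\<sigma> u = u \<ominus>\<^bsub>B_alg l\<^esub> \<one>\<^bsub>B_alg l\<^esub>"
  proof (rule inj_onD[OF repr_inj])
    have "u \<in> alg_gen (B_alg l) {u}" using H.alg_gen_base[of "{u}"] by blast
    note su = \<sigma>[OF this]
    show "repr l (\<sigma> u) = repr l (u \<ominus>\<^bsub>B_alg l\<^esub> \<one>\<^bsub>B_alg l\<^esub>)" using su u by (simp add: \<sigma>' repr_minus repr_simps)
    show "\<sigma> u \<in> carrier (B_alg l)" using su by blast
  qed (use u in simp)
  moreover have "is_ore_aut (B_alg l) u v \<sigma>"
    unfolding is_ore_aut_def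
  proof
    show "is_transcendental (B_alg l) u" by (rule is_transcendental_repr) fact+
    show "is_ore_extension (B_alg l) (alg_gen (B_alg l) {u}) v \<sigma> (\<lambda>_. \<zero>\<^bsub>B_alg l\<^esub>) (alg_gen (B_alg l) {u, v})"
      using \<sigma> alg_hom_zero[OF H.k_algebra_axioms scl.ta.k_algebra_axioms repr_hom[of l]]
      by (intro is_ore_extension_repr[OF u v ext]) simp_all
  qed
  ultimately show ?thesis by blast
qed

text \<open>For the derivations, \<open>\<delta>\<close> is commutation with the second generator,
  and its value on \<open>Y\<close> is found by comparing operators.\<close>

lemma ore_structure:
  "\<exists>\<delta>. is_ore_der (B_alg l) (hy l) (hx l) \<delta> \<and> \<delta> (hy l) = hy l"
  "\<exists>\<delta>. is_ore_der (B_alg l) (hy l) (gen2 l c) \<delta> \<and>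
    \<delta> (hy l) = c \<odot>\<^bsub>B_alg l\<^esub> hy l \<ominus>\<^bsub>B_alg l\<^esub> (1 / 2) \<odot>\<^bsub>B_alg l\<^esub> (hy l \<otimes>\<^bsub>B_alg l\<^esub> hy l)"
  "l = 0 \<Longrightarrow> \<exists>\<sigma>. is_ore_aut (B_alg l) (gen3u l a) (gen3 l a b) \<sigma> \<and>
    \<sigma> (gen3u l a) = gen3u l a \<ominus>\<^bsub>B_alg l\<^esub> \<one>\<^bsub>B_alg l\<^esub>"
proof -
  have "is_ore_der (B_alg l) (hy l) (hx l) (\<lambda>r. hx l \<otimes>\<^bsub>B_alg l\<^esub> r \<ominus>\<^bsub>B_alg l\<^esub> r \<otimes>\<^bsub>B_alg l\<^esub> hx l)"
    using rel_yx[of l] transc_yo[of l] free_over_X[of l] by (intro is_ore_der_repr[of _ _ 1 0]) simp_all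
  moreover have "hx l \<otimes>\<^bsub>B_alg l\<^esub> hy l \<ominus>\<^bsub>B_alg l\<^esub> hy l \<otimes>\<^bsub>B_alg l\<^esub> hx l = hy l"
    by (rule inj_onD[OF repr_inj[of l]]) (simp_all add: repr_simps repr_minus xy_commute)
  ultimately show "\<exists>\<delta>. is_ore_der (B_alg l) (hy l) (hx l) \<delta> \<and> \<delta> (hy l) = hy l"
    by (intro exI[of _ "\<lambda>r. hx l \<otimes>\<^bsub>B_alg l\<^esub> r \<ominus>\<^bsub>B_alg l\<^esub> r \<otimes>\<^bsub>B_alg l\<^esub> hx l"] conjI)
  have 2: "repr l (gen2 l c) = vii l c" "repr l (hy l) = yo l" "gen2 l c \<in> carrier (B_alg l)" "hy l \<in> carrier (B_alg l)"
    using repr_gens(2)[of l c] gens_carrier(2)[of l c] by simp_all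
  have "is_ore_der (B_alg l) (hy l) (gen2 l c) (\<lambda>r. gen2 l c \<otimes>\<^bsub>B_alg l\<^esub> r \<ominus>\<^bsub>B_alg l\<^esub> r \<otimes>\<^bsub>B_alg l\<^esub> gen2 l c)"
    by (rule is_ore_der_repr[OF 2(4,3), unfolded 2(1,2), OF rel_vii transc_yo free_vii])
  moreover have "gen2 l c \<otimes>\<^bsub>B_alg l\<^esub> hy l \<ominus>\<^bsub>B_alg l\<^esub> hy l \<otimes>\<^bsub>B_alg l\<^esub> gen2 l c =
      c \<odot>\<^bsub>B_alg l\<^esub> hy l \<ominus>\<^bsub>B_alg l\<^esub> (1 / 2) \<odot>\<^bsub>B_alg l\<^esub> (hy l \<otimes>\<^bsub>B_alg l\<^esub> hy l)" (is "?a = ?b")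
  proof (rule inj_onD[OF repr_inj[of l]])
    have "repr l ?a = vii l c * yo l - yo l * vii l c"
      using 2 by (simp only: repr_minus H.m_closed repr_simps)
    also have "\<dots> = scl c * yo l - scl (1 / 2) * (yo l * yo l)" unfolding vii_commute by simp
    also have "\<dots> = repr l ?b" by (simp add: repr_minus repr_simps)
    finally show "repr l ?a = repr l ?b" .
  qed (use 2 in \<open>simp_all only: H.m_closed H.minus_closed H.smult_closed\<close>)
  ultimately show "\<exists>\<delta>. is_ore_der (B_alg l) (hy l) (gen2 l c) \<delta> \<and>
      \<delta> (hy l) = c \<odot>\<^bsub>B_alg l\<^esub> hy l \<ominus>\<^bsub>B_alg l\<^esub> (1 / 2) \<odot>\<^bsub>B_alg l\<^esub> (hy l \<otimes>\<^bsub>B_alg l\<^esub> hy l)"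
    by (intro exI[of _ "\<lambda>r. gen2 l c \<otimes>\<^bsub>B_alg l\<^esub> r \<ominus>\<^bsub>B_alg l\<^esub> r \<otimes>\<^bsub>B_alg l\<^esub> gen2 l c"] conjI)
  show "\<exists>\<sigma>. is_ore_aut (B_alg l) (gen3u l a) (gen3 l a b) \<sigma> \<and>
      \<sigma> (gen3u l a) = gen3u l a \<ominus>\<^bsub>B_alg l\<^esub> \<one>\<^bsub>B_alg l\<^esub>" if "l = 0"
    by (rule is_ore_aut_repr[OF gens_carrier(3,4), unfolded repr_gens(3,4), OF rel_viii[OF that] transc_u free_viii])
qed

lemma alg_gen_line_eq_iff:
  assumes "(a, b) \<noteq> (0, 0)" "(a', b') \<noteq> (0, 0)"
  shows "alg_gen (B_alg l) {genl l a b} = alg_gen (B_alg l) {genl l a' b'} \<longleftrightarrow>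
    (\<exists>t. t \<noteq> 0 \<and> a' = t * a \<and> b' = t * b)"
proof -
  have c: "{genl l a b} \<subseteq> carrier (B_alg l)" for a b using gens_carrier(1)[of l a b] by blast
  have s: "alg_gen (B_alg l) {genl l a b} \<subseteq> carrier (B_alg l)" for a b
    using H.alg_gen_subalgebra[OF c] unfolding H.subalgebra_iff by blast
  have r: "repr l ` alg_gen (B_alg l) {genl l a b} = alg_gen TA {scl a * xo l + scl b * yo l}" for a b
    by (simp only: repr_alg_gen[OF c] image_insert image_empty repr_gens(1))
  show ?thesis using repr_image_inj[OF s[of a b] s[of a' b']] line_eq_iff[OF assms, of l] unfolding r by blast
qed

lemma is_transcendental_line: "(a, b) \<noteq> (0, 0) \<Longrightarrow> is_transcendental (B_alg l) (genl l a b)"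
  by (rule is_transcendental_repr[OF gens_carrier(1)]) (unfold repr_gens(1), rule transc_primitive)

end

theorem mainTheorem6:
  fixes l :: "'k::field_char_0" and H (structure) and x y z
  assumes "H = B_alg l" and "x = B_of l GX" and "y = B_of l GY" and "z = B_of l GZ"
  shows
    "({A. right_coideal_subalgebra H (B_comult l) A} =
       {scalars H, carrier H} \<union>
       {A. right_coideal_subalgebra H (B_comult l) A \<and> GK_dim H A = 1} \<union>
       {A. right_coideal_subalgebra H (B_comult l) A \<and> GK_dim H A = 2})
     \<and>
     ({A. right_coideal_subalgebra H (B_comult l) A \<and> GK_dim H A = 1} =
       {alg_gen H {a \<odot> x \<oplus> b \<odot> y} | a b. (a, b) \<noteq> (0, 0)})
     \<and>
     (\<forall>a b. (a, b) \<noteq> (0, 0) \<longrightarrow> is_transcendental H (a \<odot> x \<oplus> b \<odot> y))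
     \<and>
     (\<forall>a b a' b'. (a, b) \<noteq> (0, 0) \<longrightarrow> (a', b') \<noteq> (0, 0) \<longrightarrow>
       (alg_gen H {a \<odot> x \<oplus> b \<odot> y} = alg_gen H {a' \<odot> x \<oplus> b' \<odot> y} \<longleftrightarrow>
        (\<exists>t. t \<noteq> 0 \<and> a' = t * a \<and> b' = t * b)))
     \<and>
     ({A. right_coideal_subalgebra H (B_comult l) A \<and> GK_dim H A = 2} =
       {alg_gen H {y, x}} \<union>
       {alg_gen H {y, z \<oplus> c \<odot> x \<ominus> y \<otimes> x} | c. True} \<union>
       {alg_gen H {x \<oplus> a \<odot> y, z \<oplus> b \<odot> y \<oplus> (a / 2) \<odot> (y \<otimes> y)} | a b. l = 0})
     \<and>
     (\<exists>\<delta>. is_ore_der H y x \<delta> \<and> \<delta> y = y)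
     \<and>
     (\<forall>c. \<exists>\<delta>. is_ore_der H y (z \<oplus> c \<odot> x \<ominus> y \<otimes> x) \<delta> \<and>
       \<delta> y = c \<odot> y \<ominus> (1 / 2) \<odot> (y \<otimes> y))
     \<and>
     (l = 0 \<longrightarrow> (\<forall>a b. \<exists>\<sigma>.
       is_ore_aut H (x \<oplus> a \<odot> y) (z \<oplus> b \<odot> y \<oplus> (a / 2) \<odot> (y \<otimes> y)) \<sigma> \<and>
       \<sigma> (x \<oplus> a \<odot> y) = x \<oplus> a \<odot> y \<ominus> \<one>))"
proof -
  let ?C = "right_coideal_subalgebra (B_alg l) (B_comult l)" and ?g = "alg_gen (B_alg l)" and ?d = "GK_dim (B_alg l)"
  have d0: "?d (scalars (B_alg l)) \<noteq> 1" "?d (scalars (B_alg l)) \<noteq> 2"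
    and d3: "?d (carrier (B_alg l)) \<noteq> 1" "?d (carrier (B_alg l)) \<noteq> 2"
    using GK_dim_values(1,2)[of l] by auto
  have d12: "(1::ereal) \<noteq> 2" by simp
  have "({A. ?C A} = {scalars (B_alg l), carrier (B_alg l)} \<union> {A. ?C A \<and> ?d A = 1} \<union> {A. ?C A \<and> ?d A = 2})"
  proof (intro equalityI subsetI)
    fix A assume "A \<in> {A. ?C A}"
    then have A: "?C A" by simp
    have "A = scalars (B_alg l) \<or> A = carrier (B_alg l) \<or> ?d A = 1 \<or> ?d A = 2"
      using right_coideal_cases[OF A] GK_dim_values(3)[of _ _ l] GK_dim_values(4-6)[of l] by metis
    then show "A \<in> {scalars (B_alg l), carrier (B_alg l)} \<union> {A. ?C A \<and> ?d A = 1} \<union> {A. ?C A \<and> ?d A = 2}"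
      using A by blast
  qed (use right_coideal_converse(1,2)[of l] in blast)
  moreover have "{A. ?C A \<and> ?d A = 1} = {?g {genl l a b} | a b. (a, b) \<noteq> (0, 0)}"
  proof (intro equalityI subsetI)
    fix A assume "A \<in> {A. ?C A \<and> ?d A = 1}"
    then have A: "?C A" "?d A = 1" by simp_all
    \<comment> \<open>The dimension singles out one kind of subalgebra in
      \<open>right_coideal_cases\<close>: the scalars and \<open>H\<close> have neither dimension 1
      nor 2, and the planes have dimension 2.\<close>
    have "\<exists>a b. (a, b) \<noteq> (0, 0) \<and> A = ?g {genl l a b}"
      using right_coideal_cases[OF A(1)] A(2) d0(1) d3(1) d12 GK_dim_values(4-6)[of l] by metis
    then show "A \<in> {?g {genl l a b} | a b. (a, b) \<noteq> (0, 0)}" by blast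
  qed (use right_coideal_converse(3)[of l] GK_dim_values(3)[of _ _ l] in blast)
  moreover have "{A. ?C A \<and> ?d A = 2} = {?g {hy l, hx l}} \<union> {?g {hy l, gen2 l c} | c. True} \<union>
      {?g {gen3u l a, gen3 l a b} | a b. l = 0}"
  proof (intro equalityI subsetI)
    fix A assume "A \<in> {A. ?C A \<and> ?d A = 2}"
    then have A: "?C A" "?d A = 2" by simp_all
    have "A = ?g {hy l, hx l} \<or> (\<exists>c. A = ?g {hy l, gen2 l c}) \<or> (l = 0 \<and> (\<exists>a b. A = ?g {gen3u l a, gen3 l a b}))"
      using right_coideal_cases[OF A(1)] A(2) d0(2) d3(2) d12 GK_dim_values(3)[of _ _ l] by metis
    then show "A \<in> {?g {hy l, hx l}} \<union> {?g {hy l, gen2 l c} | c. True} \<union> {?g {gen3u l a, gen3 l a b} | a b. l = 0}"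
      by blast
  qed (use right_coideal_converse(4-6)[of l] GK_dim_values(4-6)[of l] in blast)
  ultimately show ?thesis
    unfolding assms using is_transcendental_line[of _ _ l] alg_gen_line_eq_iff[of _ _ _ _ l] ore_structure[of l]
    by (intro conjI allI impI)
qed

end
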